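(* Consider the fractional SAA distributionally robust 2-stage set cover problem $\min_{x\in\mathcal{P}}h_{\hat p}(x)$. Suppose that we have a $(\beta_1,\beta_2)$-approximation algorithm for $g(0,y,A)$ for any $(y,A)\in\mathbb{R}_{\ge0}\times\mathcal{A}$. Then for any $\varepsilon>0$, in time polynomial in $\mathcal{I}$ and $\log(1/\varepsilon)$, we can compute $\bar x\in\mathcal{P}$ and an estimate $\bar f$ of $h_{\hat p}(\bar x)$ satisfying $h_{\hat p}(\bar x)\le\beta_1\beta_2\bar f$ and $\bar f\le2(1+\varepsilon)\min_{x\in\mathcal{P}}h_{\hat p}(x)$.
   Context: Set cover instance: ground set $U$, collection $\mathcal{S}\subseteq 2^U$, first- and second-stage costs $c_S,c^{II}_S\ge0$; $\mathcal{P}=[0,1]^{\mathcal{S}}$; scenarios are subsets of $U$ forming a collection $\mathcal{A}$. For $x\in\mathcal{P}$, $A\subseteq U$: $g(x,A)=\min\{\sum_S c^{II}_Sz_S: z\ge0,\ \sum_{S\ni e}(x_S+z_S)\ge1\ \forall e\in A\}$. $\kappa_{sc}$ is a scenario metric on $\mathcal{A}$ with $\kappa_{sc}(A,A)=0$, $\kappa_{\max}=\max\kappa_{sc}$ is known, $r>0$. $\hat p$ is an explicitly given distribution with polynomial-size support $\mathcal{A}_{sup}$; $z_{\hat p}(x)=\max\{\sum_{(A,A')\in\mathcal{A}_{sup}\times\mathcal{A}}\gamma_{A,A'}g(x,A'):\gamma\ge0,\ \sum_{A'}\gamma_{A,A'}\le\hat p_A\ \forall A,\ \sum_{A,A'}\kappa_{sc}(A,A')\gamma_{A,A'}\le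 r\}$, $h_{\hat p}(x)=c^\top x+z_{\hat p}(x)$; $\mathcal{I}$ is the input size. Standing assumption: every non-null scenario $A$ (i.e., one with $g(x,A)\ne g(0,A)$ for some $x\in\mathcal{P}$) satisfies $c^\top x+g(x,A)\ge1$ for all $x\in\mathcal{P}$. $g(x,y,A)=\max_{A'\in\mathcal{A}}(g(x,A')-y\kappa_{sc}(A,A'))$; a $(\beta_1,\beta_2)$-approximation algorithm for it returns $\bar A\in\mathcal{A}$ with $g(x,\bar A)-y\kappa_{sc}(A,\bar A)\ge g(x,A')/\beta_1-\beta_2y\kappa_{sc}(A,A')$ for all $A'\in\mathcal{A}$; this is assumed available for every set cover instance of this form (in particular when extra sets of zero cost are added). *)

theory Defs
  imports "HOL-Analysis.Analysis" "HOL-Library.Log_Nat"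
begin

section \<open>The fractional distributionally robust 2-stage set cover problem\<close>

text \<open>
  \<open>recourse \<S> d x A\<close> is $g(x,A)$ for the set collection \<open>\<S>\<close> and second-stage costs \<open>d\<close>.
  The minimum and the maximum of the two linear programs below are written \<open>Inf\<close> and \<open>Sup\<close>.
  They are attained when \<open>\<S>\<close> and the scenario collection are finite, all costs, distances,
  probabilities and the radius are nonnegative, and \<open>\<S>\<close> covers every scenario
  (see \<open>valid_instance\<close>).
\<close>

definition recourse ::
    "'e set set \<Rightarrow> ('e set \<Rightarrow> real) \<Rightarrow> ('e set \<Rightarrow> real) \<Rightarrow> 'e set \<Rightarrow> real" where
  "recourse \<S> d x A = Inf {\<Sum>S\<in>\<S>. d S * z S | z.
     (\<forall>S\<in>\<S>. 0 \<le> z S) \<and> (\<forall>e\<in>A. 1 \<le> (\<Sum>S | S \<in> \<S> \<and> e \<in> S. x S + z S))}"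

definition robust_recourse ::
    "'e set set \<Rightarrow> ('e set \<Rightarrow> real) \<Rightarrow> 'e set set \<Rightarrow> ('e set \<Rightarrow> 'e set \<Rightarrow> real) \<Rightarrow> real \<Rightarrow>
     'e set set \<Rightarrow> ('e set \<Rightarrow> real) \<Rightarrow> ('e set \<Rightarrow> real) \<Rightarrow> real" where
  "robust_recourse \<S> d \<A> \<kappa> r supp p x =
     Sup {\<Sum>A\<in>supp. \<Sum>A'\<in>\<A>. \<gamma> A A' * recourse \<S> d x A' | \<gamma>.
       (\<forall>A\<in>supp. \<forall>A'\<in>\<A>. 0 \<le> \<gamma> A A') \<and>
       (\<forall>A\<in>supp. (\<Sum>A'\<in>\<A>. \<gamma> A A') \<le> p A) \<and>
       (\<Sum>A\<in>supp. \<Sum>A'\<in>\<A>. \<kappa> A A' * \<gamma> A A') \<le> r}"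

text \<open>
  The element returned by a $(\beta_1,\beta_2)$-approximation algorithm for
  $g(0,y,A) = \max_{A'} (g(0,A') - y \kappa(A,A'))$.
\<close>

definition approx_scenario ::
    "'e set set \<Rightarrow> ('e set \<Rightarrow> real) \<Rightarrow> 'e set set \<Rightarrow> ('e set \<Rightarrow> 'e set \<Rightarrow> real) \<Rightarrow>
     real \<Rightarrow> real \<Rightarrow> real \<Rightarrow> 'e set \<Rightarrow> 'e set \<Rightarrow> bool" where
  "approx_scenario \<S> d \<A> \<kappa> \<beta>1 \<beta>2 y A B \<longleftrightarrow>
     B \<in> \<A> \<and>
     (\<forall>A'\<in>\<A>. recourse \<S> d (\<lambda>_. 0) A' / \<beta>1 - \<beta>2 * y * \<kappa> A A'
        \<le> recourse \<S> d (\<lambda>_. 0) B - y * \<kappa> A B)"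

section \<open>Instances\<close>

text \<open>
  As the input of an algorithm, an instance has ground set \<open>{..<num_elems}\<close>, rational data, and
  enumerated set collection and support. The scenario collection and its distance function
  are possibly of exponential size and are not written out in the input.
\<close>

record dr_instance =
  num_elems :: nat
  sets_of :: "nat set list"
  cost1 :: "nat set \<Rightarrow> rat"
  cost2 :: "nat set \<Rightarrow> rat"
  scenarios :: "nat set set"
  scen_dist :: "nat set \<Rightarrow> nat set \<Rightarrow> rat"
  radius :: rat
  support_of :: "nat set list"
  prob_of :: "nat set \<Rightarrow> rat"

definition covering_collection :: "dr_instance \<Rightarrow> nat set list \<Rightarrow> bool" where
  "covering_collection I Ss \<longleftrightarrow>
     distinct Ss \<and> (\<forall>S\<in>set Ss. S \<subseteq> {..<num_elems I}) \<and>
     (\<forall>A\<in>scenarios I. A \<subseteq> \<Union>(set Ss))"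

text \<open>
  Neither symmetry nor the triangle inequality is required of \<open>scen_dist\<close>, so that
  asymmetric scenario metrics are included.
\<close>

definition valid_instance :: "dr_instance \<Rightarrow> bool" where
  "valid_instance I \<longleftrightarrow>
     covering_collection I (sets_of I) \<and>
     (\<forall>S\<in>set (sets_of I). 0 \<le> cost1 I S \<and> 0 \<le> cost2 I S) \<and>
     scenarios I \<subseteq> Pow {..<num_elems I} \<and>
     (\<forall>A\<in>scenarios I. \<forall>A'\<in>scenarios I. 0 \<le> scen_dist I A A') \<and>
     (\<forall>A\<in>scenarios I. scen_dist I A A = 0) \<and>
     0 < radius I \<and>
     distinct (support_of I) \<and> set (support_of I) \<subseteq> scenarios I \<and>
     (\<forall>A\<in>set (support_of I). 0 < prob_of I A) \<and>
     (\<Sum>A\<in>set (support_of I). prob_of I A) = 1"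

definition fractional_decisions :: "dr_instance \<Rightarrow> (nat set \<Rightarrow> real) set" where
  "fractional_decisions I = set (sets_of I) \<rightarrow> {0..1}"

definition first_stage :: "dr_instance \<Rightarrow> (nat set \<Rightarrow> real) \<Rightarrow> real" where
  "first_stage I x = (\<Sum>S\<in>set (sets_of I). of_rat (cost1 I S) * x S)"

definition second_stage :: "dr_instance \<Rightarrow> (nat set \<Rightarrow> real) \<Rightarrow> nat set \<Rightarrow> real" where
  "second_stage I x A = recourse (set (sets_of I)) (\<lambda>S. of_rat (cost2 I S)) x A"

definition robust_objective :: "dr_instance \<Rightarrow> (nat set \<Rightarrow> real) \<Rightarrow> real" where
  "robust_objective I x = first_stage I x +
     robust_recourse (set (sets_of I)) (\<lambda>S. of_rat (cost2 I S)) (scenarios I)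
       (\<lambda>A A'. of_rat (scen_dist I A A')) (of_rat (radius I))
       (set (support_of I)) (\<lambda>A. of_rat (prob_of I A)) x"

definition non_null :: "dr_instance \<Rightarrow> nat set \<Rightarrow> bool" where
  "non_null I A \<longleftrightarrow>
     (\<exists>x\<in>fractional_decisions I. second_stage I x A \<noteq> second_stage I (\<lambda>_. 0) A)"

definition non_null_cost_ge_1 :: "dr_instance \<Rightarrow> bool" where
  "non_null_cost_ge_1 I \<longleftrightarrow>
     (\<forall>A\<in>scenarios I. non_null I A \<longrightarrow>
        (\<forall>x\<in>fractional_decisions I. 1 \<le> first_stage I x + second_stage I x A))"

definition max_scen_dist :: "dr_instance \<Rightarrow> rat" where
  "max_scen_dist I = Max {scen_dist I A A' | A A'. A \<in> scenarios I \<and> A' \<in> scenarios I}"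

section \<open>Encodings and input size\<close>

definition word_size :: "int list \<Rightarrow> nat" where
  "word_size ws = (\<Sum>w\<leftarrow>ws. 1 + floorlog 2 (nat \<bar>w\<bar>))"

definition enc_rat :: "rat \<Rightarrow> int list" where
  "enc_rat q = [fst (quotient_of q), snd (quotient_of q)]"

definition enc_set :: "nat \<Rightarrow> nat set \<Rightarrow> int list" where
  "enc_set n A = map (\<lambda>i. if i \<in> A then 1 else 0) [0..<n]"

definition enc_sets :: "nat \<Rightarrow> nat set list \<Rightarrow> int list" where
  "enc_sets n As = int (length As) # concat (map (enc_set n) As)"

definition enc_vec :: "nat set list \<Rightarrow> (nat set \<Rightarrow> rat) \<Rightarrow> int list" where
  "enc_vec As v = concat (map (\<lambda>A. enc_rat (v A)) As)"

definition enc_instance :: "dr_instance \<Rightarrow> int list" where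
  "enc_instance I =
     int (num_elems I) #
     enc_sets (num_elems I) (sets_of I) @
     enc_vec (sets_of I) (cost1 I) @ enc_vec (sets_of I) (cost2 I) @
     enc_rat (radius I) @ enc_rat (max_scen_dist I) @
     enc_sets (num_elems I) (support_of I) @ enc_vec (support_of I) (prob_of I)"

text \<open>
  The values of \<open>scen_dist\<close> are part of the data of an instance, but are accessed only through
  queries; the input size accounts for them by the largest encoding length of a single value.
\<close>

definition input_size :: "dr_instance \<Rightarrow> nat" where
  "input_size I = word_size (enc_instance I) +
     Max {word_size (enc_rat (scen_dist I A A')) | A A'. A \<in> scenarios I \<and> A' \<in> scenarios I}"

section \<open>Random access machines with logarithmic cost and a subroutine\<close>

text \<open>
  Programs operate on a memory of integer cells with indirect addressing. Every value that is
  computed or transferred, addresses included, is charged its bit length, so that time bounds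
  agree with those of Turing machines up to a polynomial.
\<close>

type_synonym memory = "int \<Rightarrow> int"

datatype aexp =
    Const int
  | Cell aexp
  | Plus aexp aexp
  | Minus aexp aexp
  | Times aexp aexp
  | Quot aexp aexp

fun aval :: "aexp \<Rightarrow> memory \<Rightarrow> int" where
  "aval (Const k) s = k"
| "aval (Cell a) s = s (aval a s)"
| "aval (Plus a b) s = aval a s + aval b s"
| "aval (Minus a b) s = aval a s - aval b s"
| "aval (Times a b) s = aval a s * aval b s"
| "aval (Quot a b) s = aval a s div aval b s"

fun acost :: "aexp \<Rightarrow> memory \<Rightarrow> nat" where
  "acost (Const k) s = word_size [k]"
| "acost (Cell a) s = acost a s + word_size [aval (Cell a) s]"
| "acost (Plus a b) s = acost a s + acost b s + word_size [aval (Plus a b) s]"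
| "acost (Minus a b) s = acost a s + acost b s + word_size [aval (Minus a b) s]"
| "acost (Times a b) s = acost a s + acost b s + word_size [aval (Times a b) s]"
| "acost (Quot a b) s = acost a s + acost b s + word_size [aval (Quot a b) s]"

text \<open>A block of words at address \<open>a\<close>: its length in cell \<open>a\<close>, followed by the words.\<close>

definition read_block :: "memory \<Rightarrow> int \<Rightarrow> int list" where
  "read_block s a = map (\<lambda>i. s (a + 1 + int i)) [0..<nat (s a)]"

definition write_block :: "memory \<Rightarrow> int \<Rightarrow> int list \<Rightarrow> memory" where
  "write_block s a ws = (\<lambda>j. if j = a then int (length ws)
     else if a < j \<and> j \<le> a + int (length ws) then ws ! nat (j - a - 1) else s j)"

text \<open>
  \<open>Ask a b\<close> passes the block at address \<open>a\<close> to the subroutine and writes the answer as a block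
  at address \<open>b\<close>. A call is charged the size of the query and of the answer.
\<close>

datatype com =
    Skip
  | Store aexp aexp
  | Seq com com
  | IfPos aexp com com
  | WhilePos aexp com
  | Ask aexp aexp

inductive exec :: "(int list \<Rightarrow> int list) \<Rightarrow> com \<Rightarrow> memory \<Rightarrow> nat \<Rightarrow> memory \<Rightarrow> bool"
  for sub :: "int list \<Rightarrow> int list" where
  "exec sub Skip s 1 s"
| "exec sub (Store a b) s (1 + acost a s + acost b s) (s(aval a s := aval b s))"
| "\<lbrakk>exec sub c s t s'; exec sub c' s' t' s''\<rbrakk> \<Longrightarrow> exec sub (Seq c c') s (1 + t + t') s''"
| "\<lbrakk>0 < aval a s; exec sub c s t s'\<rbrakk> \<Longrightarrow> exec sub (IfPos a c c') s (1 + acost a s + t) s'"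
| "\<lbrakk>\<not> 0 < aval a s; exec sub c' s t s'\<rbrakk> \<Longrightarrow> exec sub (IfPos a c c') s (1 + acost a s + t) s'"
| "\<not> 0 < aval a s \<Longrightarrow> exec sub (WhilePos a c) s (1 + acost a s) s"
| "\<lbrakk>0 < aval a s; exec sub c s t s'; exec sub (WhilePos a c) s' t' s''\<rbrakk>
   \<Longrightarrow> exec sub (WhilePos a c) s (1 + acost a s + t + t') s''"
| "exec sub (Ask a b) s
     (1 + acost a s + acost b s
        + word_size (read_block s (aval a s)) + word_size (sub (read_block s (aval a s))))
     (write_block s (aval b s) (sub (read_block s (aval a s))))"

text \<open>
  \<open>exec\<close> is deterministic, so an existential statement about runs is one about the only run.
\<close>

lemma exec_deterministic:
  assumes "exec sub c s t s'" and "exec sub c s u s''"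
  shows "t = u \<and> s' = s''"
  using assms
proof (induction arbitrary: u s'' rule: exec.induct)
qed (erule exec.cases; blast)+

definition initial_memory :: "int list \<Rightarrow> memory" where
  "initial_memory ws = write_block (\<lambda>_. 0) 0 ws"

section \<open>The approximation algorithm as a subroutine\<close>

text \<open>
  Queries starting with 0 ask for an approximate maximiser for $g(0,y,A)$; they may use any set
  collection covering the scenarios and any nonnegative second-stage costs, while ground set,
  scenarios and distances are those of the instance. Queries starting with 1 ask for a value
  of \<open>scen_dist\<close>. Nothing is assumed about the answers to other queries.
\<close>

definition approx_subroutine ::
    "dr_instance \<Rightarrow> real \<Rightarrow> real \<Rightarrow> (int list \<Rightarrow> int list) \<Rightarrow> bool" where
  "approx_subroutine I \<beta>1 \<beta>2 sub \<longleftrightarrow>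
     (\<forall>Ss d y A.
        covering_collection I Ss \<and> (\<forall>S\<in>set Ss. 0 \<le> d S) \<and> 0 \<le> y \<and> A \<in> scenarios I \<longrightarrow>
        (\<exists>B. sub (0 # enc_sets (num_elems I) Ss @ enc_vec Ss d @ enc_rat y
                    @ enc_set (num_elems I) A) = enc_set (num_elems I) B \<and>
             approx_scenario (set Ss) (\<lambda>S. of_rat (d S)) (scenarios I)
               (\<lambda>A A'. of_rat (scen_dist I A A')) \<beta>1 \<beta>2 (of_rat y) A B)) \<and>
     (\<forall>A\<in>scenarios I. \<forall>A'\<in>scenarios I.
        sub (1 # enc_set (num_elems I) A @ enc_set (num_elems I) A')
          = enc_rat (scen_dist I A A'))"

text \<open>
  The accuracy \<open>\<epsilon>\<close> is passed as the integer \<open>\<lceil>1 / \<epsilon>\<rceil>\<close>, whose bit length is of order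
  $\log(1/\varepsilon)$ even if \<open>\<epsilon>\<close> is irrational or has a long representation.
\<close>

definition run_input :: "dr_instance \<Rightarrow> real \<Rightarrow> int list" where
  "run_input I \<epsilon> = \<lceil>1 / \<epsilon>\<rceil> # enc_instance I"

end

theory Submission
  imports Defs
begin

text \<open>
  Call an element settled if the first stage covers it to the extent 11/21, half-settled if only to the extent
  1/3, unsettled otherwise, and query the approximation algorithm with the sets $S$ at cost $3d_S$, their parts without unsettled
  elements at cost $2d_S$, and their settled parts at cost $0$. One threshold 1/2 would
  lose a factor 2; two thresholds lose a constant factor below 2, so a solver of fixed accuracy
  already gives the estimate $2\min h$, for every \<open>\<epsilon>\<close>.

  By weak duality, $\min h$ is a covering problem in $(x,y,\theta)$ with one row
  $\theta_k+\kappa(A_k,B)\,y+\sum_S w(S\cap B)\,x_S\ge w(B)$ for each $k$, each scenario $B$ and each $w\ge0$ with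
  $w(S)\le d_S$. It is solved by width-independent multiplicative weights. Given a candidate of value $T$, the
  scenario $B$ returned for $A_k$ is either fractionally covered within the budget
  $\theta_k+\kappa(A_k,B)\,y$ up to a constant, or an inner multiplicative weights run yields a $w$ whose row is violated.
  If no $k$ yields a violated row, the candidate scaled by 21/11 is the answer. Otherwise the accumulated rows
  certify $\min h\ge T/1.01$, and $T$ grows by the factor 1.005. The scan starts at $0$ and then
  at $r/(r+\kappa_{\max})$, a lower bound on every positive optimum since non-null scenarios cost at least 1.

  All numbers are kept as integers over common denominators. The program is written in a language of
  integer arrays in which array $j$ is only modified by terms over arrays of smaller index, up to
  additive or multiplicative accumulation; polynomial bit lengths then follow by induction on $j$.
\<close>

section \<open>A language of integer arrays\<close>

text \<open>The subroutine only treats the first stage 0, so a fractional first stage must be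
  absorbed into the queried collection; this is what the classes and restricted copies of sets do.
  The constants balance as follows. Up to a common factor, an inner packing has load at most
  \<open>3 * d\<close> on each set and at most \<open>2 * d\<close> on its part without unsettled
  elements. It is multiplied by 5 on unsettled and by 7 on half-settled elements, which gives load
  at most 5 * 3 + 2 * 2 = 19 times \<open>d\<close>. The residual demands there exceed 2/3 and
  10/21, and 5 * 2/3 = 7 * 10/21 = 10/3, so a packing of value V gives a row worth 10/57 V. Measured
  against costs \<open>3 * d\<close>, the second stage loses 57/10 / 3 = 19/10; the first stage
  loses 21/11. The inner error 1.01 raises 19/10 to less than 39/20, and 117/20 = 3 * 39/20 is the
  factor in the queries and budgets. Rounding the output raises the loss to at most 1226/625. The
  accepted value of T is at most 127/125 times the optimum, since 1.01 * 1.005 < 127/125, and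
  1226/625 * 127/125 < 2.\<close>

datatype hexp = HN int | HV nat hexp
  | HAdd hexp hexp (infixl "\<oplus>" 65) | HSub hexp hexp (infixl "\<ominus>" 65)
  | HMul hexp hexp (infixl "\<otimes>" 70) | HDiv hexp hexp (infixl "\<oslash>" 70)

type_synonym arrays = "nat \<Rightarrow> nat \<Rightarrow> int"
type_synonym block = "nat \<Rightarrow> int"

primrec hval :: "hexp \<Rightarrow> arrays \<Rightarrow> int" where
  "hval (HN k) a = k"
| "hval (HV j e) a = a j (nat \<bar>hval e a\<bar>)"
| "hval (e \<oplus> f) a = hval e a + hval f a"
| "hval (e \<ominus> f) a = hval e a - hval f a"
| "hval (e \<otimes> f) a = hval e a * hval f a"
| "hval (e \<oslash> f) a = hval e a div hval f a"

text \<open>\<open>HGet\<close>, \<open>HPut\<close> and \<open>HAsk\<close> are the only access to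
  the block, which carries input, queries, answers and output. All working data lives in the arrays,
  so growth of numbers has to be controlled for \<open>HSet\<close> alone.\<close>

datatype hcom = HSkip | HSet nat hexp hexp | HGet nat hexp hexp | HPut hexp hexp
  | HSeq hcom hcom (infixr ";;" 60) | HIf hexp hcom hcom | HWhile hexp hcom | HAsk

definition upd :: "arrays \<Rightarrow> nat \<Rightarrow> nat \<Rightarrow> int \<Rightarrow> arrays" where
  "upd a j i v = a(j := (a j)(i := v))"

lemma upd_apply [simp]: "upd a j i v j' = (if j' = j then (a j)(i := v) else a j')"
  by (simp add: upd_def)

definition query :: "block \<Rightarrow> int list" where
  "query b = map (\<lambda>i. b (Suc i)) [0..<nat (b 0)]"

definition answer :: "block \<Rightarrow> int list \<Rightarrow> block" where
  "answer b ws = (\<lambda>i. if i = 0 then int (length ws) else if i \<le> length ws then ws ! (i - 1) else b i)"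

text \<open>Here \<open>L\<close> bounds the iterations of every loop, the length of queries and answers, and the bit length
  of everything read from the block.\<close>

primrec wp :: "(int list \<Rightarrow> int list) \<Rightarrow> nat \<Rightarrow> hcom \<Rightarrow> (arrays \<Rightarrow> block \<Rightarrow> bool) \<Rightarrow> arrays \<Rightarrow> block \<Rightarrow> bool"
where
  "wp sub L HSkip Q = Q"
| "wp sub L (HSet j i e) Q = (\<lambda>a b. Q (upd a j (nat \<bar>hval i a\<bar>) (hval e a)) b)"
| "wp sub L (HGet j i e) Q = (\<lambda>a b. 0 \<le> hval e a \<and> \<bar>b (nat (hval e a))\<bar> \<le> 2 ^ L \<and>
     Q (upd a j (nat \<bar>hval i a\<bar>) (b (nat (hval e a)))) b)"
| "wp sub L (HPut i e) Q = (\<lambda>a b. 0 \<le> hval i a \<and> Q a (b(nat (hval i a) := hval e a)))"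
| "wp sub L (c ;; d) Q = wp sub L c (wp sub L d Q)"
| "wp sub L (HIf e c d) Q = (\<lambda>a b. if 0 < hval e a then wp sub L c Q a b else wp sub L d Q a b)"
| "wp sub L (HWhile e c) Q =
     ((\<lambda>X a b. if 0 < hval e a then wp sub L c X a b else Q a b) ^^ Suc L) (\<lambda>_ _. False)"
| "wp sub L HAsk Q = (\<lambda>a b. nat (b 0) \<le> L \<and> length (sub (query b)) \<le> L \<and>
     (\<forall>v\<in>set (sub (query b)). \<bar>v\<bar> \<le> 2 ^ L) \<and> Q a (answer b (sub (query b))))"

declare wp.simps(7) [simp del]

lemma wp_mono:
  "wp sub L c Q a b \<Longrightarrow> (\<And>a b. Q a b \<Longrightarrow> R a b) \<Longrightarrow> wp sub L c R a b"
proof (induction c arbitrary: Q R a b)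
  case (HSeq c d)
  show ?case using HSeq.prems HSeq.IH(1)[of "wp sub L d Q"] HSeq.IH(2) by auto
next
  case (HWhile e c)
  have "((\<lambda>X a b. if 0 < hval e a then wp sub L c X a b else Q a b) ^^ k) (\<lambda>_ _. False) a b \<Longrightarrow>
    ((\<lambda>X a b. if 0 < hval e a then wp sub L c X a b else R a b) ^^ k) (\<lambda>_ _. False) a b" for k a b
  proof (induction k arbitrary: a b)
    case (Suc k)
    show ?case
    proof (cases "0 < hval e a")
      case True
      then have "wp sub L c (((\<lambda>X a b. if 0 < hval e a then wp sub L c X a b else Q a b) ^^ k)
        (\<lambda>_ _. False)) a b" using Suc.prems by simp
      from HWhile.IH[OF this Suc.IH] show ?thesis using True by simp
    qed (use Suc.prems HWhile.prems(2) in simp)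
  qed simp
  from this[of "Suc L"] show ?case using HWhile.prems(1) unfolding wp.simps(7) .
qed (auto split: if_splits)

section \<open>Frame property and loop rules\<close>

primrec mods :: "hcom \<Rightarrow> nat set" where
  "mods HSkip = {}" | "mods (HSet j i e) = {j}" | "mods (HGet j i e) = {j}" | "mods (HPut i e) = {}"
| "mods (c ;; d) = mods c \<union> mods d" | "mods (HIf e c d) = mods c \<union> mods d"
| "mods (HWhile e c) = mods c" | "mods HAsk = {}"

primrec touches_block :: "hcom \<Rightarrow> bool" where
  "touches_block HSkip = False" | "touches_block (HSet j i e) = False"
| "touches_block (HGet j i e) = False" | "touches_block (HPut i e) = True"
| "touches_block (c ;; d) = (touches_block c \<or> touches_block d)"
| "touches_block (HIf e c d) = (touches_block c \<or> touches_block d)"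
| "touches_block (HWhile e c) = touches_block c" | "touches_block HAsk = True"

primrec hvars :: "hexp \<Rightarrow> nat set" where
  "hvars (HN k) = {}" | "hvars (HV j e) = insert j (hvars e)"
| "hvars (e \<oplus> f) = hvars e \<union> hvars f" | "hvars (e \<ominus> f) = hvars e \<union> hvars f"
| "hvars (e \<otimes> f) = hvars e \<union> hvars f" | "hvars (e \<oslash> f) = hvars e \<union> hvars f"

lemma hval_cong: "(\<And>j. j \<in> hvars e \<Longrightarrow> a j = a' j) \<Longrightarrow> hval e a = hval e a'"
  by (induction e) auto

definition same_off :: "nat set \<Rightarrow> bool \<Rightarrow> arrays \<Rightarrow> block \<Rightarrow> arrays \<Rightarrow> block \<Rightarrow> bool" where
  "same_off M t a b a' b' \<longleftrightarrow> (\<forall>j. j \<notin> M \<longrightarrow> a' j = a j) \<and> (\<not> t \<longrightarrow> b' = b)"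

lemma same_off_trans:
  "same_off M t a b a1 b1 \<Longrightarrow> same_off N u a1 b1 a2 b2 \<Longrightarrow> M \<subseteq> M' \<Longrightarrow> N \<subseteq> M' \<Longrightarrow>
   (t \<longrightarrow> t') \<Longrightarrow> (u \<longrightarrow> t') \<Longrightarrow> same_off M' t' a b a2 b2"
  unfolding same_off_def by (metis subsetD)

text \<open>A program writes only to the arrays in \<open>mods\<close>, and to the block only if
  \<open>touches_block\<close> holds. Adding this to any established postcondition spares the
  invariants below all mention of unmodified data.\<close>

lemma wp_frame:
  "wp sub L c Q a b \<Longrightarrow>
   wp sub L c (\<lambda>a' b'. Q a' b' \<and> same_off (mods c) (touches_block c) a b a' b') a b"
proof (induction c arbitrary: Q a b)
  case (HSeq c d)
  have "wp sub L c (\<lambda>a1 b1. wp sub L d Q a1 b1 \<and> same_off (mods c) (touches_block c) a b a1 b1) a b"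
    using HSeq.IH(1) HSeq.prems by simp
  then show ?case
    unfolding wp.simps
  proof (rule wp_mono)
    fix a1 b1 assume h: "wp sub L d Q a1 b1 \<and> same_off (mods c) (touches_block c) a b a1 b1"
    then have "wp sub L d (\<lambda>a' b'. Q a' b' \<and> same_off (mods d) (touches_block d) a1 b1 a' b') a1 b1"
      using HSeq.IH(2) by simp
    then show "wp sub L d (\<lambda>a' b'. Q a' b' \<and>
        same_off (mods (c ;; d)) (touches_block (c ;; d)) a b a' b') a1 b1"
      by (rule wp_mono) (use h in \<open>auto intro: same_off_trans\<close>)
  qed
next
  case (HIf e c d)
  show ?case
  proof (cases "0 < hval e a")
    case True
    then have "wp sub L c Q a b" using HIf.prems by simp
    from HIf.IH(1)[OF this] have "wp sub L c (\<lambda>a' b'. Q a' b' \<and>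
        same_off (mods (HIf e c d)) (touches_block (HIf e c d)) a b a' b') a b"
      by (rule wp_mono) (auto simp: same_off_def)
    then show ?thesis using True by simp
  next
    case False
    then have "wp sub L d Q a b" using HIf.prems by simp
    from HIf.IH(2)[OF this] have "wp sub L d (\<lambda>a' b'. Q a' b' \<and>
        same_off (mods (HIf e c d)) (touches_block (HIf e c d)) a b a' b') a b"
      by (rule wp_mono) (auto simp: same_off_def)
    then show ?thesis using False by simp
  qed
next
  case (HWhile e c)
  let ?S = "same_off (mods c) (touches_block c)"
  have "((\<lambda>X a b. if 0 < hval e a then wp sub L c X a b else Q a b) ^^ k) (\<lambda>_ _. False) a1 b1 \<Longrightarrow>
    ?S a b a1 b1 \<Longrightarrow>
    ((\<lambda>X a' b'. if 0 < hval e a' then wp sub L c X a' b' else Q a' b' \<and> ?S a b a' b') ^^ k)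
      (\<lambda>_ _. False) a1 b1" for k a1 b1
  proof (induction k arbitrary: a1 b1)
    case (Suc k)
    show ?case
    proof (cases "0 < hval e a1")
      case True
      then have "wp sub L c (\<lambda>a2 b2. ((\<lambda>X a b. if 0 < hval e a then wp sub L c X a b else Q a b) ^^ k)
         (\<lambda>_ _. False) a2 b2 \<and> ?S a1 b1 a2 b2) a1 b1"
        using Suc.prems(1) HWhile.IH by simp
      then have "wp sub L c (((\<lambda>X a' b'. if 0 < hval e a' then wp sub L c X a' b'
         else Q a' b' \<and> ?S a b a' b') ^^ k) (\<lambda>_ _. False)) a1 b1"
      proof (rule wp_mono)
        fix a2 b2 assume h: "((\<lambda>X a b. if 0 < hval e a then wp sub L c X a b else Q a b) ^^ k)
         (\<lambda>_ _. False) a2 b2 \<and> ?S a1 b1 a2 b2"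
        then have "?S a b a2 b2" using Suc.prems(2) by (auto simp: same_off_def)
        then show "((\<lambda>X a' b'. if 0 < hval e a' then wp sub L c X a' b'
         else Q a' b' \<and> ?S a b a' b') ^^ k) (\<lambda>_ _. False) a2 b2" using Suc.IH h by blast
      qed
      then show ?thesis using True by simp
    qed (use Suc.prems in simp)
  qed simp
  moreover have "?S a b a b" by (simp add: same_off_def)
  ultimately show ?case using HWhile.prems unfolding wp.simps(7) mods.simps touches_block.simps by blast
qed (auto simp: same_off_def)

text \<open>\<open>k\<close> is a variant bounding the remaining iterations. The
  \<open>Suc L\<close> unfoldings in \<open>wp\<close> allow \<open>L\<close> executions of the body
  and the final test.\<close>

lemma wp_While:
  assumes "I k a b" "k \<le> L"
    and step: "\<And>k a b. I k a b \<Longrightarrow> 0 < hval e a \<Longrightarrow> 0 < k \<and> wp sub L c (I (k - 1)) a b"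
    and post: "\<And>k a b. I k a b \<Longrightarrow> \<not> 0 < hval e a \<Longrightarrow> Q a b"
  shows "wp sub L (HWhile e c) Q a b"
proof -
  have "I k a b \<Longrightarrow> k \<le> l \<Longrightarrow>
    ((\<lambda>X a b. if 0 < hval e a then wp sub L c X a b else Q a b) ^^ Suc l) (\<lambda>_ _. False) a b"
    for k l a b
  proof (induction l arbitrary: k a b)
    case 0
    then show ?case using step[of k a b] post[of k a b] by auto
  next
    case (Suc l)
    show ?case
    proof (cases "0 < hval e a")
      case True
      with step[OF Suc.prems(1) True] Suc.prems(2)
      have "wp sub L c (I (k - 1)) a b" "k - 1 \<le> l" by auto
      from wp_mono[OF this(1) Suc.IH[OF _ this(2)]] True show ?thesis by simp
    qed (use Suc.prems post in simp)
  qed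
  from this[OF assms(1,2)] show ?thesis unfolding wp.simps(7) .
qed

definition HFor :: "nat \<Rightarrow> hexp \<Rightarrow> hcom \<Rightarrow> hcom" where
  "HFor v e c = HSet v (HN 0) (HN 0) ;; HWhile (e \<ominus> HV v (HN 0)) (c ;; HSet v (HN 0) (HV v (HN 0) \<oplus> HN 1))"

lemma mods_HFor [simp]: "mods (HFor v e c) = insert v (mods c)"
  and touches_block_HFor [simp]: "touches_block (HFor v e c) = touches_block c"
  by (auto simp: HFor_def)

text \<open>The frame relative to the start of the loop is handed to every step and to the
  postcondition. The bound \<open>e\<close> reads no array changed by the loop, so it keeps the
  value \<open>N\<close> although it is evaluated again in each test.\<close>

lemma wp_For:
  assumes N: "hval e a0 = int N" "N \<le> L"
    and syn: "v \<notin> mods c" "hvars e \<inter> insert v (mods c) = {}"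
    and I0: "I 0 (upd a0 v 0 0) b0"
    and step: "\<And>i a b. i < N \<Longrightarrow> I i a b \<Longrightarrow> a v 0 = int i \<Longrightarrow>
      same_off (insert v (mods c)) (touches_block c) a0 b0 a b \<Longrightarrow>
      wp sub L c (\<lambda>a b. I (Suc i) (upd a v 0 (int (Suc i))) b) a b"
    and post: "\<And>a b. I N a b \<Longrightarrow> a v 0 = int N \<Longrightarrow>
      same_off (insert v (mods c)) (touches_block c) a0 b0 a b \<Longrightarrow> Q a b"
  shows "wp sub L (HFor v e c) Q a0 b0"
proof -
  let ?S = "same_off (insert v (mods c)) (touches_block c)"
  define J where "J = (\<lambda>k a b. \<exists>i. i + k = N \<and> I i a b \<and> a v 0 = int i \<and> ?S a0 b0 a b)"
  have he: "hval e a = int N" if "?S a0 b0 a b" for a b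
  proof -
    have "hval e a = hval e a0"
      by (rule hval_cong) (use that syn in \<open>auto simp: same_off_def\<close>)
    then show ?thesis using N by simp
  qed
  have "wp sub L (HWhile (e \<ominus> HV v (HN 0)) (c ;; HSet v (HN 0) (HV v (HN 0) \<oplus> HN 1))) Q
    (upd a0 v 0 0) b0"
  proof (rule wp_While[where I = J and k = N])
    show "J N (upd a0 v 0 0) b0" unfolding J_def using I0 by (auto simp: same_off_def)
    show "N \<le> L" by fact
    fix k a b assume J: "J k a b"
    then obtain i where i: "i + k = N" "I i a b" "a v 0 = int i" "?S a0 b0 a b"
      unfolding J_def by auto
    have hv: "hval (e \<ominus> HV v (HN 0)) a = int N - int i" using he[OF i(4)] i(3) by simp
    { assume "0 < hval (e \<ominus> HV v (HN 0)) a"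
      then have lt: "i < N" using hv by simp
      have "wp sub L c (\<lambda>a b. J (k - 1) (upd a v 0 (a v 0 + 1)) b) a b"
        using wp_frame[OF step[OF lt i(2,3,4)]]
      proof (rule wp_mono)
        fix a' b' assume h: "I (Suc i) (upd a' v 0 (int (Suc i))) b' \<and>
          same_off (mods c) (touches_block c) a b a' b'"
        then have v: "a' v 0 = int i" using syn i by (simp add: same_off_def)
        have "?S a0 b0 (upd a' v 0 (int (Suc i))) b'" using h i(4) by (auto simp: same_off_def)
        then show "J (k - 1) (upd a' v 0 (a' v 0 + 1)) b'"
          unfolding J_def using h v lt i(1) by (intro exI[of _ "Suc i"]) (auto simp: add.commute)
      qed
      then show "0 < k \<and> wp sub L (c ;; HSet v (HN 0) (HV v (HN 0) \<oplus> HN 1)) (J (k - 1)) a b"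
        using lt i(1) by simp }
    { assume "\<not> 0 < hval (e \<ominus> HV v (HN 0)) a"
      then have "i = N" using hv i(1) by simp
      then show "Q a b" using post i by simp }
  qed
  then show ?thesis by (simp add: HFor_def)
qed

section \<open>Compilation to the random access machine\<close>

definition haddr :: "nat \<Rightarrow> aexp \<Rightarrow> aexp" where
  "haddr j x = Minus (Const (- (1 + int j))) (Times (Const 64) (Times x x))"

primrec cexp :: "hexp \<Rightarrow> aexp" where
  "cexp (HN k) = Const k"
| "cexp (HV j e) = Cell (haddr j (cexp e))"
| "cexp (e \<oplus> f) = Plus (cexp e) (cexp f)"
| "cexp (e \<ominus> f) = Minus (cexp e) (cexp f)"
| "cexp (e \<otimes> f) = Times (cexp e) (cexp f)"
| "cexp (e \<oslash> f) = Quot (cexp e) (cexp f)"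

primrec comp :: "hcom \<Rightarrow> com" where
  "comp HSkip = Skip"
| "comp (HSet j i e) = Store (haddr j (cexp i)) (cexp e)"
| "comp (HGet j i e) = Store (haddr j (cexp i)) (Cell (cexp e))"
| "comp (HPut i e) = Store (cexp i) (cexp e)"
| "comp (c ;; d) = Seq (comp c) (comp d)"
| "comp (HIf e c d) = IfPos (cexp e) (comp c) (comp d)"
| "comp (HWhile e c) = WhilePos (cexp e) (comp c)"
| "comp HAsk = Ask (Const 0) (Const 0)"

text \<open>The block occupies the nonnegative addresses; entry \<open>i\<close> of array
  \<open>j\<close> lies at a negative address with residue \<open>- (1 + j)\<close> modulo 64.
  Squaring the index makes the address independent of its sign, which replaces the absolute value in
  \<open>hval\<close> by one multiplication and only doubles the length of addresses.\<close>

definition rel :: "memory \<Rightarrow> arrays \<Rightarrow> block \<Rightarrow> bool" where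
  "rel s a b \<longleftrightarrow> (\<forall>i. s (int i) = b i) \<and>
     (\<forall>j<64. \<forall>i. s (- (1 + int j) - 64 * (int i * int i)) = a j i)"

lemma aval_haddr:
  "aval (haddr j x) s = - (1 + int j) - 64 * (int (nat \<bar>aval x s\<bar>) * int (nat \<bar>aval x s\<bar>))"
  by (simp add: haddr_def flip: abs_mult)

lemma aval_cexp:
  "rel s a b \<Longrightarrow> hvars e \<subseteq> {..<64} \<Longrightarrow> aval (cexp e) s = hval e a"
proof (induction e)
  case (HV j e)
  then have e: "aval (cexp e) s = hval e a" by auto
  have "s (- (1 + int j) - 64 * (int i * int i)) = a j i" for i
    using HV.prems unfolding rel_def by auto
  then show ?case unfolding cexp.simps aval.simps aval_haddr e hval.simps .
qed auto

text \<open>The residue modulo 64 determines the array, and what remains is the square of the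
  index.\<close>

lemma haddr_inj:
  assumes "j < 64" "j' < 64"
    and "- (1 + int j) - 64 * (int i * int i) = - (1 + int j') - 64 * (int i' * int i')"
  shows "j = j' \<and> i = i'"
proof -
  have eq: "int j + 64 * (int i * int i) = int j' + 64 * (int i' * int i')" using assms(3) by simp
  then have "(int j + 64 * (int i * int i)) mod 64 = (int j' + 64 * (int i' * int i')) mod 64" by simp
  then have j: "j = j'" using assms(1,2) by simp
  then have "i * i = i' * i'" using eq by (simp flip: of_nat_mult)
  then have "i = i'" by (metis power2_eq_imp_eq power2_eq_square zero_le)
  with j show ?thesis by simp
qed

lemma rel_upd:
  assumes "rel s a b" "j < 64"
  shows "rel (s(- (1 + int j) - 64 * (int i * int i) := v)) (upd a j i v) b"
proof -
  have sq: "0 \<le> int i * int i" by simp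
  have "int k \<noteq> - (1 + int j) - 64 * (int i * int i)" for k
    using sq by linarith
  then show ?thesis using assms haddr_inj[OF _ assms(2)] unfolding rel_def by (auto simp: fun_upd_def)
qed

lemma rel_write:
  assumes "rel s a b" and "\<And>i. s' (int i) = b' i" and "\<And>z. z < 0 \<Longrightarrow> s' z = s z"
  shows "rel s' a b'"
proof -
  have "- (1 + int j) - 64 * (int i * int i) < 0" for i j
  proof -
    have "0 \<le> int i * int i" by simp
    then show ?thesis by linarith
  qed
  then show ?thesis using assms unfolding rel_def by auto
qed

text \<open>\<open>weight e\<close> bounds the bit length of \<open>e\<close> in units of the bit length of the memory entries,
  \<open>work e\<close> its evaluation cost.\<close>

primrec weight :: "hexp \<Rightarrow> nat" where
  "weight (HN k) = nat \<bar>k\<bar> + 1" | "weight (HV j e) = 1"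
| "weight (e \<oplus> f) = weight e + weight f" | "weight (e \<ominus> f) = weight e + weight f"
| "weight (e \<otimes> f) = weight e + weight f" | "weight (e \<oslash> f) = weight e + weight f"

primrec work :: "hexp \<Rightarrow> nat" where
  "work (HN k) = nat \<bar>k\<bar> + 3" | "work (HV j e) = 2 * work e + 6 * weight e + 50"
| "work (e \<oplus> f) = work e + work f + weight e + weight f + 2"
| "work (e \<ominus> f) = work e + work f + weight e + weight f + 2"
| "work (e \<otimes> f) = work e + work f + weight e + weight f + 2"
| "work (e \<oslash> f) = work e + work f + weight e + weight f + 2"

lemma weight_pos: "1 \<le> weight e"
  by (induction e) auto

lemma abs_le_two_power: "\<bar>k\<bar> \<le> (2::int) ^ (nat \<bar>k\<bar>)"
proof -
  have "nat \<bar>k\<bar> < 2 ^ nat \<bar>k\<bar>" by (rule less_exp)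
  then have "int (nat \<bar>k\<bar>) < int (2 ^ nat \<bar>k\<bar>)" by (simp only: of_nat_less_iff)
  then show ?thesis by simp
qed

lemma add_le_two_power:
  "\<bar>x\<bar> \<le> (2::int) ^ m \<Longrightarrow> \<bar>y\<bar> \<le> 2 ^ n \<Longrightarrow> 1 \<le> m \<Longrightarrow> 1 \<le> n \<Longrightarrow>
   \<bar>x + y\<bar> \<le> 2 ^ (m + n) \<and> \<bar>x - y\<bar> \<le> 2 ^ (m + n)"
proof -
  assume h: "\<bar>x\<bar> \<le> (2::int) ^ m" "\<bar>y\<bar> \<le> 2 ^ n" "1 \<le> m" "1 \<le> n"
  have "(2::int) \<le> 2 ^ m" "(2::int) \<le> 2 ^ n"
    using h(3,4) power_increasing[of 1 m "2::int"] power_increasing[of 1 n "2::int"] by auto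
  \<comment> \<open>Expanding the product gives 2^(m+n) >= 2 * (2^m + 2^n) - 4, which is at least
    2^m + 2^n because that sum is at least 4.\<close>
  then have "0 \<le> ((2::int) ^ m - 2) * (2 ^ n - 2)" "(4::int) \<le> 2 ^ m + 2 ^ n"
    by (auto intro: mult_nonneg_nonneg)
  then have "(2::int) ^ m + 2 ^ n \<le> 2 ^ (m + n)"
    unfolding power_add by (simp only: left_diff_distrib right_diff_distrib)
  then show ?thesis using h by linarith
qed

lemma mult_le_two_power:
  "\<bar>x\<bar> \<le> (2::int) ^ m \<Longrightarrow> \<bar>y\<bar> \<le> 2 ^ n \<Longrightarrow> \<bar>x * y\<bar> \<le> 2 ^ (m + n)"
  by (simp add: abs_mult power_add mult_mono)

lemma abs_div_le: "\<bar>x div y\<bar> \<le> \<bar>x::int\<bar>"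
proof -
  have pos: "\<bar>x div y\<bar> \<le> \<bar>x\<bar>" if "0 < y" for x y :: int
  proof (cases "0 \<le> x")
    case True
    then show ?thesis using that zdiv_mono2[of x 1 y] pos_imp_zdiv_nonneg_iff[of y x] by simp
  next
    case False
    then show ?thesis using that zdiv_mono2_neg[of x 1 y] pos_imp_zdiv_neg_iff[of y x] by simp
  qed
  show ?thesis
  proof (cases "y = 0")
    case False
    then consider "0 < y" | "0 < - y" by linarith
    then show ?thesis using pos[of y x] pos[of "- y" "- x"] by cases (auto simp: div_minus_minus)
  qed simp
qed

section \<open>Bit lengths of computed values\<close>

primrec below :: "nat \<Rightarrow> hexp \<Rightarrow> bool" where
  "below j (HN k) = True" | "below j (HV i e) = (i < j)"
| "below j (e \<oplus> f) = (below j e \<and> below j f)" | "below j (e \<ominus> f) = (below j e \<and> below j f)"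
| "below j (e \<otimes> f) = (below j e \<and> below j f)" | "below j (e \<oslash> f) = below j e"

text \<open>Only one factor of a product may involve array \<open>j\<close>, because repeated
  squaring of an accumulator would double its length each time. \<open>HV\<close> restricts the
  array but not the index expression, as the bounds are uniform in the index; divisors are
  unrestricted, as a quotient never exceeds its dividend in absolute value.\<close>

primrec acc :: "nat \<Rightarrow> hexp \<Rightarrow> bool" where
  "acc j (HN k) = True" | "acc j (HV i e) = (i \<le> j)"
| "acc j (e \<oplus> f) = (acc j e \<and> acc j f)" | "acc j (e \<ominus> f) = (acc j e \<and> acc j f)"
| "acc j (e \<otimes> f) = (acc j e \<and> below j f \<or> below j e \<and> acc j f)" | "acc j (e \<oslash> f) = acc j e"

lemma below_le:
  assumes "\<And>j' i. j' < j \<Longrightarrow> \<bar>a j' i\<bar> \<le> 2 ^ B" "below j e"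
  shows "\<bar>hval e a\<bar> \<le> 2 ^ (weight e * (B + 1))"
  using assms(2)
proof (induction e)
  case (HN k)
  have "(2::int) ^ nat \<bar>k\<bar> \<le> 2 ^ (weight (HN k) * (B + 1))" by (intro power_increasing) auto
  with abs_le_two_power[of k] show ?case by simp
next
  case (HV j e)
  then have "\<bar>hval (HV j e) a\<bar> \<le> 2 ^ B" using assms(1) by simp
  also have "\<dots> \<le> 2 ^ (weight (HV j e) * (B + 1))" by (intro power_increasing) auto
  finally show ?case .
next
  case (HAdd e f)
  then show ?case
    using add_le_two_power[of "hval e a" "weight e * (B + 1)" "hval f a" "weight f * (B + 1)"]
      weight_pos[of e] weight_pos[of f] by (simp add: algebra_simps)
next
  case (HSub e f)
  then show ?case
    using add_le_two_power[of "hval e a" "weight e * (B + 1)" "hval f a" "weight f * (B + 1)"]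
      weight_pos[of e] weight_pos[of f] by (simp add: algebra_simps)
next
  case (HMul e f)
  then show ?case
    using mult_le_two_power[of "hval e a" "weight e * (B + 1)" "hval f a" "weight f * (B + 1)"]
    by (simp add: algebra_simps)
next
  case (HDiv e f)
  then have "\<bar>hval e a\<bar> \<le> 2 ^ (weight e * (B + 1))" by simp
  also have "\<dots> \<le> 2 ^ (weight (e \<oslash> f) * (B + 1))" by (intro power_increasing) (auto simp: algebra_simps)
  finally show ?case using abs_div_le[of "hval e a" "hval f a"] by simp
qed

lemma hval_le:
  assumes "\<And>j i. j < 64 \<Longrightarrow> \<bar>a j i\<bar> \<le> 2 ^ B" "hvars e \<subseteq> {..<64}"
  shows "\<bar>hval e a\<bar> \<le> 2 ^ (weight e * (B + 1))"
proof (rule below_le[of 64])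
  show "below 64 e" using assms(2) by (induction e) auto
qed (use assms in auto)

lemma word_size_single_le: "\<bar>v\<bar> \<le> 2 ^ x \<Longrightarrow> word_size [v] \<le> x + 2"
proof -
  assume "\<bar>v\<bar> \<le> 2 ^ x"
  then have "nat \<bar>v\<bar> < 2 ^ (x + 1)"
    by (simp add: nat_less_iff) (smt (verit) zero_less_power)
  then have "floorlog 2 (nat \<bar>v\<bar>) \<le> x + 1" by (subst floorlog_le_iff) auto
  then show ?thesis by (simp add: word_size_def)
qed

lemma acost_haddr:
  assumes "j < 64" "\<bar>aval x s\<bar> \<le> 2 ^ y"
  shows "acost (haddr j x) s \<le> 2 * acost x s + 6 * y + 40"
proof -
  have 1: "word_size [- (1 + int j)] \<le> 6 + 2"
    by (rule word_size_single_le) (use assms(1) in simp)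
  have 2: "word_size [64] \<le> 6 + 2" by (rule word_size_single_le) simp
  have xx: "\<bar>aval x s * aval x s\<bar> \<le> 2 ^ (y + y)" by (rule mult_le_two_power) fact+
  then have 3: "word_size [aval x s * aval x s] \<le> (y + y) + 2" by (rule word_size_single_le)
  have x4: "\<bar>64 * (aval x s * aval x s)\<bar> \<le> 2 ^ (6 + (y + y))"
    by (rule mult_le_two_power[OF _ xx]) simp
  then have 4: "word_size [64 * (aval x s * aval x s)] \<le> (6 + (y + y)) + 2" by (rule word_size_single_le)
  have "\<bar>- (1 + int j) - 64 * (aval x s * aval x s)\<bar> \<le> 2 ^ (6 + (6 + (y + y)))"
    by (rule add_le_two_power[THEN conjunct2, OF _ x4]) (use assms(1) in auto)
  then have 5: "word_size [- (1 + int j) - 64 * (aval x s * aval x s)] \<le> (6 + (6 + (y + y))) + 2"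
    by (rule word_size_single_le)
  have "acost (haddr j x) s = word_size [- (1 + int j)] + (word_size [64] +
      (acost x s + acost x s + word_size [aval x s * aval x s]) +
      word_size [64 * (aval x s * aval x s)]) + word_size [- (1 + int j) - 64 * (aval x s * aval x s)]"
    unfolding haddr_def acost.simps aval.simps by simp
  then show ?thesis using 1 2 3 4 5 by linarith
qed

lemma acost_cexp_le:
  assumes r: "rel s a b" and le: "\<And>j i. j < 64 \<Longrightarrow> \<bar>a j i\<bar> \<le> 2 ^ B" and "hvars e \<subseteq> {..<64}"
  shows "acost (cexp e) s \<le> work e * (B + 1)"
  using assms(3)
proof (induction e)
  case (HN k)
  have "word_size [k] \<le> nat \<bar>k\<bar> + 2" by (rule word_size_single_le[OF abs_le_two_power])
  then show ?case by simp
next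
  case (HV j e)
  have e: "aval (cexp e) s = hval e a" using aval_cexp[OF r] HV.prems by auto
  have "\<bar>aval (cexp e) s\<bar> \<le> 2 ^ (weight e * (B + 1))" unfolding e using hval_le[OF le] HV.prems by auto
  then have 1: "acost (haddr j (cexp e)) s \<le> 2 * acost (cexp e) s + 6 * (weight e * (B + 1)) + 40"
    by (rule acost_haddr[rotated]) (use HV.prems in auto)
  have "aval (cexp (HV j e)) s = hval (HV j e) a" using aval_cexp[OF r HV.prems] .
  then have "\<bar>aval (cexp (HV j e)) s\<bar> \<le> 2 ^ B" using le HV.prems by simp
  then have 2: "word_size [aval (cexp (HV j e)) s] \<le> B + 2" by (rule word_size_single_le)
  have "acost (cexp (HV j e)) s = acost (haddr j (cexp e)) s + word_size [aval (cexp (HV j e)) s]"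
    by simp
  with 1 2 HV show ?case by (simp add: algebra_simps)
next
  case (HAdd e f)
  have "aval (cexp (HAdd e f)) s = hval (HAdd e f) a" by (rule aval_cexp[OF r HAdd.prems])
  then have "word_size [aval (cexp (HAdd e f)) s] \<le> weight (HAdd e f) * (B + 1) + 2"
    using word_size_single_le[OF hval_le[OF le HAdd.prems]] by simp
  then show ?case using HAdd by (simp add: algebra_simps)
next
  case (HSub e f)
  have "aval (cexp (HSub e f)) s = hval (HSub e f) a" by (rule aval_cexp[OF r HSub.prems])
  then have "word_size [aval (cexp (HSub e f)) s] \<le> weight (HSub e f) * (B + 1) + 2"
    using word_size_single_le[OF hval_le[OF le HSub.prems]] by simp
  then show ?case using HSub by (simp add: algebra_simps)
next
  case (HMul e f)
  have "aval (cexp (HMul e f)) s = hval (HMul e f) a" by (rule aval_cexp[OF r HMul.prems])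
  then have "word_size [aval (cexp (HMul e f)) s] \<le> weight (HMul e f) * (B + 1) + 2"
    using word_size_single_le[OF hval_le[OF le HMul.prems]] by simp
  then show ?case using HMul by (simp add: algebra_simps)
next
  case (HDiv e f)
  have "aval (cexp (HDiv e f)) s = hval (HDiv e f) a" by (rule aval_cexp[OF r HDiv.prems])
  then have "word_size [aval (cexp (HDiv e f)) s] \<le> weight (HDiv e f) * (B + 1) + 2"
    using word_size_single_le[OF hval_le[OF le HDiv.prems]] by simp
  then show ?case using HDiv by (simp add: algebra_simps)
qed

text \<open>The length \<open>A\<close> of array \<open>j\<close> itself enters the exponent only
  once: in sums 2^A factors out, and in products only one side carries it. Everything else comes
  from lower arrays and costs \<open>weight e * (B + 1)\<close> bits.\<close>

lemma acc_le:
  assumes lt: "\<And>j' i. j' < j \<Longrightarrow> \<bar>a j' i\<bar> \<le> 2 ^ B" and le: "\<And>j' i. j' \<le> j \<Longrightarrow> \<bar>a j' i\<bar> \<le> 2 ^ A"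
    and "acc j e"
  shows "\<bar>hval e a\<bar> \<le> 2 ^ (A + weight e * (B + 1))"
  using assms(3)
proof (induction e)
  case (HN k)
  have "(2::int) ^ nat \<bar>k\<bar> \<le> 2 ^ (A + weight (HN k) * (B + 1))" by (intro power_increasing) auto
  with abs_le_two_power[of k] show ?case by simp
next
  case (HV j e)
  then have "\<bar>hval (HV j e) a\<bar> \<le> 2 ^ A" using le by simp
  also have "\<dots> \<le> 2 ^ (A + weight (HV j e) * (B + 1))" by (intro power_increasing) auto
  finally show ?case .
next
  case (HAdd e f)
  have "\<bar>hval e a + hval f a\<bar> \<le> 2 ^ A * 2 ^ (weight (e \<oplus> f) * (B + 1))"
  proof -
    have "\<bar>hval e a + hval f a\<bar> \<le> 2 ^ A * (2 ^ (weight e * (B + 1)) + 2 ^ (weight f * (B + 1)))"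
      using HAdd by (simp add: power_add distrib_left)
    also have "\<dots> \<le> 2 ^ A * 2 ^ (weight (e \<oplus> f) * (B + 1))"
      using add_le_two_power[of "2 ^ (weight e * (B + 1))" "weight e * (B + 1)"
          "2 ^ (weight f * (B + 1))" "weight f * (B + 1)"] weight_pos[of e] weight_pos[of f]
      by (intro mult_left_mono) (simp_all add: algebra_simps)
    finally show ?thesis .
  qed
  then show ?case by (simp add: power_add)
next
  case (HSub e f)
  have "\<bar>hval e a - hval f a\<bar> \<le> 2 ^ A * 2 ^ (weight (e \<ominus> f) * (B + 1))"
  proof -
    have "\<bar>hval e a - hval f a\<bar> \<le> 2 ^ A * (2 ^ (weight e * (B + 1)) + 2 ^ (weight f * (B + 1)))"
      using HSub by (simp add: power_add distrib_left)
    also have "\<dots> \<le> 2 ^ A * 2 ^ (weight (e \<ominus> f) * (B + 1))"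
      using add_le_two_power[of "2 ^ (weight e * (B + 1))" "weight e * (B + 1)"
          "2 ^ (weight f * (B + 1))" "weight f * (B + 1)"] weight_pos[of e] weight_pos[of f]
      by (intro mult_left_mono) (simp_all add: algebra_simps)
    finally show ?thesis .
  qed
  then show ?case by (simp add: power_add)
next
  case (HMul e f)
  from HMul.prems show ?case unfolding acc.simps
  proof (elim disjE conjE)
    assume "acc j e" "below j f"
    then show ?thesis
      using mult_le_two_power[of "hval e a" "A + weight e * (B + 1)" "hval f a" "weight f * (B + 1)"]
        HMul.IH(1) below_le[of j a B f] lt by (simp add: algebra_simps)
  next
    assume "acc j f" "below j e"
    then show ?thesis
      using mult_le_two_power[of "hval e a" "weight e * (B + 1)" "hval f a" "A + weight f * (B + 1)"]
        HMul.IH(2) below_le[of j a B e] lt by (simp add: algebra_simps)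
  qed
next
  case (HDiv e f)
  then have "\<bar>hval e a\<bar> \<le> 2 ^ (A + weight e * (B + 1))" by simp
  also have "\<dots> \<le> 2 ^ (A + weight (e \<oslash> f) * (B + 1))" by (intro power_increasing) (auto simp: algebra_simps)
  finally show ?case using abs_div_le[of "hval e a" "hval f a"] by simp
qed

text \<open>\<open>acc\<close> is demanded of \<open>HSet\<close> only: values fetched by
  \<open>HGet\<close> are bounded by \<open>2 ^ L\<close> through \<open>wp\<close>, and values
  written by \<open>HPut\<close> do not enter an array except through \<open>HGet\<close>.\<close>

primrec wf :: "hcom \<Rightarrow> bool" where
  "wf HSkip = True"
| "wf (HSet j i e) = (j < 64 \<and> hvars i \<subseteq> {..<64} \<and> hvars e \<subseteq> {..<64} \<and> acc j e)"
| "wf (HGet j i e) = (j < 64 \<and> hvars i \<subseteq> {..<64} \<and> hvars e \<subseteq> {..<64})"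
| "wf (HPut i e) = (hvars i \<subseteq> {..<64} \<and> hvars e \<subseteq> {..<64})"
| "wf (c ;; d) = (wf c \<and> wf d)"
| "wf (HIf e c d) = (hvars e \<subseteq> {..<64} \<and> wf c \<and> wf d)"
| "wf (HWhile e c) = (hvars e \<subseteq> {..<64} \<and> wf c)"
| "wf HAsk = True"

primrec csize :: "hcom \<Rightarrow> nat" where
  "csize HSkip = 1"
| "csize (HSet j i e) = 2 * work i + 6 * weight i + 50 + work e + weight e"
| "csize (HGet j i e) = 2 * work i + 6 * weight i + 50 + work e + weight e"
| "csize (HPut i e) = work i + work e + weight e + weight i"
| "csize (c ;; d) = csize c + csize d"
| "csize (HIf e c d) = work e + csize c + csize d"
| "csize (HWhile e c) = work e + csize c"
| "csize HAsk = 1"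

text \<open>One number serves twice: it bounds the elementary steps of a run, hence its time, and
  the number of assignments, which controls the growth of the entries.\<close>

primrec steps :: "nat \<Rightarrow> hcom \<Rightarrow> nat" where
  "steps L HSkip = 1" | "steps L (HSet j i e) = 1" | "steps L (HGet j i e) = 1"
| "steps L (HPut i e) = 1" | "steps L (c ;; d) = 1 + steps L c + steps L d"
| "steps L (HIf e c d) = 1 + steps L c + steps L d"
| "steps L (HWhile e c) = Suc L * (1 + steps L c)" | "steps L HAsk = 1"

text \<open>\<open>E\<close> stands for the size of the program's expressions and \<open>N\<close>
  for the number of steps of a whole run; both are fixed before the bit lengths are
  estimated.\<close>

locale bit_bound =
  fixes L E N :: nat
  assumes L: "1 \<le> L" and E: "1 \<le> E" and N: "1 \<le> N"
begin

text \<open>An assignment to array \<open>j\<close> adds at most a multiple of the bit lengths of the arrays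
  below \<open>j\<close> to the bit length of array \<open>j\<close>, so that \<open>N\<close> assignments multiply the bound by \<open>O(N)\<close> per array.\<close>

primrec lev :: "nat \<Rightarrow> nat" where
  "lev 0 = L" | "lev (Suc j) = L + N * (E * (lev j + 1))"

abbreviation "tlev \<equiv> lev 64"
abbreviation "blev \<equiv> L + E * (tlev + 1)"

text \<open>Bound for the cost of one elementary step: evaluating its expressions on entries of
  \<open>tlev\<close> bits, or passing a query and an answer of at most \<open>L\<close> words
  each.\<close>

definition unit :: nat where "unit = 10 + E * (tlev + 1) + 2 * L * (blev + 2) + blev"

text \<open>\<open>p\<close> counts the steps made so far; each may lengthen array \<open>j\<close>
  by \<open>E * (lev j + 1)\<close> bits, where \<open>lev j\<close> bounds the arrays below
  \<open>j\<close> during the whole run.\<close>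

definition arr_ok :: "nat \<Rightarrow> arrays \<Rightarrow> bool" where
  "arr_ok p a \<longleftrightarrow> (\<forall>j<64. \<forall>i. \<bar>a j i\<bar> \<le> 2 ^ (L + p * (E * (lev j + 1))))"

definition blk_ok :: "block \<Rightarrow> bool" where
  "blk_ok b \<longleftrightarrow> (\<forall>i. \<bar>b i\<bar> \<le> 2 ^ blev)"

lemma lev_Suc: "lev j \<le> lev (Suc j)"
proof -
  have "1 * lev j \<le> (N * E) * (lev j + 1)" using E N by (intro mult_mono) auto
  then show ?thesis by (simp add: algebra_simps)
qed

lemma lev_mono: "i \<le> j \<Longrightarrow> lev i \<le> lev j"
  by (rule lift_Suc_mono_le[of lev]) (use lev_Suc in auto)

lemma arr_ok_lev: "arr_ok p a \<Longrightarrow> p \<le> N \<Longrightarrow> j < 64 \<Longrightarrow> \<bar>a j i\<bar> \<le> 2 ^ lev (Suc j)"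
proof -
  assume h: "arr_ok p a" "p \<le> N" "j < 64"
  have "(2::int) ^ (L + p * (E * (lev j + 1))) \<le> 2 ^ lev (Suc j)"
    using h(2) by (intro power_increasing) (auto intro: mult_le_mono1)
  moreover have "\<bar>a j i\<bar> \<le> 2 ^ (L + p * (E * (lev j + 1)))" using h unfolding arr_ok_def by blast
  ultimately show ?thesis by linarith
qed

lemma arr_ok_top: "arr_ok p a \<Longrightarrow> p \<le> N \<Longrightarrow> j < 64 \<Longrightarrow> \<bar>a j i\<bar> \<le> 2 ^ tlev"
proof -
  assume h: "arr_ok p a" "p \<le> N" "j < 64"
  have "(2::int) ^ lev (Suc j) \<le> 2 ^ tlev"
    using h(3) lev_mono[of "Suc j" 64] by (intro power_increasing) auto
  then show ?thesis using arr_ok_lev[OF h, of i] by linarith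
qed

lemma arr_ok_mono: "arr_ok p a \<Longrightarrow> p \<le> q \<Longrightarrow> arr_ok q a"
  unfolding arr_ok_def
  by (meson add_left_mono mult_le_mono1 one_le_numeral order_trans power_increasing)

lemma arr_ok_upd:
  assumes "arr_ok p a" "j < 64 \<Longrightarrow> \<bar>v\<bar> \<le> 2 ^ (L + (p + 1) * (E * (lev j + 1)))"
  shows "arr_ok (p + 1) (upd a j i v)"
  using arr_ok_mono[OF assms(1), of "p + 1"] assms(2) by (auto simp: arr_ok_def)

lemma arr_ok_set:
  assumes "arr_ok p a" "p \<le> N" "j < 64" "acc j e" "weight e \<le> E"
  shows "\<bar>hval e a\<bar> \<le> 2 ^ (L + (p + 1) * (E * (lev j + 1)))"
proof -
  have "\<bar>hval e a\<bar> \<le> 2 ^ ((L + p * (E * (lev j + 1))) + weight e * (lev j + 1))"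
  proof (rule acc_le[OF _ _ assms(4)])
    fix j' i assume "j' < j"
    then have "\<bar>a j' i\<bar> \<le> 2 ^ lev (Suc j')" "lev (Suc j') \<le> lev j"
      using arr_ok_lev[OF assms(1,2), of j'] assms(3) lev_mono[of "Suc j'" j] by auto
    then show "\<bar>a j' i\<bar> \<le> 2 ^ lev j"
      by (meson one_le_numeral order_trans power_increasing)
  next
    fix j' i assume "j' \<le> j"
    then have "\<bar>a j' i\<bar> \<le> 2 ^ (L + p * (E * (lev j' + 1)))"
      "L + p * (E * (lev j' + 1)) \<le> L + p * (E * (lev j + 1))"
      using assms(1,3) lev_mono[of j' j] by (auto simp: arr_ok_def)
    then show "\<bar>a j' i\<bar> \<le> 2 ^ (L + p * (E * (lev j + 1)))"
      by (meson one_le_numeral order_trans power_increasing)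
  qed
  also have "\<dots> \<le> 2 ^ (L + (p + 1) * (E * (lev j + 1)))"
    using mult_le_mono1[OF assms(5), of "lev j + 1"] by (intro power_increasing) (auto simp: algebra_simps)
  finally show ?thesis .
qed

lemma blk_ok_val:
  assumes "arr_ok p a" "p \<le> N" "hvars e \<subseteq> {..<64}" "weight e \<le> E"
  shows "\<bar>hval e a\<bar> \<le> 2 ^ blev"
proof -
  have "\<bar>hval e a\<bar> \<le> 2 ^ (weight e * (tlev + 1))"
    by (rule hval_le[OF arr_ok_top[OF assms(1,2)] assms(3)])
  also have "\<dots> \<le> 2 ^ blev"
    using mult_le_mono1[OF assms(4), of "tlev + 1"] by (intro power_increasing) (auto simp: algebra_simps)
  finally show ?thesis .
qed

lemma word_size_list: "(\<And>v. v \<in> set ws \<Longrightarrow> \<bar>v\<bar> \<le> 2 ^ x) \<Longrightarrow> word_size ws \<le> length ws * (x + 2)"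
proof (induction ws)
  case (Cons w ws)
  have "word_size (w # ws) = word_size [w] + word_size ws" by (simp add: word_size_def)
  also have "\<dots> \<le> (x + 2) + length ws * (x + 2)"
    using Cons by (intro add_mono word_size_single_le) auto
  finally show ?case by simp
qed (simp add: word_size_def)

lemma test_cost:
  assumes "rel s a b" "arr_ok p a" "p \<le> N" "hvars e \<subseteq> {..<64}" "work e \<le> E"
  shows "1 + acost (cexp e) s \<le> unit"
proof -
  have "acost (cexp e) s \<le> work e * (tlev + 1)"
    by (rule acost_cexp_le[OF assms(1) arr_ok_top[OF assms(2,3)] assms(4)])
  also have "\<dots> \<le> E * (tlev + 1)" using assms(5) by (rule mult_le_mono1)
  finally show ?thesis by (simp add: unit_def)
qed

text \<open>Induction on the program with the number \<open>p\<close> of steps already made left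
  general, so that the bounds on array entries pass from one command to the next while the total
  stays below \<open>N\<close>.\<close>

theorem wp_sound:
  assumes "wf c" "csize c \<le> E" "wp sub L c Q a b" "rel s a b" "arr_ok p a" "blk_ok b"
    "p + steps L c \<le> N"
  shows "\<exists>t s' a' b'. exec sub (comp c) s t s' \<and> rel s' a' b' \<and> Q a' b' \<and>
    arr_ok (p + steps L c) a' \<and> blk_ok b' \<and> t \<le> steps L c * unit"
  using assms
proof (induction c arbitrary: Q a b s p)
  case HSkip
  have "exec sub (comp HSkip) s 1 s" unfolding comp.simps by (rule exec.intros)
  then show ?case using HSkip arr_ok_mono[OF HSkip(5), of "p + 1"]
    by (intro exI[of _ 1] exI[of _ s] exI[of _ a] exI[of _ b]) (auto simp: unit_def)
next
  case (HSet j i e)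
  have pN: "p \<le> N" using HSet.prems by simp
  let ?x = "haddr j (cexp i)" and ?i = "nat \<bar>hval i a\<bar>"
  have vi: "aval (cexp i) s = hval i a" and ve: "aval (cexp e) s = hval e a"
    using HSet.prems by (auto intro!: aval_cexp)
  have ex: "exec sub (comp (HSet j i e)) s (1 + acost ?x s + acost (cexp e) s)
    (s(aval ?x s := aval (cexp e) s))" unfolding comp.simps by (rule exec.intros)
  have r: "rel (s(aval ?x s := aval (cexp e) s)) (upd a j ?i (hval e a)) b"
    unfolding aval_haddr vi ve by (rule rel_upd) (use HSet.prems in auto)
  have ok: "arr_ok (p + 1) (upd a j ?i (hval e a))"
    by (rule arr_ok_upd[OF HSet.prems(5) arr_ok_set[OF HSet.prems(5) pN]]) (use HSet.prems in auto)
  have wi: "\<bar>hval i a\<bar> \<le> 2 ^ (weight i * (tlev + 1))"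
    by (rule hval_le[OF arr_ok_top[OF HSet.prems(5) pN]]) (use HSet.prems in auto)
  have "acost ?x s \<le> 2 * acost (cexp i) s + 6 * (weight i * (tlev + 1)) + 40"
    by (rule acost_haddr) (use HSet.prems wi vi in auto)
  moreover have "acost (cexp i) s \<le> work i * (tlev + 1)" "acost (cexp e) s \<le> work e * (tlev + 1)"
    by (rule acost_cexp_le[OF HSet.prems(4) arr_ok_top[OF HSet.prems(5) pN]]; use HSet.prems in auto)+
  ultimately have "acost ?x s + acost (cexp e) s \<le> csize (HSet j i e) * (tlev + 1)"
    by (simp add: algebra_simps)
  also have "\<dots> \<le> E * (tlev + 1)" using HSet.prems(2) by (rule mult_le_mono1)
  finally have "1 + acost ?x s + acost (cexp e) s \<le> unit" by (simp add: unit_def)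
  then show ?case using ex r ok HSet.prems(3,6) by (auto intro!: exI)
next
  case (HGet j i e)
  have pN: "p \<le> N" using HGet.prems by simp
  let ?x = "haddr j (cexp i)" and ?i = "nat \<bar>hval i a\<bar>"
  let ?v = "b (nat (hval e a))"
  have vi: "aval (cexp i) s = hval i a" and ve: "aval (cexp e) s = hval e a"
    using HGet.prems by (auto intro!: aval_cexp)
  have v: "aval (Cell (cexp e)) s = ?v" "\<bar>?v\<bar> \<le> 2 ^ L"
    using HGet.prems(3,4) unfolding aval.simps ve rel_def by (auto simp: int_nat_eq dest: spec[of _ "nat (hval e a)"])
  have ex: "exec sub (comp (HGet j i e)) s (1 + acost ?x s + acost (Cell (cexp e)) s)
    (s(aval ?x s := aval (Cell (cexp e)) s))" unfolding comp.simps by (rule exec.intros)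
  have r: "rel (s(aval ?x s := aval (Cell (cexp e)) s)) (upd a j ?i ?v) b"
    unfolding aval_haddr vi v by (rule rel_upd) (use HGet.prems in auto)
  have "(2::int) ^ L \<le> 2 ^ (L + (p + 1) * (E * (lev j + 1)))" by (intro power_increasing) auto
  then have ok: "arr_ok (p + 1) (upd a j ?i ?v)"
    using v(2) by (intro arr_ok_upd[OF HGet.prems(5)]) linarith
  have wi: "\<bar>hval i a\<bar> \<le> 2 ^ (weight i * (tlev + 1))"
    by (rule hval_le[OF arr_ok_top[OF HGet.prems(5) pN]]) (use HGet.prems in auto)
  have "acost ?x s \<le> 2 * acost (cexp i) s + 6 * (weight i * (tlev + 1)) + 40"
    by (rule acost_haddr) (use HGet.prems wi vi in auto)
  moreover have "acost (cexp i) s \<le> work i * (tlev + 1)" "acost (cexp e) s \<le> work e * (tlev + 1)"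
    by (rule acost_cexp_le[OF HGet.prems(4) arr_ok_top[OF HGet.prems(5) pN]]; use HGet.prems in auto)+
  ultimately have "acost ?x s + acost (cexp e) s \<le> csize (HGet j i e) * (tlev + 1)"
    by (simp add: algebra_simps)
  also have "\<dots> \<le> E * (tlev + 1)" using HGet.prems(2) by (rule mult_le_mono1)
  finally have "1 + acost ?x s + acost (Cell (cexp e)) s \<le> unit"
    using word_size_single_le[of ?v L] v unfolding acost.simps by (simp add: unit_def)
  then show ?case using ex r ok HGet.prems(3,6) by (auto intro!: exI simp del: acost.simps aval.simps)
next
  case (HPut i e)
  have pN: "p \<le> N" using HPut.prems by simp
  have vi: "aval (cexp i) s = hval i a" and ve: "aval (cexp e) s = hval e a"
    using HPut.prems by (auto intro!: aval_cexp)
  have ex: "exec sub (comp (HPut i e)) s (1 + acost (cexp i) s + acost (cexp e) s)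
    (s(aval (cexp i) s := aval (cexp e) s))" unfolding comp.simps by (rule exec.intros)
  have i0: "0 \<le> hval i a" using HPut.prems by simp
  have r: "rel (s(aval (cexp i) s := aval (cexp e) s)) a (b(nat (hval i a) := hval e a))"
    unfolding vi ve
    by (rule rel_write[OF HPut.prems(4)]) (use i0 HPut.prems(4) in \<open>auto simp: rel_def\<close>)
  have ok: "blk_ok (b(nat (hval i a) := hval e a))"
    using blk_ok_val[OF HPut.prems(5) pN, of e] HPut.prems unfolding blk_ok_def by auto
  have "acost (cexp i) s \<le> work i * (tlev + 1)" "acost (cexp e) s \<le> work e * (tlev + 1)"
    by (rule acost_cexp_le[OF HPut.prems(4) arr_ok_top[OF HPut.prems(5) pN]]; use HPut.prems in auto)+
  then have "acost (cexp i) s + acost (cexp e) s \<le> csize (HPut i e) * (tlev + 1)"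
    by (simp add: algebra_simps)
  also have "\<dots> \<le> E * (tlev + 1)" using HPut.prems(2) by (rule mult_le_mono1)
  finally have "1 + acost (cexp i) s + acost (cexp e) s \<le> unit" by (simp add: unit_def)
  then show ?case using ex r ok HPut.prems(3) arr_ok_mono[OF HPut.prems(5), of "p + 1"]
    by (auto intro!: exI)
next
  case (HSeq c d)
  obtain t s1 a1 b1 where 1: "exec sub (comp c) s t s1" "rel s1 a1 b1" "wp sub L d Q a1 b1"
    "arr_ok (p + steps L c) a1" "blk_ok b1" "t \<le> steps L c * unit"
    using HSeq.IH(1)[of "wp sub L d Q" a b s p] HSeq.prems by auto
  obtain t' s2 a2 b2 where 2: "exec sub (comp d) s1 t' s2" "rel s2 a2 b2" "Q a2 b2"
    "arr_ok (p + steps L c + steps L d) a2" "blk_ok b2" "t' \<le> steps L d * unit"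
    using HSeq.IH(2)[of Q a1 b1 s1 "p + steps L c"] HSeq.prems 1 by auto
  have "exec sub (comp (c ;; d)) s (1 + t + t') s2"
    unfolding comp.simps by (rule exec.intros(3)[OF 1(1) 2(1)])
  moreover have "1 + t + t' \<le> steps L (c ;; d) * unit"
    using 1(6) 2(6) by (simp add: algebra_simps unit_def)
  moreover have "arr_ok (p + steps L (c ;; d)) a2" using arr_ok_mono[OF 2(4)] by simp
  ultimately show ?case using 2 by blast
next
  case (HIf e c d)
  have ve: "aval (cexp e) s = hval e a" using HIf.prems by (auto intro!: aval_cexp)
  have cost: "1 + acost (cexp e) s \<le> unit"
    using test_cost[OF HIf.prems(4,5)] HIf.prems by simp
  show ?case
  proof (cases "0 < hval e a")
    case True
    obtain t s1 a1 b1 where 1: "exec sub (comp c) s t s1" "rel s1 a1 b1" "Q a1 b1"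
      "arr_ok (p + steps L c) a1" "blk_ok b1" "t \<le> steps L c * unit"
      using HIf.IH(1)[of Q a b s p] HIf.prems True by auto
    have "exec sub (comp (HIf e c d)) s (1 + acost (cexp e) s + t) s1"
      unfolding comp.simps by (rule exec.intros(4)[OF _ 1(1)]) (use True ve in simp)
    moreover have "1 + acost (cexp e) s + t \<le> steps L (HIf e c d) * unit"
      using 1(6) cost by (simp add: algebra_simps)
    moreover have "arr_ok (p + steps L (HIf e c d)) a1" using arr_ok_mono[OF 1(4)] by simp
    ultimately show ?thesis using 1 by blast
  next
    case False
    obtain t s1 a1 b1 where 1: "exec sub (comp d) s t s1" "rel s1 a1 b1" "Q a1 b1"
      "arr_ok (p + steps L d) a1" "blk_ok b1" "t \<le> steps L d * unit"
      using HIf.IH(2)[of Q a b s p] HIf.prems False by auto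
    have "exec sub (comp (HIf e c d)) s (1 + acost (cexp e) s + t) s1"
      unfolding comp.simps by (rule exec.intros(5)[OF _ 1(1)]) (use False ve in simp)
    moreover have "1 + acost (cexp e) s + t \<le> steps L (HIf e c d) * unit"
      using 1(6) cost by (simp add: algebra_simps)
    moreover have "arr_ok (p + steps L (HIf e c d)) a1" using arr_ok_mono[OF 1(4)] by simp
    ultimately show ?thesis using 1 by blast
  qed
next
  case (HWhile e c)
  let ?F = "\<lambda>X a b. if 0 < hval e a then wp sub L c X a b else Q a b"
  \<comment> \<open>Inner induction on the unfoldings left in the \<open>wp\<close> of the loop.
    With none left the hypothesis is \<open>False\<close>, so the machine loop terminates.\<close>
  have "(?F ^^ k) (\<lambda>_ _. False) a b \<Longrightarrow> rel s a b \<Longrightarrow> arr_ok p a \<Longrightarrow> blk_ok b \<Longrightarrow>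
    p + k * (1 + steps L c) \<le> N \<Longrightarrow>
    \<exists>t s' a' b'. exec sub (comp (HWhile e c)) s t s' \<and> rel s' a' b' \<and> Q a' b' \<and>
    arr_ok (p + k * (1 + steps L c)) a' \<and> blk_ok b' \<and> t \<le> k * (1 + steps L c) * unit" for k a b s p
  proof (induction k arbitrary: a b s p)
    case (Suc k)
    have ve: "aval (cexp e) s = hval e a" using HWhile.prems Suc.prems by (auto intro!: aval_cexp)
    have cost: "1 + acost (cexp e) s \<le> unit"
      using test_cost[OF Suc.prems(2,3)] HWhile.prems Suc.prems by simp
    show ?case
    proof (cases "0 < hval e a")
      case True
      then have w: "wp sub L c ((?F ^^ k) (\<lambda>_ _. False)) a b" using Suc.prems(1) by simp
      obtain t s1 a1 b1 where 1: "exec sub (comp c) s t s1" "rel s1 a1 b1" "(?F ^^ k) (\<lambda>_ _. False) a1 b1"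
        "arr_ok (p + steps L c) a1" "blk_ok b1" "t \<le> steps L c * unit"
        using HWhile.IH[OF _ _ w Suc.prems(2-4)] HWhile.prems Suc.prems(5) by auto
      obtain t' s2 a2 b2 where 2: "exec sub (comp (HWhile e c)) s1 t' s2" "rel s2 a2 b2" "Q a2 b2"
        "arr_ok (p + steps L c + k * (1 + steps L c)) a2" "blk_ok b2" "t' \<le> k * (1 + steps L c) * unit"
        using Suc.IH[OF 1(3,2,4,5)] Suc.prems(5) by auto
      have "exec sub (comp (HWhile e c)) s (1 + acost (cexp e) s + t + t') s2"
        unfolding comp.simps
        by (rule exec.intros(7)[OF _ 1(1)]) (use True ve 2(1) in simp_all)
      moreover have "1 + acost (cexp e) s + t + t' \<le> Suc k * (1 + steps L c) * unit"
        using 1(6) 2(6) cost by (simp add: algebra_simps)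
      moreover have "arr_ok (p + Suc k * (1 + steps L c)) a2" using arr_ok_mono[OF 2(4)] by simp
      ultimately show ?thesis using 2 by blast
    next
      case False
      have "exec sub (comp (HWhile e c)) s (1 + acost (cexp e) s) s"
        unfolding comp.simps by (rule exec.intros(6)) (use False ve in simp)
      moreover have "1 + acost (cexp e) s \<le> Suc k * (1 + steps L c) * unit"
        using cost by (simp add: algebra_simps)
      moreover have "arr_ok (p + Suc k * (1 + steps L c)) a" using arr_ok_mono[OF Suc.prems(3)] by simp
      ultimately show ?thesis using Suc.prems False by auto
    qed
  qed simp
  from this[of "Suc L" a b s p] show ?case using HWhile.prems unfolding wp.simps(7) steps.simps by blast
next
  case HAsk
  let ?ws = "sub (query b)"
  have rb: "read_block s 0 = query b"
    using HAsk.prems(4) by (auto simp: read_block_def query_def rel_def intro!: map_cong)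
      (metis of_nat_0, metis of_nat_Suc add.commute)
  have ex: "exec sub (comp HAsk) s (1 + acost (Const 0) s + acost (Const 0) s
      + word_size (query b) + word_size ?ws) (write_block s 0 ?ws)"
    using exec.intros(8)[of sub "Const 0" "Const 0" s] rb by simp
  have r: "rel (write_block s 0 ?ws) a (answer b ?ws)"
  proof (rule rel_write[OF HAsk.prems(4)])
    fix i show "write_block s 0 ?ws (int i) = answer b ?ws i"
    proof (cases i)
      case (Suc k)
      have "s (int (Suc k)) = b (Suc k)" using HAsk.prems(4) unfolding rel_def by blast
      then have "s (1 + int k) = b (Suc k)" by simp
      then show ?thesis using Suc by (auto simp: write_block_def answer_def nat_diff_distrib)
    qed (simp add: write_block_def answer_def)
  qed (auto simp: write_block_def)
  have le: "(2::int) ^ L \<le> 2 ^ blev" by (intro power_increasing) auto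
  have ok: "blk_ok (answer b ?ws)"
    unfolding blk_ok_def
  proof
    fix i
    have "length ?ws \<le> L" using HAsk.prems(3) by simp
    then have "length ?ws \<le> 2 ^ L" using less_exp[of L] by linarith
    then have "int (length ?ws) \<le> int (2 ^ L)" by (simp only: of_nat_le_iff)
    then have "int (length ?ws) \<le> 2 ^ L" by simp
    then have "\<bar>answer b ?ws i\<bar> \<le> 2 ^ L \<or> answer b ?ws i = b i"
      using HAsk.prems(3) by (auto simp: answer_def)
    then show "\<bar>answer b ?ws i\<bar> \<le> 2 ^ blev"
      using HAsk.prems(6) le unfolding blk_ok_def by (metis order_trans)
  qed
  have "word_size (query b) \<le> length (query b) * (blev + 2)"
    by (rule word_size_list) (use HAsk.prems(6) in \<open>auto simp: query_def blk_ok_def\<close>)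
  also have "\<dots> \<le> L * (blev + 2)" using HAsk.prems(3) by (intro mult_le_mono1) (simp add: query_def)
  finally have 1: "word_size (query b) \<le> L * (blev + 2)" .
  have "word_size ?ws \<le> length ?ws * (L + 2)"
    by (rule word_size_list) (use HAsk.prems(3) in auto)
  also have "\<dots> \<le> L * (blev + 2)" using HAsk.prems(3) by (intro mult_le_mono) auto
  finally have 2: "word_size ?ws \<le> L * (blev + 2)" .
  have "word_size [0] = 1" by (simp add: word_size_def floorlog_def)
  then have "1 + acost (Const 0) s + acost (Const 0) s + word_size (query b) + word_size ?ws \<le> unit"
    using 1 2 unfolding unit_def by simp
  then show ?case using ex r ok HAsk.prems(3) arr_ok_mono[OF HAsk.prems(5), of "p + 1"]
    by (auto intro!: exI simp del: acost.simps)
qed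

end

section \<open>Polynomial bounds in \<open>L\<close>\<close>

definition poly_bounded :: "(nat \<Rightarrow> nat) \<Rightarrow> bool" where
  "poly_bounded f \<longleftrightarrow> (\<exists>C k. \<forall>L\<ge>1. f L \<le> C * L ^ k)"

lemma poly_bounded_const: "poly_bounded (\<lambda>_. c)"
  unfolding poly_bounded_def by (intro exI[of _ c] exI[of _ 0]) simp

lemma poly_bounded_id: "poly_bounded (\<lambda>L. L)"
  unfolding poly_bounded_def by (intro exI[of _ 1] exI[of _ 1]) simp

lemma poly_bounded_add: "poly_bounded f \<Longrightarrow> poly_bounded g \<Longrightarrow> poly_bounded (\<lambda>L. f L + g L)"
  unfolding poly_bounded_def
proof (elim exE)
  fix C k D l assume h: "\<forall>L\<ge>1. f L \<le> C * L ^ k" "\<forall>L\<ge>1. g L \<le> D * L ^ l"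
  have "f L + g L \<le> (C + D) * L ^ (k + l)" if "1 \<le> L" for L
  proof -
    have "C * L ^ k \<le> C * L ^ (k + l)" "D * L ^ l \<le> D * L ^ (k + l)"
      using that by (intro mult_le_mono2 power_increasing; simp)+
    moreover have "f L \<le> C * L ^ k" "g L \<le> D * L ^ l" using h that by auto
    ultimately show ?thesis unfolding add_mult_distrib by linarith
  qed
  then show "\<exists>C k. \<forall>L\<ge>1. f L + g L \<le> C * L ^ k" by blast
qed

lemma poly_bounded_mult: "poly_bounded f \<Longrightarrow> poly_bounded g \<Longrightarrow> poly_bounded (\<lambda>L. f L * g L)"
  unfolding poly_bounded_def
proof (elim exE)
  fix C k D l assume h: "\<forall>L\<ge>1. f L \<le> C * L ^ k" "\<forall>L\<ge>1. g L \<le> D * L ^ l"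
  have "f L * g L \<le> (C * D) * L ^ (k + l)" if "1 \<le> L" for L
    using mult_le_mono[of "f L" "C * L ^ k" "g L" "D * L ^ l"] h that by (simp add: power_add algebra_simps)
  then show "\<exists>C k. \<forall>L\<ge>1. f L * g L \<le> C * L ^ k" by blast
qed

lemma poly_bounded_power: "poly_bounded f \<Longrightarrow> poly_bounded (\<lambda>L. f L ^ k)"
  by (induction k) (auto intro: poly_bounded_const poly_bounded_mult)

lemma poly_bounded_mono: "poly_bounded f \<Longrightarrow> (\<And>L. 1 \<le> L \<Longrightarrow> g L \<le> f L) \<Longrightarrow> poly_bounded g"
  unfolding poly_bounded_def by (meson order_trans)

lemmas poly_bounded_intros = poly_bounded_const poly_bounded_id poly_bounded_add poly_bounded_mult
  poly_bounded_power

lemma poly_bounded_steps: "poly_bounded (\<lambda>L. steps L c)"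
proof (induction c)
  case (HWhile e c)
  have "poly_bounded (\<lambda>L. (L + 1) * (1 + steps L c))"
    by (intro poly_bounded_intros HWhile)
  then show ?case by simp
qed (auto intro!: poly_bounded_intros poly_bounded_add[of "\<lambda>_. Suc 0", simplified])

text \<open>\<open>C\<close> and \<open>k\<close> depend on the program alone. \<open>steps\<close>
  is a polynomial in \<open>L\<close> for a fixed program, and each of the 64 levels is a polynomial
  in \<open>L\<close> and the level below; composing a fixed number of them stays
  polynomial.\<close>

theorem wp_exec:
  assumes "wf c"
  shows "\<exists>C k. \<forall>sub L Q a b s. 1 \<le> L \<and> wp sub L c Q a b \<and> rel s a b \<and> (\<forall>j i. \<bar>a j i\<bar> \<le> 2 ^ L) \<and>
    (\<forall>i. \<bar>b i\<bar> \<le> 2 ^ L) \<longrightarrow>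
    (\<exists>t s' a' b'. exec sub (comp c) s t s' \<and> rel s' a' b' \<and> Q a' b' \<and> t \<le> C * L ^ k)"
proof -
  define E where "E = csize c + 1"
  define N where "N L = steps L c + 1" for L
  have bb: "bit_bound L E (N L)" if "1 \<le> L" for L
    using that by unfold_locales (auto simp: E_def N_def)
  have N: "poly_bounded N" unfolding N_def by (intro poly_bounded_intros poly_bounded_steps)
  have lev: "poly_bounded (\<lambda>L. bit_bound.lev L E (N L) j)" for j
  proof (induction j)
    case 0
    then show ?case
      by (rule poly_bounded_mono[OF poly_bounded_id]) (simp add: bit_bound.lev.simps[OF bb])
  next
    case (Suc j)
    have "poly_bounded (\<lambda>L. L + N L * (E * (bit_bound.lev L E (N L) j + 1)))"
      by (intro poly_bounded_intros Suc N)
    then show ?case by (rule poly_bounded_mono) (simp add: bit_bound.lev.simps[OF bb])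
  qed
  have "poly_bounded (\<lambda>L. steps L c * (10 + E * (bit_bound.lev L E (N L) 64 + 1) +
      2 * L * ((L + E * (bit_bound.lev L E (N L) 64 + 1)) + 2) + (L + E * (bit_bound.lev L E (N L) 64 + 1))))"
    by (intro poly_bounded_intros poly_bounded_steps lev)
  then have "poly_bounded (\<lambda>L. steps L c * bit_bound.unit L E (N L))"
    by (rule poly_bounded_mono) (simp add: bit_bound.unit_def[OF bb])
  then obtain C k where Ck: "\<And>L. 1 \<le> L \<Longrightarrow> steps L c * bit_bound.unit L E (N L) \<le> C * L ^ k"
    unfolding poly_bounded_def by blast
  show ?thesis
  proof (rule exI[of _ C], rule exI[of _ k], intro allI impI, elim conjE)
    fix sub L Q a b s
    assume L: "1 \<le> L" and w: "wp sub L c Q a b" and r: "rel s a b"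
      and a: "\<forall>j i. \<bar>a j i\<bar> \<le> 2 ^ L" and b: "\<forall>i. \<bar>b i\<bar> \<le> 2 ^ L"
    interpret bit_bound L E "N L" by (rule bb[OF L])
    have a0: "arr_ok 0 a" using a by (simp add: arr_ok_def)
    have "(2::int) ^ L \<le> 2 ^ blev" by (intro power_increasing) auto
    then have b0: "blk_ok b" using b unfolding blk_ok_def by (metis order_trans)
    have sz: "csize c \<le> E" "0 + steps L c \<le> N L" by (auto simp: E_def N_def)
    obtain t s' a' b' where "exec sub (comp c) s t s'" "rel s' a' b'" "Q a' b'"
      "t \<le> steps L c * unit"
      using wp_sound[OF assms sz(1) w r a0 b0 sz(2)] by blast
    then show "\<exists>t s' a' b'. exec sub (comp c) s t s' \<and> rel s' a' b' \<and> Q a' b' \<and> t \<le> C * L ^ k"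
      using Ck[OF L] by (meson order_trans)
  qed
qed

section \<open>Multiplicative weights and the covering problem\<close>

text \<open>State of a covering problem of budget \<open>T\<close> after \<open>t\<close> rows, with
  step size 1/200: \<open>load\<close> is the sum of the normalised rows and
  \<open>\<Lambda>\<close> that of their right-hand sides. \<open>Z\<close> absorbs common factors
  of the weights, which are kept integral by multiplying and are never divided. The last conjunct
  records that each row has an entry 1, the source of independence of the width.\<close>

definition mwu_state :: "nat \<Rightarrow> real \<Rightarrow> nat \<Rightarrow> (nat \<Rightarrow> real) \<Rightarrow> (nat \<Rightarrow> real) \<Rightarrow> real \<Rightarrow> bool" where
  "mwu_state M T t u load \<Lambda> \<longleftrightarrow>
     (\<exists>Z>0. (\<Sum>i<M. u i) \<le> Z * real M * exp (\<Lambda> / (200 * T)) \<and>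
        (\<forall>i<M. Z * (201 / 200) powr load i \<le> u i)) \<and>
     real t \<le> (\<Sum>i<M. load i)"

lemma mwu_state_init: "mwu_state M T 0 (\<lambda>_. 1) (\<lambda>_. 0) 0"
  unfolding mwu_state_def by (auto intro!: exI[of _ 1])

lemma mwu_state_cong:
  "mwu_state M T t u l \<Lambda> \<Longrightarrow> (\<And>i. i < M \<Longrightarrow> u i = u' i) \<Longrightarrow> (\<And>i. i < M \<Longrightarrow> l i = l' i) \<Longrightarrow>
   mwu_state M T t u' l' \<Lambda>"
  unfolding mwu_state_def by simp

text \<open>Weighted arithmetic-geometric mean of 201/200 and 1 with weights \<open>q\<close> and
  \<open>1 - q\<close>.\<close>

lemma powr_le_one_plus:
  assumes "0 \<le> q" "q \<le> 1"
  shows "(201 / 200) powr q \<le> 1 + q / (200::real)"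
  using Youngs_inequality_0[of q "1 - q" "201 / 200" 1] assms by (simp add: algebra_simps)

text \<open>\<open>q\<close> is a row scaled to maximum 1 and \<open>s\<close> its right-hand side
  in the same scale. By \<open>viol\<close> the candidate \<open>T * u\<close> over the sum of
  \<open>u\<close> attains at most \<open>s\<close>. Hence the total weight grows by at most 1 +
  s/(200 T), which is below the exponential, while each weight grows at least like the power of its
  load.\<close>

lemma mwu_state_step:
  assumes st: "mwu_state M T t u load \<Lambda>" and T: "0 < T" and C: "0 < C"
    and q: "\<And>i. i < M \<Longrightarrow> 0 \<le> q i \<and> q i \<le> 1" and q1: "\<exists>i<M. q i = 1"
    and viol: "T * (\<Sum>i<M. q i * u i) \<le> s * (\<Sum>i<M. u i)"
    and u': "\<And>i. i < M \<Longrightarrow> u' i = C * (u i * (1 + q i / 200))"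
  shows "mwu_state M T (Suc t) u' (\<lambda>i. load i + q i) (\<Lambda> + s)"
proof -
  from st obtain Z where Z: "0 < Z" "(\<Sum>i<M. u i) \<le> Z * real M * exp (\<Lambda> / (200 * T))"
    "\<And>i. i < M \<Longrightarrow> Z * (201 / 200) powr load i \<le> u i" and t: "real t \<le> (\<Sum>i<M. load i)"
    unfolding mwu_state_def by auto
  have u0: "0 \<le> u i" if "i < M" for i
    using Z(3)[OF that] Z(1) by (meson less_eq_real_def mult_nonneg_nonneg order_trans powr_ge_zero)
  let ?U = "\<Sum>i<M. u i"
  have "(\<Sum>i<M. u' i) = C * (?U + (\<Sum>i<M. q i * u i) / 200)"
    by (simp add: u' sum_distrib_left sum.distrib sum_divide_distrib algebra_simps)
  also have "\<dots> \<le> C * (?U * (1 + s / (200 * T)))"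
    using viol T C by (intro mult_left_mono) (auto simp: field_simps)
  also have "\<dots> \<le> C * (?U * exp (s / (200 * T)))"
    using C u0 by (intro mult_left_mono exp_ge_add_one_self sum_nonneg) auto
  also have "\<dots> \<le> C * ((Z * real M * exp (\<Lambda> / (200 * T))) * exp (s / (200 * T)))"
    using C Z by (intro mult_left_mono mult_right_mono) auto
  also have "\<dots> = (C * Z) * real M * exp ((\<Lambda> + s) / (200 * T))"
    by (simp add: add_divide_distrib exp_add)
  finally have 1: "(\<Sum>i<M. u' i) \<le> (C * Z) * real M * exp ((\<Lambda> + s) / (200 * T))" .
  have 2: "(C * Z) * (201 / 200) powr (load i + q i) \<le> u' i" if "i < M" for i
  proof -
    have "(C * Z) * (201 / 200) powr (load i + q i) = C * ((Z * (201 / 200) powr load i) * (201 / 200) powr q i)"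
      by (simp add: powr_add)
    also have "\<dots> \<le> C * (u i * (1 + q i / 200))"
      using C Z that u0 q by (intro mult_left_mono mult_mono powr_le_one_plus) auto
    finally show ?thesis using u' that by simp
  qed
  from q1 obtain i0 where "i0 < M" "q i0 = 1" by blast
  then have "1 \<le> (\<Sum>i<M. q i)" using q member_le_sum[of i0 "{..<M}" q] by auto
  then have "real (Suc t) \<le> (\<Sum>i<M. load i + q i)" using t by (simp add: sum.distrib)
  then show ?thesis unfolding mwu_state_def using 1 2 C Z(1) by (intro conjI exI[of _ "C * Z"]) auto
qed

text \<open>Comparing one weight with the total gives load * ln(201/200) <= ln M + \<Lambda>/(200
  T). The loads sum to at least 160000 M^2, so some load is at least 160000 M; this makes ln M
  negligible against \<Lambda>/(200 T), and 1/(200 ln(201/200)) leaves room below 1.01.\<close>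

lemma mwu_state_final:
  assumes st: "mwu_state M T t u load \<Lambda>" and T: "0 < T" and M: "0 < M" and t: "160000 * M\<^sup>2 \<le> t"
    and i: "i < M"
  shows "T * load i \<le> 101 / 100 * \<Lambda>"
proof -
  from st obtain Z where Z: "0 < Z" "(\<Sum>i<M. u i) \<le> Z * real M * exp (\<Lambda> / (200 * T))"
    "\<And>i. i < M \<Longrightarrow> Z * (201 / 200) powr load i \<le> u i" and tl: "real t \<le> (\<Sum>i<M. load i)"
    unfolding mwu_state_def by auto
  have u0: "0 \<le> u i" if "i < M" for i
    using Z(3)[OF that] Z(1) by (meson less_eq_real_def mult_nonneg_nonneg order_trans powr_ge_zero)
  define X where "X = \<Lambda> / (200 * T)"
  define \<beta> where "\<beta> = ln (201 / 200 :: real)"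
  have "1 / 200 - (1 / 200)\<^sup>2 \<le> ln (1 + 1 / 200 :: real)" by (rule ln_one_plus_pos_lower_bound) auto
  then have \<beta>: "199 / 40000 \<le> \<beta>" by (simp add: \<beta>_def power2_eq_square)
  have bound: "load j * \<beta> \<le> ln (real M) + X" if "j < M" for j
  proof -
    have "Z * (201 / 200) powr load j \<le> (\<Sum>i<M. u i)"
      using Z(3)[OF that] member_le_sum[of j "{..<M}" u] u0 that by auto
    then have "(201 / 200) powr load j \<le> real M * exp X"
    proof -
      have "Z * (201 / 200) powr load j \<le> Z * (real M * exp X)"
        using \<open>Z * (201 / 200) powr load j \<le> (\<Sum>i<M. u i)\<close> Z(2) unfolding X_def mult.assoc by linarith
      then show ?thesis using Z(1) by (simp only: mult_le_cancel_left_pos)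
    qed
    then have "ln ((201 / 200) powr load j) \<le> ln (real M * exp X)" using M by (subst ln_le_cancel_iff) auto
    then show ?thesis using M by (simp add: \<beta>_def ln_mult ln_powr)
  qed
  have "\<exists>j<M. 160000 * real M \<le> load j"
  proof (rule ccontr)
    assume "\<not> ?thesis"
    then have "(\<Sum>i<M. load i) < (\<Sum>i<M. 160000 * real M)" using M by (intro sum_strict_mono) auto
    also have "\<dots> = real (160000 * M\<^sup>2)" by (simp add: power2_eq_square)
    also have "\<dots> \<le> real t" using t by (simp only: of_nat_le_iff)
    finally show False using tl by simp
  qed
  then obtain j where j: "j < M" "160000 * real M \<le> load j" by blast
  have "796 * real M = 160000 * real M * (199 / 40000)" by simp
  also have "\<dots> \<le> load j * \<beta>" using j(2) \<beta> by (intro mult_mono) auto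
  also have "\<dots> \<le> ln (real M) + X" by (rule bound[OF j(1)])
  finally have 1: "796 * real M \<le> ln (real M) + X" .
  have lnM: "ln (real M) \<le> real M" "0 \<le> ln (real M)" using M ln_le_minus_one[of "real M"] by auto
  then have X: "795 * ln (real M) \<le> X" "0 \<le> X" using 1 by linarith+
  show ?thesis
  proof (cases "load i \<le> 0")
    case True
    have "0 \<le> \<Lambda>" using X(2) T unfolding X_def by (simp add: zero_le_divide_iff)
    moreover have "T * load i \<le> 0" using True T by (simp add: mult_nonneg_nonpos)
    ultimately show ?thesis by simp
  next
    case False
    have "load i * (199 / 40000) \<le> load i * \<beta>" using False \<beta> by (intro mult_left_mono) auto
    also have "\<dots> \<le> ln (real M) + X" by (rule bound[OF i])
    \<comment> \<open>This is 795 ln M <= X. Together with 40000/199 * 796/795 < 202 it gives the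
      next line, and 202/200 is the final factor 101/100.\<close>
    also have "\<dots> \<le> 796 / 795 * X" using X by simp
    finally have "load i \<le> 202 * X" using X(2) by simp
    then have "T * load i \<le> T * (202 * X)" using T by simp
    also have "\<dots> = 101 / 100 * \<Lambda>" using T by (simp add: X_def)
    finally show ?thesis .
  qed
qed

section \<open>Weak duality for the two linear programs\<close>

lemma recourse_bdd_below:
  assumes "\<And>S. S \<in> \<S> \<Longrightarrow> 0 \<le> (d S :: real)"
  shows "bdd_below {\<Sum>S\<in>\<S>. d S * z S | z.
     (\<forall>S\<in>\<S>. 0 \<le> z S) \<and> (\<forall>e\<in>A. 1 \<le> (\<Sum>S | S \<in> \<S> \<and> e \<in> S. x S + z S))}"
  by (rule bdd_belowI[of _ 0]) (use assms in \<open>auto intro!: sum_nonneg\<close>)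

lemma recourse_le:
  assumes "\<And>S. S \<in> \<S> \<Longrightarrow> 0 \<le> (d S :: real)" "\<And>S. S \<in> \<S> \<Longrightarrow> 0 \<le> z S"
    and "\<And>e. e \<in> A \<Longrightarrow> 1 \<le> (\<Sum>S | S \<in> \<S> \<and> e \<in> S. x S + z S)"
  shows "recourse \<S> d x A \<le> (\<Sum>S\<in>\<S>. d S * z S)"
  unfolding recourse_def
  by (rule cInf_lower[OF _ recourse_bdd_below]) (use assms in auto)

lemma recourse_ge:
  assumes fin: "finite \<S>" and cov: "A \<subseteq> \<Union>\<S>"
    and le: "\<And>z. (\<And>S. S \<in> \<S> \<Longrightarrow> 0 \<le> z S) \<Longrightarrow>
      (\<And>e. e \<in> A \<Longrightarrow> 1 \<le> (\<Sum>S | S \<in> \<S> \<and> e \<in> S. x S + z S)) \<Longrightarrow> (b :: real) \<le> (\<Sum>S\<in>\<S>. d S * z S)"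
  shows "b \<le> recourse \<S> d x A"
  unfolding recourse_def
proof (rule cInf_greatest)
  \<comment> \<open>Witness that the infimum is over a nonempty set: every single
    \<open>x S + ?z S\<close> is at least 1, whatever the sign of \<open>x S\<close>.\<close>
  let ?z = "\<lambda>S. 1 + \<bar>x S\<bar>"
  have "1 \<le> (\<Sum>S | S \<in> \<S> \<and> e \<in> S. x S + ?z S)" if e: "e \<in> A" for e
  proof -
    obtain T where T: "T \<in> \<S>" "e \<in> T" using cov e by auto
    have "x T + ?z T \<le> (\<Sum>S | S \<in> \<S> \<and> e \<in> S. x S + ?z S)"
      using fin T by (intro member_le_sum[where f = "\<lambda>S. x S + ?z S"]) auto
    moreover have "1 \<le> x T + ?z T" by simp
    ultimately show ?thesis by linarith
  qed
  then show "{\<Sum>S\<in>\<S>. d S * z S | z. (\<forall>S\<in>\<S>. 0 \<le> z S) \<and>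
     (\<forall>e\<in>A. 1 \<le> (\<Sum>S | S \<in> \<S> \<and> e \<in> S. x S + z S))} \<noteq> {}"
    by (auto intro!: exI[of _ ?z])
qed (use le in auto)

text \<open>\<open>w\<close> is dual feasible for demands reduced by the coverage of
  \<open>x\<close>. A negative reduced demand is not cut off at 0: the bound stays affine in
  \<open>x\<close>, which lets rows be accumulated in \<open>cert\<close>.\<close>

lemma recourse_dual:
  assumes fin: "finite \<S>" "finite A" and cov: "A \<subseteq> \<Union>\<S>"
    and w: "\<And>e. e \<in> A \<Longrightarrow> 0 \<le> (w e :: real)" "\<And>S. S \<in> \<S> \<Longrightarrow> (\<Sum>e\<in>A \<inter> S. w e) \<le> d S"
  shows "(\<Sum>e\<in>A. w e * (1 - (\<Sum>S | S \<in> \<S> \<and> e \<in> S. x S))) \<le> recourse \<S> d x A"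
proof (rule recourse_ge[OF fin(1) cov])
  fix z :: "'a set \<Rightarrow> real"
  assume z: "\<And>S. S \<in> \<S> \<Longrightarrow> 0 \<le> z S" and cv: "\<And>e. e \<in> A \<Longrightarrow> 1 \<le> (\<Sum>S | S \<in> \<S> \<and> e \<in> S. x S + z S)"
  have "(\<Sum>e\<in>A. w e * (1 - (\<Sum>S | S \<in> \<S> \<and> e \<in> S. x S))) \<le> (\<Sum>e\<in>A. w e * (\<Sum>S | S \<in> \<S> \<and> e \<in> S. z S))"
  proof (intro sum_mono mult_left_mono)
    fix e assume "e \<in> A"
    then show "1 - (\<Sum>S | S \<in> \<S> \<and> e \<in> S. x S) \<le> (\<Sum>S | S \<in> \<S> \<and> e \<in> S. z S)" "0 \<le> w e"
      using cv[of e] w(1) by (simp_all add: sum.distrib)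
  qed
  also have "\<dots> = (\<Sum>e\<in>A. \<Sum>S\<in>\<S>. if e \<in> S then w e * z S else 0)"
    using fin by (auto simp: sum_distrib_left sum.If_cases Int_def intro!: sum.cong)
  also have "\<dots> = (\<Sum>S\<in>\<S>. \<Sum>e\<in>A. if e \<in> S then w e * z S else 0)" by (rule sum.swap)
  also have "\<dots> = (\<Sum>S\<in>\<S>. (\<Sum>e\<in>A \<inter> S. w e) * z S)"
    using fin by (auto simp: sum_distrib_right sum.inter_restrict intro!: sum.cong)
  also have "\<dots> \<le> (\<Sum>S\<in>\<S>. d S * z S)" using w(2) z by (intro sum_mono mult_right_mono) auto
  finally show "(\<Sum>e\<in>A. w e * (1 - (\<Sum>S | S \<in> \<S> \<and> e \<in> S. x S))) \<le> (\<Sum>S\<in>\<S>. d S * z S)" .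
qed

text \<open>\<open>\<theta> A\<close> prices the mass of support scenario \<open>A\<close> and
  \<open>y\<close> the transport budget; with these multipliers the right-hand side is a dual
  objective value.\<close>

lemma robust_recourse_le:
  assumes fin: "finite \<A>" "finite supp" and p: "\<And>A. A \<in> supp \<Longrightarrow> 0 \<le> (p A :: real)" and r: "0 \<le> r"
    and y: "0 \<le> y" and th: "\<And>A. A \<in> supp \<Longrightarrow> 0 \<le> \<theta> A"
    and le: "\<And>A A'. A \<in> supp \<Longrightarrow> A' \<in> \<A> \<Longrightarrow> recourse \<S> d x A' \<le> \<theta> A + y * \<kappa> A A'"
  shows "robust_recourse \<S> d \<A> \<kappa> r supp p x \<le> (\<Sum>A\<in>supp. p A * \<theta> A) + r * y"
  unfolding robust_recourse_def
proof (rule cSup_least)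
  show "{\<Sum>A\<in>supp. \<Sum>A'\<in>\<A>. \<gamma> A A' * recourse \<S> d x A' | \<gamma>.
       (\<forall>A\<in>supp. \<forall>A'\<in>\<A>. 0 \<le> \<gamma> A A') \<and> (\<forall>A\<in>supp. (\<Sum>A'\<in>\<A>. \<gamma> A A') \<le> p A) \<and>
       (\<Sum>A\<in>supp. \<Sum>A'\<in>\<A>. \<kappa> A A' * \<gamma> A A') \<le> r} \<noteq> {}"
    using p r by (auto intro!: exI[of _ "\<lambda>_ _. 0"])
  fix v assume "v \<in> {\<Sum>A\<in>supp. \<Sum>A'\<in>\<A>. \<gamma> A A' * recourse \<S> d x A' | \<gamma>.
       (\<forall>A\<in>supp. \<forall>A'\<in>\<A>. 0 \<le> \<gamma> A A') \<and> (\<forall>A\<in>supp. (\<Sum>A'\<in>\<A>. \<gamma> A A') \<le> p A) \<and>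
       (\<Sum>A\<in>supp. \<Sum>A'\<in>\<A>. \<kappa> A A' * \<gamma> A A') \<le> r}"
  then obtain \<gamma> where g: "\<And>A A'. A \<in> supp \<Longrightarrow> A' \<in> \<A> \<Longrightarrow> 0 \<le> \<gamma> A A'"
    "\<And>A. A \<in> supp \<Longrightarrow> (\<Sum>A'\<in>\<A>. \<gamma> A A') \<le> p A" "(\<Sum>A\<in>supp. \<Sum>A'\<in>\<A>. \<kappa> A A' * \<gamma> A A') \<le> r"
    and v: "v = (\<Sum>A\<in>supp. \<Sum>A'\<in>\<A>. \<gamma> A A' * recourse \<S> d x A')" by auto
  have "v \<le> (\<Sum>A\<in>supp. \<Sum>A'\<in>\<A>. \<gamma> A A' * (\<theta> A + y * \<kappa> A A'))"
    unfolding v using g le by (intro sum_mono mult_left_mono) auto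
  also have "\<dots> = (\<Sum>A\<in>supp. (\<Sum>A'\<in>\<A>. \<gamma> A A') * \<theta> A) + y * (\<Sum>A\<in>supp. \<Sum>A'\<in>\<A>. \<kappa> A A' * \<gamma> A A')"
    by (simp add: sum.distrib sum_distrib_left sum_distrib_right algebra_simps)
  also have "\<dots> \<le> (\<Sum>A\<in>supp. p A * \<theta> A) + y * r"
    using g th y by (intro add_mono sum_mono mult_right_mono mult_left_mono) auto
  finally show "v \<le> (\<Sum>A\<in>supp. p A * \<theta> A) + r * y" by (simp add: mult.commute)
qed

lemma robust_recourse_ge:
  assumes fin: "finite \<A>" "finite supp"
    and nn: "\<And>A'. A' \<in> \<A> \<Longrightarrow> 0 \<le> recourse \<S> d x A'"
    and g: "\<And>A A'. A \<in> supp \<Longrightarrow> A' \<in> \<A> \<Longrightarrow> 0 \<le> (\<gamma> A A' :: real)"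
    "\<And>A. A \<in> supp \<Longrightarrow> (\<Sum>A'\<in>\<A>. \<gamma> A A') \<le> p A" "(\<Sum>A\<in>supp. \<Sum>A'\<in>\<A>. \<kappa> A A' * \<gamma> A A') \<le> r"
  shows "(\<Sum>A\<in>supp. \<Sum>A'\<in>\<A>. \<gamma> A A' * recourse \<S> d x A') \<le> robust_recourse \<S> d \<A> \<kappa> r supp p x"
  unfolding robust_recourse_def
proof (rule cSup_upper)
  show "bdd_above {\<Sum>A\<in>supp. \<Sum>A'\<in>\<A>. \<gamma> A A' * recourse \<S> d x A' | \<gamma>.
       (\<forall>A\<in>supp. \<forall>A'\<in>\<A>. 0 \<le> \<gamma> A A') \<and> (\<forall>A\<in>supp. (\<Sum>A'\<in>\<A>. \<gamma> A A') \<le> p A) \<and>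
       (\<Sum>A\<in>supp. \<Sum>A'\<in>\<A>. \<kappa> A A' * \<gamma> A A') \<le> r}"
  \<comment> \<open>A nonnegative plan has \<open>\<delta> A A' <= p A\<close> entrywise, which
    makes the supremum finite.\<close>
  proof (rule bdd_aboveI[of _ "\<Sum>A\<in>supp. \<Sum>A'\<in>\<A>. p A * recourse \<S> d x A'"])
    fix v assume "v \<in> {\<Sum>A\<in>supp. \<Sum>A'\<in>\<A>. \<gamma> A A' * recourse \<S> d x A' | \<gamma>.
       (\<forall>A\<in>supp. \<forall>A'\<in>\<A>. 0 \<le> \<gamma> A A') \<and> (\<forall>A\<in>supp. (\<Sum>A'\<in>\<A>. \<gamma> A A') \<le> p A) \<and>
       (\<Sum>A\<in>supp. \<Sum>A'\<in>\<A>. \<kappa> A A' * \<gamma> A A') \<le> r}"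
    then obtain \<delta> where d: "\<And>A A'. A \<in> supp \<Longrightarrow> A' \<in> \<A> \<Longrightarrow> 0 \<le> \<delta> A A'"
      "\<And>A. A \<in> supp \<Longrightarrow> (\<Sum>A'\<in>\<A>. \<delta> A A') \<le> p A"
      and v: "v = (\<Sum>A\<in>supp. \<Sum>A'\<in>\<A>. \<delta> A A' * recourse \<S> d x A')" by auto
    have "\<delta> A A' \<le> p A" if "A \<in> supp" "A' \<in> \<A>" for A A'
      using member_le_sum[of A' \<A> "\<delta> A"] d that fin by force
    then show "v \<le> (\<Sum>A\<in>supp. \<Sum>A'\<in>\<A>. p A * recourse \<S> d x A')"
      unfolding v using nn by (intro sum_mono mult_right_mono) auto
  qed
qed (use g in auto)

text \<open>The fractional cover is given on candidate indices, several of which may denote the same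
  set. Their values are added up, and the set is charged a cost that exceeds none of its candidates'
  costs.\<close>

lemma recourse_le_indexed:
  fixes cand :: "nat \<Rightarrow> 'e set"
  assumes fin: "finite J" and dq: "\<And>X. X \<in> cand ` J \<Longrightarrow> 0 \<le> dq X" and v: "\<And>c. c < N \<Longrightarrow> 0 \<le> v c"
    and rep: "\<And>c. c < N \<Longrightarrow> cand c \<in> cand ` J \<and> dq (cand c) \<le> D c"
    and cv: "\<And>e. e \<in> B \<Longrightarrow> 1 \<le> (\<Sum>c<N. if e \<in> cand c then v c else 0)"
  shows "recourse (cand ` J) dq (\<lambda>_. 0) B \<le> (\<Sum>c<N. D c * v c)"
proof -
  define z where "z X = (\<Sum>c<N. if cand c = X then v c else 0)" for X
  have "recourse (cand ` J) dq (\<lambda>_. 0) B \<le> (\<Sum>X\<in>cand ` J. dq X * z X)"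
  proof (rule recourse_le)
    show "0 \<le> z X" for X unfolding z_def using v by (intro sum_nonneg) auto
    fix e assume e: "e \<in> B"
    have "(\<Sum>X | X \<in> cand ` J \<and> e \<in> X. z X) = (\<Sum>c<N. \<Sum>X | X \<in> cand ` J \<and> e \<in> X. if cand c = X then v c else 0)"
      unfolding z_def by (rule sum.swap)
    also have "\<dots> = (\<Sum>c<N. if e \<in> cand c then v c else 0)"
      using fin rep by (intro sum.cong) (auto simp: sum.delta)
    finally show "1 \<le> (\<Sum>X | X \<in> cand ` J \<and> e \<in> X. 0 + z X)" using cv[OF e] by simp
  qed (use dq in auto)
  also have "\<dots> = (\<Sum>c<N. \<Sum>X\<in>cand ` J. if cand c = X then dq X * v c else 0)"
    unfolding z_def sum_distrib_left by (subst sum.swap) (auto intro!: sum.cong)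
  also have "\<dots> = (\<Sum>c<N. dq (cand c) * v c)"
    using fin rep by (intro sum.cong) (auto simp: sum.delta)
  also have "\<dots> \<le> (\<Sum>c<N. D c * v c)" using rep v by (intro sum_mono mult_right_mono) auto
  finally show ?thesis .
qed

section \<open>The instance and its optimum in terms of indices\<close>

locale dr_inst =
  fixes I :: dr_instance
  assumes valid: "valid_instance I"
begin

abbreviation "n \<equiv> num_elems I"
abbreviation "m \<equiv> length (sets_of I)"
abbreviation "SS i \<equiv> sets_of I ! i"
abbreviation "K \<equiv> length (support_of I)"
abbreviation "AA k \<equiv> support_of I ! k"
abbreviation "\<A> \<equiv> scenarios I"
abbreviation "c i \<equiv> real_of_rat (cost1 I (SS i))"
abbreviation "d i \<equiv> real_of_rat (cost2 I (SS i))"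
abbreviation "p k \<equiv> real_of_rat (prob_of I (AA k))"
abbreviation "r \<equiv> real_of_rat (radius I)"
abbreviation "\<kappa> A B \<equiv> real_of_rat (scen_dist I A B)"
abbreviation "\<kappa>max \<equiv> real_of_rat (max_scen_dist I)"
abbreviation "g \<equiv> second_stage I"
abbreviation "h \<equiv> robust_objective I"
abbreviation "P \<equiv> fractional_decisions I"
abbreviation "cov x e \<equiv> (\<Sum>i<m. if e \<in> SS i then x (SS i) else 0 :: real)"

lemma sets_sum: "(\<Sum>S\<in>set (sets_of I). f S) = (\<Sum>i<m. f (SS i))"
  using valid unfolding valid_instance_def covering_collection_def
  by (intro sum.reindex_bij_betw[symmetric] bij_betw_nth) auto

lemma supp_sum: "(\<Sum>A\<in>set (support_of I). f A) = (\<Sum>k<K. f (AA k))"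
  using valid unfolding valid_instance_def
  by (intro sum.reindex_bij_betw[symmetric] bij_betw_nth) auto

lemma cover_sum: "(\<Sum>S | S \<in> set (sets_of I) \<and> e \<in> S. f S) = (\<Sum>i<m. if e \<in> SS i then f (SS i) else 0)"
proof -
  have "(\<Sum>S | S \<in> set (sets_of I) \<and> e \<in> S. f S) = (\<Sum>S\<in>set (sets_of I). if e \<in> S then f S else 0)"
    by (simp add: sum.inter_filter)
  then show ?thesis by (simp only: sets_sum)
qed

lemma inst_facts:
  shows fin_scen: "finite \<A>" and scen_sub: "\<And>A. A \<in> \<A> \<Longrightarrow> A \<subseteq> {..<n}"
    and scen_cov: "\<And>A. A \<in> \<A> \<Longrightarrow> A \<subseteq> \<Union>(set (sets_of I))"
    and sets_sub: "\<And>i. i < m \<Longrightarrow> SS i \<subseteq> {..<n}"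
    and c_nonneg: "\<And>i. i < m \<Longrightarrow> 0 \<le> c i" and d_nonneg: "\<And>i. i < m \<Longrightarrow> 0 \<le> d i"
    and p_pos: "\<And>k. k < K \<Longrightarrow> 0 < p k" and r_pos: "0 < r"
    and AA_in: "\<And>k. k < K \<Longrightarrow> AA k \<in> \<A>"
    and kap_nonneg: "\<And>A B. A \<in> \<A> \<Longrightarrow> B \<in> \<A> \<Longrightarrow> 0 \<le> \<kappa> A B"
    and p_sum: "(\<Sum>k<K. p k) = 1"
proof -
  have s: "\<A> \<subseteq> Pow {..<n}" using valid unfolding valid_instance_def by blast
  then show "finite \<A>" by (rule finite_subset) simp
  show "A \<subseteq> {..<n}" if "A \<in> \<A>" for A using s that by auto
  show "A \<subseteq> \<Union>(set (sets_of I))" if "A \<in> \<A>" for A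
    using valid that unfolding valid_instance_def covering_collection_def by auto
  show "SS i \<subseteq> {..<n}" if "i < m" for i
    using valid that unfolding valid_instance_def covering_collection_def by auto
  show "0 \<le> c i" "0 \<le> d i" if "i < m" for i
    using valid that unfolding valid_instance_def by auto
  show "0 < p k" "AA k \<in> \<A>" if "k < K" for k
    using valid that unfolding valid_instance_def by auto
  show "0 < r" using valid unfolding valid_instance_def by auto
  show "0 \<le> \<kappa> A B" if "A \<in> \<A>" "B \<in> \<A>" for A B
    using valid that unfolding valid_instance_def by auto
  have "(\<Sum>A\<in>set (support_of I). prob_of I A) = 1" using valid unfolding valid_instance_def by auto
  then have "(\<Sum>k<K. prob_of I (AA k)) = 1" by (simp only: supp_sum)
  then have "real_of_rat (\<Sum>k<K. prob_of I (AA k)) = 1" by simp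
  then show "(\<Sum>k<K. p k) = 1" by (simp only: of_rat_sum)
qed

lemma kap_le_max: "A \<in> \<A> \<Longrightarrow> B \<in> \<A> \<Longrightarrow> \<kappa> A B \<le> \<kappa>max"
proof -
  assume h: "A \<in> \<A>" "B \<in> \<A>"
  have "{scen_dist I A A' | A A'. A \<in> \<A> \<and> A' \<in> \<A>} = (\<lambda>(A, A'). scen_dist I A A') ` (\<A> \<times> \<A>)" by auto
  then have "finite {scen_dist I A A' | A A'. A \<in> \<A> \<and> A' \<in> \<A>}" using fin_scen by simp
  then have "scen_dist I A B \<le> max_scen_dist I" unfolding max_scen_dist_def using h by (intro Max_ge) auto
  then show ?thesis by (simp add: of_rat_less_eq)
qed

lemma kmax_nonneg: "0 \<le> \<kappa>max"
proof -
  have "K \<noteq> 0" using p_sum by (intro notI) simp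
  then have "AA 0 \<in> \<A>" by (simp add: AA_in)
  then show ?thesis using kap_le_max[of "AA 0" "AA 0"] kap_nonneg[of "AA 0" "AA 0"] by linarith
qed

lemma g_le:
  assumes "\<And>i. i < m \<Longrightarrow> 0 \<le> z i" and "\<And>e. e \<in> A \<Longrightarrow> 1 \<le> cov x e + (\<Sum>i<m. if e \<in> SS i then z i else 0)"
  shows "g x A \<le> (\<Sum>i<m. d i * z i)"
proof -
  have dist: "distinct (sets_of I)" using valid unfolding valid_instance_def covering_collection_def by auto
  \<comment> \<open>\<open>recourse\<close> expects a function on sets; the list of sets is
    distinct, so each set has a unique index.\<close>
  define zz where "zz S = z (THE i. i < m \<and> SS i = S)" for S
  have zz: "zz (SS i) = z i" if "i < m" for i
  proof -
    have "(THE j. j < m \<and> SS j = SS i) = i"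
      by (rule the_equality) (use that dist in \<open>auto simp: nth_eq_iff_index_eq\<close>)
    then show ?thesis by (simp add: zz_def)
  qed
  have "g x A \<le> (\<Sum>S\<in>set (sets_of I). real_of_rat (cost2 I S) * zz S)"
    unfolding second_stage_def
  proof (rule recourse_le)
    fix S assume "S \<in> set (sets_of I)"
    then obtain i where "i < m" "S = SS i" by (metis in_set_conv_nth)
    then show "0 \<le> real_of_rat (cost2 I S)" "0 \<le> zz S" using d_nonneg assms zz by auto
  next
    fix e assume "e \<in> A"
    have "cov x e + (\<Sum>i<m. if e \<in> SS i then z i else 0) = (\<Sum>i<m. if e \<in> SS i then x (SS i) + zz (SS i) else 0)"
      unfolding sum.distrib[symmetric] by (rule sum.cong) (auto simp: zz)
    then show "1 \<le> (\<Sum>S | S \<in> set (sets_of I) \<and> e \<in> S. x S + zz S)"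
      unfolding cover_sum using assms(2)[OF \<open>e \<in> A\<close>] by simp
  qed
  also have "\<dots> = (\<Sum>i<m. d i * z i)" unfolding sets_sum by (simp add: zz)
  finally show ?thesis .
qed

lemma g_ge:
  assumes "A \<in> \<A>" "\<And>e. e \<in> A \<Longrightarrow> 0 \<le> w e" "\<And>i. i < m \<Longrightarrow> (\<Sum>e\<in>A \<inter> SS i. w e) \<le> d i"
  shows "(\<Sum>e\<in>A. w e * (1 - cov x e)) \<le> g x A"
  unfolding second_stage_def cover_sum[symmetric]
proof (rule recourse_dual)
  show "finite A" using scen_sub[OF assms(1)] finite_subset by blast
  fix S assume "S \<in> set (sets_of I)"
  then obtain i where "i < m" "S = SS i" by (metis in_set_conv_nth)
  then show "(\<Sum>e\<in>A \<inter> S. w e) \<le> real_of_rat (cost2 I S)" using assms(3) by simp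
qed (use assms scen_cov in auto)

lemma g_nonneg: "A \<in> \<A> \<Longrightarrow> 0 \<le> g x A"
  using g_ge[of A "\<lambda>_. 0" x] d_nonneg by simp

lemma h_eq: "h x = (\<Sum>i<m. c i * x (SS i)) +
  robust_recourse (set (sets_of I)) (\<lambda>S. of_rat (cost2 I S)) \<A> \<kappa> r (set (support_of I)) (\<lambda>A. of_rat (prob_of I A)) x"
  unfolding robust_objective_def first_stage_def sets_sum by simp

lemma h_le:
  assumes "0 \<le> y" "\<And>k. k < K \<Longrightarrow> 0 \<le> \<theta> k"
    and "\<And>k B. k < K \<Longrightarrow> B \<in> \<A> \<Longrightarrow> g x B \<le> \<theta> k + y * \<kappa> (AA k) B"
  shows "h x \<le> (\<Sum>i<m. c i * x (SS i)) + (\<Sum>k<K. p k * \<theta> k) + r * y"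
proof -
  have dist: "distinct (support_of I)" using valid unfolding valid_instance_def by auto
  define th where "th A = \<theta> (THE i. i < K \<and> AA i = A)" for A
  have th: "th (AA i) = \<theta> i" if "i < K" for i
  proof -
    have "(THE j. j < K \<and> AA j = AA i) = i"
      by (rule the_equality) (use that dist in \<open>auto simp: nth_eq_iff_index_eq\<close>)
    then show ?thesis by (simp add: th_def)
  qed
  have "robust_recourse (set (sets_of I)) (\<lambda>S. of_rat (cost2 I S)) \<A> \<kappa> r (set (support_of I)) (\<lambda>A. of_rat (prob_of I A)) x
    \<le> (\<Sum>A\<in>set (support_of I). real_of_rat (prob_of I A) * th A) + r * y"
  proof (rule robust_recourse_le)
    fix A assume "A \<in> set (support_of I)"
    then obtain k where k: "k < K" "A = AA k" by (metis in_set_conv_nth)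
    then show "0 \<le> real_of_rat (prob_of I A)" "0 \<le> th A" using p_pos[of k] assms(2) th by auto
    fix A' assume "A' \<in> \<A>"
    then show "recourse (set (sets_of I)) (\<lambda>S. of_rat (cost2 I S)) x A' \<le> th A + y * \<kappa> A A'"
      using assms(3)[of k A'] k th unfolding second_stage_def by simp
  qed (use fin_scen r_pos assms in auto)
  also have "(\<Sum>A\<in>set (support_of I). real_of_rat (prob_of I A) * th A) = (\<Sum>k<K. p k * \<theta> k)"
    unfolding supp_sum by (simp add: th)
  finally show ?thesis unfolding h_eq by simp
qed

lemma h_ge:
  assumes "\<And>k B. k < K \<Longrightarrow> B \<in> \<A> \<Longrightarrow> 0 \<le> \<gamma> k B" "\<And>k. k < K \<Longrightarrow> (\<Sum>B\<in>\<A>. \<gamma> k B) \<le> p k"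
    "(\<Sum>k<K. \<Sum>B\<in>\<A>. \<kappa> (AA k) B * \<gamma> k B) \<le> r"
  shows "(\<Sum>i<m. c i * x (SS i)) + (\<Sum>k<K. \<Sum>B\<in>\<A>. \<gamma> k B * g x B) \<le> h x"
proof -
  have dist: "distinct (support_of I)" using valid unfolding valid_instance_def by auto
  define ga where "ga A = \<gamma> (THE i. i < K \<and> AA i = A)" for A
  have ga: "ga (AA i) = \<gamma> i" if "i < K" for i
  proof -
    have "(THE j. j < K \<and> AA j = AA i) = i"
      by (rule the_equality) (use that dist in \<open>auto simp: nth_eq_iff_index_eq\<close>)
    then show ?thesis by (simp add: ga_def)
  qed
  have "(\<Sum>A\<in>set (support_of I). \<Sum>B\<in>\<A>. ga A B * recourse (set (sets_of I)) (\<lambda>S. of_rat (cost2 I S)) x B)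
    \<le> robust_recourse (set (sets_of I)) (\<lambda>S. of_rat (cost2 I S)) \<A> \<kappa> r (set (support_of I)) (\<lambda>A. of_rat (prob_of I A)) x"
  proof (rule robust_recourse_ge)
    fix A assume "A \<in> set (support_of I)"
    then obtain k where k: "k < K" "A = AA k" by (metis in_set_conv_nth)
    then show "(\<Sum>B\<in>\<A>. ga A B) \<le> real_of_rat (prob_of I A)" using assms(2) ga by auto
    show "0 \<le> ga A B" if "B \<in> \<A>" for B using k assms(1) ga that by auto
  next
    show "(\<Sum>A\<in>set (support_of I). \<Sum>B\<in>\<A>. \<kappa> A B * ga A B) \<le> r"
      unfolding supp_sum using assms(3) by (simp add: ga)
    show "0 \<le> recourse (set (sets_of I)) (\<lambda>S. of_rat (cost2 I S)) x A'" if "A' \<in> \<A>" for A'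
      using g_nonneg[OF that, of x] unfolding second_stage_def .
  qed (use fin_scen in auto)
  then show ?thesis unfolding h_eq supp_sum by (simp add: ga second_stage_def)
qed

lemma P_D: "x \<in> P \<Longrightarrow> i < m \<Longrightarrow> 0 \<le> x (SS i) \<and> x (SS i) \<le> 1"
  unfolding fractional_decisions_def by (auto simp: Pi_iff)

lemma h_nonneg: "x \<in> P \<Longrightarrow> 0 \<le> h x"
proof -
  assume x: "x \<in> P"
  have "0 \<le> (\<Sum>i<m. c i * x (SS i))" using P_D[OF x] c_nonneg by (intro sum_nonneg) auto
  then show ?thesis using h_ge[of "\<lambda>_ _. 0" x] p_pos r_pos by (simp add: less_imp_le)
qed

definition opt :: real where "opt = (INF x\<in>P. h x)"

lemma P_one: "(\<lambda>_. 1) \<in> P"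
  by (simp add: fractional_decisions_def)

lemma opt_greatest: "(\<And>x. x \<in> P \<Longrightarrow> b \<le> h x) \<Longrightarrow> b \<le> opt"
  unfolding opt_def using P_one by (intro cINF_greatest) auto

lemma opt_nonneg: "0 \<le> opt"
  using opt_greatest h_nonneg by blast

lemma opt_lower: "x \<in> P \<Longrightarrow> opt \<le> h x"
  unfolding opt_def by (intro cINF_lower bdd_belowI2[of _ 0]) (use h_nonneg in auto)

lemma g_one: "A \<in> \<A> \<Longrightarrow> g (\<lambda>_. 1) A = 0"
proof -
  assume A: "A \<in> \<A>"
  have "g (\<lambda>_. 1) A \<le> (\<Sum>i<m. d i * 0)"
  proof (rule g_le)
    fix e assume "e \<in> A"
    then obtain S where "S \<in> set (sets_of I)" "e \<in> S" using scen_cov[OF A] by auto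
    then obtain i where i: "i < m" "e \<in> SS i" by (metis in_set_conv_nth)
    have "(if e \<in> SS i then 1 else 0 :: real) \<le> cov (\<lambda>_. 1) e"
      using i by (intro member_le_sum[where f = "\<lambda>i. if e \<in> SS i then 1 else 0 :: real"]) auto
    then show "1 \<le> cov (\<lambda>_. 1) e + (\<Sum>i<m. if e \<in> SS i then 0 else 0)" using i by simp
  qed simp
  then show ?thesis using g_nonneg[OF A, of "\<lambda>_. 1"] by simp
qed

text \<open>Taking all sets fully leaves nothing to the second stage. This is the cap that ends the
  scan over \<open>T\<close>.\<close>

lemma opt_le_cost: "opt \<le> (\<Sum>i<m. c i)"
proof -
  have "h (\<lambda>_. 1) \<le> (\<Sum>i<m. c i * 1) + (\<Sum>k<K. p k * 0) + r * 0"
    by (rule h_le) (auto simp: g_one)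
  then show ?thesis using opt_lower[OF P_one] by simp
qed

text \<open>Moving the fraction l = r/(r + \<kappa>max) of every support scenario to
  \<open>B\<close> costs at most l * \<kappa>max <= r. As l <= 1, \<open>h x\<close> is at least l
  times first-stage cost plus \<open>g x B\<close>, and that sum is at least 1: \<open>B\<close> is
  non-null because its recourse is positive at 0 and zero at the all-ones decision.\<close>

lemma opt_ge_of_non_null:
  assumes nn: "non_null_cost_ge_1 I" and B: "B \<in> \<A>" and pos: "0 < g (\<lambda>_. 0) B"
  shows "r / (r + \<kappa>max) \<le> opt"
proof (rule opt_greatest)
  fix x assume x: "x \<in> P"
  define l where "l = r / (r + \<kappa>max)"
  have "0 < a / (a + b) \<and> a / (a + b) \<le> 1 \<and> a / (a + b) * b \<le> a" if "0 < a" "0 \<le> b" for a b :: real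
    using that by (auto simp: field_simps add_pos_nonneg)
  from this[OF r_pos kmax_nonneg] have l: "0 < l" "l \<le> 1" "l * \<kappa>max \<le> r"
    unfolding l_def by auto
  have "non_null I B" unfolding non_null_def using P_one g_one[OF B] pos
    by (intro bexI[of _ "\<lambda>_. 1"]) auto
  then have "1 \<le> first_stage I x + g x B" using nn B x unfolding non_null_cost_ge_1_def by blast
  then have 1: "1 \<le> (\<Sum>i<m. c i * x (SS i)) + g x B" unfolding first_stage_def sets_sum .
  have "(\<Sum>i<m. c i * x (SS i)) + (\<Sum>k<K. \<Sum>B'\<in>\<A>. (if B' = B then l * p k else 0) * g x B') \<le> h x"
  proof (rule h_ge)
    have "(\<Sum>k<K. \<Sum>B'\<in>\<A>. \<kappa> (AA k) B' * (if B' = B then l * p k else 0)) = (\<Sum>k<K. \<kappa> (AA k) B * (l * p k))"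
      using B fin_scen by (simp add: if_distrib sum.delta cong: if_cong)
    also have "\<dots> \<le> (\<Sum>k<K. \<kappa>max * (l * p k))"
      using kap_le_max AA_in B l p_pos by (intro sum_mono mult_right_mono) (auto intro: less_imp_le)
    also have "\<dots> = l * \<kappa>max * (\<Sum>k<K. p k)" by (simp add: sum_distrib_left algebra_simps)
    also have "\<dots> \<le> r" using l p_sum by simp
    finally show "(\<Sum>k<K. \<Sum>B'\<in>\<A>. \<kappa> (AA k) B' * (if B' = B then l * p k else 0)) \<le> r" .
    show "(\<Sum>B'\<in>\<A>. if B' = B then l * p k else 0) \<le> p k" if "k < K" for k
      using that B fin_scen l p_pos[OF that] by (simp add: sum.delta mult_left_le_one_le)
  qed (use l p_pos in \<open>auto intro: less_imp_le\<close>)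
  moreover have "(\<Sum>k<K. \<Sum>B'\<in>\<A>. (if B' = B then l * p k else 0) * g x B') = (\<Sum>k<K. p k) * (l * g x B)"
  proof -
    have "(\<Sum>B'\<in>\<A>. (if B' = B then l * p k else 0) * g x B') = (\<Sum>B'\<in>\<A>. if B' = B then l * p k * g x B else 0)" for k
      by (intro sum.cong) auto
    then show ?thesis using B fin_scen by (simp add: sum.delta sum_distrib_right sum_distrib_left algebra_simps)
  qed
  moreover have "l * (\<Sum>i<m. c i * x (SS i)) \<le> (\<Sum>i<m. c i * x (SS i))"
    using l P_D[OF x] c_nonneg by (intro mult_left_le_one_le sum_nonneg) auto
  moreover have "l * 1 \<le> l * ((\<Sum>i<m. c i * x (SS i)) + g x B)" using 1 l by (intro mult_left_mono) auto
  ultimately show "r / (r + \<kappa>max) \<le> h x" unfolding p_sum l_def[symmetric] by (simp add: distrib_left)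
qed

text \<open>Sum of the weak duality bounds of the rows met so far: \<open>\<gamma>\<close> is the
  mass they put on scenarios, \<open>G\<close> collects their first-stage coefficients and
  \<open>\<Lambda>\<close> their constant terms. Stating it for all nonnegative \<open>x\<close>
  removes any need to remember the individual rows.\<close>

definition cert :: "(nat \<Rightarrow> nat set \<Rightarrow> real) \<Rightarrow> (nat \<Rightarrow> real) \<Rightarrow> real \<Rightarrow> bool" where
  "cert \<gamma> G \<Lambda> \<longleftrightarrow> (\<forall>k B. 0 \<le> \<gamma> k B) \<and>
     (\<forall>x. (\<forall>i<m. 0 \<le> x (SS i)) \<longrightarrow>
        \<Lambda> - (\<Sum>i<m. G i * x (SS i)) \<le> (\<Sum>k<K. \<Sum>B\<in>\<A>. \<gamma> k B * g x B))"

lemma cert_init: "cert (\<lambda>_ _. 0) (\<lambda>_. 0) 0"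
  by (simp add: cert_def)

definition bump :: "(nat \<Rightarrow> nat set \<Rightarrow> real) \<Rightarrow> nat \<Rightarrow> nat set \<Rightarrow> real \<Rightarrow> nat \<Rightarrow> nat set \<Rightarrow> real" where
  "bump \<gamma> k B \<sigma> = (\<lambda>k' B'. \<gamma> k' B' + (if k' = k \<and> B' = B then \<sigma> else 0))"

lemma bump_sum:
  assumes "B \<in> \<A>"
  shows "(\<Sum>B'\<in>\<A>. f B' * bump \<gamma> k B \<sigma> k' B') = (\<Sum>B'\<in>\<A>. f B' * \<gamma> k' B') + (if k' = k then f B * \<sigma> else 0)"
proof -
  have "f B' * bump \<gamma> k B \<sigma> k' B' = f B' * \<gamma> k' B' + (if B' = B then if k' = k then f B * \<sigma> else 0 else 0)" for B'
    by (simp add: bump_def distrib_left)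
  then show ?thesis using assms fin_scen by (simp only: sum.distrib sum.delta if_True)
qed

text \<open>Adds \<open>\<sigma>\<close> times the weak duality bound of \<open>w\<close> for the
  recourse of \<open>B\<close>, charged to support scenario \<open>k\<close>.\<close>

lemma cert_step:
  assumes ct: "cert \<gamma> G \<Lambda>" and k: "k < K" and B: "B \<in> \<A>" and s: "0 \<le> \<sigma>"
    and w: "\<And>e. e \<in> B \<Longrightarrow> 0 \<le> w e" "\<And>i. i < m \<Longrightarrow> (\<Sum>e\<in>B \<inter> SS i. w e) \<le> d i"
  shows "cert (bump \<gamma> k B \<sigma>) (\<lambda>i. G i + \<sigma> * (\<Sum>e\<in>B \<inter> SS i. w e)) (\<Lambda> + \<sigma> * (\<Sum>e\<in>B. w e))"
  unfolding cert_def
proof (intro conjI allI impI)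
  show "0 \<le> bump \<gamma> k B \<sigma> k' B'" for k' B' using ct s by (auto simp: bump_def cert_def)
  fix x :: "nat set \<Rightarrow> real" assume x: "\<forall>i<m. 0 \<le> x (SS i)"
  have fB: "finite B" using scen_sub[OF B] finite_subset by blast
  have 0: "\<Lambda> - (\<Sum>i<m. G i * x (SS i)) \<le> (\<Sum>k<K. \<Sum>B\<in>\<A>. \<gamma> k B * g x B)" using ct x by (auto simp: cert_def)
  have "(\<Sum>e\<in>B. w e * cov x e) = (\<Sum>e\<in>B. \<Sum>i<m. if e \<in> SS i then w e * x (SS i) else 0)"
    by (auto simp: sum_distrib_left intro!: sum.cong)
  also have "\<dots> = (\<Sum>i<m. \<Sum>e\<in>B. if e \<in> SS i then w e * x (SS i) else 0)" by (rule sum.swap)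
  also have "\<dots> = (\<Sum>i<m. (\<Sum>e\<in>B \<inter> SS i. w e) * x (SS i))"
    using fB by (auto simp: sum_distrib_right sum.inter_restrict intro!: sum.cong)
  finally have "(\<Sum>e\<in>B. w e) - (\<Sum>i<m. (\<Sum>e\<in>B \<inter> SS i. w e) * x (SS i)) \<le> g x B"
    using g_ge[OF B w, of x] by (simp add: right_diff_distrib sum_subtractf)
  moreover define W where "W i = (\<Sum>e\<in>B \<inter> SS i. w e)" for i
  ultimately have "(\<Sum>e\<in>B. w e) - (\<Sum>i<m. W i * x (SS i)) \<le> g x B" by simp
  from mult_left_mono[OF this s]
  have "\<sigma> * (\<Sum>e\<in>B. w e) - (\<Sum>i<m. \<sigma> * W i * x (SS i)) \<le> \<sigma> * g x B"
    by (simp add: right_diff_distrib sum_distrib_left mult.assoc)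
  then have 1: "\<sigma> * (\<Sum>e\<in>B. w e) - (\<Sum>i<m. \<sigma> * (\<Sum>e\<in>B \<inter> SS i. w e) * x (SS i)) \<le> \<sigma> * g x B"
    unfolding W_def .
  have "(\<Sum>k'<K. \<Sum>B'\<in>\<A>. bump \<gamma> k B \<sigma> k' B' * g x B') =
      (\<Sum>k'<K. (\<Sum>B'\<in>\<A>. \<gamma> k' B' * g x B') + (if k' = k then \<sigma> * g x B else 0))"
    using bump_sum[OF B, of "g x" \<gamma> k \<sigma>] by (simp only: mult.commute[of _ "g x _"])
  also have "\<dots> = (\<Sum>k<K. \<Sum>B\<in>\<A>. \<gamma> k B * g x B) + \<sigma> * g x B"
    using k by (simp add: sum.distrib sum.delta)
  finally show "\<Lambda> + \<sigma> * (\<Sum>e\<in>B. w e) - (\<Sum>i<m. (G i + \<sigma> * (\<Sum>e\<in>B \<inter> SS i. w e)) * x (SS i)) \<le>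
    (\<Sum>k'<K. \<Sum>B'\<in>\<A>. bump \<gamma> k B \<sigma> k' B' * g x B')"
    using 0 1 by (simp add: distrib_right sum.distrib)
qed

text \<open>Dividing by \<open>\<zeta>\<close> turns \<open>\<gamma>\<close> into a feasible
  transport plan and \<open>G\<close> into coefficients below \<open>c\<close>, so that the
  first-stage cost in \<open>h\<close> absorbs the negative terms.\<close>

lemma cert_final:
  assumes ct: "cert \<gamma> G \<Lambda>" and z: "0 < \<zeta>" and "\<And>k. k < K \<Longrightarrow> (\<Sum>B\<in>\<A>. \<gamma> k B) \<le> \<zeta> * p k"
    and "(\<Sum>k<K. \<Sum>B\<in>\<A>. \<kappa> (AA k) B * \<gamma> k B) \<le> \<zeta> * r" and G: "\<And>i. i < m \<Longrightarrow> G i \<le> \<zeta> * c i"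
  shows "\<Lambda> / \<zeta> \<le> opt"
proof (rule opt_greatest)
  fix x assume x: "x \<in> P"
  have "(\<Sum>i<m. c i * x (SS i)) + (\<Sum>k<K. \<Sum>B\<in>\<A>. (\<gamma> k B / \<zeta>) * g x B) \<le> h x"
  proof (rule h_ge)
    have "(\<Sum>k<K. \<Sum>B\<in>\<A>. \<kappa> (AA k) B * (\<gamma> k B / \<zeta>)) = (\<Sum>k<K. \<Sum>B\<in>\<A>. \<kappa> (AA k) B * \<gamma> k B) / \<zeta>"
      by (simp add: sum_divide_distrib)
    then show "(\<Sum>k<K. \<Sum>B\<in>\<A>. \<kappa> (AA k) B * (\<gamma> k B / \<zeta>)) \<le> r"
      using assms(4) z by (simp add: pos_divide_le_eq mult.commute)
    show "0 \<le> \<gamma> k B / \<zeta>" for k B using ct z by (simp add: cert_def)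
    show "(\<Sum>B\<in>\<A>. \<gamma> k B / \<zeta>) \<le> p k" if "k < K" for k
      using assms(3)[OF that] z by (simp add: sum_divide_distrib[symmetric] pos_divide_le_eq mult.commute)
  qed
  moreover have "(\<Sum>k<K. \<Sum>B\<in>\<A>. (\<gamma> k B / \<zeta>) * g x B) = (\<Sum>k<K. \<Sum>B\<in>\<A>. \<gamma> k B * g x B) / \<zeta>"
    by (simp add: sum_divide_distrib)
  moreover have "\<Lambda> - (\<Sum>i<m. G i * x (SS i)) \<le> (\<Sum>k<K. \<Sum>B\<in>\<A>. \<gamma> k B * g x B)"
    using ct P_D[OF x] unfolding cert_def by blast
  moreover have "(\<Sum>i<m. G i * x (SS i)) \<le> (\<Sum>i<m. \<zeta> * c i * x (SS i))"
    using G P_D[OF x] by (intro sum_mono mult_right_mono) auto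
  moreover have "(\<Sum>i<m. \<zeta> * c i * x (SS i)) = \<zeta> * (\<Sum>i<m. c i * x (SS i))"
    by (simp add: sum_distrib_left mult.assoc)
  moreover have "((\<Sum>k<K. \<Sum>B\<in>\<A>. \<gamma> k B * g x B) + \<zeta> * (\<Sum>i<m. c i * x (SS i))) / \<zeta> =
      (\<Sum>k<K. \<Sum>B\<in>\<A>. \<gamma> k B * g x B) / \<zeta> + (\<Sum>i<m. c i * x (SS i))"
    using z by (simp add: add_divide_distrib)
  moreover have "\<Lambda> / \<zeta> \<le> ((\<Sum>k<K. \<Sum>B\<in>\<A>. \<gamma> k B * g x B) + \<zeta> * (\<Sum>i<m. c i * x (SS i))) / \<zeta>"
    using calculation(3-5) z by (intro divide_right_mono) auto
  ultimately show "\<Lambda> / \<zeta> \<le> h x" by linarith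
qed

text \<open>Index \<open>k = 3 * i + j\<close> denotes the part of set \<open>i\<close> on classes
  above \<open>j\<close>. Classes 1, 2, 3 mean unsettled, half-settled and settled, so
  \<open>j = 0\<close> is the whole set.\<close>

definition cand :: "(nat \<Rightarrow> int) \<Rightarrow> nat \<Rightarrow> nat set" where
  "cand cl k = {e \<in> SS (k div 3). int (k mod 3) < cl e}"

text \<open>An element of class 2 is covered to the extent 1/3 by the first stage, so that
  two thirds of a set restricted to class 2 suffice; elements of class 3 are covered.\<close>

lemma recourse_cand_ge:
  assumes A: "A \<in> \<A>" and fin: "J \<subseteq> {..<3 * m}" and inj: "inj_on (cand cl) J"
    and cvd: "A \<subseteq> \<Union>(cand cl ` J)" and H: "0 \<le> H"
    and dq: "\<And>k. k \<in> J \<Longrightarrow> dq (cand cl k) =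
      H * d (k div 3) * (if k mod 3 = 0 then 1 else if k mod 3 = 1 then 2 / 3 else 0)"
    and x: "\<And>i. i < m \<Longrightarrow> 0 \<le> x (SS i)"
    and cl: "\<And>e. e \<in> A \<Longrightarrow> cl e = 1 \<or> cl e = 2 \<and> 1 / 3 \<le> cov x e \<or> cl e = 3 \<and> 1 \<le> cov x e"
  shows "H * g x A \<le> recourse (cand cl ` J) dq (\<lambda>_. 0) A"
proof (rule recourse_ge)
  let ?f = "\<lambda>k :: nat. if k mod 3 = 0 then 1 else if k mod 3 = 1 then 2 / 3 else (0 :: real)"
  have facc: "finite J" using fin finite_subset by blast
  then show "finite (cand cl ` J)" by simp
  show "A \<subseteq> \<Union>(cand cl ` J)" by fact
  fix z :: "nat set \<Rightarrow> real"
  assume z: "\<And>S. S \<in> cand cl ` J \<Longrightarrow> 0 \<le> z S"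
    and cv: "\<And>e. e \<in> A \<Longrightarrow> 1 \<le> (\<Sum>S | S \<in> cand cl ` J \<and> e \<in> S. 0 + z S)"
  \<comment> \<open>A cover by restricted copies becomes one by original sets. The factor
    \<open>?f\<close> is the ratio of the copy's cost to that of the whole set, so the cost is
    preserved exactly.\<close>
  define zi where "zi i = (\<Sum>k\<in>J. if k div 3 = i then ?f k * z (cand cl k) else 0)" for i
  have lt: "k div 3 < m" if "k \<in> J" for k using that fin less_mult_imp_div_less[of k m 3] by (auto simp: mult.commute)
  have swap: "(\<Sum>i<m. a i * zi i) = (\<Sum>k\<in>J. a (k div 3) * (?f k * z (cand cl k)))" for a
  proof -
    have "(\<Sum>i<m. a i * zi i) = (\<Sum>k\<in>J. \<Sum>i<m. if k div 3 = i then a i * (?f k * z (cand cl k)) else 0)"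
      unfolding zi_def sum_distrib_left by (subst sum.swap) (intro sum.cong refl, simp)
    also have "\<dots> = (\<Sum>k\<in>J. a (k div 3) * (?f k * z (cand cl k)))"
      by (rule sum.cong) (simp_all add: sum.delta' lt)
    finally show ?thesis .
  qed
  have "g x A \<le> (\<Sum>i<m. d i * zi i)"
  proof (rule g_le)
    show "0 \<le> zi i" for i unfolding zi_def using z by (intro sum_nonneg) simp
    fix e assume e: "e \<in> A"
    have cx: "0 \<le> cov x e" using x by (intro sum_nonneg) auto
    let ?Z = "\<Sum>i<m. if e \<in> SS i then zi i else 0"
    have Z: "?Z = (\<Sum>k\<in>J. (if e \<in> SS (k div 3) then 1 else 0) * (?f k * z (cand cl k)))"
    proof -
      have "?Z = (\<Sum>i<m. (if e \<in> SS i then 1 else 0) * zi i)" by (rule sum.cong) simp_all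
      then show ?thesis unfolding swap .
    qed
    have zi0: "0 \<le> zi i" for i unfolding zi_def using z by (intro sum_nonneg) simp
    then have Z0: "0 \<le> ?Z" by (intro sum_nonneg) simp
    have "1 \<le> (\<Sum>S\<in>cand cl ` J. if e \<in> S then z S else 0)"
      using cv[OF e] facc by (simp add: sum.inter_filter)
    also have "\<dots> = (\<Sum>k\<in>J. if e \<in> cand cl k then z (cand cl k) else 0)"
      using inj by (simp add: sum.reindex)
    finally have c1: "1 \<le> (\<Sum>k\<in>J. if e \<in> cand cl k then z (cand cl k) else 0)" .
    consider "cl e = 1" | "cl e = 2" "1 / 3 \<le> cov x e" | "cl e = 3" "1 \<le> cov x e" using cl[OF e] by blast
    then show "1 \<le> cov x e + ?Z"
    proof cases
      case 1
      have "(\<Sum>k\<in>J. if e \<in> cand cl k then z (cand cl k) else 0) \<le> ?Z"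
        unfolding Z
      proof (intro sum_mono)
        fix k assume k: "k \<in> J"
        then have "0 \<le> z (cand cl k)" using z by blast
        moreover have "k mod 3 = 0 \<and> e \<in> SS (k div 3)" if "e \<in> cand cl k" using that 1 by (simp add: cand_def)
        ultimately show "(if e \<in> cand cl k then z (cand cl k) else 0) \<le>
          (if e \<in> SS (k div 3) then 1 else 0) * (?f k * z (cand cl k))"
          by (cases "e \<in> cand cl k") simp_all
      qed
      then show ?thesis using c1 cx by linarith
    next
      case 2
      have "(\<Sum>k\<in>J. 2 / 3 * (if e \<in> cand cl k then z (cand cl k) else 0)) \<le> ?Z"
        unfolding Z
      proof (intro sum_mono)
        fix k assume k: "k \<in> J"
        then have "0 \<le> z (cand cl k)" using z by blast
        moreover have "(k mod 3 = 0 \<or> k mod 3 = 1) \<and> e \<in> SS (k div 3)" if "e \<in> cand cl k"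
        proof -
          have "int (k mod 3) < 2" "e \<in> SS (k div 3)" using that 2(1) by (simp_all add: cand_def)
          then show ?thesis by linarith
        qed
        ultimately show "2 / 3 * (if e \<in> cand cl k then z (cand cl k) else 0) \<le>
          (if e \<in> SS (k div 3) then 1 else 0) * (?f k * z (cand cl k))"
          by (cases "e \<in> cand cl k") auto
      qed
      then have "2 / 3 * (\<Sum>k\<in>J. if e \<in> cand cl k then z (cand cl k) else 0) \<le> ?Z"
        by (simp only: sum_distrib_left)
      then show ?thesis using c1 2(2) by linarith
    next
      case 3
      then show ?thesis using Z0 by linarith
    qed
  qed
  then have "H * g x A \<le> H * (\<Sum>i<m. d i * zi i)" using H by (rule mult_left_mono)
  also have "\<dots> = (\<Sum>k\<in>J. dq (cand cl k) * z (cand cl k))"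
    unfolding swap sum_distrib_left by (rule sum.cong) (simp_all only: dq mult.assoc)
  also have "\<dots> = (\<Sum>S\<in>cand cl ` J. dq S * z S)" using inj by (simp add: sum.reindex)
  finally show "H * g x A \<le> (\<Sum>S\<in>cand cl ` J. dq S * z S)" .
qed

end

section \<open>The program\<close>

lemma wp_seqI:
  assumes "wp sub L c R a b"
    and "\<And>a' b'. R a' b' \<Longrightarrow> same_off (mods c) (touches_block c) a b a' b' \<Longrightarrow> wp sub L d Q a' b'"
  shows "wp sub L (c ;; d) Q a b"
  using wp_mono[OF wp_frame[OF assms(1)], of "wp sub L d Q"] assms(2) by simp

lemma same_offD: "same_off M t a b a' b' \<Longrightarrow> j \<notin> M \<Longrightarrow> a' j = a j"
  by (simp add: same_off_def)

lemma nat_abs_add: "0 \<le> x \<Longrightarrow> 0 \<le> y \<Longrightarrow> nat \<bar>x + y\<bar> = nat \<bar>x\<bar> + nat \<bar>y :: int\<bar>"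
  by linarith

lemma nat_abs_div3: "nat \<bar>int k div 3\<bar> = k div 3"
  by linarith

lemma int_mult_nonneg: "0 \<le> int i * int j"
  by simp

lemmas idx = nat_abs_add nat_abs_mult_distrib nat_abs_div3 int_mult_nonneg

lemma idx_inj: "e < n \<Longrightarrow> e' < n \<Longrightarrow> (k * n + e = k' * n + e') \<longleftrightarrow> (k = k' \<and> e = (e'::nat))"
  by (metis div_mult_self3 add.commute add_left_cancel div_less less_nat_zero_code add_cancel_left_right)

text \<open>The number of an array is its level: an array may only be computed from arrays of smaller number,
  which dictates the order below.\<close>

abbreviation (input) "aINP \<equiv> 2::nat"
abbreviation (input) "aLen \<equiv> 3::nat"
abbreviation (input) "aQn \<equiv> 4::nat"
abbreviation (input) "aQd \<equiv> 5::nat"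
abbreviation (input) "aBB \<equiv> 6::nat"
abbreviation (input) "i1 \<equiv> 7::nat"
abbreviation (input) "i2 \<equiv> 8::nat"
abbreviation (input) "i3 \<equiv> 9::nat"
abbreviation (input) "i4 \<equiv> 10::nat"
abbreviation (input) "aViol \<equiv> 13::nat"
abbreviation (input) "aSuc \<equiv> 14::nat"
abbreviation (input) "aFnd \<equiv> 15::nat"
abbreviation (input) "aFr \<equiv> 16::nat"
abbreviation (input) "aKp \<equiv> 17::nat"
abbreviation (input) "aDf \<equiv> 18::nat"
abbreviation (input) "aCL \<equiv> 19::nat"
abbreviation (input) "aCB \<equiv> 20::nat"
abbreviation (input) "aRow \<equiv> 21::nat"
abbreviation (input) "aKL \<equiv> 22::nat"
abbreviation (input) "aCnt \<equiv> 23::nat"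
abbreviation (input) "aIt \<equiv> 24::nat"
abbreviation (input) "aN \<equiv> 25::nat"
abbreviation (input) "aM \<equiv> 26::nat"
abbreviation (input) "aK \<equiv> 27::nat"
abbreviation (input) "aRn \<equiv> 28::nat"
abbreviation (input) "aRd \<equiv> 29::nat"
abbreviation (input) "oC1 \<equiv> 30::nat"
abbreviation (input) "oC2 \<equiv> 31::nat"
abbreviation (input) "oR \<equiv> 32::nat"
abbreviation (input) "oA \<equiv> 33::nat"
abbreviation (input) "oP \<equiv> 34::nat"
abbreviation (input) "aDd \<equiv> 35::nat"
abbreviation (input) "aCC \<equiv> 36::nat"
abbreviation (input) "aPi \<equiv> 37::nat"
abbreviation (input) "aIC \<equiv> 38::nat"
abbreviation (input) "aGa \<equiv> 39::nat"
abbreviation (input) "aXF \<equiv> 40::nat"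
abbreviation (input) "aTA \<equiv> 41::nat"
abbreviation (input) "aTB \<equiv> 42::nat"
abbreviation (input) "aIM \<equiv> 43::nat"
abbreviation (input) "aRM \<equiv> 44::nat"
abbreviation (input) "aLa \<equiv> 45::nat"
abbreviation (input) "aIu \<equiv> 46::nat"
abbreviation (input) "aIU \<equiv> 47::nat"
abbreviation (input) "aLhs \<equiv> 48::nat"
abbreviation (input) "aLd \<equiv> 49::nat"
abbreviation (input) "aML \<equiv> 50::nat"
abbreviation (input) "aWD \<equiv> 51::nat"
abbreviation (input) "aOm \<equiv> 52::nat"
abbreviation (input) "aPP \<equiv> 53::nat"
abbreviation (input) "aPM \<equiv> 54::nat"
abbreviation (input) "aW \<equiv> 55::nat"
abbreviation (input) "aU \<equiv> 56::nat"
abbreviation (input) "aXD \<equiv> 57::nat"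
abbreviation (input) "aXN \<equiv> 58::nat"
abbreviation (input) "aY \<equiv> 59::nat"
abbreviation (input) "aTN \<equiv> 60::nat"
abbreviation (input) "aTD \<equiv> 61::nat"

abbreviation (input) V :: "nat \<Rightarrow> hexp" where "V x \<equiv> HV x (HN 0)"
abbreviation (input) SV :: "nat \<Rightarrow> hexp \<Rightarrow> hcom" where "SV x e \<equiv> HSet x (HN 0) e"
abbreviation (input) When :: "hexp \<Rightarrow> hcom \<Rightarrow> hcom" where "When e c \<equiv> HIf e c HSkip"
abbreviation (input) "eCn \<equiv> HV aINP (V oC1 \<oplus> HN 2 \<otimes> V i1)"
abbreviation (input) "eCd \<equiv> HV aINP (V oC1 \<oplus> HN 2 \<otimes> V i1 \<oplus> HN 1)"
abbreviation (input) "eDn \<equiv> HV aINP (V oC2 \<oplus> HN 2 \<otimes> V i1)"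
abbreviation (input) "eDd \<equiv> HV aINP (V oC2 \<oplus> HN 2 \<otimes> V i1 \<oplus> HN 1)"
abbreviation (input) "eBit i e \<equiv> HV aINP (HN 3 \<oplus> i \<otimes> V aN \<oplus> e)"
abbreviation (input) "eM3 \<equiv> HN 3 \<otimes> V aM"
abbreviation (input) "eMv \<equiv> V aM \<oplus> HN 1 \<oplus> V aK"
abbreviation (input) "ePn \<equiv> HV aINP (V oP \<oplus> HN 2 \<otimes> V i1)"
abbreviation (input) "ePd \<equiv> HV aINP (V oP \<oplus> HN 2 \<otimes> V i1 \<oplus> HN 1)"

definition p_read :: hcom where
  "p_read = HGet aLen (HN 0) (HN 0) ;;
   HFor i1 (V aLen) (HGet aINP (V i1) (HN 1 \<oplus> V i1)) ;;
   SV aN (HV aINP (HN 1)) ;; SV aM (HV aINP (HN 2)) ;;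
   SV oC1 (HN 3 \<oplus> V aM \<otimes> V aN) ;; SV oC2 (V oC1 \<oplus> HN 2 \<otimes> V aM) ;; SV oR (V oC2 \<oplus> HN 2 \<otimes> V aM) ;;
   SV aK (HV aINP (V oR \<oplus> HN 4)) ;; SV oA (V oR \<oplus> HN 5) ;; SV oP (V oA \<oplus> V aK \<otimes> V aN) ;;
   SV aRn (HV aINP (V oR)) ;; SV aRd (HV aINP (V oR \<oplus> HN 1))"

definition p_Dd :: hcom where
  "p_Dd = SV aDd (HN 1) ;; HFor i1 (V aM) (SV aDd (V aDd \<otimes> eDd))"

definition p_CC :: hcom where
  "p_CC = HFor i1 (V aM) (
     HSet aCC (HN 3 \<otimes> V i1) (HN 3 \<otimes> (eDn \<otimes> V aDd \<oslash> eDd)) ;;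
     HSet aCC (HN 3 \<otimes> V i1 \<oplus> HN 1) (HN 2 \<otimes> (eDn \<otimes> V aDd \<oslash> eDd)) ;;
     HSet aCC (HN 3 \<otimes> V i1 \<oplus> HN 2) (HN 0))"

definition p_Pi :: hcom where
  "p_Pi = SV aPi (HN 1) ;; HFor i1 eM3 (When (HV aCC (V i1)) (SV aPi (V aPi \<otimes> HV aCC (V i1))))"

definition p_IC :: hcom where
  "p_IC = HFor i1 eM3 (HSet aIC (V i1) (V aPi \<oslash> HV aCC (V i1)))"

definition p_Ga :: hcom where
  "p_Ga = SV aGa (HN 1) ;; HFor i1 (V aM) (When eCn (SV aGa (V aGa \<otimes> eCn)))"

definition p_XF :: hcom where
  "p_XF = HFor i1 (V aM) (HSet aXF (V i1) (eCd \<otimes> (V aGa \<oslash> eCn)))"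

definition p_ones :: hcom where
  "p_ones = HFor i1 eMv (HSet aW (V i1) (HN 1))"

definition p_init :: hcom where
  "p_init = p_read ;; p_Dd ;; p_CC ;; p_Pi ;; p_IC ;; p_Ga ;; p_XF ;; p_ones ;;
   SV aTA (HN 0) ;; SV aTB (HN 1) ;; SV aIt (HN 0) ;; SV aViol (HN 1)"

definition p_U :: hcom where
  "p_U = SV aU (HN 0) ;; HFor i1 eMv (SV aU (V aU \<oplus> HV aW (V i1)))"

text \<open>The candidate divides the value T = \<open>aTA / aTB\<close> among the variables in
  proportion to their weights: x_i = T W_i / (U c_i), written over the common denominator
  \<open>aXD\<close>. Sets of first-stage cost 0 are taken fully.\<close>

definition p_XN :: hcom where
  "p_XN = SV aXD (V aTB \<otimes> V aU \<otimes> V aGa) ;;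
   HFor i1 (V aM) (HIf eCn (HSet aXN (V i1) (V aTA \<otimes> HV aW (V i1) \<otimes> HV aXF (V i1)))
     (HSet aXN (V i1) (V aXD)))"

definition p_Y :: hcom where
  "p_Y = SV aY (HN 0) ;; HFor i2 (V aM) (When (eBit (V i2) (V i1)) (SV aY (V aY \<oplus> HV aXN (V i2))))"

text \<open>\<open>HIf\<close> tests for strict positivity, hence the added 1 in the weak
  comparisons with 11/21 and 1/3.\<close>

definition p_CL :: hcom where
  "p_CL = HFor i1 (V aN) (p_Y ;;
     HIf (HN 21 \<otimes> V aY \<ominus> HN 11 \<otimes> V aXD \<oplus> HN 1) (HSet aCL (V i1) (HN 3))
       (HIf (HN 3 \<otimes> V aY \<ominus> V aXD \<oplus> HN 1) (HSet aCL (V i1) (HN 2)) (HSet aCL (V i1) (HN 1))))"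

text \<open>Characteristic vectors of the candidates;
  \<open>V i1 \<ominus> HN 3 \<otimes> (V i1 \<oslash> HN 3)\<close> is the remainder modulo
  3.\<close>

definition p_CB :: hcom where
  "p_CB = HFor i1 eM3 (HFor i2 (V aN) (
     HSet aCB (V i1 \<otimes> V aN \<oplus> V i2) (HN 0) ;;
     When (eBit (V i1 \<oslash> HN 3) (V i2))
       (When (HV aCL (V i2) \<ominus> (V i1 \<ominus> HN 3 \<otimes> (V i1 \<oslash> HN 3)))
         (HSet aCB (V i1 \<otimes> V aN \<oplus> V i2) (HN 1)))))"

text \<open>The collection of a queried instance has no repetitions, so among equal candidates only the
  cheapest one is kept.\<close>

definition p_diff :: hcom where
  "p_diff = SV aDf (HN 0) ;; HFor i3 (V aN) (
     When ((HV aCB (V i1 \<otimes> V aN \<oplus> V i3) \<ominus> HV aCB (V i2 \<otimes> V aN \<oplus> V i3)) \<otimes>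
           (HV aCB (V i1 \<otimes> V aN \<oplus> V i3) \<ominus> HV aCB (V i2 \<otimes> V aN \<oplus> V i3))) (SV aDf (HN 1)))"

definition p_keep1 :: hcom where
  "p_keep1 = SV aKp (HN 1) ;; HFor i2 eM3 (p_diff ;;
     When (HN 1 \<ominus> V aDf) (When ((HV aCC (V i1) \<otimes> eM3 \<oplus> V i1) \<ominus> (HV aCC (V i2) \<otimes> eM3 \<oplus> V i2))
       (SV aKp (HN 0))))"

definition p_keep :: hcom where
  "p_keep = SV aCnt (HN 0) ;; HFor i1 eM3 (p_keep1 ;;
     When (V aKp) (HSet aKL (V aCnt) (V i1) ;; SV aCnt (V aCnt \<oplus> HN 1)))"

text \<open>Block addresses at which a query holds the costs and the multiplier of the distance,
  respectively.\<close>

abbreviation (input) "eQ0 \<equiv> HN 3 \<oplus> V aCnt \<otimes> V aN"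
abbreviation (input) "eQ1 \<equiv> HN 3 \<oplus> V aCnt \<otimes> V aN \<oplus> HN 2 \<otimes> V aCnt"

definition p_qbits :: hcom where
  "p_qbits = HFor i2 (V aCnt) (HFor i3 (V aN) (
     HPut (HN 3 \<oplus> V i2 \<otimes> V aN \<oplus> V i3) (HV aCB (HV aKL (V i2) \<otimes> V aN \<oplus> V i3))))"

text \<open>Costs and distance multiplier are scaled by one common denominator, so that every
  rational sent is an integer over 1 and thus already in lowest terms.\<close>

definition p_qcosts :: hcom where
  "p_qcosts = HFor i2 (V aCnt) (
     HPut (eQ0 \<oplus> HN 2 \<otimes> V i2) (HV aCC (HV aKL (V i2)) \<otimes> (HN 20 \<otimes> V aTB \<otimes> V aU \<otimes> V aRn)) ;;
     HPut (eQ0 \<oplus> HN 2 \<otimes> V i2 \<oplus> HN 1) (HN 1))"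

definition p_qscen :: hcom where
  "p_qscen = HFor i2 (V aN) (HPut (eQ1 \<oplus> HN 2 \<oplus> V i2) (HV aINP (V oA \<oplus> V i1 \<otimes> V aN \<oplus> V i2)))"

definition p_ask :: hcom where
  "p_ask = HPut (HN 1) (HN 0) ;; HPut (HN 2) (V aCnt) ;; p_qbits ;; p_qcosts ;;
   HPut eQ1 (HN 117 \<otimes> V aDd \<otimes> V aTA \<otimes> HV aW (V aM) \<otimes> V aRd) ;; HPut (eQ1 \<oplus> HN 1) (HN 1) ;;
   p_qscen ;; HPut (HN 0) (eQ1 \<oplus> HN 1 \<oplus> V aN) ;; HAsk ;;
   HFor i2 (V aN) (HGet aBB (V i2) (HN 1 \<oplus> V i2))"

definition p_dist :: hcom where
  "p_dist = HPut (HN 1) (HN 1) ;;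
   HFor i2 (V aN) (HPut (HN 2 \<oplus> V i2) (HV aINP (V oA \<oplus> V i1 \<otimes> V aN \<oplus> V i2)) ;;
     HPut (HN 2 \<oplus> V aN \<oplus> V i2) (HV aBB (V i2))) ;;
   HPut (HN 0) (HN 1 \<oplus> HN 2 \<otimes> V aN) ;; HAsk ;; HGet aQn (HN 0) (HN 1) ;; HGet aQd (HN 0) (HN 2)"

definition p_target :: hcom where
  "p_target = SV aTN (HN 117 \<otimes> V aDd \<otimes> V aTA \<otimes> (HV aW (V aM \<oplus> HN 1 \<oplus> V i1) \<otimes> ePd \<otimes> V aQd \<otimes> V aRn \<oplus>
       V aQn \<otimes> HV aW (V aM) \<otimes> V aRd \<otimes> ePn)) ;;
   SV aTD (HN 20 \<otimes> V aTB \<otimes> V aU \<otimes> ePn \<otimes> V aQd \<otimes> V aRn)"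

definition p_start :: hcom where
  "p_start = HFor i2 eM3 (HSet aIu (V i2) (HN 1)) ;; HFor i2 (V aN) (HSet aLa (V i2) (HN 0)) ;; SV aSuc (HN 0)"

definition p_iU :: hcom where
  "p_iU = SV aIU (HN 0) ;; HFor i3 eM3 (SV aIU (V aIU \<oplus> HV aIu (V i3)))"

definition p_lhs :: hcom where
  "p_lhs = SV aLhs (HN 0) ;; SV aIM (HN 0) ;; SV aFr (HN 0) ;;
   HFor i4 eM3 (When (HV aCB (V i4 \<otimes> V aN \<oplus> V i3)) (
     HIf (HV aCC (V i4)) (SV aLhs (V aLhs \<oplus> HV aIu (V i4) \<otimes> HV aIC (V i4)) ;;
       When (HV aIC (V i4) \<ominus> V aIM) (SV aIM (HV aIC (V i4)))) (SV aFr (HN 1))))"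

definition p_find :: hcom where
  "p_find = SV aFnd (HN 0) ;; HFor i3 (V aN) (When (HV aBB (V i3)) (When (HN 1 \<ominus> V aFnd) (p_lhs ;;
     When (HN 1 \<ominus> V aFr) (When (V aTD \<otimes> V aPi \<otimes> V aIU \<ominus> V aTN \<otimes> V aLhs)
       (SV aFnd (HN 1) ;; SV aRow (V i3) ;; SV aRM (V aIM))))))"

text \<open>The update by 1 + q/200 with q = \<open>aIC / aRM\<close> is multiplied through by
  \<open>200 * aRM\<close>; the common factor disappears in the normaliser of
  \<open>mwu_state\<close>.\<close>

definition p_upd :: hcom where
  "p_upd = HSet aLa (V aRow) (HV aLa (V aRow) \<oplus> V aPi \<oslash> V aRM) ;;
   HFor i3 eM3 (HIf (HV aCB (V i3 \<otimes> V aN \<oplus> V aRow))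
     (HSet aIu (V i3) (HV aIu (V i3) \<otimes> (HN 200 \<otimes> V aRM \<oplus> HV aIC (V i3))))
     (HSet aIu (V i3) (HV aIu (V i3) \<otimes> (HN 200 \<otimes> V aRM))))"

text \<open>1440000 m^2 = 160000 (3 m)^2 is the number of steps needed for \<open>3 * m\<close>
  weights. The additional step makes the count positive even for \<open>m = 0\<close>, so that an
  unsuccessful run has certainly found a row.\<close>

definition p_inner :: hcom where
  "p_inner = p_start ;; HFor i2 (HN 1440000 \<otimes> V aM \<otimes> V aM \<oplus> HN 1) (When (HN 1 \<ominus> V aSuc) (
     p_iU ;; p_find ;; HIf (V aFnd) p_upd (SV aSuc (HN 1))))"

definition p_ML :: hcom where
  "p_ML = SV aML (HN 0) ;; HFor i2 eM3 (SV aLd (HN 0) ;;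
     HFor i3 (V aN) (When (HV aCB (V i2 \<otimes> V aN \<oplus> V i3)) (SV aLd (V aLd \<oplus> HV aLa (V i3)))) ;;
     When (V aLd \<otimes> HV aIC (V i2) \<ominus> V aML) (SV aML (V aLd \<otimes> HV aIC (V i2))))"

definition p_row :: hcom where
  "p_row = p_ML ;; SV aWD (HN 19 \<otimes> V aML \<otimes> V aDd) ;;
   HFor i2 eMv (HSet aPP (V i2) (HN 0)) ;;
   HFor i2 (V aM) (SV aOm (HN 0) ;;
     HFor i3 (V aN) (When (eBit (V i2) (V i3))
       (SV aOm (V aOm \<oplus> HV aLa (V i3) \<otimes> (HN 3 \<oplus> HN 2 \<otimes> HV aCL (V i3)) \<otimes> V aPi))) ;;
     HSet aPP (V i2) (V aOm \<otimes> HV aXF (V i2) \<otimes> V aQd \<otimes> V aRn \<otimes> ePn)) ;;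
   HSet aPP (V aM) (V aQn \<otimes> V aRd \<otimes> V aWD \<otimes> V aGa \<otimes> ePn) ;;
   HSet aPP (V aM \<oplus> HN 1 \<oplus> V i1) (ePd \<otimes> V aWD \<otimes> V aGa \<otimes> V aQd \<otimes> V aRn)"

definition p_check :: hcom where
  "p_check = SV aViol (HN 0) ;; HFor i1 (V aK) (When (HN 1 \<ominus> V aViol) (
     p_ask ;; p_dist ;; p_target ;; p_inner ;; When (HN 1 \<ominus> V aSuc) (p_row ;; SV aViol (HN 1))))"

text \<open>Largest entry of the row; dividing by it is the normalisation to maximum 1.\<close>

definition p_PM :: hcom where
  "p_PM = SV aPM (HN 0) ;; HFor i1 eMv (When (HV aPP (V i1) \<ominus> V aPM) (SV aPM (HV aPP (V i1))))"

definition p_step :: hcom where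
  "p_step = p_PM ;; HFor i1 eMv (HSet aW (V i1) (HV aW (V i1) \<otimes> (HN 200 \<otimes> V aPM \<oplus> HV aPP (V i1)))) ;;
   SV aIt (V aIt \<oplus> HN 1) ;;
   When (V aIt \<ominus> HN 160000 \<otimes> eMv \<otimes> eMv \<oplus> HN 1) (SV aIt (HN 0) ;; p_ones ;;
     HIf (V aTA) (SV aTA (V aTA \<otimes> HN 201) ;; SV aTB (V aTB \<otimes> HN 200))
       (SV aTA (V aRn \<otimes> HV aINP (V oR \<oplus> HN 3)) ;;
        SV aTB (V aRn \<otimes> HV aINP (V oR \<oplus> HN 3) \<oplus> HV aINP (V oR \<oplus> HN 2) \<otimes> V aRd)))"

definition p_main :: hcom where
  "p_main = HWhile (V aViol) (p_U ;; p_XN ;; p_CL ;; p_CB ;; p_keep ;; p_check ;; When (V aViol) p_step)"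

text \<open>Rationals must be written in lowest terms: $P/Q$ is replaced by the slightly larger $(PQ+1)/Q^2$,
  which avoids computing a gcd.\<close>

abbreviation (input) "eP \<equiv> HN 21 \<otimes> HV aXN (V i1)"
abbreviation (input) "eQ \<equiv> HN 11 \<otimes> V aXD"

text \<open>The estimate 49/25 T is rounded up by the same device with P = 49 \<open>aTA\<close> and
  Q = 25 \<open>aTB\<close>: 1225 = 49 * 25 and 625 = 25^2.\<close>

definition p_out :: hcom where
  "p_out = HPut (HN 0) (HN 2 \<otimes> V aM \<oplus> HN 2) ;;
   HFor i1 (V aM) (
     HPut (HN 1 \<oplus> HN 2 \<otimes> V i1) (HN 1) ;; HPut (HN 2 \<oplus> HN 2 \<otimes> V i1) (HN 1) ;;
     When (eQ \<ominus> eP) (HIf eP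
       (HPut (HN 1 \<oplus> HN 2 \<otimes> V i1) (eP \<otimes> eQ \<oplus> HN 1) ;; HPut (HN 2 \<oplus> HN 2 \<otimes> V i1) (eQ \<otimes> eQ))
       (HPut (HN 1 \<oplus> HN 2 \<otimes> V i1) (HN 0)))) ;;
   HIf (V aTA) (HPut (HN 1 \<oplus> HN 2 \<otimes> V aM) (HN 1225 \<otimes> V aTA \<otimes> V aTB \<oplus> HN 1) ;;
       HPut (HN 2 \<oplus> HN 2 \<otimes> V aM) (HN 625 \<otimes> V aTB \<otimes> V aTB))
     (HPut (HN 1 \<oplus> HN 2 \<otimes> V aM) (HN 0) ;; HPut (HN 2 \<oplus> HN 2 \<otimes> V aM) (HN 1))"

definition program :: hcom where
  "program = p_init ;; p_main ;; p_out"

lemmas p_defs = p_read_def p_Dd_def p_CC_def p_Pi_def p_IC_def p_Ga_def p_XF_def p_ones_def p_init_def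
  p_U_def p_XN_def p_Y_def p_CL_def p_CB_def p_diff_def p_keep1_def p_keep_def p_qbits_def p_qcosts_def
  p_qscen_def p_ask_def p_dist_def p_target_def p_start_def p_iU_def p_lhs_def p_find_def p_upd_def
  p_inner_def p_ML_def p_row_def p_check_def p_PM_def p_step_def p_main_def p_out_def program_def

lemma wf_program: "wf program"
  by (simp add: p_defs HFor_def)

lemma mods_frag:
  "mods p_U = {aU, i1}" "mods p_XN = {aXD, aXN, i1}" "mods p_CL = {aCL, aY, i1, i2}"
  "mods p_CB = {aCB, i1, i2}" "mods p_keep = {aCnt, aKL, aKp, aDf, i1, i2, i3}"
  "mods p_ask = {aBB, i2, i3}" "mods p_dist = {aQn, aQd, i2}" "mods p_target = {aTN, aTD}"
  "mods p_inner = {aIu, aLa, aSuc, aIU, aLhs, aIM, aFr, aFnd, aRow, aRM, i2, i3, i4}"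
  "mods p_row = {aML, aLd, aWD, aPP, aOm, i2, i3}"
  "mods p_PM = {aPM, i1}" "mods p_ones = {aW, i1}"
  by (auto simp: p_defs)

section \<open>Rounding the first stage\<close>

text \<open>A single \<open>L\<close> serves all resource limits of \<open>wp\<close>:
  \<open>L_len\<close>, \<open>L_in\<close> and \<open>L_len2\<close> for reading the input,
  \<open>L_kap\<close> for the words of distances, \<open>L_n\<close> for distance queries,
  \<open>L_q\<close> for the long queries, \<open>L_m\<close> for the inner run and
  \<open>L_mv\<close> for loops over all variables.\<close>

locale dr_run = dr_inst +
  fixes sub :: "int list \<Rightarrow> int list" and \<beta>1 \<beta>2 \<epsilon> :: real and L :: nat
  assumes approx: "approx_subroutine I \<beta>1 \<beta>2 sub" and b1: "1 \<le> \<beta>1" and b2: "1 \<le> \<beta>2" and eps: "0 < \<epsilon>"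
    and nonnull: "non_null_cost_ge_1 I"
    and L_len: "length (run_input I \<epsilon>) \<le> L" and L_in: "\<And>v. v \<in> set (run_input I \<epsilon>) \<Longrightarrow> \<bar>v\<bar> \<le> 2 ^ L"
    and L_len2: "int (length (run_input I \<epsilon>)) \<le> 2 ^ L"
    and L_kap: "\<And>A B v. A \<in> scenarios I \<Longrightarrow> B \<in> scenarios I \<Longrightarrow> v \<in> set (enc_rat (scen_dist I A B)) \<Longrightarrow> \<bar>v\<bar> \<le> 2 ^ L"
    and L_n: "2 * num_elems I + 2 \<le> L" and L_m: "1440000 * length (sets_of I) * length (sets_of I) + 1 \<le> L"
    and L_q: "4 + 3 * length (sets_of I) * num_elems I + 6 * length (sets_of I) + num_elems I \<le> L"
    and L_mv: "length (sets_of I) + 1 + length (support_of I) \<le> L"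
begin

abbreviation "wpL \<equiv> wp sub L"

section \<open>Integers behind the rational data\<close>

definition "cn i = fst (quotient_of (cost1 I (SS i)))"
definition "cd i = snd (quotient_of (cost1 I (SS i)))"
definition "dn i = fst (quotient_of (cost2 I (SS i)))"
definition "dd i = snd (quotient_of (cost2 I (SS i)))"
definition "pn k = fst (quotient_of (prob_of I (AA k)))"
definition "pd k = snd (quotient_of (prob_of I (AA k)))"
definition "rn = fst (quotient_of (radius I))"
definition "rd = snd (quotient_of (radius I))"
definition "kn = fst (quotient_of (max_scen_dist I))"
definition "kd = snd (quotient_of (max_scen_dist I))"

lemma quot: "real_of_rat q = real_of_int (fst (quotient_of q)) / real_of_int (snd (quotient_of q))"
  "0 < snd (quotient_of q)" "0 \<le> q \<Longrightarrow> 0 \<le> fst (quotient_of q)" "0 < q \<Longrightarrow> 0 < fst (quotient_of q)"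
proof -
  obtain a b where ab: "quotient_of q = (a, b)" by (cases "quotient_of q") auto
  have b: "0 < b" using quotient_of_denom_pos[OF ab] .
  have q: "q = of_int a / of_int b" using quotient_of_div[OF ab] .
  show "real_of_rat q = real_of_int (fst (quotient_of q)) / real_of_int (snd (quotient_of q))"
    by (simp add: ab, simp add: q of_rat_divide)
  show "0 < snd (quotient_of q)" using ab b by simp
  show "0 \<le> q \<Longrightarrow> 0 \<le> fst (quotient_of q)" "0 < q \<Longrightarrow> 0 < fst (quotient_of q)"
    using b by (simp_all add: ab) (simp_all add: q zero_le_divide_iff zero_less_divide_iff)
qed

lemma int_facts:
  shows c_eq: "\<And>i. c i = cn i / cd i" and cd_pos: "\<And>i. 0 < cd i" and cn_nonneg: "\<And>i. i < m \<Longrightarrow> 0 \<le> cn i"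
    and d_eq: "\<And>i. d i = dn i / dd i" and dd_pos: "\<And>i. 0 < dd i" and dn_nonneg: "\<And>i. i < m \<Longrightarrow> 0 \<le> dn i"
    and p_eq: "\<And>k. p k = pn k / pd k" and pd_pos: "\<And>k. 0 < pd k" and pn_pos: "\<And>k. k < K \<Longrightarrow> 0 < pn k"
    and r_eq: "r = rn / rd" and rd_pos: "0 < rd" and rn_pos: "0 < rn"
    and k_eq: "\<kappa>max = kn / kd" and kd_pos: "0 < kd" and kn_nonneg: "0 \<le> kn"
proof -
  have rat: "0 \<le> max_scen_dist I" "0 < radius I" "\<And>i. i < m \<Longrightarrow> 0 \<le> cost1 I (SS i)"
    "\<And>i. i < m \<Longrightarrow> 0 \<le> cost2 I (SS i)" "\<And>k. k < K \<Longrightarrow> 0 < prob_of I (AA k)"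
    using kmax_nonneg r_pos c_nonneg d_nonneg p_pos by simp_all
  show "\<And>i. c i = cn i / cd i" "\<And>i. d i = dn i / dd i" "\<And>k. p k = pn k / pd k" "r = rn / rd" "\<kappa>max = kn / kd"
    unfolding cn_def cd_def dn_def dd_def pn_def pd_def rn_def rd_def kn_def kd_def by (rule quot(1))+
  show "\<And>i. 0 < cd i" "\<And>i. 0 < dd i" "\<And>k. 0 < pd k" "0 < rd" "0 < kd"
    unfolding cd_def dd_def pd_def rd_def kd_def by (rule quot(2))+
  show "\<And>i. i < m \<Longrightarrow> 0 \<le> cn i" "\<And>i. i < m \<Longrightarrow> 0 \<le> dn i" "0 \<le> kn"
    unfolding cn_def dn_def kn_def using rat by (auto intro: quot(3))
  show "\<And>k. k < K \<Longrightarrow> 0 < pn k" "0 < rn" unfolding pn_def rn_def using rat by (auto intro: quot(4))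
qed

text \<open>Number of variables of the outer problem: \<open>x\<close> occupies the indices below
  \<open>m\<close>, \<open>y\<close> the index \<open>m\<close>, and the \<open>\<theta>\<close> of
  the support scenarios follow.\<close>

definition "Mv = m + 1 + K"
definition "Dd = (\<Prod>i<m. dd i)"
definition "CC k = (if k mod 3 = 0 then 3 else if k mod 3 = 1 then 2 else 0) * (dn (k div 3) * Dd div dd (k div 3))"
text \<open>A common multiple of the positive candidate costs, so that \<open>IC k\<close> is
  \<open>PC\<close> times the inverse cost as an exact integer. \<open>Ga\<close> and
  \<open>XF\<close> do the same for the first-stage costs. Cost 0 gives 0 in both cases, since
  division by 0 yields 0.\<close>

definition "PC = (\<Prod>k<3 * m. if 0 < CC k then CC k else 1)"
definition "IC k = PC div CC k"
definition "Ga = (\<Prod>i<m. if 0 < cn i then cn i else 1)"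
definition "XF i = cd i * (Ga div cn i)"

lemma Dd_pos: "0 < Dd" unfolding Dd_def using dd_pos by (intro prod_pos) auto
lemma PC_pos: "0 < PC" unfolding PC_def by (intro prod_pos) auto
lemma Ga_pos: "0 < Ga" unfolding Ga_def by (intro prod_pos) auto

lemma DI_eq: "i < m \<Longrightarrow> real_of_int (dn i * Dd div dd i) = d i * Dd"
proof -
  assume "i < m"
  then have "dd i dvd Dd" unfolding Dd_def by (intro dvd_prodI) auto
  then obtain q where q: "Dd = dd i * q" by blast
  show ?thesis using dd_pos[of i] by (simp add: d_eq q)
qed

lemma CC_eq: "k < 3 * m \<Longrightarrow> real_of_int (CC k) =
   3 * real_of_int Dd * d (k div 3) * (if k mod 3 = 0 then 1 else if k mod 3 = 1 then 2 / 3 else 0)"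
proof -
  assume "k < 3 * m"
  then have "k div 3 < m" using less_mult_imp_div_less[of k m 3] by (simp add: mult.commute)
  from DI_eq[OF this] show ?thesis unfolding CC_def by simp
qed

lemma CC_nonneg: "k < 3 * m \<Longrightarrow> 0 \<le> CC k"
proof -
  assume k: "k < 3 * m"
  then have "k div 3 < m" using less_mult_imp_div_less[of k m 3] by (simp add: mult.commute)
  then have "0 \<le> real_of_int (CC k)" unfolding CC_eq[OF k] using d_nonneg Dd_pos by simp
  then show ?thesis by simp
qed

lemma IC_eq: "k < 3 * m \<Longrightarrow> 0 < CC k \<Longrightarrow> IC k * CC k = PC"
proof -
  assume h: "k < 3 * m" "0 < CC k"
  have "(if 0 < CC k then CC k else 1) dvd PC" unfolding PC_def using h by (intro dvd_prodI) auto
  then show ?thesis using h unfolding IC_def by simp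
qed

lemma IC_pos: "k < 3 * m \<Longrightarrow> 0 < CC k \<Longrightarrow> 0 < IC k"
  using IC_eq[of k] PC_pos by (metis zero_less_mult_pos2)

lemma IC_zero: "\<not> 0 < CC k \<Longrightarrow> k < 3 * m \<Longrightarrow> IC k = 0"
  using CC_nonneg[of k] by (simp add: IC_def)

lemma XF_eq: "i < m \<Longrightarrow> 0 < cn i \<Longrightarrow> XF i * c i = Ga"
proof -
  assume h: "i < m" "0 < cn i"
  have "(if 0 < cn i then cn i else 1) dvd Ga" unfolding Ga_def using h by (intro dvd_prodI) auto
  then obtain q where q: "Ga = cn i * q" using h by auto
  show ?thesis using h cd_pos[of i] by (simp add: XF_def c_eq q)
qed

lemma XF_zero: "i < m \<Longrightarrow> \<not> 0 < cn i \<Longrightarrow> XF i = 0"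
  using cn_nonneg[of i] by (simp add: XF_def)

lemma XF_nonneg: "i < m \<Longrightarrow> 0 \<le> XF i"
  using cn_nonneg[of i] Ga_pos cd_pos[of i] by (simp add: XF_def pos_imp_zdiv_nonneg_iff div_int_pos_iff less_imp_le)

text \<open>Offsets in \<open>aINP\<close>, the copy of \<open>run_input\<close>. Word 0 is the
  accuracy, words 1 and 2 are the sizes of the ground set and of the collection, so the incidence
  bits start at 3.\<close>

definition "off1 = 3 + m * n"
definition "off2 = off1 + 2 * m"
definition "offR = off2 + 2 * m"
definition "offA = offR + 5"
definition "offP = offA + K * n"

definition inp :: "arrays \<Rightarrow> bool" where
  "inp a \<longleftrightarrow> a aN 0 = int n \<and> a aM 0 = int m \<and> a aK 0 = int K \<and> a aRn 0 = rn \<and> a aRd 0 = rd \<and>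
     a oC1 0 = int off1 \<and> a oC2 0 = int off2 \<and> a oR 0 = int offR \<and> a oA 0 = int offA \<and> a oP 0 = int offP \<and>
     (\<forall>i<m. \<forall>e<n. a aINP (3 + i * n + e) = (if e \<in> SS i then 1 else 0)) \<and>
     (\<forall>i<m. a aINP (off1 + 2 * i) = cn i \<and> a aINP (Suc (off1 + 2 * i)) = cd i) \<and>
     (\<forall>i<m. a aINP (off2 + 2 * i) = dn i \<and> a aINP (Suc (off2 + 2 * i)) = dd i) \<and>
     a aINP (offR + 2) = kn \<and> a aINP (offR + 3) = kd \<and>
     (\<forall>k<K. \<forall>e<n. a aINP (offA + k * n + e) = (if e \<in> AA k then 1 else 0)) \<and>
     (\<forall>k<K. a aINP (offP + 2 * k) = pn k \<and> a aINP (Suc (offP + 2 * k)) = pd k)"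

definition base :: "arrays \<Rightarrow> bool" where
  "base a \<longleftrightarrow> inp a \<and> a aDd 0 = Dd \<and> (\<forall>k<3 * m. a aCC k = CC k) \<and> a aPi 0 = PC \<and>
     (\<forall>k<3 * m. a aIC k = IC k) \<and> a aGa 0 = Ga \<and> (\<forall>i<m. a aXF i = XF i)"

text \<open>The set of numbers lists the arrays occurring in \<open>inp\<close>, so a program
  preserves \<open>inp\<close> as soon as its \<open>mods\<close> avoid this set.\<close>

lemma inp_cong:
  assumes "inp a" and eq: "\<And>j. j \<in> {2, 25, 26, 27, 28, 29, 30, 31, 32, 33, 34} \<Longrightarrow> a' j = a j"
  shows "inp a'"
proof -
  have e: "a' 2 = a 2" "a' 25 = a 25" "a' 26 = a 26" "a' 27 = a 27" "a' 28 = a 28" "a' 29 = a 29"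
    "a' 30 = a 30" "a' 31 = a 31" "a' 32 = a 32" "a' 33 = a 33" "a' 34 = a 34"
    by (rule eq, simp)+
  show ?thesis using assms(1) unfolding inp_def e .
qed

lemma base_cong:
  assumes "base a" and eq: "\<And>j. j \<in> {2, 25, 26, 27, 28, 29, 30, 31, 32, 33, 34, 35, 36, 37, 38, 39, 40} \<Longrightarrow> a' j = a j"
  shows "base a'"
proof -
  have e: "a' 35 = a 35" "a' 36 = a 36" "a' 37 = a 37" "a' 38 = a 38" "a' 39 = a 39" "a' 40 = a 40"
    by (rule eq, simp)+
  have "inp a'" using assms by (intro inp_cong[of a a'] eq) (auto simp: base_def)
  then show ?thesis using assms(1) unfolding base_def e by blast
qed

lemma base_off: "base a \<Longrightarrow> same_off M t a b a' b' \<Longrightarrow>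
  M \<inter> {2, 25, 26, 27, 28, 29, 30, 31, 32, 33, 34, 35, 36, 37, 38, 39, 40} = {} \<Longrightarrow> base a'"
  by (erule base_cong) (unfold same_off_def, blast)

lemma inp_off: "inp a \<Longrightarrow> same_off M t a b a' b' \<Longrightarrow>
  M \<inter> {2, 25, 26, 27, 28, 29, 30, 31, 32, 33, 34} = {} \<Longrightarrow> inp a'"
  by (erule inp_cong) (unfold same_off_def, blast)

lemma inpD:
  assumes "inp a"
  shows "a aN 0 = int n" "a aM 0 = int m" "a aK 0 = int K" "a aRn 0 = rn" "a aRd 0 = rd"
     "a oC1 0 = int off1" "a oC2 0 = int off2" "a oR 0 = int offR" "a oA 0 = int offA" "a oP 0 = int offP"
     "i < m \<Longrightarrow> e < n \<Longrightarrow> a aINP (3 + i * n + e) = (if e \<in> SS i then 1 else 0)"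
     "i < m \<Longrightarrow> a aINP (off1 + 2 * i) = cn i" "i < m \<Longrightarrow> a aINP (Suc (off1 + 2 * i)) = cd i"
     "i < m \<Longrightarrow> a aINP (off2 + 2 * i) = dn i" "i < m \<Longrightarrow> a aINP (Suc (off2 + 2 * i)) = dd i"
     "a aINP (offR + 2) = kn" "a aINP (offR + 3) = kd"
     "k < K \<Longrightarrow> e < n \<Longrightarrow> a aINP (offA + k * n + e) = (if e \<in> AA k then 1 else 0)"
     "k < K \<Longrightarrow> a aINP (offP + 2 * k) = pn k" "k < K \<Longrightarrow> a aINP (Suc (offP + 2 * k)) = pd k"
  using assms unfolding inp_def by auto

lemma baseD:
  assumes "base a"
  shows "inp a" "a aDd 0 = Dd" "k < 3 * m \<Longrightarrow> a aCC k = CC k" "a aPi 0 = PC" "k < 3 * m \<Longrightarrow> a aIC k = IC k"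
    "a aGa 0 = Ga" "i < m \<Longrightarrow> a aXF i = XF i"
  using assms unfolding base_def by auto

lemma L_facts: "n \<le> L" "m \<le> L" "3 * m \<le> L" "Mv \<le> L" "K \<le> L"
proof -
  show "3 * m \<le> L" using L_q by linarith
  then show "m \<le> L" by simp
  show "n \<le> L" "Mv \<le> L" "K \<le> L" using L_n L_mv by (simp_all add: Mv_def)
qed

definition "Us u = (\<Sum>i<Mv. u i :: int)"
definition "XDs u TB = TB * Us u * Ga"
definition "XNs u TA TB i = (if 0 < cn i then TA * u i * XF i else XDs u TB)"
definition "Ys u TA TB e = (\<Sum>i<m. if e \<in> SS i then XNs u TA TB i else 0)"
definition "CLs u TA TB e = (if 11 * XDs u TB \<le> 21 * Ys u TA TB e then 3
   else if XDs u TB \<le> 3 * Ys u TA TB e then 2 else 1 :: int)"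

definition ost :: "(nat \<Rightarrow> int) \<Rightarrow> int \<Rightarrow> int \<Rightarrow> arrays \<Rightarrow> bool" where
  "ost u TA TB a \<longleftrightarrow> base a \<and> (\<forall>i<Mv. a aW i = u i) \<and> a aTA 0 = TA \<and> a aTB 0 = TB"

lemma ost_off:
  assumes "ost u TA TB a" and so: "same_off M t a b a' b'" and
  M: "M \<inter> {2, 25, 26, 27, 28, 29, 30, 31, 32, 33, 34, 35, 36, 37, 38, 39, 40, 41, 42, 55} = {}"
  shows "ost u TA TB a'"
proof -
  have "base a'" using assms(1) unfolding ost_def by (intro base_off[OF _ so]) (use M in blast)+
  moreover have "a' 41 = a 41" "a' 42 = a 42" "a' 55 = a 55" using M by (intro same_offD[OF so]; blast)+
  ultimately show ?thesis using assms(1) unfolding ost_def by simp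
qed

lemma wp_U:
  assumes "ost u TA TB a"
  shows "wpL p_U (\<lambda>a' b'. a' aU 0 = Us u) a b"
proof -
  have B: "inp a" using assms by (auto simp: ost_def base_def)
  note [simp] = inpD[OF B]
  have W: "i < Mv \<Longrightarrow> a aW i = u i" for i using assms by (simp add: ost_def)
  show ?thesis unfolding p_U_def wp.simps
  proof (rule wp_For[where N = Mv and I = "\<lambda>i a b. a aU 0 = (\<Sum>j<i. u j)"])
    fix i a' b' assume "i < Mv" and I: "a' aU 0 = (\<Sum>j<i. u j)" "a' i1 0 = int i"
      and so: "same_off (insert i1 (mods (SV aU (V aU \<oplus> HV aW (V i1)))))
        (touches_block (SV aU (V aU \<oplus> HV aW (V i1)))) (upd a aU (nat \<bar>hval (HN 0) a\<bar>) (hval (HN 0) a)) b a' b'"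
    then have "a' aW i = u i" using W by (simp add: same_off_def)
    then show "wpL (SV aU (V aU \<oplus> HV aW (V i1)))
          (\<lambda>a b. upd a i1 0 (int (Suc i)) aU 0 = (\<Sum>j<Suc i. u j)) a' b'"
      using I by simp
  qed (use L_facts in \<open>auto simp: Mv_def Us_def\<close>)
qed

lemma wp_XN:
  assumes o: "ost u TA TB a" and U: "a aU 0 = Us u"
  shows "wpL p_XN (\<lambda>a' b'. a' aXD 0 = XDs u TB \<and> (\<forall>i<m. a' aXN i = XNs u TA TB i)) a b"
proof -
  have B: "inp a" using assms by (auto simp: ost_def base_def)
  note [simp] = inpD[OF B]
  have [simp]: "a aTA 0 = TA" "a aTB 0 = TB" "a aGa 0 = Ga" "\<And>i. i < m \<Longrightarrow> a aXF i = XF i"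
    "\<And>i. i < m \<Longrightarrow> a aW i = u i"
    using o by (simp_all add: ost_def base_def Mv_def)
  show ?thesis unfolding p_XN_def wp.simps
    by (rule wp_For[where N = m and I = "\<lambda>i a b. a aXD 0 = XDs u TB \<and> (\<forall>j<i. a aXN j = XNs u TA TB j)"])
     (use L_facts U in \<open>auto simp: same_off_def idx nat_add_distrib nat_mult_distrib nat_div_distrib XDs_def XNs_def less_Suc_eq\<close>)
qed

end

lemmas idxs = idx nat_add_distrib nat_mult_distrib nat_div_distrib

context dr_run
begin

lemma div3_less: "k < 3 * m \<Longrightarrow> k div 3 < m"
  using less_mult_imp_div_less[of k m 3] by (simp add: mult.commute)

lemma cand_sub: "k < 3 * m \<Longrightarrow> cand cl k \<subseteq> {..<n}"
  using sets_sub[of "k div 3"] div3_less by (auto simp: cand_def)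

lemma wp_Y:
  assumes B: "inp a" and e: "e < n" "a i1 0 = int e" and X: "\<And>i. i < m \<Longrightarrow> a aXN i = XNs u TA TB i"
  shows "wpL p_Y (\<lambda>a' b'. a' aY 0 = Ys u TA TB e) a b"
proof -
  note [simp] = inpD[OF B]
  show ?thesis unfolding p_Y_def wp.simps
    by (rule wp_For[where N = m and
        I = "\<lambda>i a b. a aY 0 = (\<Sum>j<i. if e \<in> SS j then XNs u TA TB j else 0)"])
     (use L_facts e X in \<open>auto simp: same_off_def idxs Ys_def\<close>)
qed

lemma wp_CL:
  assumes B: "inp a" and X: "\<And>i. i < m \<Longrightarrow> a aXN i = XNs u TA TB i" and D: "a aXD 0 = XDs u TB"
  shows "wpL p_CL (\<lambda>a' b'. \<forall>e<n. a' aCL e = CLs u TA TB e) a b"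
  unfolding p_CL_def
proof (rule wp_For[where N = n and I = "\<lambda>i a b. \<forall>e<i. a aCL e = CLs u TA TB e"], goal_cases)
  case (6 e a' b')
  have B': "inp a'" by (rule inp_off[OF B 6(4)]) (simp add: p_Y_def)
  have X': "i < m \<Longrightarrow> a' aXN i = XNs u TA TB i" for i
    using same_offD[OF 6(4), of aXN] X by (simp add: p_Y_def)
  show ?case
  proof (rule wp_seqI[OF wp_Y[OF B' 6(1,3) X']])
    fix a2 b2 assume Y: "a2 aY 0 = Ys u TA TB e" and so: "same_off (mods p_Y) (touches_block p_Y) a' b' a2 b2"
    have "a2 aXD 0 = XDs u TB" "a2 i1 0 = int e" "a2 aCL = a' aCL"
      using same_offD[OF so, of aXD] same_offD[OF 6(4), of aXD] same_offD[OF so, of i1]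
        same_offD[OF so, of aCL] D 6(3) by (simp_all add: p_Y_def)
    then show "wpL (HIf (HN 21 \<otimes> V aY \<ominus> HN 11 \<otimes> V aXD \<oplus> HN 1) (HSet aCL (V i1) (HN 3))
       (HIf (HN 3 \<otimes> V aY \<ominus> V aXD \<oplus> HN 1) (HSet aCL (V i1) (HN 2)) (HSet aCL (V i1) (HN 1))))
       (\<lambda>a b. \<forall>e'<Suc e. upd a i1 0 (int (Suc e)) aCL e' = CLs u TA TB e') a2 b2"
      using 6(2) Y by (auto simp: CLs_def less_Suc_eq)
  qed
qed (use L_facts inpD[OF B] in \<open>auto simp: p_Y_def\<close>)

definition bits_ok :: "(nat \<Rightarrow> int) \<Rightarrow> arrays \<Rightarrow> bool" where
  "bits_ok cl a \<longleftrightarrow> (\<forall>k<3 * m. \<forall>e<n. a aCB (k * n + e) = (if e \<in> cand cl k then 1 else 0))"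

lemma wp_CB:
  assumes B: "inp a" and CL: "\<And>e. e < n \<Longrightarrow> a aCL e = cl e"
  shows "wpL p_CB (\<lambda>a' b'. bits_ok cl a') a b"
  unfolding p_CB_def
proof (rule wp_For[where N = "3 * m" and
    I = "\<lambda>i a b. \<forall>k<i. \<forall>e<n. a aCB (k * n + e) = (if e \<in> cand cl k then 1 else 0)"], goal_cases)
  case (6 k a' b')
  have B': "inp a'" by (rule inp_off[OF B 6(4)]) simp
  note [simp] = inpD[OF B']
  have CL': "e < n \<Longrightarrow> a' aCL e = cl e" for e using same_offD[OF 6(4), of aCL] CL by simp
  note k3 = div3_less[OF 6(1)]
  show ?case
  proof (rule wp_For[where N = n and I = "\<lambda>j a b. (\<forall>k'<k. \<forall>e<n. a aCB (k' * n + e) = (if e \<in> cand cl k' then 1 else 0))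
      \<and> (\<forall>e<j. a aCB (k * n + e) = (if e \<in> cand cl k then 1 else 0))"], goal_cases)
    case (6 e a2 b2)
    have [simp]: "a2 i1 0 = int k" "a2 i2 0 = int e" "a2 25 = a' 25" "a2 2 = a' 2" "a2 aCL = a' aCL"
      using same_offD[OF 6(4)] \<open>a' i1 0 = int k\<close> 6(3) by simp_all
    have md: "int k - 3 * (int k div 3) = int (k mod 3)" by (simp add: minus_mult_div_eq_mod zmod_int)
    have bit: "a' 2 (3 + k div 3 * n + e) = (if e \<in> SS (k div 3) then 1 else 0)"
      using inpD(11)[OF B' k3 6(1)] .
    have cl: "a' aCL e = cl e" using CL' 6(1) by simp
    have mem: "e \<in> cand cl k \<longleftrightarrow> e \<in> SS (k div 3) \<and> int (k mod 3) < cl e" by (simp add: cand_def)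
    show ?case
      using 6(1,2) bit cl
      by (auto simp: idxs mem md idx_inj less_Suc_eq)
  qed (use L_facts 6 in \<open>auto simp: less_Suc_eq\<close>)
qed (use L_facts inpD[OF B] in \<open>auto simp: bits_ok_def\<close>)

text \<open>Lexicographic order by cost and then by index, encoded in one integer since indices stay
  below \<open>3 * m\<close>.\<close>

definition rank :: "nat \<Rightarrow> int" where "rank k = CC k * (3 * int m) + int k"

definition keeps :: "(nat \<Rightarrow> int) \<Rightarrow> nat \<Rightarrow> bool" where
  "keeps cl k \<longleftrightarrow> (\<forall>k'<3 * m. cand cl k = cand cl k' \<longrightarrow> rank k \<le> rank k')"

definition klist :: "(nat \<Rightarrow> int) \<Rightarrow> nat list" where
  "klist cl = filter (keeps cl) [0..<3 * m]"

lemma bits_off: "bits_ok cl a \<Longrightarrow> same_off M t a b a' b' \<Longrightarrow> aCB \<notin> M \<Longrightarrow> bits_ok cl a'"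
  unfolding bits_ok_def using same_offD[of M t a b a' b' aCB] by simp

lemma bits_okD: "bits_ok cl a \<Longrightarrow> k < 3 * m \<Longrightarrow> e < n \<Longrightarrow> a aCB (k * n + e) = (if e \<in> cand cl k then 1 else 0)"
  by (simp add: bits_ok_def)

lemma wp_diff:
  assumes B: "inp a" and C: "bits_ok cl a" and k: "k < 3 * m" "a i1 0 = int k" "k' < 3 * m" "a i2 0 = int k'"
  shows "wpL p_diff (\<lambda>a' b'. a' aDf 0 = (if cand cl k = cand cl k' then 0 else 1)) a b"
proof -
  note [simp] = inpD[OF B]
  have eq: "(\<forall>e<n. (e \<in> cand cl k) = (e \<in> cand cl k')) = (cand cl k = cand cl k')"
    using cand_sub[OF k(1), of cl] cand_sub[OF k(3), of cl] by auto
  show ?thesis unfolding p_diff_def wp.simps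
  proof (rule wp_For[where N = n and
        I = "\<lambda>i a b. a aDf 0 = (if \<forall>e<i. (e \<in> cand cl k) = (e \<in> cand cl k') then 0 else 1)"], goal_cases)
    case (6 e a' b')
    have [simp]: "a' i1 0 = int k" "a' i2 0 = int k'" "a' 25 = a 25" "a' 20 = a 20"
      using same_offD[OF 6(4)] k by simp_all
    have "a 20 (k * n + e) = (if e \<in> cand cl k then 1 else 0)" "a 20 (k' * n + e) = (if e \<in> cand cl k' then 1 else 0)"
      using bits_okD[OF C _ 6(1)] k by auto
    then show ?case using 6 by (auto simp: idxs less_Suc_eq)
  next
    case (7 a' b')
    then show ?case using eq by simp
  qed (use L_facts k in auto)
qed

lemma wp_keep1:
  assumes B: "base a" and C: "bits_ok cl a" and k: "k < 3 * m" "a i1 0 = int k"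
  shows "wpL p_keep1 (\<lambda>a' b'. a' aKp 0 = (if keeps cl k then 1 else 0)) a b"
proof -
  note [simp] = inpD[OF baseD(1)[OF B]]
  show ?thesis unfolding p_keep1_def wp.simps
  proof (rule wp_For[where N = "3 * m" and
        I = "\<lambda>i a b. a aKp 0 = (if \<forall>k'<i. cand cl k = cand cl k' \<longrightarrow> rank k \<le> rank k' then 1 else 0)"], goal_cases)
    case (6 k' a' b')
    have so: "same_off {aKp, aDf, i2, i3} False a b a' b'"
      using 6(4) by (auto simp: same_off_def p_diff_def)
    have B': "base a'" by (rule base_off[OF B so]) simp
    have C': "bits_ok cl a'" by (rule bits_off[OF C so]) simp
    have k': "a' i1 0 = int k" using same_offD[OF so, of i1] k by simp
    show ?case
    proof (rule wp_seqI[OF wp_diff[OF baseD(1)[OF B'] C' k(1) k' 6(1,3)]])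
      fix a2 b2 assume df: "a2 aDf 0 = (if cand cl k = cand cl k' then 0 else 1)"
        and "same_off (mods p_diff) (touches_block p_diff) a' b' a2 b2"
      then have so2: "same_off {aDf, i3} False a' b' a2 b2" by (auto simp: same_off_def p_diff_def)
      have B2: "base a2" by (rule base_off[OF B' so2]) simp
      have [simp]: "a2 i1 0 = int k" "a2 i2 0 = int k'" "a2 aKp = a' aKp"
        using same_offD[OF so2] k' 6(3) by simp_all
      have [simp]: "a2 aCC k = CC k" "a2 aCC k' = CC k'" "a2 aM 0 = int m"
        using baseD(3)[OF B2] k(1) 6(1) inpD(2)[OF baseD(1)[OF B2]] by simp_all
      show "wpL (When (HN 1 \<ominus> V aDf) (When ((HV aCC (V i1) \<otimes> eM3 \<oplus> V i1) \<ominus> (HV aCC (V i2) \<otimes> eM3 \<oplus> V i2))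
       (SV aKp (HN 0)))) (\<lambda>a b. upd a i2 0 (int (Suc k')) aKp 0 =
          (if \<forall>k''<Suc k'. cand cl k = cand cl k'' \<longrightarrow> rank k \<le> rank k'' then 1 else 0)) a2 b2"
        using df 6(2) by (auto simp: less_Suc_eq rank_def)
    qed
  qed (use L_facts k in \<open>auto simp: p_diff_def keeps_def\<close>)
qed

definition keep_ok :: "(nat \<Rightarrow> int) \<Rightarrow> arrays \<Rightarrow> bool" where
  "keep_ok cl a \<longleftrightarrow> a aCnt 0 = int (length (klist cl)) \<and> (\<forall>q<length (klist cl). a aKL q = int (klist cl ! q))"

lemma wp_keep:
  assumes B: "base a" and C: "bits_ok cl a"
  shows "wpL p_keep (\<lambda>a' b'. keep_ok cl a') a b"
proof -
  note [simp] = inpD[OF baseD(1)[OF B]]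
  show ?thesis unfolding p_keep_def wp.simps
  proof (rule wp_For[where N = "3 * m" and
        I = "\<lambda>i a b. a aCnt 0 = int (length (filter (keeps cl) [0..<i])) \<and>
          (\<forall>q<length (filter (keeps cl) [0..<i]). a aKL q = int (filter (keeps cl) [0..<i] ! q))"], goal_cases)
    case (6 k a' b')
    have so: "same_off {aKp, aDf, i1, i2, i3, aCnt, aKL} False a b a' b'"
      using 6(4) by (auto simp: same_off_def p_diff_def p_keep1_def)
    have B': "base a'" by (rule base_off[OF B so]) simp
    have C': "bits_ok cl a'" by (rule bits_off[OF C so]) simp
    show ?case
    proof (rule wp_seqI[OF wp_keep1[OF B' C' 6(1,3)]])
      fix a2 b2 assume kp: "a2 aKp 0 = (if keeps cl k then 1 else 0)"
        and "same_off (mods p_keep1) (touches_block p_keep1) a' b' a2 b2"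
      then have so2: "same_off {aKp, aDf, i2, i3} False a' b' a2 b2" by (auto simp: same_off_def p_diff_def p_keep1_def)
      have [simp]: "a2 i1 0 = int k" "a2 aCnt = a' aCnt" "a2 aKL = a' aKL"
        using same_offD[OF so2] 6(3) by simp_all
      show "wpL (When (V aKp) (HSet aKL (V aCnt) (V i1) ;; SV aCnt (V aCnt \<oplus> HN 1)))
        (\<lambda>a b. upd a i1 0 (int (Suc k)) aCnt 0 = int (length (filter (keeps cl) [0..<Suc k])) \<and>
          (\<forall>q<length (filter (keeps cl) [0..<Suc k]). upd a i1 0 (int (Suc k)) aKL q = int (filter (keeps cl) [0..<Suc k] ! q))) a2 b2"
        using kp 6(2) by (auto simp: nth_append less_Suc_eq)
    qed
  qed (use L_facts in \<open>auto simp: p_diff_def p_keep1_def keep_ok_def klist_def\<close>)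
qed

end

section \<open>Queries\<close>

text \<open>Matches a segment of memory with a list; it distributes over append and
  \<open>concat\<close>, so an encoding can be checked piece by piece.\<close>

definition has :: "(nat \<Rightarrow> 'a) \<Rightarrow> nat \<Rightarrow> 'a list \<Rightarrow> bool" where
  "has f p ws \<longleftrightarrow> (\<forall>i<length ws. f (p + i) = ws ! i)"

lemma has_Nil [simp]: "has f p []"
  by (simp add: has_def)

lemma has_Cons [simp]: "has f p (w # ws) \<longleftrightarrow> f p = w \<and> has f (Suc p) ws"
  by (simp add: has_def All_less_Suc2)

lemma has_append [simp]: "has f p (xs @ ys) \<longleftrightarrow> has f p xs \<and> has f (p + length xs) ys"
  by (induction xs arbitrary: p) simp_all

lemma length_concat_const: "(\<And>x. x \<in> set xs \<Longrightarrow> length (F x) = l) \<Longrightarrow> length (concat (map F xs)) = length xs * l"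
  by (induction xs) auto

lemma has_concat:
  "(\<And>q. q < k \<Longrightarrow> length (F q) = l) \<Longrightarrow>
   has f p (concat (map F [0..<k])) \<longleftrightarrow> (\<forall>q<k. has f (p + q * l) (F q))"
proof (induction k)
  case (Suc k)
  have "length (concat (map F [0..<k])) = length [0..<k] * l"
    by (rule length_concat_const) (use Suc.prems in auto)
  then show ?case using Suc.IH Suc.prems by (simp add: All_less_Suc conj_commute)
qed simp

lemma concat_map_nth: "concat (map F xs) = concat (map (\<lambda>q. F (xs ! q)) [0..<length xs])"
proof -
  have "map F xs = map (\<lambda>q. F (xs ! q)) [0..<length xs]" by (rule nth_equalityI) auto
  then show ?thesis by simp
qed

lemma length_enc_set [simp]: "length (enc_set n A) = n"
  by (simp add: enc_set_def)

lemma has_enc_set: "has f p (enc_set n A) \<longleftrightarrow> (\<forall>e<n. f (p + e) = (if e \<in> A then 1 else 0))"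
  by (auto simp: has_def enc_set_def)

lemma length_enc_rat [simp]: "length (enc_rat q) = 2"
  by (simp add: enc_rat_def)

lemma enc_rat_of_int: "enc_rat (of_int z) = [z, 1]"
  by (simp add: enc_rat_def)

lemma query_eq: "b 0 = int (length ws) \<Longrightarrow> has b 1 ws \<Longrightarrow> query b = ws"
  by (auto simp: query_def has_def intro!: nth_equalityI)

lemma wp_put2: "wp sub L (HPut x y ;; HPut z w ;; c) Q a b \<longleftrightarrow> 0 \<le> hval x a \<and> 0 \<le> hval z a \<and>
    wp sub L c Q a (b(nat (hval x a) := hval y a, nat (hval z a) := hval w a))"
  by simp

lemma wp_put_ask:
  assumes "hval x a = 0" "b(0 := hval y a) = b'" "query b' = ws" "nat (hval y a) \<le> L" "sub ws = as" "length as \<le> L"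
    "\<And>v. v \<in> set as \<Longrightarrow> \<bar>v\<bar> \<le> 2 ^ L" "wp sub L c Q a (answer b' as)"
  shows "wp sub L (HPut x y ;; HAsk ;; c) Q a b"
  using assms by auto

context dr_run
begin

definition "ust u TA TB \<longleftrightarrow> 0 \<le> TA \<and> (0::int) < TB \<and> (\<forall>i<Mv. (1::int) \<le> u i)"
text \<open>With y = \<open>TA / (TB * Us u) * u m / r\<close> the value of the candidate's
  \<open>y\<close>, the quotient \<open>yqs / YDs\<close> is 117/20 \<open>Dd\<close> y. Relative to
  costs \<open>3 * d\<close> in units of \<open>Dd\<close> this is the multiplier 39/20 y;
  \<open>YDs\<close> is the denominator cleared from the whole query.\<close>

definition "YDs u TB = 20 * TB * Us u * rn"
definition "yqs u TA = 117 * Dd * TA * u m * rd"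
text \<open>The subroutine takes costs as a function of sets. On the kept candidates
  \<open>cand cl\<close> is injective, so the index and its cost can be recovered from the
  set.\<close>

definition dqs :: "(nat \<Rightarrow> int) \<Rightarrow> (nat \<Rightarrow> int) \<Rightarrow> int \<Rightarrow> nat set \<Rightarrow> rat" where
  "dqs cl u TB X = of_int (CC (inv_into (set (klist cl)) (cand cl) X) * YDs u TB)"

lemma Us_ge: "ust u TA TB \<Longrightarrow> int Mv \<le> Us u"
proof -
  assume "ust u TA TB"
  then have "(\<Sum>i<Mv. 1) \<le> (\<Sum>i<Mv. u i)" by (intro sum_mono) (auto simp: ust_def)
  then show ?thesis by (simp add: Us_def)
qed

lemma Us_pos: "ust u TA TB \<Longrightarrow> 0 < Us u"
  using Us_ge[of u TA TB] by (simp add: Mv_def)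

lemma klist_lt: "k \<in> set (klist cl) \<Longrightarrow> k < 3 * m"
  by (simp add: klist_def)

lemma rank_CC_le: "k < 3 * m \<Longrightarrow> k' < 3 * m \<Longrightarrow> rank k \<le> rank k' \<Longrightarrow> CC k \<le> CC k'"
proof (rule ccontr)
  assume h: "k < 3 * m" "k' < 3 * m" "rank k \<le> rank k'" "\<not> CC k \<le> CC k'"
  then have "(CC k' + 1) * (3 * int m) \<le> CC k * (3 * int m)" by (intro mult_right_mono) auto
  then have "CC k' * (3 * int m) + 3 * int m \<le> CC k * (3 * int m)" by (simp add: algebra_simps)
  then show False using h(1-3) unfolding rank_def by linarith
qed

lemma klist_inj: "inj_on (cand cl) (set (klist cl))"
proof (rule inj_onI)
  fix k k' assume h: "k \<in> set (klist cl)" "k' \<in> set (klist cl)" "cand cl k = cand cl k'"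
  then have "rank k \<le> rank k'" "rank k' \<le> rank k" and lt: "k < 3 * m" "k' < 3 * m"
    by (auto simp: klist_def keeps_def)
  then have "CC k = CC k'" "rank k = rank k'" using rank_CC_le[of k k'] rank_CC_le[of k' k] by auto
  then show "k = k'" by (simp add: rank_def)
qed

text \<open>The candidate of least \<open>rank\<close> among those equal to \<open>cand cl k\<close>
  is the one that is kept.\<close>

lemma klist_rep: "k < 3 * m \<Longrightarrow> \<exists>k'\<in>set (klist cl). cand cl k' = cand cl k \<and> CC k' \<le> CC k"
proof -
  assume k: "k < 3 * m"
  let ?S = "{k'. k' < 3 * m \<and> cand cl k' = cand cl k}"
  have "finite ?S" "k \<in> ?S" using k by auto
  then obtain k' where k': "k' \<in> ?S" "\<And>j. j \<in> ?S \<Longrightarrow> rank k' \<le> rank j"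
    using arg_min_if_finite[of ?S rank] by (metis (no_types, lifting) empty_iff linorder_not_less)
  then have "k' \<in> set (klist cl)" by (auto simp: klist_def keeps_def)
  moreover have "CC k' \<le> CC k" using k' k rank_CC_le[of k' k] by auto
  ultimately show ?thesis using k' by auto
qed

lemma dqs_cand: "k \<in> set (klist cl) \<Longrightarrow> dqs cl u TB (cand cl k) = of_int (CC k * YDs u TB)"
  by (simp add: dqs_def inv_into_f_f[OF klist_inj])

lemma klist_cov:
  assumes cl: "\<And>e. 1 \<le> cl e" and A: "A \<in> \<A>"
  shows "A \<subseteq> \<Union>(cand cl ` set (klist cl))"
proof
  fix e assume "e \<in> A"
  then obtain S where "S \<in> set (sets_of I)" "e \<in> S" using scen_cov[OF A] by auto
  then obtain i where i: "i < m" "e \<in> SS i" by (metis in_set_conv_nth)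
  then have "e \<in> cand cl (3 * i)" using cl[of e] by (simp add: cand_def)
  moreover obtain k' where "k' \<in> set (klist cl)" "cand cl k' = cand cl (3 * i)"
    using klist_rep[of "3 * i" cl] i by auto
  ultimately show "e \<in> \<Union>(cand cl ` set (klist cl))" by blast
qed

lemma covering_klist:
  assumes "\<And>e. 1 \<le> cl e"
  shows "covering_collection I (map (cand cl) (klist cl))"
  unfolding covering_collection_def
proof (intro conjI ballI)
  show "distinct (map (cand cl) (klist cl))"
    using klist_inj by (simp add: distinct_map klist_def)
  show "S \<subseteq> {..<n}" if "S \<in> set (map (cand cl) (klist cl))" for S
    using that cand_sub klist_lt by auto
  show "A \<subseteq> \<Union>(set (map (cand cl) (klist cl)))" if "A \<in> \<A>" for A
    using klist_cov[of cl A] assms that by simp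
qed

lemma length_klist: "length (klist cl) \<le> 3 * m"
  unfolding klist_def using length_filter_le[of "keeps cl" "[0..<3 * m]"] by simp

lemma wp_qbits:
  assumes B: "inp a" and C: "bits_ok cl a" and Kp: "keep_ok cl a"
  shows "wpL p_qbits (\<lambda>a' b'. (\<forall>q<length (klist cl). \<forall>e<n.
     b' (3 + q * n + e) = (if e \<in> cand cl (klist cl ! q) then 1 else 0)) \<and> (\<forall>j<3. b' j = b j)) a b"
  unfolding p_qbits_def
proof (rule wp_For[where N = "length (klist cl)" and I = "\<lambda>i a b'. (\<forall>q<i. \<forall>e<n.
     b' (3 + q * n + e) = (if e \<in> cand cl (klist cl ! q) then 1 else 0)) \<and> (\<forall>j<3. b' j = b j)"], goal_cases)
  case (6 q a' b')
  have so: "same_off {i2, i3} True a b a' b'" using 6(4) by (auto simp: same_off_def)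
  have B': "inp a'" by (rule inp_off[OF B so]) simp
  have C': "bits_ok cl a'" by (rule bits_off[OF C so]) simp
  have KL: "a' aKL q = int (klist cl ! q)" using same_offD[OF so, of aKL] Kp 6(1) by (simp add: keep_ok_def)
  have lt: "klist cl ! q < 3 * m" using 6(1) klist_lt nth_mem by blast
  show ?case
  proof (rule wp_For[where N = n and I = "\<lambda>j a b'. (\<forall>q'<q. \<forall>e<n.
     b' (3 + q' * n + e) = (if e \<in> cand cl (klist cl ! q') then 1 else 0)) \<and>
     (\<forall>e<j. b' (3 + q * n + e) = (if e \<in> cand cl (klist cl ! q) then 1 else 0)) \<and> (\<forall>j<3. b' j = b j)"], goal_cases)
    case (6 e a2 b2)
    have [simp]: "a2 i2 0 = int q" "a2 i3 0 = int e" "a2 25 0 = int n" "a2 20 = a' 20" "a2 aKL q = int (klist cl ! q)"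
      using same_offD[OF 6(4)] \<open>a' i2 0 = int q\<close> 6(3) KL inpD(1)[OF B'] by simp_all
    have ix: "(3 + q' * n + e' = 3 + q * n + e) = (q' = q \<and> e' = e)" if "e' < n" for q' e'
      using idx_inj[OF that 6(1)] by simp
    have "a' 20 (klist cl ! q * n + e) = (if e \<in> cand cl (klist cl ! q) then 1 else 0)"
      using bits_okD[OF C' lt 6(1)] .
    then show ?case using 6(1,2) ix by (auto simp: idxs less_Suc_eq)
  qed (use L_facts 6 inpD(1)[OF B'] in \<open>auto simp: less_Suc_eq\<close>)
qed (use L_facts length_klist[of cl] Kp in \<open>auto simp: keep_ok_def\<close>)

lemma wp_qcosts:
  assumes B: "base a" and Kp: "keep_ok cl a" and v: "a aTB 0 = TB" "a aU 0 = Us u"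
  shows "wpL p_qcosts (\<lambda>a' b'. (\<forall>q<length (klist cl).
     b' (3 + length (klist cl) * n + 2 * q) = CC (klist cl ! q) * YDs u TB \<and>
     b' (Suc (3 + length (klist cl) * n + 2 * q)) = 1) \<and> (\<forall>j<3 + length (klist cl) * n. b' j = b j)) a b"
  unfolding p_qcosts_def
proof (rule wp_For[where N = "length (klist cl)" and I = "\<lambda>i a b'. (\<forall>q<i.
     b' (3 + length (klist cl) * n + 2 * q) = CC (klist cl ! q) * YDs u TB \<and>
     b' (Suc (3 + length (klist cl) * n + 2 * q)) = 1) \<and> (\<forall>j<3 + length (klist cl) * n. b' j = b j)"], goal_cases)
  case (6 q a' b')
  have so: "same_off {i2} True a b a' b'" using 6(4) by (auto simp: same_off_def)
  have B': "base a'" by (rule base_off[OF B so]) simp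
  have lt: "klist cl ! q < 3 * m" using 6(1) klist_lt nth_mem by blast
  have [simp]: "a' aKL q = int (klist cl ! q)" "a' aCnt 0 = int (length (klist cl))" "a' aTB 0 = TB" "a' aU 0 = Us u"
    using same_offD[OF so] Kp 6(1) v by (simp_all add: keep_ok_def)
  have [simp]: "a' aCC (klist cl ! q) = CC (klist cl ! q)" using baseD(3)[OF B' lt] .
  have [simp]: "a' i2 0 = int q" "a' aN 0 = int n" "a' aRn 0 = rn"
    using 6(3) inpD[OF baseD(1)[OF B']] by simp_all
  show ?case using 6(2) by (auto simp: idxs less_Suc_eq YDs_def)
qed (use L_facts length_klist[of cl] Kp in \<open>auto simp: keep_ok_def\<close>)

lemma wp_qscen:
  assumes B: "inp a" and Kp: "keep_ok cl a" and k: "k < K" "a i1 0 = int k"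
  defines "pos \<equiv> 3 + length (klist cl) * n + 2 * length (klist cl) + 2"
  shows "wpL p_qscen (\<lambda>a' b'. (\<forall>e<n. b' (pos + e) = (if e \<in> AA k then 1 else 0)) \<and> (\<forall>j<pos. b' j = b j)) a b"
  unfolding p_qscen_def
proof (rule wp_For[where N = n and I = "\<lambda>i a b'. (\<forall>e<i. b' (pos + e) = (if e \<in> AA k then 1 else 0)) \<and>
     (\<forall>j<pos. b' j = b j)"], goal_cases)
  case (6 e a' b')
  have so: "same_off {i2} True a b a' b'" using 6(4) by (auto simp: same_off_def)
  have B': "inp a'" by (rule inp_off[OF B so]) simp
  have [simp]: "a' aCnt 0 = int (length (klist cl))" "a' i1 0 = int k" "a' aN 0 = int n" "a' oA 0 = int offA"
    using same_offD[OF so] Kp k inpD[OF B'] by (simp_all add: keep_ok_def)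
  have [simp]: "a' 2 (offA + k * n + e) = (if e \<in> AA k then 1 else 0)" using inpD(18)[OF B' k(1) 6(1)] .
  have ix: "nat (hval (eQ1 \<oplus> HN 2 \<oplus> V i2) a') = pos + e" "0 \<le> hval (eQ1 \<oplus> HN 2 \<oplus> V i2) a'"
    using 6(3) by (simp_all add: idxs pos_def)
  have vl: "hval (HV aINP (V oA \<oplus> V i1 \<otimes> V aN \<oplus> V i2)) a' = (if e \<in> AA k then 1 else 0)"
    using 6(3) by (simp add: idxs)
  show ?case using 6(2) unfolding wp.simps ix vl by (auto simp: ix(2) less_Suc_eq simp del: hval.simps)
qed (use L_facts inpD[OF B] in auto)

lemma wp_ask:
  assumes B: "base a" and Kp: "keep_ok cl a" and C: "bits_ok cl a" and k: "k < K" "a i1 0 = int k"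
    and v: "a aTB 0 = TB" "a aTA 0 = TA" "a aU 0 = Us u" "a aW m = u m"
    and us: "ust u TA TB" and cl: "\<And>e. 1 \<le> cl e"
  shows "wpL p_ask (\<lambda>a' b'. \<exists>B\<in>\<A>. (\<forall>e<n. a' aBB e = (if e \<in> B then 1 else 0)) \<and>
     approx_scenario (cand cl ` set (klist cl)) (\<lambda>S. of_rat (dqs cl u TB S)) \<A> \<kappa> \<beta>1 \<beta>2 (yqs u TA) (AA k) B) a b"
proof -
  note I = inpD[OF baseD(1)[OF B]]
  let ?l = "length (klist cl)"
  define Q0 where "Q0 = 3 + ?l * n"
  define Q1 where "Q1 = Q0 + 2 * ?l"
  \<comment> \<open>The query in the form answered by \<open>approx_subroutine\<close>. The rest of
    the proof checks that each segment of the block holds the corresponding piece and is left alone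
    by later writes.\<close>
  define ws where "ws = 0 # enc_sets n (map (cand cl) (klist cl)) @ enc_vec (map (cand cl) (klist cl)) (dqs cl u TB)
     @ enc_rat (of_int (yqs u TA)) @ enc_set n (AA k)"
  have cnt: "a aCnt 0 = int ?l" using Kp by (simp add: keep_ok_def)
  have lws: "length ws = Q1 + 1 + n"
    by (simp add: ws_def enc_sets_def enc_vec_def length_concat_const Q0_def Q1_def)
  obtain S where S: "sub ws = enc_set n S" "approx_scenario (cand cl ` set (klist cl))
     (\<lambda>S. of_rat (dqs cl u TB S)) \<A> \<kappa> \<beta>1 \<beta>2 (of_rat (of_int (yqs u TA))) (AA k) S"
  proof -
    have "\<forall>S\<in>set (map (cand cl) (klist cl)). 0 \<le> dqs cl u TB S"
      using CC_nonneg klist_lt us Us_pos[OF us] rn_pos by (auto simp: dqs_cand YDs_def ust_def less_imp_le)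
    moreover have "0 \<le> yqs u TA"
    proof -
      have "m < Mv" by (simp add: Mv_def)
      then have "1 \<le> u m" using us unfolding ust_def by blast
      then show ?thesis using us Dd_pos rd_pos by (simp add: yqs_def ust_def)
    qed
    then have "(0::rat) \<le> of_int (yqs u TA)" by simp
    moreover have "covering_collection I (map (cand cl) (klist cl))" by (rule covering_klist) (rule cl)
    ultimately have "\<exists>B. sub (0 # enc_sets n (map (cand cl) (klist cl)) @ enc_vec (map (cand cl) (klist cl)) (dqs cl u TB)
        @ enc_rat (of_int (yqs u TA)) @ enc_set n (AA k)) = enc_set n B \<and>
      approx_scenario (set (map (cand cl) (klist cl))) (\<lambda>S. of_rat (dqs cl u TB S)) \<A> \<kappa> \<beta>1 \<beta>2
        (of_rat (of_int (yqs u TA))) (AA k) B"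
      using conjunct1[OF approx[unfolded approx_subroutine_def], rule_format,
        of "map (cand cl) (klist cl)" "dqs cl u TB" "of_int (yqs u TA)" "AA k"]
        AA_in[OF k(1)] by blast
    then show ?thesis using that unfolding ws_def set_map by blast
  qed
  then have SA: "S \<in> \<A>" by (simp add: approx_scenario_def)
  have "wpL p_qbits (\<lambda>a' b'. (\<forall>q<?l. \<forall>e<n.
     b' (3 + q * n + e) = (if e \<in> cand cl (klist cl ! q) then 1 else 0)) \<and> (\<forall>j<3. b' j = (b(1 := 0, 2 := int ?l)) j))
     a (b(1 := 0, 2 := int ?l))" by (rule wp_qbits[OF baseD(1)[OF B] C Kp])
  then have "wpL (p_qbits ;; p_qcosts ;;
   HPut eQ1 (HN 117 \<otimes> V aDd \<otimes> V aTA \<otimes> HV aW (V aM) \<otimes> V aRd) ;; HPut (eQ1 \<oplus> HN 1) (HN 1) ;;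
   p_qscen ;; HPut (HN 0) (eQ1 \<oplus> HN 1 \<oplus> V aN) ;; HAsk ;;
   HFor i2 (V aN) (HGet aBB (V i2) (HN 1 \<oplus> V i2))) (\<lambda>a' b'. \<exists>B\<in>\<A>. (\<forall>e<n. a' aBB e = (if e \<in> B then 1 else 0)) \<and>
     approx_scenario (cand cl ` set (klist cl)) (\<lambda>S. of_rat (dqs cl u TB S)) \<A> \<kappa> \<beta>1 \<beta>2 (yqs u TA) (AA k) B)
     a (b(1 := 0, 2 := int ?l))"
  proof (rule wp_seqI)
    fix a1 b1 assume h1: "(\<forall>q<?l. \<forall>e<n. b1 (3 + q * n + e) = (if e \<in> cand cl (klist cl ! q) then 1 else 0)) \<and>
       (\<forall>j<3. b1 j = (b(1 := 0, 2 := int ?l)) j)"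
      and "same_off (mods p_qbits) (touches_block p_qbits) a (b(1 := 0, 2 := int ?l)) a1 b1"
    then have so1: "same_off {i2, i3} True a b a1 b1" by (auto simp: same_off_def p_qbits_def)
    have Kp1: "keep_ok cl a1" using Kp same_offD[OF so1, of aCnt] same_offD[OF so1, of aKL] by (simp add: keep_ok_def)
    have v1: "a1 aTB 0 = TB" "a1 aU 0 = Us u" using same_offD[OF so1] v by simp_all
    have B1: "base a1" by (rule base_off[OF B so1]) simp
    show "wpL (p_qcosts ;;
       HPut eQ1 (HN 117 \<otimes> V aDd \<otimes> V aTA \<otimes> HV aW (V aM) \<otimes> V aRd) ;; HPut (eQ1 \<oplus> HN 1) (HN 1) ;;
       p_qscen ;; HPut (HN 0) (eQ1 \<oplus> HN 1 \<oplus> V aN) ;; HAsk ;;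
       HFor i2 (V aN) (HGet aBB (V i2) (HN 1 \<oplus> V i2))) (\<lambda>a' b'. \<exists>B\<in>\<A>. (\<forall>e<n. a' aBB e = (if e \<in> B then 1 else 0)) \<and>
     approx_scenario (cand cl ` set (klist cl)) (\<lambda>S. of_rat (dqs cl u TB S)) \<A> \<kappa> \<beta>1 \<beta>2 (yqs u TA) (AA k) B) a1 b1"
    proof (rule wp_seqI[OF wp_qcosts[OF B1 Kp1 v1]])
      fix a2 b2 assume h2: "(\<forall>q<?l. b2 (3 + ?l * n + 2 * q) = CC (klist cl ! q) * YDs u TB \<and>
         b2 (Suc (3 + ?l * n + 2 * q)) = 1) \<and> (\<forall>j<3 + ?l * n. b2 j = b1 j)"
        and "same_off (mods p_qcosts) (touches_block p_qcosts) a1 b1 a2 b2"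
      then have so2: "same_off {i2, i3} True a b a2 b2" using so1 by (auto simp: same_off_def p_qcosts_def)
      have Kp2: "keep_ok cl a2" using Kp same_offD[OF so2, of aCnt] same_offD[OF so2, of aKL] by (simp add: keep_ok_def)
      have B2: "base a2" by (rule base_off[OF B so2]) simp
      have k2: "a2 i1 0 = int k" using same_offD[OF so2] k by simp
      have [simp]: "a2 aCnt 0 = int ?l" "a2 aTA 0 = TA" "a2 aW m = u m"
        using same_offD[OF so2] cnt v by simp_all
      note [simp] = inpD[OF baseD(1)[OF B2]] baseD(2)[OF B2]
      let ?b3 = "b2(Q1 := yqs u TA, Suc Q1 := 1)"
      have "wpL (p_qscen ;; HPut (HN 0) (eQ1 \<oplus> HN 1 \<oplus> V aN) ;; HAsk ;;
         HFor i2 (V aN) (HGet aBB (V i2) (HN 1 \<oplus> V i2))) (\<lambda>a' b'. \<exists>B\<in>\<A>. (\<forall>e<n. a' aBB e = (if e \<in> B then 1 else 0)) \<and>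
         approx_scenario (cand cl ` set (klist cl)) (\<lambda>S. of_rat (dqs cl u TB S)) \<A> \<kappa> \<beta>1 \<beta>2 (yqs u TA) (AA k) B) a2 ?b3"
      proof (rule wp_seqI[OF wp_qscen[OF baseD(1)[OF B2] Kp2 k(1) k2]])
        fix a4 b4 assume h4: "(\<forall>e<n. b4 (3 + ?l * n + 2 * ?l + 2 + e) = (if e \<in> AA k then 1 else 0)) \<and>
           (\<forall>j<3 + ?l * n + 2 * ?l + 2. b4 j = ?b3 j)"
          and "same_off (mods p_qscen) (touches_block p_qscen) a2 ?b3 a4 b4"
        then have so4: "same_off {i2, i3} True a b a4 b4" using so2 by (auto simp: same_off_def p_qscen_def)
        have B4: "base a4" by (rule base_off[OF B so4]) simp
        have [simp]: "a4 aCnt 0 = int ?l" "a4 aN 0 = int n"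
          using same_offD[OF so4] cnt inpD[OF baseD(1)[OF B4]] by simp_all
        let ?b5 = "b4(0 := int (Q1 + 1 + n))"
        have hq1: "has ?b5 3 (concat (map (enc_set n) (map (cand cl) (klist cl))))"
        proof -
          have "?b5 (3 + (q * n + e)) = (if e \<in> cand cl (klist cl ! q) then 1 else 0)" if "q < ?l" "e < n" for q e
          proof -
            have "(q + 1) * n \<le> ?l * n" using that(1) by (intro mult_le_mono1) auto
            then have lt: "3 + q * n + e < 3 + ?l * n" using that(2) by simp
            then have "b4 (3 + q * n + e) = b2 (3 + q * n + e)" using h4 by (simp add: Q1_def Q0_def)
            also have "\<dots> = b1 (3 + q * n + e)" using h2 lt by blast
            also have "\<dots> = (if e \<in> cand cl (klist cl ! q) then 1 else 0)" using h1 that by blast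
            finally show ?thesis by (simp add: add.assoc)
          qed
          then show ?thesis
            by (subst concat_map_nth, subst has_concat[where l = n]) (auto simp: has_enc_set add.assoc)
        qed
        have hq2: "has ?b5 Q0 (concat (map (\<lambda>A. enc_rat (dqs cl u TB A)) (map (cand cl) (klist cl))))"
        proof -
          have "?b5 (Q0 + q * 2) = CC (klist cl ! q) * YDs u TB \<and> ?b5 (Suc (Q0 + q * 2)) = 1" if "q < ?l" for q
            using h2 h4 that by (auto simp: Q0_def Q1_def mult.commute)
          then show ?thesis
            by (subst concat_map_nth, subst has_concat[where l = 2]) (auto simp: dqs_cand enc_rat_of_int simp del: of_int_mult)
        qed
        have "?b5 1 = 0" "?b5 2 = int ?l" using h1 h2 h4 by (auto simp: Q0_def Q1_def)
        moreover have "?b5 Q1 = yqs u TA" "?b5 (Suc Q1) = 1" using h4 by (auto simp: Q0_def Q1_def)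
        moreover have "has ?b5 (Q1 + 2) (enc_set n (AA k))" using h4 by (auto simp: has_enc_set Q0_def Q1_def)
        ultimately have "has ?b5 1 ws"
          using hq1 hq2 unfolding ws_def enc_sets_def enc_vec_def enc_rat_of_int
          by (simp add: length_concat_const Q0_def Q1_def eval_nat_numeral)
        then have q: "query ?b5 = ws" by (intro query_eq) (simp_all add: lws)
        have "Q1 + 1 + n \<le> L"
          using L_q length_klist[of cl] mult_le_mono1[OF length_klist[of cl], of n] unfolding Q1_def Q0_def by linarith
        moreover have "wpL (HFor i2 (V aN) (HGet aBB (V i2) (HN 1 \<oplus> V i2))) (\<lambda>a' b'. \<exists>B\<in>\<A>. (\<forall>e<n. a' aBB e = (if e \<in> B then 1 else 0)) \<and>
         approx_scenario (cand cl ` set (klist cl)) (\<lambda>S. of_rat (dqs cl u TB S)) \<A> \<kappa> \<beta>1 \<beta>2 (yqs u TA) (AA k) B) a4 (answer ?b5 (enc_set n S))"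
        proof (rule wp_For[where N = n and I = "\<lambda>i a b. \<forall>e<i. a aBB e = (if e \<in> S then 1 else 0)"], goal_cases)
          case (6 e a' b')
          have b': "b' = answer ?b5 (enc_set n S)" using 6(4) by (simp add: same_off_def)
          have "b' (Suc e) = (if e \<in> S then 1 else 0)" using 6(1) unfolding b' answer_def by (simp add: enc_set_def)
          then show ?case using 6(1-3) by (auto simp: idxs less_Suc_eq nat_add_distrib)
        qed (use L_facts S SA in \<open>auto simp: of_rat_of_int_eq\<close>)
        moreover have "hval (eQ1 \<oplus> HN 1 \<oplus> V aN) a4 = int (Q1 + 1 + n)" by (simp add: Q0_def Q1_def)
        moreover have "\<bar>v\<bar> \<le> 2 ^ L" if "v \<in> set (enc_set n S)" for v
          using that by (auto simp: enc_set_def)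
        ultimately show "wpL (HPut (HN 0) (eQ1 \<oplus> HN 1 \<oplus> V aN) ;; HAsk ;;
         HFor i2 (V aN) (HGet aBB (V i2) (HN 1 \<oplus> V i2))) (\<lambda>a' b'. \<exists>B\<in>\<A>. (\<forall>e<n. a' aBB e = (if e \<in> B then 1 else 0)) \<and>
         approx_scenario (cand cl ` set (klist cl)) (\<lambda>S. of_rat (dqs cl u TB S)) \<A> \<kappa> \<beta>1 \<beta>2 (yqs u TA) (AA k) B) a4 b4"
          using q S(1) L_facts
          by (intro wp_put_ask[where b' = "?b5" and ws = ws and as = "enc_set n S"])
            (simp_all only: hval.simps(1) length_enc_set nat_int)
      qed
      note A = this
      have ev: "nat (hval eQ1 a2) = Q1" "nat (hval (eQ1 \<oplus> HN 1) a2) = Suc Q1" "0 \<le> hval eQ1 a2" "0 \<le> hval (eQ1 \<oplus> HN 1) a2"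
        "hval (HN 117 \<otimes> V aDd \<otimes> V aTA \<otimes> HV aW (V aM) \<otimes> V aRd) a2 = yqs u TA"
        by (simp_all add: idxs Q0_def Q1_def yqs_def)
      show "wpL (HPut eQ1 (HN 117 \<otimes> V aDd \<otimes> V aTA \<otimes> HV aW (V aM) \<otimes> V aRd) ;; HPut (eQ1 \<oplus> HN 1) (HN 1) ;;
       p_qscen ;; HPut (HN 0) (eQ1 \<oplus> HN 1 \<oplus> V aN) ;; HAsk ;;
       HFor i2 (V aN) (HGet aBB (V i2) (HN 1 \<oplus> V i2))) (\<lambda>a' b'. \<exists>B\<in>\<A>. (\<forall>e<n. a' aBB e = (if e \<in> B then 1 else 0)) \<and>
       approx_scenario (cand cl ` set (klist cl)) (\<lambda>S. of_rat (dqs cl u TB S)) \<A> \<kappa> \<beta>1 \<beta>2 (yqs u TA) (AA k) B) a2 b2"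
        unfolding wp_put2 ev(1,2,5) hval.simps(1) using A ev(3,4) by blast
    qed
  qed
  moreover have "nat (hval (HN 1) a) = 1" "nat (hval (HN 2) a) = 2" "0 \<le> hval (HN 1) a" "0 \<le> hval (HN 2) a"
    "hval (HN 0) a = 0" "hval (V aCnt) a = int ?l" using cnt by simp_all
  ultimately show ?thesis unfolding p_ask_def wp_put2 by (simp only: simp_thms)
qed

lemma wp_dist:
  assumes B: "inp a" and k: "k < K" "a i1 0 = int k" and S: "S \<in> \<A>" "\<And>e. e < n \<Longrightarrow> a aBB e = (if e \<in> S then 1 else 0)"
  shows "wpL p_dist (\<lambda>a' b'. a' aQn 0 = fst (quotient_of (scen_dist I (AA k) S)) \<and>
     a' aQd 0 = snd (quotient_of (scen_dist I (AA k) S))) a b"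
proof -
  note [simp] = inpD[OF B]
  define ws where "ws = 1 # enc_set n (AA k) @ enc_set n S"
  let ?q = "enc_rat (scen_dist I (AA k) S)"
  have sub: "sub ws = ?q"
    using approx AA_in[OF k(1)] S(1) unfolding approx_subroutine_def ws_def by blast
  have small: "\<bar>v\<bar> \<le> 2 ^ L" if "v \<in> set ?q" for v using L_kap[OF AA_in[OF k(1)] S(1) that] .
  have "wpL (HFor i2 (V aN) (HPut (HN 2 \<oplus> V i2) (HV aINP (V oA \<oplus> V i1 \<otimes> V aN \<oplus> V i2)) ;;
     HPut (HN 2 \<oplus> V aN \<oplus> V i2) (HV aBB (V i2)))) (\<lambda>a' b'. b' 1 = 1 \<and>
       (\<forall>e<n. b' (2 + e) = (if e \<in> AA k then 1 else 0)) \<and> (\<forall>e<n. b' (2 + n + e) = (if e \<in> S then 1 else 0))) a (b(1 := 1))"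
  proof (rule wp_For[where N = n and I = "\<lambda>i a b'. b' 1 = 1 \<and> (\<forall>e<i. b' (2 + e) = (if e \<in> AA k then 1 else 0)) \<and>
      (\<forall>e<i. b' (2 + n + e) = (if e \<in> S then 1 else 0))"], goal_cases)
    case (6 e a' b')
    have so: "same_off {i2} True a b a' b'" using 6(4) by (auto simp: same_off_def)
    have [simp]: "a' i1 0 = int k" "a' aN = a aN" "a' oA = a oA" "a' aBB = a aBB" "a' aINP = a aINP"
      using same_offD[OF so] k by simp_all
    show ?case using 6(1-3) inpD(18)[OF B k(1) 6(1)] S(2)[OF 6(1)] by (auto simp: idxs less_Suc_eq)
  qed (use L_facts in auto)
  then have "wpL (HFor i2 (V aN) (HPut (HN 2 \<oplus> V i2) (HV aINP (V oA \<oplus> V i1 \<otimes> V aN \<oplus> V i2)) ;;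
     HPut (HN 2 \<oplus> V aN \<oplus> V i2) (HV aBB (V i2))) ;;
     HPut (HN 0) (HN 1 \<oplus> HN 2 \<otimes> V aN) ;; HAsk ;; HGet aQn (HN 0) (HN 1) ;; HGet aQd (HN 0) (HN 2))
     (\<lambda>a' b'. a' aQn 0 = fst (quotient_of (scen_dist I (AA k) S)) \<and>
     a' aQd 0 = snd (quotient_of (scen_dist I (AA k) S))) a (b(1 := 1))"
  proof (rule wp_seqI, goal_cases)
    case (1 a1 b1)
    have so: "same_off {i2} True a b a1 b1" using 1(2) by (auto simp: same_off_def)
    let ?b = "b1(0 := 1 + 2 * int n)"
    have [simp]: "a1 aN 0 = int n" using same_offD[OF so, of aN] by simp
    have "has ?b 1 ws" using 1(1) by (simp add: ws_def has_enc_set eval_nat_numeral)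
    then have q: "query ?b = ws" by (intro query_eq) (simp_all add: ws_def)
    have "answer ?b ?q 1 = fst (quotient_of (scen_dist I (AA k) S))"
      "answer ?b ?q 2 = snd (quotient_of (scen_dist I (AA k) S))"
      by (simp_all add: answer_def enc_rat_def)
    then show ?case using q sub small L_n by (auto simp: enc_rat_def nat_add_distrib nat_mult_distrib)
  qed
  then show ?thesis unfolding p_dist_def by simp
qed

text \<open>For distance \<open>qn / qd\<close> from support scenario \<open>k\<close>,
  \<open>TNs / TDs\<close> is 117/20 \<open>Dd\<close> times \<theta>_k + \<kappa> y, with
  \<theta>_k and y read off the candidate. It is the budget, enlarged by 39/20, for covering the
  returned scenario at costs \<open>CC\<close>.\<close>

definition "TNs u TA k qn qd = 117 * Dd * TA * (u (m + 1 + k) * pd k * qd * rn + qn * u m * rd * pn k)"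
definition "TDs u TB k qd = 20 * TB * Us u * pn k * qd * rn"

lemma wp_target:
  assumes o: "ost u TA TB a" and U: "a aU 0 = Us u" and k: "k < K" "a i1 0 = int k" and q: "a aQn 0 = qn" "a aQd 0 = qd"
  shows "wpL p_target (\<lambda>a' b'. a' aTN 0 = TNs u TA k qn qd \<and> a' aTD 0 = TDs u TB k qd) a b"
proof -
  have B: "base a" using o by (simp add: ost_def)
  note [simp] = inpD[OF baseD(1)[OF B]] baseD(2)[OF B]
  have [simp]: "a aTA 0 = TA" "a aTB 0 = TB" "a aW m = u m" "a aW (Suc (m + k)) = u (Suc (m + k))"
    using o k by (simp_all add: ost_def Mv_def)
  show ?thesis unfolding p_target_def using U k q
    by (simp add: idxs TNs_def TDs_def)
qed

end

section \<open>The inner covering problem\<close>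

lemma wp_if_pos: "0 < hval e a \<Longrightarrow> wp sub L c Q a b \<Longrightarrow> wp sub L (HIf e c d) Q a b"
  by simp

lemma wp_if_neg: "\<not> 0 < hval e a \<Longrightarrow> wp sub L d Q a b \<Longrightarrow> wp sub L (HIf e c d) Q a b"
  by simp

text \<open>Turns the integer comparison made by the program into the hypothesis \<open>viol\<close>
  of \<open>mwu_state_step\<close>.\<close>

lemma scaled_violation:
  fixes N D l x c W :: real
  assumes "0 < D" "0 < x" "N * l \<le> D * (x * c) * W"
  shows "N / D * (l / x) \<le> c * W"
proof -
  have "N / D * (l / x) = N * l / (D * x)" by simp
  also have "\<dots> \<le> c * W" using assms by (subst pos_divide_le_eq) (auto simp: algebra_simps)
  finally show ?thesis .
qed

context dr_run
begin

text \<open>Elements of a zero-cost candidate can be covered at no expense; a packing must vanish on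
  them.\<close>

definition free :: "(nat \<Rightarrow> int) \<Rightarrow> nat \<Rightarrow> bool" where
  "free cl e \<longleftrightarrow> (\<exists>k<3 * m. e \<in> cand cl k \<and> \<not> 0 < CC k)"

definition lhs :: "(nat \<Rightarrow> int) \<Rightarrow> (nat \<Rightarrow> int) \<Rightarrow> nat \<Rightarrow> int" where
  "lhs cl iu e = (\<Sum>k<3 * m. if e \<in> cand cl k then if 0 < CC k then iu k * IC k else 0 else 0)"

text \<open>Since \<open>IC\<close> is \<open>PC\<close> over the cost, \<open>PC / x\<close> is the
  cheapest cost of a candidate containing \<open>e\<close>. The bound \<open>N\<close> makes it a
  loop invariant, with value 0 as long as no such candidate has been met.\<close>

definition max_IC :: "(nat \<Rightarrow> int) \<Rightarrow> nat \<Rightarrow> nat \<Rightarrow> int \<Rightarrow> bool" where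
  "max_IC cl N e x \<longleftrightarrow> 0 \<le> x \<and> (\<forall>k<N. e \<in> cand cl k \<and> 0 < CC k \<longrightarrow> IC k \<le> x) \<and>
     (x = 0 \<or> (\<exists>k<N. e \<in> cand cl k \<and> 0 < CC k \<and> x = IC k))"

definition load :: "(nat \<Rightarrow> int) \<Rightarrow> (nat \<Rightarrow> int) \<Rightarrow> nat \<Rightarrow> real" where
  "load cl la k = (if 0 < CC k then (\<Sum>e<n. if e \<in> cand cl k then real_of_int (la e) else 0) / CC k else 0)"

text \<open>Weights \<open>iu\<close> sit on the candidates, and \<open>la\<close> is the packing of
  elements accumulated from violated rows. Budget 0 is split off because \<open>mwu_state\<close>
  divides by the budget; in that case a nonzero packing is all that is required later.\<close>

definition inner_st :: "(nat \<Rightarrow> int) \<Rightarrow> nat set \<Rightarrow> int \<Rightarrow> int \<Rightarrow> nat \<Rightarrow> (nat \<Rightarrow> int) \<Rightarrow> (nat \<Rightarrow> int) \<Rightarrow> bool" where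
  "inner_st cl S TN TD j la iu \<longleftrightarrow> (\<forall>e<n. 0 \<le> la e) \<and> (\<forall>e<n. la e \<noteq> 0 \<longrightarrow> e \<in> S \<and> \<not> free cl e) \<and>
     (\<forall>k<3 * m. 1 \<le> iu k) \<and>
     (0 < TN \<longrightarrow> mwu_state (3 * m) (TN / TD) j (\<lambda>k. iu k) (load cl la) (\<Sum>e<n. real_of_int (la e))) \<and>
     (0 < j \<longrightarrow> (\<exists>e<n. 0 < la e))"

definition covers :: "(nat \<Rightarrow> int) \<Rightarrow> nat set \<Rightarrow> real \<Rightarrow> bool" where
  "covers cl S t \<longleftrightarrow> (\<exists>v. (\<forall>k<3 * m. 0 \<le> v k) \<and>
     (\<forall>e\<in>S. 1 \<le> (\<Sum>k<3 * m. if e \<in> cand cl k then v k else 0)) \<and> (\<Sum>k<3 * m. real_of_int (CC k) * v k) \<le> t)"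

lemma inner_init: "(\<And>e. e < n \<Longrightarrow> la e = 0) \<Longrightarrow> (\<And>k. k < 3 * m \<Longrightarrow> iu k = 1) \<Longrightarrow> inner_st cl S TN TD 0 la iu"
  unfolding inner_st_def
  by (auto simp: load_def intro!: mwu_state_cong[OF mwu_state_init] sum.neutral)

lemma scen_in_cand:
  assumes "S \<in> \<A>" "e \<in> S" "\<And>e. 1 \<le> cl e"
  shows "\<exists>k<3 * m. e \<in> cand cl k"
proof -
  obtain T where "T \<in> set (sets_of I)" "e \<in> T" using scen_cov[OF assms(1)] assms(2) by auto
  then obtain i where i: "i < m" "e \<in> SS i" by (metis in_set_conv_nth)
  then have "e \<in> cand cl (3 * i)" using assms(3)[of e] by (simp add: cand_def)
  then show ?thesis using i by (intro exI[of _ "3 * i"]) auto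
qed

text \<open>The covering row of \<open>e\<close> is multiplied by the least cost
  \<open>CC k0\<close> among candidates containing \<open>e\<close>. In terms of money spent, its
  entries become \<open>CC k0 / CC k\<close>, at most 1 and equal to 1 at \<open>k0\<close>; its
  right-hand side \<open>CC k0\<close> is what \<open>la e\<close> gains.\<close>

lemma inner_step:
  assumes st: "inner_st cl S TN TD j la iu" and S: "S \<in> \<A>" and cl: "\<And>e. 1 \<le> cl e" and TD: "0 < TD"
    and e: "e < n" "e \<in> S" "\<not> free cl e" and x: "max_IC cl (3 * m) e x"
    and viol: "TN * lhs cl iu e < TD * PC * (\<Sum>k<3 * m. iu k)"
    and la': "\<And>e'. e' < n \<Longrightarrow> la' e' = (if e' = e then la e + PC div x else la e')"
    and iu': "\<And>k. k < 3 * m \<Longrightarrow> iu' k = iu k * (if e \<in> cand cl k then 200 * x + IC k else 200 * x)"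
  shows "inner_st cl S TN TD (Suc j) la' iu'"
proof -
  have pos: "e \<in> cand cl k \<Longrightarrow> k < 3 * m \<Longrightarrow> 0 < CC k" for k using e(3) by (auto simp: free_def)
  obtain k1 where "k1 < 3 * m" "e \<in> cand cl k1" using scen_in_cand[of S e cl] S e(2) cl by auto
  then have "0 < x" using x IC_pos pos unfolding max_IC_def by (meson less_le_trans)
  then obtain k0 where k0: "k0 < 3 * m" "e \<in> cand cl k0" "x = IC k0" using x unfolding max_IC_def by auto
  have C0: "0 < CC k0" using pos k0 by auto
  have PCx: "PC = x * CC k0" using IC_eq[OF k0(1) C0] k0(3) by simp
  then have s: "PC div x = CC k0" using \<open>0 < x\<close> by simp
  have icx: "real_of_int (IC k) / x = CC k0 / CC k" if "k < 3 * m" "0 < CC k" for k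
  proof -
    have "real_of_int (IC k * CC k) = real_of_int (x * CC k0)" using IC_eq[OF that] PCx by simp
    then show ?thesis using that \<open>0 < x\<close> by (simp add: field_simps)
  qed
  have la: "\<And>e. e < n \<Longrightarrow> 0 \<le> la e" "\<And>e. e < n \<Longrightarrow> la e \<noteq> 0 \<Longrightarrow> e \<in> S \<and> \<not> free cl e"
    and iu: "\<And>k. k < 3 * m \<Longrightarrow> 1 \<le> iu k" using st by (auto simp: inner_st_def)
  have "1 \<le> iu' k" if k: "k < 3 * m" for k
  proof -
    have "1 * 1 \<le> iu k * (if e \<in> cand cl k then 200 * x + IC k else 200 * x)"
      using iu[OF k] \<open>0 < x\<close> IC_pos[OF k] pos[OF _ k] by (intro mult_mono) (auto simp: add_increasing2 less_imp_le)
    then show ?thesis using iu'[OF k] by simp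
  qed
  moreover have "mwu_state (3 * m) (TN / TD) (Suc j) (\<lambda>k. iu' k) (load cl la') (\<Sum>e<n. real_of_int (la' e))" if TN: "0 < TN"
  proof -
    define q where "q k = (if e \<in> cand cl k then real_of_int (IC k) / x else 0)" for k
    have mw: "mwu_state (3 * m) (TN / TD) j (\<lambda>k. iu k) (load cl la) (\<Sum>e<n. real_of_int (la e))"
      using st TN by (simp add: inner_st_def)
    have "mwu_state (3 * m) (TN / TD) (Suc j) (\<lambda>k. iu' k) (\<lambda>k. load cl la k + q k) ((\<Sum>e<n. real_of_int (la e)) + CC k0)"
    proof (rule mwu_state_step[OF mw, where C = "200 * real_of_int x"])
      show "0 < real_of_int TN / TD" "0 < 200 * real_of_int x" using TN TD \<open>0 < x\<close> by auto
      show "0 \<le> q k \<and> q k \<le> 1" if k: "k < 3 * m" for k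
        using x pos[OF _ k] IC_pos[OF k] k \<open>0 < x\<close> unfolding q_def max_IC_def by (auto simp: less_imp_le)
      show "\<exists>k<3 * m. q k = 1" using k0 \<open>0 < x\<close> by (intro exI[of _ k0]) (auto simp: q_def)
      have "(\<Sum>k<3 * m. q k * iu k) = lhs cl iu e / x"
        unfolding lhs_def q_def of_int_sum sum_divide_distrib using pos by (intro sum.cong) auto
      moreover have "real_of_int (TN * lhs cl iu e) \<le> real_of_int (TD * (x * CC k0) * (\<Sum>k<3 * m. iu k))"
        using viol unfolding PCx by (simp only: of_int_le_iff less_imp_le)
      ultimately show "real_of_int TN / TD * (\<Sum>k<3 * m. q k * iu k) \<le> CC k0 * (\<Sum>k<3 * m. real_of_int (iu k))"
        using scaled_violation[of TD x TN "lhs cl iu e" "CC k0" "\<Sum>k<3 * m. real_of_int (iu k)"] TD \<open>0 < x\<close>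
        by simp
      show "real_of_int (iu' k) = 200 * real_of_int x * (iu k * (1 + q k / 200))" if "k < 3 * m" for k
        using \<open>0 < x\<close> by (simp add: iu'[OF that] q_def field_simps)
    qed
    moreover have "(\<Sum>e'<n. real_of_int (la' e')) = (\<Sum>e<n. real_of_int (la e)) + CC k0"
    proof -
      have "(\<Sum>e'<n. real_of_int (la' e')) = (\<Sum>e'<n. real_of_int (la e') + (if e' = e then real_of_int (CC k0) else 0))"
        using la' s by (intro sum.cong) auto
      then show ?thesis using e by (simp add: sum.distrib sum.delta)
    qed
    moreover have "load cl la k + q k = load cl la' k" if k: "k < 3 * m" for k
    proof (cases "0 < CC k")
      case True
      have "(\<Sum>e'<n. if e' \<in> cand cl k then real_of_int (la' e') else 0) =
        (\<Sum>e'<n. (if e' \<in> cand cl k then real_of_int (la e') else 0) +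
          (if e' = e then if e \<in> cand cl k then real_of_int (CC k0) else 0 else 0))"
        using la' s by (intro sum.cong) auto
      also have "\<dots> = (\<Sum>e'<n. if e' \<in> cand cl k then real_of_int (la e') else 0) +
          (if e \<in> cand cl k then real_of_int (CC k0) else 0)"
        using e by (simp add: sum.distrib sum.delta)
      finally show ?thesis using True icx[OF k True] by (auto simp: load_def q_def add_divide_distrib)
    next
      case False
      then have "e \<notin> cand cl k" using pos k by auto
      then show ?thesis using False by (simp add: load_def q_def)
    qed
    ultimately show ?thesis by (auto elim: mwu_state_cong)
  qed
  moreover have "0 < la' e" using la'[OF e(1)] s C0 la(1)[OF e(1)] by simp
  moreover have "\<forall>e'<n. 0 \<le> la' e'" "\<forall>e'<n. la' e' \<noteq> 0 \<longrightarrow> e' \<in> S \<and> \<not> free cl e'"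
    using la' la e s C0 by (auto split: if_splits)
  ultimately show ?thesis unfolding inner_st_def using e(1) by blast
qed

lemma inner_covers:
  assumes iu: "\<And>k. k < 3 * m \<Longrightarrow> 1 \<le> iu k" and S: "S \<in> \<A>" and cl: "\<And>e. 1 \<le> cl e" and TD: "0 < TD" and TN: "0 \<le> TN"
    and ok: "\<And>e. e \<in> S \<Longrightarrow> free cl e \<or> TD * PC * (\<Sum>k<3 * m. iu k) \<le> TN * lhs cl iu e"
  shows "covers cl S (TN / TD)"
proof -
  define iU where "iU = (\<Sum>k<3 * m. iu k)"
  \<comment> \<open>Candidate \<open>k\<close> receives the share \<open>iu k / iU\<close> of the
    budget, spent at price \<open>CC k\<close>; zero-cost candidates are taken fully, which settles
    the free elements.\<close>
  define v where "v k = (if 0 < CC k then (TN / TD) * iu k / (iU * CC k) else 1)" for k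
  have iU0: "0 \<le> iU" unfolding iU_def using iu by (intro sum_nonneg) (auto simp: order_trans[OF zero_le_one])
  have v0: "0 \<le> v k" if "k < 3 * m" for k
    using that TN TD iU0 iu[OF that] by (auto simp: v_def intro!: divide_nonneg_nonneg mult_nonneg_nonneg)
  have "1 \<le> (\<Sum>k<3 * m. if e \<in> cand cl k then v k else 0)" if e: "e \<in> S" for e
  proof (cases "free cl e")
    case True
    then obtain k where k: "k < 3 * m" "e \<in> cand cl k" "\<not> 0 < CC k" by (auto simp: free_def)
    have "(if e \<in> cand cl k then v k else 0) \<le> (\<Sum>k<3 * m. if e \<in> cand cl k then v k else 0)"
      using k(1) v0 by (intro member_le_sum[where f = "\<lambda>k. if e \<in> cand cl k then v k else 0"]) auto
    then show ?thesis using k by (simp add: v_def)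
  next
    case False
    obtain k1 where k1: "k1 < 3 * m" using scen_in_cand[of S e cl] S e cl by auto
    have "iu k1 \<le> iU" unfolding iU_def using k1 iu
      by (intro member_le_sum) (auto simp: order_trans[OF zero_le_one])
    then have iUp: "0 < iU" using iu[OF k1] by linarith
    have "(\<Sum>k<3 * m. if e \<in> cand cl k then v k else 0) = (\<Sum>k<3 * m. (if e \<in> cand cl k then if 0 < CC k then iu k * IC k else 0 else 0) * ((TN / TD) / (iU * PC)))"
    proof (intro sum.cong refl)
      fix k assume "k \<in> {..<3 * m}"
      then have k: "k < 3 * m" by simp
      have "real_of_int PC = IC k * CC k" if "0 < CC k" using IC_eq[OF k that] by (metis of_int_mult)
      then show "(if e \<in> cand cl k then v k else 0) =
         (if e \<in> cand cl k then if 0 < CC k then iu k * IC k else 0 else 0) * ((TN / TD) / (iU * PC))"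
        using False k IC_pos[OF k] by (auto simp: v_def free_def field_simps)
    qed
    also have "\<dots> = lhs cl iu e * ((TN / TD) / (iU * PC))" unfolding lhs_def of_int_sum sum_distrib_right by simp
    finally have eq: "(\<Sum>k<3 * m. if e \<in> cand cl k then v k else 0) = lhs cl iu e * ((TN / TD) / (iU * PC))" .
    have "TD * PC * iU \<le> TN * lhs cl iu e" using ok[OF e] False by (simp add: iU_def)
    then have "real_of_int (TD * PC * iU) \<le> real_of_int (TN * lhs cl iu e)" by (simp only: of_int_le_iff)
    then show ?thesis unfolding eq using TD PC_pos iUp by (simp add: field_simps)
  qed
  moreover have "(\<Sum>k<3 * m. CC k * v k) \<le> TN / TD"
  proof -
    have "(\<Sum>k<3 * m. CC k * v k) \<le> (\<Sum>k<3 * m. (TN / TD) / iU * iu k)"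
    proof (intro sum_mono)
      fix k assume "k \<in> {..<3 * m}"
      then have k: "k < 3 * m" by simp
      have "0 \<le> (TN / TD) / iU * iu k"
        using TN TD iU0 iu[OF k] by (intro mult_nonneg_nonneg divide_nonneg_nonneg) auto
      then show "real_of_int (CC k) * v k \<le> (TN / TD) / iU * iu k"
        using CC_nonneg[OF k] by (cases "0 < CC k") (auto simp: v_def)
    qed
    also have "\<dots> = (TN / TD) / iU * iU" unfolding iU_def of_int_sum sum_distrib_left ..
    also have "\<dots> \<le> TN / TD" using TN TD by simp
    finally show ?thesis .
  qed
  ultimately show ?thesis unfolding covers_def using v0 by (intro exI[of _ v]) auto
qed

definition istat :: "(nat \<Rightarrow> int) \<Rightarrow> nat set \<Rightarrow> int \<Rightarrow> int \<Rightarrow> arrays \<Rightarrow> bool" where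
  "istat cl S TN TD a \<longleftrightarrow> base a \<and> bits_ok cl a \<and> (\<forall>e<n. a aBB e = (if e \<in> S then 1 else 0)) \<and>
     a aTN 0 = TN \<and> a aTD 0 = TD"

lemma istat_off:
  assumes "istat cl S TN TD a" and so: "same_off M t a b a' b'" and
    M: "M \<inter> {2, 6, 20, 25, 26, 27, 28, 29, 30, 31, 32, 33, 34, 35, 36, 37, 38, 39, 40, 60, 61} = {}"
  shows "istat cl S TN TD a'"
proof -
  have "base a'" using assms(1) unfolding istat_def by (intro base_off[OF _ so]) (use M in blast)+
  moreover have "bits_ok cl a'" using assms(1) unfolding istat_def by (intro bits_off[OF _ so]) (use M in blast)+
  moreover have "a' 6 = a 6" "a' 60 = a 60" "a' 61 = a 61" using M by (intro same_offD[OF so]; blast)+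
  ultimately show ?thesis using assms(1) unfolding istat_def by simp
qed

lemma wp_iU:
  assumes "inp a"
  shows "wpL p_iU (\<lambda>a' b'. a' aIU 0 = (\<Sum>k<3 * m. a aIu k)) a b"
proof -
  note [simp] = inpD[OF assms]
  show ?thesis unfolding p_iU_def wp.simps
    by (rule wp_For[where N = "3 * m" and I = "\<lambda>i a' b. a' aIU 0 = (\<Sum>k<i. a aIu k)"])
      (use L_facts in \<open>auto simp: same_off_def\<close>)
qed

lemma wp_lhs:
  assumes st: "istat cl S TN TD a" and e: "e < n" "a i3 0 = int e"
  shows "wpL p_lhs (\<lambda>a' b'. a' aLhs 0 = lhs cl (a aIu) e \<and> max_IC cl (3 * m) e (a' aIM 0) \<and>
     a' aFr 0 = (if free cl e then 1 else 0)) a b"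
proof -
  have B: "base a" and C: "bits_ok cl a" using st by (auto simp: istat_def)
  note [simp] = inpD[OF baseD(1)[OF B]]
  show ?thesis unfolding p_lhs_def wp.simps
  proof (rule wp_For[where N = "3 * m" and I = "\<lambda>i a' b.
      a' aLhs 0 = (\<Sum>k<i. if e \<in> cand cl k then if 0 < CC k then a aIu k * IC k else 0 else 0) \<and>
      max_IC cl i e (a' aIM 0) \<and>
      a' aFr 0 = (if \<exists>k<i. e \<in> cand cl k \<and> \<not> 0 < CC k then 1 else 0)"], goal_cases)
    case (6 k a' b')
    have so: "same_off {aLhs, aIM, aFr, i4} False a b a' b'" using 6(4) by (auto simp: same_off_def)
    have B': "base a'" by (rule base_off[OF B so]) simp
    have C': "bits_ok cl a'" by (rule bits_off[OF C so]) simp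
    have [simp]: "a' i3 0 = int e" "a' aIu = a aIu" "a' aN = a aN" using same_offD[OF so] e by simp_all
    have [simp]: "a' aCC k = CC k" "a' aIC k = IC k" "a' aCB (k * n + e) = (if e \<in> cand cl k then 1 else 0)"
      using baseD(3,5)[OF B' 6(1)] bits_okD[OF C' 6(1) e(1)] by simp_all
    have IC0: "0 < CC k \<Longrightarrow> 0 < IC k" using IC_pos[OF 6(1)] .
    show ?case using 6(2,3) IC0
      by (auto simp: idxs less_Suc_eq max_IC_def)
  qed (use L_facts in \<open>auto simp: lhs_def free_def max_IC_def\<close>)
qed

definition found :: "(nat \<Rightarrow> int) \<Rightarrow> nat set \<Rightarrow> int \<Rightarrow> int \<Rightarrow> (nat \<Rightarrow> int) \<Rightarrow> nat \<Rightarrow> bool" where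
  "found cl S TN TD iu e \<longleftrightarrow> e \<in> S \<and> \<not> free cl e \<and> TN * lhs cl iu e < TD * PC * (\<Sum>k<3 * m. iu k)"

lemma wp_find:
  assumes st: "istat cl S TN TD a" and U: "a aIU 0 = (\<Sum>k<3 * m. a aIu k)"
  shows "wpL p_find (\<lambda>a' b'. a' aFnd 0 = 0 \<and> (\<forall>e<n. \<not> found cl S TN TD (a aIu) e) \<or>
     a' aFnd 0 = 1 \<and> (\<exists>e<n. found cl S TN TD (a aIu) e \<and> a' aRow 0 = int e \<and> max_IC cl (3 * m) e (a' aRM 0))) a b"
proof -
  have B: "base a" using st by (auto simp: istat_def)
  note [simp] = inpD[OF baseD(1)[OF B]]
  show ?thesis unfolding p_find_def wp.simps
  proof (rule wp_For[where N = n and I = "\<lambda>i a' b. a' aFnd 0 = 0 \<and> (\<forall>e<i. \<not> found cl S TN TD (a aIu) e) \<or>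
     a' aFnd 0 = 1 \<and> (\<exists>e<n. found cl S TN TD (a aIu) e \<and> a' aRow 0 = int e \<and> max_IC cl (3 * m) e (a' aRM 0))"], goal_cases)
    case (6 e a1 b1)
    have so: "same_off {aFnd, aRow, aRM, aLhs, aIM, aFr, i3, i4} False a b a1 b1"
      using 6(4) by (auto simp: same_off_def p_lhs_def)
    have st1: "istat cl S TN TD a1" by (rule istat_off[OF st so]) simp
    have BB: "a1 aBB e = (if e \<in> S then 1 else 0)" using st1 6(1) by (simp add: istat_def)
    have iu: "a1 aIu = a aIu" using same_offD[OF so] by simp
    show ?case
    proof (cases "e \<in> S \<and> a1 aFnd 0 = 0")
      case False
      then have "e \<notin> S \<or> a1 aFnd 0 = 1" using 6(2) by blast
      then show ?thesis
      proof
        assume "e \<notin> S"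
        then have "\<not> found cl S TN TD (a aIu) e" by (simp add: found_def)
        then show ?thesis using 6(2,3) BB \<open>e \<notin> S\<close> by (auto simp: less_Suc_eq)
      next
        assume "a1 aFnd 0 = 1"
        then show ?thesis using 6(2,3) BB by auto
      qed
    next
      case True
      have "wpL (p_lhs ;; When (HN 1 \<ominus> V aFr) (When (V aTD \<otimes> V aPi \<otimes> V aIU \<ominus> V aTN \<otimes> V aLhs)
         (SV aFnd (HN 1) ;; SV aRow (V i3) ;; SV aRM (V aIM))))
        (\<lambda>a' b'. upd a' i3 0 (int (Suc e)) aFnd 0 = 0 \<and> (\<forall>e'<Suc e. \<not> found cl S TN TD (a aIu) e') \<or>
         upd a' i3 0 (int (Suc e)) aFnd 0 = 1 \<and> (\<exists>e<n. found cl S TN TD (a aIu) e \<and>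
         upd a' i3 0 (int (Suc e)) aRow 0 = int e \<and> max_IC cl (3 * m) e (upd a' i3 0 (int (Suc e)) aRM 0))) a1 b1"
      proof (rule wp_seqI[OF wp_lhs[OF st1 6(1,3)]], goal_cases)
        case (1 a2 b2)
        have so2: "same_off {aLhs, aIM, aFr, i4} False a1 b1 a2 b2" using 1(2) by (auto simp: same_off_def p_lhs_def)
        have st2: "istat cl S TN TD a2" by (rule istat_off[OF st1 so2]) simp
        have [simp]: "a2 aTN 0 = TN" "a2 aTD 0 = TD" "a2 aPi 0 = PC" "a2 aFnd 0 = 0" "a2 i3 0 = int e"
            "a2 aIU 0 = (\<Sum>k<3 * m. a aIu k)" "a2 aLhs 0 = lhs cl (a aIu) e"
          using st2 baseD(4)[of a2] same_offD[OF so2] same_offD[OF so] True 6(3) U 1(1) iu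
          by (simp_all add: istat_def)
        have fnd: "found cl S TN TD (a aIu) e \<longleftrightarrow> \<not> free cl e \<and> TN * lhs cl (a aIu) e < TD * PC * (\<Sum>k<3 * m. a aIu k)"
          using True by (simp add: found_def)
        have nf: "\<forall>e'<e. \<not> found cl S TN TD (a aIu) e'" using 6(2) True by auto
        show ?case using 1(1) 6(1) fnd nf by (auto simp: less_Suc_eq)
      qed
      then show ?thesis using True BB 6(3) by simp
    qed
  qed (use L_facts in \<open>auto simp: p_lhs_def\<close>)
qed

lemma wp_upd:
  assumes st: "istat cl S TN TD a" and e: "e < n" "a aRow 0 = int e"
  shows "wpL p_upd (\<lambda>a' b'. (\<forall>e'<n. a' aLa e' = (if e' = e then a aLa e + PC div a aRM 0 else a aLa e')) \<and>
     (\<forall>k<3 * m. a' aIu k = a aIu k * (if e \<in> cand cl k then 200 * a aRM 0 + IC k else 200 * a aRM 0))) a b"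
proof -
  have B: "base a" and C: "bits_ok cl a" using st by (auto simp: istat_def)
  note [simp] = inpD[OF baseD(1)[OF B]]
  show ?thesis unfolding p_upd_def wp.simps
  proof (rule wp_For[where N = "3 * m" and I = "\<lambda>i a' b. (\<forall>e'<n. a' aLa e' = (if e' = e then a aLa e + PC div a aRM 0 else a aLa e')) \<and>
     (\<forall>k. a' aIu k = (if k < i then a aIu k * (if e \<in> cand cl k then 200 * a aRM 0 + IC k else 200 * a aRM 0) else a aIu k))"], goal_cases)
    case (6 k a1 b1)
    have so: "same_off {aLa, aIu, i3} False a b a1 b1" using 6(4) by (auto simp: same_off_def)
    have B': "base a1" by (rule base_off[OF B so]) simp
    have C': "bits_ok cl a1" by (rule bits_off[OF C so]) simp
    have [simp]: "a1 aRow 0 = int e" "a1 aRM = a aRM" "a1 aN = a aN" "a1 aIC k = IC k"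
        "a1 aCB (k * n + e) = (if e \<in> cand cl k then 1 else 0)"
      using same_offD[OF so] e baseD(5)[OF B' 6(1)] bits_okD[OF C' 6(1) e(1)] by simp_all
    show ?case using 6(2,3) by (auto simp: idxs less_Suc_eq)
  qed (use L_facts e baseD(4)[OF B] in auto)
qed

lemma wp_start:
  assumes "inp a"
  shows "wpL p_start (\<lambda>a' b'. (\<forall>k<3 * m. a' aIu k = 1) \<and> (\<forall>e<n. a' aLa e = 0) \<and> a' aSuc 0 = 0) a b"
proof -
  note [simp] = inpD[OF assms]
  have 1: "wpL (HFor i2 eM3 (HSet aIu (V i2) (HN 1))) (\<lambda>a' b'. \<forall>k<3 * m. a' aIu k = 1) a b"
    by (rule wp_For[where N = "3 * m" and I = "\<lambda>i a' b. \<forall>k<i. a' aIu k = 1"])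
      (use L_facts in \<open>auto simp: same_off_def less_Suc_eq\<close>)
  show ?thesis unfolding p_start_def
  proof (rule wp_seqI[OF 1], goal_cases)
    case (1 a1 b1)
    have [simp]: "a1 aN 0 = int n" using same_offD[OF 1(2), of aN] by simp
    have "wpL (HFor i2 (V aN) (HSet aLa (V i2) (HN 0))) (\<lambda>a' b'. (\<forall>k<3 * m. a' aIu k = 1) \<and> (\<forall>e<n. a' aLa e = 0)) a1 b1"
      by (rule wp_For[where N = n and I = "\<lambda>i a' b. (\<forall>k<3 * m. a' aIu k = 1) \<and> (\<forall>e<i. a' aLa e = 0)"])
        (use L_facts 1(1) in \<open>auto simp: same_off_def less_Suc_eq\<close>)
    then show ?case by (rule wp_seqI) auto
  qed
qed

text \<open>After a success the remaining passes of the loop are idle, so the invariant is an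
  alternative between the final cover and a running packing.\<close>

lemma wp_inner:
  assumes st: "istat cl S TN TD a" and S: "S \<in> \<A>" and cl: "\<And>e. 1 \<le> cl e" and TD: "0 < TD" and TN: "0 \<le> TN"
  shows "wpL p_inner (\<lambda>a' b'. a' aSuc 0 = 1 \<and> covers cl S (TN / TD) \<or>
     a' aSuc 0 = 0 \<and> (\<exists>iu. inner_st cl S TN TD (1440000 * m * m + 1) (a' aLa) iu)) a b"
  unfolding p_inner_def
proof (rule wp_seqI[OF wp_start], goal_cases)
  case 1
  then show ?case using st by (simp add: istat_def base_def)
next
  case (2 a0 b0)
  have so0: "same_off {aIu, aLa, aSuc, i2} False a b a0 b0" using 2(2) by (auto simp: same_off_def p_start_def)
  have st0: "istat cl S TN TD a0" by (rule istat_off[OF st so0]) simp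
  have B0: "base a0" using st0 by (auto simp: istat_def)
  note [simp] = inpD[OF baseD(1)[OF B0]]
  have lm: "1440000 * m * m + 1 \<le> L" using L_m .
  show ?case
  proof (rule wp_For[where N = "1440000 * m * m + 1" and I = "\<lambda>j a b. a aSuc 0 = 1 \<and> covers cl S (TN / TD) \<or>
     a aSuc 0 = 0 \<and> inner_st cl S TN TD j (a aLa) (a aIu)"], goal_cases)
    case (6 j a1 b1)
    have so1: "same_off {aIu, aLa, aSuc, aIU, aLhs, aIM, aFr, aFnd, aRow, aRM, i2, i3, i4} False a0 b0 a1 b1"
      using 6(4) by (auto simp: same_off_def p_iU_def p_find_def p_lhs_def p_upd_def)
    have st1: "istat cl S TN TD a1" by (rule istat_off[OF st0 so1]) simp
    have B1: "base a1" using st1 by (auto simp: istat_def)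
    show ?case
    proof (cases "a1 aSuc 0 = 1")
      case True
      then show ?thesis using 6(2) by (intro wp_if_neg) simp_all
    next
      case False
      then have suc: "a1 aSuc 0 = 0" and inn: "inner_st cl S TN TD j (a1 aLa) (a1 aIu)" using 6(2) by auto
      let ?Q = "\<lambda>a b. upd a i2 0 (int (Suc j)) aSuc 0 = 1 \<and> covers cl S (TN / TD) \<or>
        upd a i2 0 (int (Suc j)) aSuc 0 = 0 \<and> inner_st cl S TN TD (Suc j) (upd a i2 0 (int (Suc j)) aLa) (upd a i2 0 (int (Suc j)) aIu)"
      have "wpL (p_iU ;; p_find ;; HIf (V aFnd) p_upd (SV aSuc (HN 1))) ?Q a1 b1"
      proof (rule wp_seqI[OF wp_iU[OF baseD(1)[OF B1]]], goal_cases)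
        case (1 a2 b2)
        have so2: "same_off {aIU, i3} False a1 b1 a2 b2" using 1(2) by (auto simp: same_off_def p_iU_def)
        have st2: "istat cl S TN TD a2" by (rule istat_off[OF st1 so2]) simp
        have iu2: "a2 aIu = a1 aIu" "a2 aLa = a1 aLa" "a2 aSuc 0 = 0" using same_offD[OF so2] suc by simp_all
        have U2: "a2 aIU 0 = (\<Sum>k<3 * m. a2 aIu k)" using 1(1) iu2 by simp
        show ?case
        proof (rule wp_seqI[OF wp_find[OF st2 U2]], goal_cases)
          case (1 a3 b3)
          have so3: "same_off {aFnd, aRow, aRM, aLhs, aIM, aFr, i3, i4} False a2 b2 a3 b3"
            using 1(2) by (auto simp: same_off_def p_find_def p_lhs_def)
          have st3: "istat cl S TN TD a3" by (rule istat_off[OF st2 so3]) simp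
          have iu3: "a3 aIu = a1 aIu" "a3 aLa = a1 aLa" "a3 aSuc 0 = 0" using same_offD[OF so3] iu2 by simp_all
          from 1(1) show ?case
          proof (elim disjE conjE exE)
            assume f: "a3 aFnd 0 = 0" "\<forall>e<n. \<not> found cl S TN TD (a2 aIu) e"
            have "covers cl S (TN / TD)"
            proof (rule inner_covers[OF _ S _ TD TN])
              show "1 \<le> a1 aIu k" if "k < 3 * m" for k using inn that by (simp add: inner_st_def)
              show "1 \<le> cl e" for e by (rule cl)
              show "free cl e \<or> TD * PC * (\<Sum>k<3 * m. a1 aIu k) \<le> TN * lhs cl (a1 aIu) e" if "e \<in> S" for e
              proof -
                have "e < n" using scen_sub[OF S] that by auto
                then have "\<not> found cl S TN TD (a1 aIu) e" using f(2) iu2(1) by simp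
                then show ?thesis using that unfolding found_def by linarith
              qed
            qed
            then show ?thesis using f by (intro wp_if_neg) simp_all
          next
            fix e assume f: "a3 aFnd 0 = 1" "e < n" "found cl S TN TD (a2 aIu) e" "a3 aRow 0 = int e"
              "max_IC cl (3 * m) e (a3 aRM 0)"
            have fd: "e \<in> S" "\<not> free cl e" "TN * lhs cl (a1 aIu) e < TD * PC * (\<Sum>k<3 * m. a1 aIu k)"
              using f(3) iu2(1) by (auto simp: found_def)
            have "wpL p_upd ?Q a3 b3"
              using wp_frame[OF wp_upd[OF st3 f(2,4)]]
            proof (rule wp_mono, goal_cases)
              case (1 a4 b4)
              have so4: "same_off {aLa, aIu, i3} False a3 b3 a4 b4" using 1 by (auto simp: same_off_def p_upd_def)
              have "inner_st cl S TN TD (Suc j) (a4 aLa) (a4 aIu)"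
              proof (rule inner_step[OF inn S _ TD f(2) fd(1,2) f(5) fd(3)])
                show "1 \<le> cl e" for e by (rule cl)
              qed (use 1 iu3 in auto)
              moreover have "a4 aSuc 0 = 0" using same_offD[OF so4, of aSuc] iu3 by simp
              ultimately show ?case by simp
            qed
            then show ?thesis using f(1) by (intro wp_if_pos) simp_all
          qed
        qed
      qed
      then show ?thesis by (rule wp_if_pos[rotated]) (simp add: suc)
    qed
  next
    case 5
    show ?case using 2(1) by (auto intro!: inner_init)
  qed (use lm in \<open>auto simp: p_iU_def p_find_def p_lhs_def p_upd_def\<close>)
qed

end

section \<open>Violated rows\<close>

lemma sum_restrict_mult:
  "finite S \<Longrightarrow> (\<Sum>e\<in>S. if e \<in> T then w e * z else 0) = (\<Sum>e\<in>S \<inter> T. w e) * (z :: real)"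
  unfolding sum_distrib_right by (subst sum.inter_restrict) auto

context dr_run
begin

definition ldi :: "(nat \<Rightarrow> int) \<Rightarrow> (nat \<Rightarrow> int) \<Rightarrow> nat \<Rightarrow> int" where
  "ldi cl la k = (\<Sum>e<n. if e \<in> cand cl k then la e else 0)"

text \<open>\<open>ldi * IC\<close> is \<open>PC\<close> times the load, so \<open>x / PC\<close> is
  the largest load of a candidate. Zero-cost candidates contribute 0 because their \<open>IC\<close>
  is 0.\<close>

definition max_load :: "(nat \<Rightarrow> int) \<Rightarrow> (nat \<Rightarrow> int) \<Rightarrow> nat \<Rightarrow> int \<Rightarrow> bool" where
  "max_load cl la N x \<longleftrightarrow> 0 \<le> x \<and> (\<forall>k<N. ldi cl la k * IC k \<le> x) \<and> (x = 0 \<or> (\<exists>k<N. x = ldi cl la k * IC k))"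

lemma wp_ML:
  assumes B: "base a" and C: "bits_ok cl a"
  shows "wpL p_ML (\<lambda>a' b'. max_load cl (a aLa) (3 * m) (a' aML 0)) a b"
proof -
  note [simp] = inpD[OF baseD(1)[OF B]]
  show ?thesis unfolding p_ML_def wp.simps
  proof (rule wp_For[where N = "3 * m" and I = "\<lambda>i a' b. max_load cl (a aLa) i (a' aML 0)"], goal_cases)
    case (6 k a1 b1)
    have so1: "same_off {aML, aLd, i2, i3} False a b a1 b1" using 6(4) by (auto simp: same_off_def)
    have [simp]: "a1 aLa = a aLa" "a1 aN = a aN" "a1 aCB = a aCB" "a1 aIC = a aIC" using same_offD[OF so1] by simp_all
    have "wpL (HFor i3 (V aN) (When (HV aCB (V i2 \<otimes> V aN \<oplus> V i3)) (SV aLd (V aLd \<oplus> HV aLa (V i3)))))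
      (\<lambda>a' b'. a' aLd 0 = ldi cl (a aLa) k) (upd a1 aLd 0 0) b1"
    proof (rule wp_For[where N = n and I = "\<lambda>i a' b. a' aLd 0 = (\<Sum>e<i. if e \<in> cand cl k then a aLa e else 0)"], goal_cases)
      case (6 e a2 b2)
      have so2: "same_off {aLd, i3} False a1 b1 a2 b2" using 6(4) by (auto simp: same_off_def)
      have [simp]: "a2 i2 0 = int k" "a2 aLa = a aLa" "a2 aN = a aN" "a2 aCB = a aCB"
        using same_offD[OF so2] \<open>a1 i2 0 = int k\<close> by simp_all
      show ?case using 6(2,3) bits_okD[OF C \<open>k < 3 * m\<close> 6(1)] by (auto simp: idxs)
    qed (use L_facts in \<open>auto simp: ldi_def\<close>)
    then have "wpL (HFor i3 (V aN) (When (HV aCB (V i2 \<otimes> V aN \<oplus> V i3)) (SV aLd (V aLd \<oplus> HV aLa (V i3)))) ;;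
      When (V aLd \<otimes> HV aIC (V i2) \<ominus> V aML) (SV aML (V aLd \<otimes> HV aIC (V i2))))
      (\<lambda>a' b'. max_load cl (a aLa) (Suc k) (upd a' i2 0 (int (Suc k)) aML 0)) (upd a1 aLd 0 0) b1"
    proof (rule wp_seqI, goal_cases)
      case (1 a3 b3)
      have so3: "same_off {aLd, i3} False a1 b1 a3 b3" using 1(2) by (auto simp: same_off_def)
      have [simp]: "a3 i2 0 = int k" "a3 aIC k = IC k" "a3 aML = a1 aML"
        using same_offD[OF so3] 6(3) baseD(5)[OF B 6(1)] by simp_all
      show ?case using 1(1) 6(2) by (auto simp: max_load_def less_Suc_eq)
    qed
    then show ?case by simp
  qed (use L_facts in \<open>auto simp: max_load_def\<close>)
qed

text \<open>Each entry is the coefficient of a variable divided by its cost (\<open>c\<close>,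
  \<open>r\<close> or \<open>p\<close>) and multiplied by
  \<open>19 * mx * Dd * Ga * qd * rn * pn k\<close>, which clears all denominators. This factor is
  the \<open>\<psi>\<close> of \<open>row_from_inner\<close>.\<close>

definition row_vals :: "(nat \<Rightarrow> int) \<Rightarrow> (nat \<Rightarrow> int) \<Rightarrow> nat \<Rightarrow> int \<Rightarrow> int \<Rightarrow> int \<Rightarrow> (nat \<Rightarrow> int) \<Rightarrow> bool" where
  "row_vals cl la k qn qd mx PP \<longleftrightarrow>
    (\<forall>i<m. PP i = (\<Sum>e<n. if e \<in> SS i then la e * (3 + 2 * cl e) * PC else 0) * XF i * qd * rn * pn k) \<and>
    PP m = qn * rd * (19 * mx * Dd) * Ga * pn k \<and>
    (\<forall>k'<K. PP (m + 1 + k') = (if k' = k then pd k * (19 * mx * Dd) * Ga * qd * rn else 0))"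

lemma wp_row:
  assumes B: "base a" and C: "bits_ok cl a" and cl: "\<And>e. e < n \<Longrightarrow> a aCL e = cl e"
    and k: "k < K" "a i1 0 = int k" and q: "a aQn 0 = qn" "a aQd 0 = qd"
  shows "wpL p_row (\<lambda>a' b'. \<exists>mx. max_load cl (a aLa) (3 * m) mx \<and> row_vals cl (a aLa) k qn qd mx (a' aPP)) a b"
  unfolding p_row_def
proof (rule wp_seqI[OF wp_ML[OF B C]], goal_cases)
  case (1 a1 b1)
  have so1: "same_off {aML, aLd, i2, i3} False a b a1 b1" using 1(2) by (auto simp: same_off_def p_ML_def)
  define mx where "mx = a1 aML 0"
  let ?a2 = "upd a1 aWD 0 (19 * mx * Dd)"
  have so2: "same_off {aML, aLd, i2, i3, aWD} False a b ?a2 b1" using so1 by (auto simp: same_off_def)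
  have B2: "base ?a2" by (rule base_off[OF B so2]) simp
  have [simp]: "a1 aDd 0 = Dd" using same_offD[OF so1, of aDd] baseD(2)[OF B] by simp
  have z: "wpL (HFor i2 eMv (HSet aPP (V i2) (HN 0))) (\<lambda>a' b'. \<forall>i<Mv. a' aPP i = 0) ?a2 b1"
    by (rule wp_For[where N = Mv and I = "\<lambda>i a' b. \<forall>j<i. a' aPP j = 0"])
      (use L_facts inpD[OF baseD(1)[OF B2]] in \<open>auto simp: same_off_def less_Suc_eq Mv_def\<close>)
  have "wpL (HFor i2 eMv (HSet aPP (V i2) (HN 0)) ;;
   HFor i2 (V aM) (SV aOm (HN 0) ;;
     HFor i3 (V aN) (When (eBit (V i2) (V i3))
       (SV aOm (V aOm \<oplus> HV aLa (V i3) \<otimes> (HN 3 \<oplus> HN 2 \<otimes> HV aCL (V i3)) \<otimes> V aPi))) ;;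
     HSet aPP (V i2) (V aOm \<otimes> HV aXF (V i2) \<otimes> V aQd \<otimes> V aRn \<otimes> ePn)) ;;
   HSet aPP (V aM) (V aQn \<otimes> V aRd \<otimes> V aWD \<otimes> V aGa \<otimes> ePn) ;;
   HSet aPP (V aM \<oplus> HN 1 \<oplus> V i1) (ePd \<otimes> V aWD \<otimes> V aGa \<otimes> V aQd \<otimes> V aRn))
   (\<lambda>a' b'. row_vals cl (a aLa) k qn qd mx (a' aPP)) ?a2 b1"
  proof (rule wp_seqI[OF z], goal_cases)
    case (1 a3 b3)
    have so3: "same_off {aML, aLd, i2, i3, aWD, aPP} False a b a3 b3" using so2 1(2) by (auto simp: same_off_def)
    have wd3: "a3 aWD 0 = 19 * mx * Dd" using same_offD[OF 1(2), of aWD] by simp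
    have B3: "base a3" by (rule base_off[OF B so3]) simp
    note [simp] = inpD[OF baseD(1)[OF B3]]
    let ?om = "\<lambda>i. \<Sum>e<n. if e \<in> SS i then a aLa e * (3 + 2 * cl e) * PC else 0"
    have "wpL (HFor i2 (V aM) (SV aOm (HN 0) ;;
     HFor i3 (V aN) (When (eBit (V i2) (V i3))
       (SV aOm (V aOm \<oplus> HV aLa (V i3) \<otimes> (HN 3 \<oplus> HN 2 \<otimes> HV aCL (V i3)) \<otimes> V aPi))) ;;
     HSet aPP (V i2) (V aOm \<otimes> HV aXF (V i2) \<otimes> V aQd \<otimes> V aRn \<otimes> ePn)))
     (\<lambda>a' b'. (\<forall>i<m. a' aPP i = ?om i * XF i * qd * rn * pn k) \<and> (\<forall>i<Mv. m \<le> i \<longrightarrow> a' aPP i = 0)) a3 b3"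
    proof (rule wp_For[where N = m and I = "\<lambda>j a' b'. (\<forall>i<j. a' aPP i = ?om i * XF i * qd * rn * pn k) \<and>
        (\<forall>i<Mv. m \<le> i \<longrightarrow> a' aPP i = 0)"], goal_cases)
      case (6 i a4 b4)
      have so4: "same_off {i2, i3, aPP, aOm} False a3 b3 a4 b4" using 6(4) by (auto simp: same_off_def)
      have so4a: "same_off {aML, aLd, i2, i3, aWD, aPP, aOm} False a b a4 b4" using so3 so4 by (auto simp: same_off_def)
      have B4: "base a4" by (rule base_off[OF B so4a]) simp
      have [simp]: "a4 aLa = a aLa" "a4 aQd 0 = qd" "a4 i1 0 = int k" using same_offD[OF so4a] q k by simp_all
      have cl4: "e < n \<Longrightarrow> a4 aCL e = cl e" for e using same_offD[OF so4a, of aCL] cl by simp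
      note [simp] = inpD[OF baseD(1)[OF B4]]
      have "wpL (HFor i3 (V aN) (When (eBit (V i2) (V i3))
       (SV aOm (V aOm \<oplus> HV aLa (V i3) \<otimes> (HN 3 \<oplus> HN 2 \<otimes> HV aCL (V i3)) \<otimes> V aPi))))
       (\<lambda>a' b'. a' aOm 0 = ?om i) (upd a4 aOm 0 0) b4"
      proof (rule wp_For[where N = n and I = "\<lambda>j a' b'. a' aOm 0 = (\<Sum>e<j. if e \<in> SS i then a aLa e * (3 + 2 * cl e) * PC else 0)"], goal_cases)
        case (6 e a5 b5)
        have so5: "same_off {i3, aOm} False a4 b4 a5 b5" using 6(4) by (auto simp: same_off_def)
        have [simp]: "a5 i2 0 = int i" "a5 aLa = a aLa" "a5 aN = a4 aN" "a5 aINP = a4 aINP" "a5 aCL e = cl e" "a5 aPi 0 = PC"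
          using same_offD[OF so5] \<open>a4 i2 0 = int i\<close> cl4[OF 6(1)] baseD(4)[OF B4] by simp_all
        show ?case using 6(2,3) inpD(11)[OF baseD(1)[OF B4] \<open>i < m\<close> 6(1)] by (auto simp: idxs)
      qed (use L_facts in auto)
      then have "wpL (HFor i3 (V aN) (When (eBit (V i2) (V i3))
       (SV aOm (V aOm \<oplus> HV aLa (V i3) \<otimes> (HN 3 \<oplus> HN 2 \<otimes> HV aCL (V i3)) \<otimes> V aPi))) ;;
        HSet aPP (V i2) (V aOm \<otimes> HV aXF (V i2) \<otimes> V aQd \<otimes> V aRn \<otimes> ePn))
        (\<lambda>a' b'. (\<forall>i'<Suc i. upd a' i2 0 (int (Suc i)) aPP i' = ?om i' * XF i' * qd * rn * pn k) \<and>
        (\<forall>i'<Mv. m \<le> i' \<longrightarrow> upd a' i2 0 (int (Suc i)) aPP i' = 0)) (upd a4 aOm 0 0) b4"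
      proof (rule wp_seqI, goal_cases)
        case (1 a6 b6)
        have so6: "same_off {i3, aOm} False a4 b4 a6 b6" using 1(2) by (auto simp: same_off_def)
        have [simp]: "a6 i2 0 = int i" "a6 aXF i = XF i" "a6 aQd 0 = qd" "a6 aRn 0 = rn" "a6 oP 0 = int offP" "a6 i1 0 = int k"
            "a6 aINP (offP + 2 * k) = pn k" "a6 aPP = a4 aPP"
          using same_offD[OF so6] 6(3) baseD(7)[OF B4 6(1)] inpD(19)[OF baseD(1)[OF B4] k(1)] by simp_all
        show ?case using 1(1) 6(1,2) by (auto simp: idxs less_Suc_eq)
      qed
      then show ?case by simp
    qed (use L_facts 1(1) in auto)
    then show ?case
    proof (rule wp_seqI, goal_cases)
      case (1 a4 b4)
      have so4: "same_off {i2, i3, aPP, aOm} False a3 b3 a4 b4" using 1(2) by (auto simp: same_off_def)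
      have so4a: "same_off {aML, aLd, i2, i3, aWD, aPP, aOm} False a b a4 b4" using so3 so4 by (auto simp: same_off_def)
      have B4: "base a4" by (rule base_off[OF B so4a]) simp
      have [simp]: "a4 aWD 0 = 19 * mx * Dd" "a4 aQn 0 = qn" "a4 aQd 0 = qd" "a4 i1 0 = int k"
        using same_offD[OF so4, of aWD] wd3 same_offD[OF so4a] q k by simp_all
      note [simp] = inpD[OF baseD(1)[OF B4]] baseD(6)[OF B4]
      have [simp]: "a4 aINP (offP + 2 * k) = pn k" "a4 aINP (Suc (offP + 2 * k)) = pd k"
        using inpD(19,20)[OF baseD(1)[OF B4] k(1)] .
      show ?case using 1(1) k(1) by (auto simp: idxs row_vals_def Mv_def)
    qed
  qed
  then have "wpL (HFor i2 eMv (HSet aPP (V i2) (HN 0)) ;;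
   HFor i2 (V aM) (SV aOm (HN 0) ;;
     HFor i3 (V aN) (When (eBit (V i2) (V i3))
       (SV aOm (V aOm \<oplus> HV aLa (V i3) \<otimes> (HN 3 \<oplus> HN 2 \<otimes> HV aCL (V i3)) \<otimes> V aPi))) ;;
     HSet aPP (V i2) (V aOm \<otimes> HV aXF (V i2) \<otimes> V aQd \<otimes> V aRn \<otimes> ePn)) ;;
   HSet aPP (V aM) (V aQn \<otimes> V aRd \<otimes> V aWD \<otimes> V aGa \<otimes> ePn) ;;
   HSet aPP (V aM \<oplus> HN 1 \<oplus> V i1) (ePd \<otimes> V aWD \<otimes> V aGa \<otimes> V aQd \<otimes> V aRn))
   (\<lambda>a' b'. \<exists>mx. max_load cl (a aLa) (3 * m) mx \<and> row_vals cl (a aLa) k qn qd mx (a' aPP)) ?a2 b1"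
    by (rule wp_mono) (use 1(1) in \<open>auto simp: mx_def\<close>)
  then show ?case by (simp add: mx_def)
qed

text \<open>A row of the outer problem, given by \<open>k\<close>, \<open>S\<close> and a dual
  solution \<open>w\<close>, whose value at the current candidate does not exceed its right-hand
  side. \<open>PP\<close> is this row divided by the variable costs and scaled by
  \<open>\<psi>\<close>. Sets of first-stage cost 0 have coefficient 0, so the division is
  harmless.\<close>

definition row_spec :: "(nat \<Rightarrow> int) \<Rightarrow> int \<Rightarrow> int \<Rightarrow> (nat \<Rightarrow> int) \<Rightarrow> bool" where
  "row_spec u TA TB PP \<longleftrightarrow> (\<exists>k S w \<psi>. k < K \<and> S \<in> \<A> \<and> 0 < \<psi> \<and> (\<forall>e\<in>S. 0 \<le> w e) \<and>
     (\<forall>i<m. (\<Sum>e\<in>S \<inter> SS i. w e) \<le> d i) \<and> 0 < (\<Sum>e\<in>S. w e) \<and>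
     real_of_int TA / (TB * Us u) * (u (m + 1 + k) / p k + \<kappa> (AA k) S * u m / r +
       (\<Sum>i<m. if 0 < cn i then (\<Sum>e\<in>S \<inter> SS i. w e) * u i / c i else 0)) \<le> (\<Sum>e\<in>S. w e) \<and>
     (\<forall>i<m. 0 < cn i \<longrightarrow> PP i * c i = \<psi> * (\<Sum>e\<in>S \<inter> SS i. w e)) \<and>
     (\<forall>i<m. \<not> 0 < cn i \<longrightarrow> PP i = 0 \<and> (\<Sum>e\<in>S \<inter> SS i. w e) = 0) \<and>
     PP m * r = \<psi> * \<kappa> (AA k) S \<and>
     (\<forall>k'<K. PP (m + 1 + k') * p k' = (if k' = k then \<psi> else 0)))"

lemma XD_pos: "ust u TA TB \<Longrightarrow> 0 < XDs u TB"
  using Us_pos[of u TA TB] Ga_pos by (simp add: XDs_def ust_def)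

lemma XN_ratio:
  assumes "ust u TA TB" "i < m" "0 < cn i"
  shows "XNs u TA TB i / XDs u TB = real_of_int TA / (TB * Us u) * (u i / c i)"
proof -
  have c0: "0 < c i" using assms(3) cd_pos[of i] by (simp add: c_eq)
  have ga: "real_of_int Ga = XF i * c i" using XF_eq[OF assms(2,3)] by simp
  have "0 < real_of_int Ga" using Ga_pos by simp
  then have "real_of_int (XF i) \<noteq> 0" using ga by auto
  moreover have "0 < TB" "0 < Us u" using assms(1) Us_pos[OF assms(1)] by (auto simp: ust_def)
  ultimately show ?thesis using assms(3) c0 by (simp add: XNs_def XDs_def ga)
qed

lemma CLs_cases: "CLs u TA TB e = 1 \<or> CLs u TA TB e = 2 \<or> CLs u TA TB e = 3"
  by (simp add: CLs_def)

lemma CLs_ge: "1 \<le> CLs u TA TB e"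
  by (simp add: CLs_def)

text \<open>The third copy of a set, restricted to settled elements, costs nothing.\<close>

lemma class3_free:
  assumes "S \<in> \<A>" "e \<in> S" "cl e = 3"
  shows "free cl e"
proof -
  obtain T where "T \<in> set (sets_of I)" "e \<in> T" using scen_cov[OF assms(1)] assms(2) by auto
  then obtain i where i: "i < m" "e \<in> SS i" by (metis in_set_conv_nth)
  have "(3 * i + 2) div 3 = i" "(3 * i + 2) mod 3 = 2" by presburger+
  then have "e \<in> cand cl (3 * i + 2)" "CC (3 * i + 2) = 0" using i assms(3) by (simp_all add: cand_def CC_def)
  then show ?thesis unfolding free_def using i by (intro exI[of _ "3 * i + 2"]) auto
qed

text \<open>\<open>mwu_state_final\<close> bounds the largest load by the packing's value over the
  budget, up to 1.01. Reweighting by 5 and 7 and dividing by 19 times that load makes the packing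
  dual feasible for the original sets, with enough value left to violate the row.\<close>

lemma row_from_inner:
  assumes us: "ust u TA TB" and k: "k < K" and S: "S \<in> \<A>"
    and q: "qn = fst (quotient_of (scen_dist I (AA k) S))" "qd = snd (quotient_of (scen_dist I (AA k) S))"
    and cl: "cl = CLs u TA TB"
    and inn: "inner_st cl S (TNs u TA k qn qd) (TDs u TB k qd) (1440000 * m * m + 1) la iu"
    and ml: "max_load cl la (3 * m) mx" and pp: "row_vals cl la k qn qd mx PP"
  shows "row_spec u TA TB PP"
proof -
  have la0: "e < n \<Longrightarrow> 0 \<le> la e" and lan: "e < n \<Longrightarrow> la e \<noteq> 0 \<Longrightarrow> e \<in> S \<and> \<not> free cl e" for e
    using inn by (auto simp: inner_st_def)
  obtain e0 where e0: "e0 < n" "0 < la e0" using inn by (auto simp: inner_st_def)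
  have Sn: "S \<subseteq> {..<n}" using scen_sub[OF S] .
  have fS: "finite S" using Sn finite_subset by blast
  have cl12: "cl e = 1 \<or> cl e = 2" if "e < n" "la e \<noteq> 0" for e
    using lan[OF that] class3_free[OF S, of e cl] CLs_cases[of u TA TB e] cl by auto
  have cl1: "1 \<le> cl e" for e using CLs_ge cl by simp
  have kq: "\<kappa> (AA k) S = qn / qd" "0 < qd" using quot(1,2) q by simp_all
  have UTB: "0 < TB" "0 < Us u" "0 \<le> TA" using us Us_pos[OF us] by (auto simp: ust_def)
  have ldi0: "0 \<le> ldi cl la k'" for k' unfolding ldi_def using la0 by (intro sum_nonneg) auto
  have mx: "0 < mx"
  proof -
    obtain k1 where k1: "k1 < 3 * m" "e0 \<in> cand cl k1" using scen_in_cand[of S e0 cl] S lan[OF e0(1)] e0(2) cl1 by auto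
    have "0 < CC k1" using lan[OF e0(1)] e0(2) k1 by (auto simp: free_def)
    then have ic: "0 < IC k1" using IC_pos k1 by simp
    have "(if e0 \<in> cand cl k1 then la e0 else 0) \<le> ldi cl la k1"
      unfolding ldi_def using e0 la0 by (intro member_le_sum[where f = "\<lambda>e. if e \<in> cand cl k1 then la e else 0"]) auto
    then have "0 < ldi cl la k1" using e0 k1 by simp
    then have "0 < ldi cl la k1 * IC k1" using ic by simp
    then show ?thesis using ml k1 unfolding max_load_def by force
  qed
  have ldPC: "ldi cl la k' * PC \<le> mx * CC k'" if k': "k' < 3 * m" for k'
  proof (cases "0 < CC k'")
    case True
    have "ldi cl la k' * IC k' * CC k' \<le> mx * CC k'"
      using ml k' True unfolding max_load_def by (intro mult_right_mono) auto
    then show ?thesis using IC_eq[OF k' True] by (simp add: mult.assoc)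
  next
    case False
    have "ldi cl la k' = 0" unfolding ldi_def
      using lan False k' by (intro sum.neutral) (auto simp: free_def)
    then show ?thesis using CC_nonneg[OF k'] False by simp
  qed
  define \<Lambda> where "\<Lambda> = (\<Sum>e<n. real_of_int (la e))"
  define Tt where "Tt = real_of_int (TNs u TA k qn qd) / TDs u TB k qd"
  define \<theta> where "\<theta> = real_of_int TA / (TB * Us u) * (u (m + 1 + k) / p k)"
  define y where "y = real_of_int TA / (TB * Us u) * (u m / r)"
  have \<Lambda>0: "0 \<le> \<Lambda>" unfolding \<Lambda>_def using la0 by (intro sum_nonneg) auto
  have pos: "0 < pn k" "0 < pd k" "0 < rn" "0 < rd" using pn_pos[OF k] pd_pos rn_pos rd_pos by auto
  have Tt_eq: "Tt = 117 / 20 * Dd * (\<theta> + \<kappa> (AA k) S * y)"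
    using pos kq UTB unfolding Tt_def \<theta>_def y_def TNs_def TDs_def kq p_eq r_eq by (simp add: field_simps)
  have u1: "1 \<le> u m" "1 \<le> u (m + 1 + k)" using us k unfolding ust_def Mv_def by auto
  have TD0: "0 < TDs u TB k qd" using UTB pos kq by (simp add: TDs_def)
  have qn0: "0 \<le> qn" using kap_nonneg[OF AA_in[OF k] S] kq by (simp add: zero_le_divide_iff)
  have TN0: "0 \<le> TNs u TA k qn qd" using UTB pos kq u1 Dd_pos qn0 by (simp add: TNs_def)
  \<comment> \<open>The conclusion of the inner run: budget times largest load is at most 1.01 times
    the value of the packing. With budget 0 this is trivial.\<close>
  have Tml: "Tt * mx \<le> 101 / 100 * \<Lambda> * PC"
  proof (cases "0 < TNs u TA k qn qd")
    case True
    obtain k0 where k0: "k0 < 3 * m" "mx = ldi cl la k0 * IC k0" using ml mx unfolding max_load_def by auto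
    have C0: "0 < CC k0"
    proof (rule ccontr)
      assume "\<not> 0 < CC k0"
      then show False using IC_zero[of k0] k0 mx by simp
    qed
    have "mwu_state (3 * m) Tt (1440000 * m * m + 1) (\<lambda>k. iu k) (load cl la) \<Lambda>"
      using inn True unfolding inner_st_def \<Lambda>_def Tt_def by blast
    then have "Tt * load cl la k0 \<le> 101 / 100 * \<Lambda>"
      by (rule mwu_state_final) (use True TD0 k0 in \<open>auto simp: Tt_def power2_eq_square\<close>)
    moreover have "real_of_int mx = load cl la k0 * PC"
    proof -
      have "real_of_int PC = IC k0 * CC k0" using IC_eq[OF k0(1) C0] by (metis of_int_mult)
      moreover have "real_of_int (ldi cl la k0) = (\<Sum>e<n. if e \<in> cand cl k0 then real_of_int (la e) else 0)"
        unfolding ldi_def of_int_sum by (intro sum.cong) auto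
      ultimately show ?thesis using k0(2) C0 by (simp add: load_def)
    qed
    ultimately show ?thesis using mult_right_mono[of "Tt * load cl la k0" "101 / 100 * \<Lambda>" PC] PC_pos
      by (simp add: mult.assoc)
  next
    case False
    then have "Tt = 0" using TN0 by (simp add: Tt_def)
    then show ?thesis using \<Lambda>0 PC_pos by simp
  qed
  define W where "W = real_of_int (19 * mx * Dd)"
  have W0: "0 < W" using mx Dd_pos by (simp add: W_def)
  define w where "w e = real_of_int (la e * (3 + 2 * cl e) * PC) / W" for e
  have w0: "0 \<le> w e" if "e < n" for e
    using la0[OF that] cl1[of e] PC_pos W0 unfolding w_def by (intro divide_nonneg_pos) auto
  have wz: "w e = 0" if "e < n" "e \<notin> S" for e using lan[OF that(1)] that(2) by (auto simp: w_def)
  have wS: "(\<Sum>e\<in>S \<inter> SS i. w e) = real_of_int (\<Sum>e<n. if e \<in> SS i then la e * (3 + 2 * cl e) * PC else 0) / W"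
    if i: "i < m" for i
  proof -
    have "(\<Sum>e\<in>S \<inter> SS i. w e) = (\<Sum>e<n. if e \<in> SS i then w e else 0)"
      using Sn wz by (intro sum.mono_neutral_cong_left) (auto split: if_splits)
    also have "\<dots> = real_of_int (\<Sum>e<n. if e \<in> SS i then la e * (3 + 2 * cl e) * PC else 0) / W"
      unfolding of_int_sum sum_divide_distrib w_def by (intro sum.cong) auto
    finally show ?thesis .
  qed
  have wd: "(\<Sum>e\<in>S \<inter> SS i. w e) \<le> d i" if i: "i < m" for i
  proof -
    have md: "(3 * i) div 3 = i" "(3 * i) mod 3 = 0" "(3 * i + 1) div 3 = i" "(3 * i + 1) mod 3 = 1" by presburger+
    \<comment> \<open>Where \<open>la\<close> is nonzero the class is 1 or 2, and the factor 5 or 7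
      is 5 plus 2 on classes above 1. The sum is thus 5 times the load of the whole set plus 2 times
      that of its second copy, at most (5 * 3 + 2 * 2) d.\<close>
    have "(\<Sum>e<n. if e \<in> SS i then la e * (3 + 2 * cl e) * PC else 0) =
      (\<Sum>e<n. 5 * ((if e \<in> cand cl (3 * i) then la e else 0) * PC) + 2 * ((if e \<in> cand cl (3 * i + 1) then la e else 0) * PC))"
    proof (intro sum.cong refl)
      fix e assume "e \<in> {..<n}"
      then have "la e = 0 \<or> cl e = 1 \<or> cl e = 2" using cl12[of e] by auto
      moreover have "e \<in> cand cl (3 * i) \<longleftrightarrow> e \<in> SS i" using cl1[of e] unfolding cand_def md by auto
      moreover have "e \<in> cand cl (3 * i + 1) \<longleftrightarrow> e \<in> SS i \<and> 1 < cl e" unfolding cand_def md by auto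
      ultimately show "(if e \<in> SS i then la e * (3 + 2 * cl e) * PC else 0) =
        5 * ((if e \<in> cand cl (3 * i) then la e else 0) * PC) + 2 * ((if e \<in> cand cl (3 * i + 1) then la e else 0) * PC)"
        by auto
    qed
    also have "\<dots> = 5 * (ldi cl la (3 * i) * PC) + 2 * (ldi cl la (3 * i + 1) * PC)"
      unfolding ldi_def sum.distrib sum_distrib_left sum_distrib_right ..
    also have "\<dots> \<le> 5 * (mx * CC (3 * i)) + 2 * (mx * CC (3 * i + 1))"
      using ldPC[of "3 * i"] ldPC[of "3 * i + 1"] i by simp
    finally have le: "(\<Sum>e<n. if e \<in> SS i then la e * (3 + 2 * cl e) * PC else 0) \<le> 5 * (mx * CC (3 * i)) + 2 * (mx * CC (3 * i + 1))" .
    have c1: "real_of_int (CC (3 * i)) = 3 * Dd * d i" using CC_eq[of "3 * i"] i unfolding md by simp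
    have c2: "real_of_int (CC (3 * i + 1)) = 2 * Dd * d i" using CC_eq[of "3 * i + 1"] i unfolding md by simp
    from le have "real_of_int (\<Sum>e<n. if e \<in> SS i then la e * (3 + 2 * cl e) * PC else 0) \<le>
        real_of_int (5 * (mx * CC (3 * i)) + 2 * (mx * CC (3 * i + 1)))" by (simp only: of_int_le_iff)
    also have "\<dots> = 5 * (mx * real_of_int (CC (3 * i))) + 2 * (mx * real_of_int (CC (3 * i + 1)))" by simp
    also have "\<dots> = d i * W" unfolding c1 c2 W_def by (simp add: algebra_simps)
    finally show ?thesis unfolding wS[OF i] using W0 by (simp only: pos_divide_le_eq)
  qed
  \<comment> \<open>A set of first-stage cost 0 is taken fully by the candidate; its elements are
    settled, hence free, and carry no packing.\<close>
  have zeroc: "la e = 0" if "i < m" "\<not> 0 < cn i" "e \<in> SS i" "e < n" for i e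
  proof (rule ccontr)
    assume "la e \<noteq> 0"
    then have "cl e \<noteq> 3" using cl12[OF that(4)] by auto
    moreover have "XDs u TB \<le> Ys u TA TB e"
    proof -
      have nn: "0 \<le> XNs u TA TB j" if "j < m" for j
      proof -
        have "1 \<le> u j" using us that by (auto simp: ust_def Mv_def)
        then show ?thesis using UTB XF_nonneg[OF that] XD_pos[OF us] by (simp add: XNs_def)
      qed
      have "(if e \<in> SS i then XNs u TA TB i else 0) \<le> Ys u TA TB e"
        unfolding Ys_def using that(1) nn by (intro member_le_sum[where f = "\<lambda>i. if e \<in> SS i then XNs u TA TB i else 0"]) auto
      then show ?thesis using that by (simp add: XNs_def)
    qed
    ultimately show False using XD_pos[OF us] unfolding cl CLs_def by (auto split: if_splits)
  qed
  define cv where "cv e = real_of_int (Ys u TA TB e) / XDs u TB" for e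
  have cvs: "(\<Sum>e\<in>S. w e * cv e) = real_of_int TA / (TB * Us u) * (\<Sum>i<m. if 0 < cn i then (\<Sum>e\<in>S \<inter> SS i. w e) * u i / c i else 0)"
  proof -
    have "(\<Sum>e\<in>S. w e * cv e) = (\<Sum>e\<in>S. \<Sum>i<m. if e \<in> SS i then w e * (XNs u TA TB i / XDs u TB) else 0)"
      unfolding cv_def Ys_def of_int_sum sum_divide_distrib sum_distrib_left by (intro sum.cong) auto
    also have "\<dots> = (\<Sum>i<m. \<Sum>e\<in>S. if e \<in> SS i then w e * (XNs u TA TB i / XDs u TB) else 0)" by (rule sum.swap)
    also have "\<dots> = (\<Sum>i<m. (\<Sum>e\<in>S \<inter> SS i. w e) * (XNs u TA TB i / XDs u TB))"
      by (intro sum.cong refl sum_restrict_mult fS)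
    also have "\<dots> = (\<Sum>i<m. real_of_int TA / (TB * Us u) * (if 0 < cn i then (\<Sum>e\<in>S \<inter> SS i. w e) * u i / c i else 0))"
    proof (intro sum.cong refl)
      fix i assume "i \<in> {..<m}"
      then have i: "i < m" by simp
      show "(\<Sum>e\<in>S \<inter> SS i. w e) * (XNs u TA TB i / XDs u TB) =
        real_of_int TA / (TB * Us u) * (if 0 < cn i then (\<Sum>e\<in>S \<inter> SS i. w e) * u i / c i else 0)"
      proof (cases "0 < cn i")
        case True
        then show ?thesis using XN_ratio[OF us i True] by simp
      next
        case False
        have "(\<Sum>e\<in>S \<inter> SS i. w e) = 0" using zeroc[OF i False] Sn by (intro sum.neutral) (auto simp: w_def)
        then show ?thesis using False by simp
      qed
    qed
    finally show ?thesis by (simp only: sum_distrib_left)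
  qed
  have viol: "\<theta> + \<kappa> (AA k) S * y \<le> (\<Sum>e\<in>S. w e * (1 - cv e))"
  proof -
    \<comment> \<open>The residual demand is at least 2/3 in class 1 and at least 10/21 in class 2,
      and 5 * 2/3 = 7 * 10/21 = 10/3: the thresholds were chosen to make these agree.\<close>
    have "(10 / 3) * (PC / W) * la e \<le> w e * (1 - cv e)" if e: "e < n" for e
    proof (cases "la e = 0")
      case True
      then show ?thesis by (simp add: w_def)
    next
      case False
      have XD: "0 < real_of_int (XDs u TB)" using XD_pos[OF us] by simp
      consider "cl e = 1" | "cl e = 2" using cl12[OF e False] by blast
      then have "10 / 3 \<le> real_of_int (3 + 2 * cl e) * (1 - cv e)"
      proof cases
        case 1
        then have "3 * Ys u TA TB e < XDs u TB" unfolding cl CLs_def by (auto split: if_splits)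
        then have "3 * real_of_int (Ys u TA TB e) \<le> XDs u TB" by linarith
        then have "cv e \<le> 1 / 3" unfolding cv_def using XD by (simp add: divide_le_eq)
        then show ?thesis using 1 by simp
      next
        case 2
        then have "21 * Ys u TA TB e < 11 * XDs u TB" unfolding cl CLs_def by (auto split: if_splits)
        then have "21 * real_of_int (Ys u TA TB e) \<le> 11 * XDs u TB" by linarith
        then have "cv e \<le> 11 / 21" unfolding cv_def using XD by (simp add: divide_le_eq)
        then show ?thesis using 2 by simp
      qed
      then have "(PC / W * la e) * (10 / 3) \<le> (PC / W * la e) * (real_of_int (3 + 2 * cl e) * (1 - cv e))"
        using PC_pos W0 la0[OF e] by (intro mult_left_mono) auto
      moreover have "w e * (1 - cv e) = (PC / W * la e) * (real_of_int (3 + 2 * cl e) * (1 - cv e))"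
        by (simp add: w_def)
      moreover have "(10 / 3) * (PC / W) * la e = (PC / W * la e) * (10 / 3)" by simp
      ultimately show ?thesis by (simp only:)
    qed
    then have "(\<Sum>e<n. (10 / 3) * (PC / W) * la e) \<le> (\<Sum>e<n. w e * (1 - cv e))" by (intro sum_mono) auto
    also have "\<dots> = (\<Sum>e\<in>S. w e * (1 - cv e))"
      using Sn wz by (intro sum.mono_neutral_right) auto
    finally have 1: "(10 / 3) * (PC / W) * \<Lambda> \<le> (\<Sum>e\<in>S. w e * (1 - cv e))"
      unfolding \<Lambda>_def sum_distrib_left .
    have D0: "0 < real_of_int Dd" "0 < real_of_int mx" using Dd_pos mx by auto
    have "(\<theta> + \<kappa> (AA k) S * y) * (117 / 20 * Dd * mx) \<le> 101 / 100 * \<Lambda> * PC"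
      using Tml unfolding Tt_eq by (simp add: mult_ac)
    then have "\<theta> + \<kappa> (AA k) S * y \<le> (101 / 100 * \<Lambda> * PC) / (117 / 20 * Dd * mx)"
    proof (subst pos_le_divide_eq)
      show "0 < 117 / 20 * real_of_int Dd * real_of_int mx" using D0 by simp
    qed
    also have "\<dots> = (101 / 100 * (20 / 117)) * (\<Lambda> * PC / (Dd * mx))" by simp
    \<comment> \<open>101/100 * 20/117 <= 10/57 is where the budget factor 117/20 has to absorb the
      error 1.01 of the inner run on top of 57/10.\<close>
    also have "\<dots> \<le> (10 / 57) * (\<Lambda> * PC / (Dd * mx))"
      using D0 \<Lambda>0 PC_pos by (intro mult_right_mono divide_nonneg_pos mult_nonneg_nonneg) auto
    also have "\<dots> = (10 / 3) * (PC / W) * \<Lambda>" unfolding W_def by (simp add: mult_ac)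
    finally show ?thesis using 1 by linarith
  qed
  have wpos: "0 < (\<Sum>e\<in>S. w e)"
  proof (rule sum_pos2[OF fS])
    show "e0 \<in> S" using lan e0 by auto
    show "0 < w e0" using e0 cl1[of e0] PC_pos W0 unfolding w_def by (intro divide_pos_pos) auto
    show "0 \<le> w i" if "i \<in> S" for i using w0 Sn that by auto
  qed
  define \<psi> where "\<psi> = W * Ga * qd * rn * pn k"
  have "0 < \<psi>" unfolding \<psi>_def using W0 Ga_pos kq pos by simp
  moreover have "PP i * c i = \<psi> * (\<Sum>e\<in>S \<inter> SS i. w e)" if "i < m" "0 < cn i" for i
  proof -
    have "real_of_int (PP i) * c i = real_of_int (\<Sum>e<n. if e \<in> SS i then la e * (3 + 2 * cl e) * PC else 0) * (XF i * c i) * qd * rn * pn k"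
      using pp that unfolding row_vals_def by simp
    then show ?thesis unfolding XF_eq[OF that] wS[OF that(1)] \<psi>_def using W0 by simp
  qed
  moreover have "PP i = 0 \<and> (\<Sum>e\<in>S \<inter> SS i. w e) = 0" if "i < m" "\<not> 0 < cn i" for i
  proof
    show "PP i = 0" using pp that XF_zero[OF that] unfolding row_vals_def by simp
    show "(\<Sum>e\<in>S \<inter> SS i. w e) = 0" using zeroc[OF that] Sn by (intro sum.neutral) (auto simp: w_def)
  qed
  moreover have "PP m * r = \<psi> * \<kappa> (AA k) S"
    using pp pos kq unfolding row_vals_def r_eq \<psi>_def W_def by simp
  moreover have "PP (m + 1 + k') * p k' = (if k' = k then \<psi> else 0)" if "k' < K" for k'
    using pp pos that unfolding row_vals_def p_eq \<psi>_def W_def by simp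
  moreover have "real_of_int TA / (TB * Us u) * (u (m + 1 + k) / p k + \<kappa> (AA k) S * u m / r +
       (\<Sum>i<m. if 0 < cn i then (\<Sum>e\<in>S \<inter> SS i. w e) * u i / c i else 0)) \<le> (\<Sum>e\<in>S. w e)"
  proof -
    have "(\<Sum>e\<in>S. w e * (1 - cv e)) = (\<Sum>e\<in>S. w e) - (\<Sum>e\<in>S. w e * cv e)"
      by (simp add: right_diff_distrib sum_subtractf)
    then have "\<theta> + \<kappa> (AA k) S * y + (\<Sum>e\<in>S. w e * cv e) \<le> (\<Sum>e\<in>S. w e)" using viol by linarith
    moreover have "real_of_int TA / (TB * Us u) * (u (m + 1 + k) / p k + \<kappa> (AA k) S * u m / r + X) =
      \<theta> + \<kappa> (AA k) S * y + real_of_int TA / (TB * Us u) * X" for X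
      unfolding \<theta>_def y_def by (simp add: distrib_left)
    ultimately show ?thesis unfolding cvs by simp
  qed
  ultimately show ?thesis unfolding row_spec_def using k S w0 Sn wd wpos
    by (intro exI[of _ k] exI[of _ S] exI[of _ w] exI[of _ \<psi>]) auto
qed

text \<open>No violated row arises for \<open>k\<close>: the scenario returned for it can be covered
  within its enlarged budget.\<close>

definition good :: "(nat \<Rightarrow> int) \<Rightarrow> int \<Rightarrow> int \<Rightarrow> nat \<Rightarrow> bool" where
  "good u TA TB k \<longleftrightarrow> (\<exists>S\<in>\<A>. approx_scenario (cand (CLs u TA TB) ` set (klist (CLs u TA TB)))
      (\<lambda>S. of_rat (dqs (CLs u TA TB) u TB S)) \<A> \<kappa> \<beta>1 \<beta>2 (yqs u TA) (AA k) S \<and>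
    covers (CLs u TA TB) S (real_of_int (TNs u TA k (fst (quotient_of (scen_dist I (AA k) S))) (snd (quotient_of (scen_dist I (AA k) S))))
      / TDs u TB k (snd (quotient_of (scen_dist I (AA k) S)))))"

lemma wp_check:
  assumes o: "ost u TA TB a" and us: "ust u TA TB" and U: "a aU 0 = Us u"
    and CL: "\<And>e. e < n \<Longrightarrow> a aCL e = CLs u TA TB e" and C: "bits_ok (CLs u TA TB) a" and Kp: "keep_ok (CLs u TA TB) a"
  shows "wpL p_check (\<lambda>a' b'. a' aViol 0 = 1 \<and> row_spec u TA TB (a' aPP) \<or> a' aViol 0 = 0 \<and> (\<forall>k<K. good u TA TB k)) a b"
proof -
  define cl where "cl = CLs u TA TB"
  have cl1: "1 \<le> cl e" for e using CLs_ge by (simp add: cl_def)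
  have B: "base a" using o by (simp add: ost_def)
  note [simp] = inpD[OF baseD(1)[OF B]]
  let ?M = "{aBB, i2, i3, aQn, aQd, aTN, aTD, aIu, aLa, aSuc, aIU, aLhs, aIM, aFr, aFnd, aRow, aRM, i4, aML, aLd, aWD, aPP, aOm, aViol, i1}"
  have mods: "insert i1 (mods (When (HN 1 \<ominus> V aViol) (p_ask ;; p_dist ;; p_target ;; p_inner ;;
      When (HN 1 \<ominus> V aSuc) (p_row ;; SV aViol (HN 1))))) \<subseteq> ?M"
    by (auto simp: mods_frag)
  show ?thesis unfolding p_check_def wp.simps(5) wp.simps(2)
  proof (rule wp_For[where N = K and I = "\<lambda>k a b. a aViol 0 = 1 \<and> row_spec u TA TB (a aPP) \<or>
      a aViol 0 = 0 \<and> (\<forall>k'<k. good u TA TB k')"], goal_cases)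
    case (6 k a1 b1)
    have so1: "same_off ?M True a b a1 b1" using 6(4) mods unfolding same_off_def by auto
    show ?case
    proof (cases "a1 aViol 0 = 1")
      case True
      then show ?thesis using 6(2) by (intro wp_if_neg) simp_all
    next
      case False
      then have v0: "a1 aViol 0 = 0" and gd: "\<forall>k'<k. good u TA TB k'" using 6(2) by auto
      have o1: "ost u TA TB a1" by (rule ost_off[OF o so1]) simp
      have B1: "base a1" using o1 by (simp add: ost_def)
      have C1: "bits_ok cl a1" unfolding cl_def by (rule bits_off[OF C so1]) simp
      have Kp1: "keep_ok cl a1" using Kp same_offD[OF so1, of aCnt] same_offD[OF so1, of aKL] by (simp add: keep_ok_def cl_def)
      have x1: "a1 aTB 0 = TB" "a1 aTA 0 = TA" "a1 aU 0 = Us u" "a1 aW m = u m"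
        using o1 same_offD[OF so1, of aU] U by (simp_all add: ost_def Mv_def)
      let ?Q = "\<lambda>a b. upd a i1 0 (int (Suc k)) aViol 0 = 1 \<and> row_spec u TA TB (upd a i1 0 (int (Suc k)) aPP) \<or>
        upd a i1 0 (int (Suc k)) aViol 0 = 0 \<and> (\<forall>k'<Suc k. good u TA TB k')"
      have "wpL (p_ask ;; p_dist ;; p_target ;; p_inner ;; When (HN 1 \<ominus> V aSuc) (p_row ;; SV aViol (HN 1))) ?Q a1 b1"
      proof (rule wp_seqI[OF wp_ask[OF B1 Kp1 C1 6(1,3) x1 us]], goal_cases)
        case 1
        then show ?case by (rule cl1)
      next
        case (2 a2 b2)
        then obtain S where S: "S \<in> \<A>" "\<And>e. e < n \<Longrightarrow> a2 aBB e = (if e \<in> S then 1 else 0)"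
          "approx_scenario (cand cl ` set (klist cl)) (\<lambda>S. of_rat (dqs cl u TB S)) \<A> \<kappa> \<beta>1 \<beta>2 (yqs u TA) (AA k) S" by auto
        have so2: "same_off {aBB, i2, i3} True a1 b1 a2 b2" using 2(2) by (auto simp: same_off_def mods_frag)
        have B2: "base a2" by (rule base_off[OF B1 so2]) simp
        have k2: "a2 i1 0 = int k" using same_offD[OF so2] 6(3) by simp
        define qn qd where "qn = fst (quotient_of (scen_dist I (AA k) S))" and "qd = snd (quotient_of (scen_dist I (AA k) S))"
        show ?case
        proof (rule wp_seqI[OF wp_dist[OF baseD(1)[OF B2] 6(1) k2 S(1)]], goal_cases)
          case (1 e)
          then show ?case by (rule S(2))
        next
          case (2 a3 b3)
          have so3: "same_off {aBB, i2, i3, aQn, aQd} True a1 b1 a3 b3"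
            using so2 2(2) by (auto simp: same_off_def mods_frag)
          have BB3: "a3 aBB = a2 aBB" using same_offD[OF 2(2), of aBB] by (simp add: mods_frag)
          have q3: "a3 aQn 0 = qn" "a3 aQd 0 = qd" using 2(1) by (simp_all add: qn_def qd_def)
          have o3: "ost u TA TB a3" by (rule ost_off[OF o1 so3]) simp
          have k3: "a3 i1 0 = int k" "a3 aU 0 = Us u" using same_offD[OF so3] 6(3) x1 by simp_all
          show ?case
          proof (rule wp_seqI[OF wp_target[OF o3 k3(2) 6(1) k3(1) q3]], goal_cases)
            case (1 a4 b4)
            define TN TD where "TN = TNs u TA k qn qd" and "TD = TDs u TB k qd"
            have t4: "a4 aTN 0 = TN" "a4 aTD 0 = TD" using 1(1) by (simp_all add: TN_def TD_def)
            have so34: "same_off {aTN, aTD} False a3 b3 a4 b4" using 1(2) by (auto simp: same_off_def mods_frag p_target_def)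
            have so4: "same_off {aBB, i2, i3, aQn, aQd, aTN, aTD} True a1 b1 a4 b4"
              using so3 so34 by (auto simp: same_off_def)
            have st4: "istat cl S TN TD a4"
              unfolding istat_def using t4 base_off[OF B1 so4] bits_off[OF C1 so4] same_offD[OF so34, of aBB] BB3 S(2) by simp
            have qd0: "0 < qd" using quot(2) by (simp add: qd_def)
            have kq: "\<kappa> (AA k) S = qn / qd" using quot(1) by (simp add: qn_def qd_def)
            have qn0: "0 \<le> qn" using kap_nonneg[OF AA_in[OF 6(1)] S(1)] kq qd0 by (simp add: zero_le_divide_iff)
            have UTB: "0 < TB" "0 < Us u" "0 \<le> TA" using us Us_pos[OF us] by (auto simp: ust_def)
            have pos: "0 < pn k" "0 < pd k" "0 < rn" "0 < rd" using pn_pos[OF 6(1)] pd_pos rn_pos rd_pos by auto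
            have u1: "1 \<le> u m" "1 \<le> u (m + 1 + k)" using us 6(1) unfolding ust_def Mv_def by auto
            have TD0: "0 < TD" using UTB pos qd0 by (simp add: TD_def TDs_def)
            have TN0: "0 \<le> TN" using UTB pos qd0 qn0 u1 Dd_pos by (simp add: TN_def TNs_def)
            have wi: "wpL p_inner (\<lambda>a' b'. a' aSuc 0 = 1 \<and> covers cl S (TN / TD) \<or>
               a' aSuc 0 = 0 \<and> (\<exists>iu. inner_st cl S TN TD (1440000 * m * m + 1) (a' aLa) iu)) a4 b4"
              by (rule wp_inner[OF st4 S(1) _ TD0 TN0]) (rule cl1)
            show ?case
            proof (rule wp_seqI[OF wi], goal_cases)
              case (1 a5 b5)
              have so5: "same_off (?M - {aViol, i1, aPP}) True a1 b1 a5 b5"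
                using so4 1(2) by (auto simp: same_off_def mods_frag)
              have e5: "a5 aViol 0 = 0" "a5 i1 0 = int k" using same_offD[OF so5] v0 6(3) by simp_all
              from 1(1) show ?case
              proof (elim disjE conjE exE)
                assume s: "a5 aSuc 0 = 1" "covers cl S (TN / TD)"
                have "good u TA TB k" unfolding good_def cl_def[symmetric]
                  using S(1,3) s(2) by (intro bexI[of _ S]) (simp_all add: TN_def TD_def qn_def qd_def)
                then have "\<forall>k'<Suc k. good u TA TB k'" using gd by (simp add: less_Suc_eq)
                then show ?thesis using s(1) e5 by (intro wp_if_neg) simp_all
              next
                fix iu assume s: "a5 aSuc 0 = 0" "inner_st cl S TN TD (1440000 * m * m + 1) (a5 aLa) iu"
                have B5: "base a5" by (rule base_off[OF B1 so5]) simp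
                have C5: "bits_ok cl a5" by (rule bits_off[OF C1 so5]) simp
                have so345: "same_off (?M - {aViol, i1, aPP, aQn, aQd}) True a3 b3 a5 b5"
                  using so34 1(2) by (auto simp: same_off_def mods_frag)
                have q5: "a5 aQn 0 = qn" "a5 aQd 0 = qd" using same_offD[OF so345] q3 by simp_all
                have CL5: "a5 aCL e = cl e" if "e < n" for e
                  using same_offD[OF so5, of aCL] same_offD[OF so1, of aCL] CL[OF that] by (simp add: cl_def)
                have "wpL (p_row ;; SV aViol (HN 1)) ?Q a5 b5"
                proof (rule wp_seqI[OF wp_row[OF B5 C5 CL5 6(1) e5(2) q5]], goal_cases)
                  case (1 e)
                  then show ?case by simp
                next
                  case (2 a6 b6)
                  then have "row_spec u TA TB (a6 aPP)"
                    using row_from_inner[OF us 6(1) S(1) qn_def qd_def cl_def] s(2) by (auto simp: TN_def TD_def)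
                  then show ?case by simp
                qed
                then show ?thesis using s(1) by (intro wp_if_pos) simp_all
              qed
            qed
          qed
        qed
      qed
      then show ?thesis by (rule wp_if_pos[rotated]) (simp add: v0)
    qed
  qed (use L_facts in \<open>auto simp: mods_frag\<close>)
qed

end

section \<open>The outer covering problem\<close>

context dr_run
begin

lemma sum_Mv: "(\<Sum>i<Mv. f i) = (\<Sum>i<m. f i) + f m + (\<Sum>k<K. f (m + 1 + k) :: 'b :: comm_monoid_add)"
proof -
  have "(\<Sum>i<m + 1 + j. f i) = (\<Sum>i<m. f i) + f m + (\<Sum>k<j. f (m + 1 + k))" for j
    by (induction j) (simp_all add: add.assoc)
  then show ?thesis by (simp add: Mv_def)
qed

text \<open>Left-hand sides of the dual constraints divided by their right-hand sides
  \<open>c\<close>, \<open>r\<close> and \<open>p\<close>, for the accumulated certificate. For sets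
  of cost 0 the constraint is kept separately as \<open>G i = 0\<close>.\<close>

definition oload :: "(nat \<Rightarrow> nat set \<Rightarrow> real) \<Rightarrow> (nat \<Rightarrow> real) \<Rightarrow> nat \<Rightarrow> real" where
  "oload \<gamma> G i = (if i < m then if 0 < cn i then G i / c i else 0
     else if i = m then (\<Sum>k<K. \<Sum>B\<in>\<A>. \<kappa> (AA k) B * \<gamma> k B) / r
     else (\<Sum>B\<in>\<A>. \<gamma> (i - m - 1) B) / p (i - m - 1))"

definition T0 :: real where "T0 = r / (r + \<kappa>max)"

text \<open>The optimum may be 0, so the value 0 is tried first, and no certificate is kept for it.
  One violated row is enough there: it exhibits a scenario with positive recourse, which gives
  \<open>T0 <= opt\<close>.\<close>

definition outer_st :: "(nat \<Rightarrow> int) \<Rightarrow> int \<Rightarrow> int \<Rightarrow> nat \<Rightarrow> bool" where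
  "outer_st u TA TB t \<longleftrightarrow> ust u TA TB \<and> (0 < TA \<longrightarrow> (\<exists>\<gamma> G \<Lambda>. cert \<gamma> G \<Lambda> \<and>
      mwu_state Mv (TA / TB) t (\<lambda>i. u i) (oload \<gamma> G) \<Lambda> \<and> (\<forall>i<m. \<not> 0 < cn i \<longrightarrow> G i = 0))) \<and>
     (0 < t \<longrightarrow> T0 \<le> opt)"

lemma outer_init: "0 \<le> TA \<Longrightarrow> 0 < TB \<Longrightarrow> outer_st (\<lambda>_. 1) TA TB 0"
proof -
  assume h: "0 \<le> TA" "0 < TB"
  have "oload (\<lambda>_ _. 0) (\<lambda>_. 0) i = 0" for i by (simp add: oload_def)
  then have "mwu_state Mv (TA / TB) 0 (\<lambda>i. real_of_int 1) (oload (\<lambda>_ _. 0) (\<lambda>_. 0)) 0"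
    by (intro mwu_state_cong[OF mwu_state_init]) simp_all
  then show ?thesis unfolding outer_st_def ust_def using h cert_init by blast
qed

lemma row_nonneg:
  assumes "row_spec u TA TB PP"
  shows "\<And>i. i < Mv \<Longrightarrow> 0 \<le> PP i" "\<exists>i<Mv. 0 < PP i"
proof -
  from assms obtain k S w \<psi> where r1: "k < K" "S \<in> \<A>" "0 < \<psi>" "\<forall>e\<in>S. 0 \<le> w e"
    "\<forall>i<m. 0 < cn i \<longrightarrow> PP i * c i = \<psi> * (\<Sum>e\<in>S \<inter> SS i. w e)"
    "\<forall>i<m. \<not> 0 < cn i \<longrightarrow> PP i = 0 \<and> (\<Sum>e\<in>S \<inter> SS i. w e) = 0"
    "PP m * r = \<psi> * \<kappa> (AA k) S" "\<forall>k'<K. PP (m + 1 + k') * p k' = (if k' = k then \<psi> else 0)"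
    unfolding row_spec_def by blast
  have "0 < real_of_int (PP (m + 1 + k)) * p k" using r1 by simp
  then have "0 < PP (m + 1 + k)" using p_pos[OF r1(1)] by (simp add: zero_less_mult_iff)
  then show "\<exists>i<Mv. 0 < PP i" using r1(1) by (intro exI[of _ "m + 1 + k"]) (auto simp: Mv_def)
  fix i assume i: "i < Mv"
  consider "i < m" "0 < cn i" | "i < m" "\<not> 0 < cn i" | "i = m" | k' where "i = m + 1 + k'" "k' < K"
  proof -
    assume h: "i < m \<Longrightarrow> 0 < cn i \<Longrightarrow> thesis" "i < m \<Longrightarrow> \<not> 0 < cn i \<Longrightarrow> thesis" "i = m \<Longrightarrow> thesis"
      "\<And>k'. i = m + 1 + k' \<Longrightarrow> k' < K \<Longrightarrow> thesis"
    show thesis using h(1,2,3) h(4)[of "i - m - 1"] i by (cases "i < m"; cases "i = m") (auto simp: Mv_def)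
  qed
  then show "0 \<le> PP i"
  proof cases
    case 1
    have "0 < c i" using 1 cd_pos[of i] by (simp add: c_eq)
    moreover have "0 \<le> (\<Sum>e\<in>S \<inter> SS i. w e)" using r1(4) by (intro sum_nonneg) auto
    then have "0 \<le> real_of_int (PP i) * c i" using r1(5) 1 r1(3) by simp
    ultimately show ?thesis by (simp add: zero_le_mult_iff)
  next
    case 2
    then show ?thesis using r1(6) by simp
  next
    case 3
    have "0 \<le> real_of_int (PP m) * r" using r1(7,3) kap_nonneg[OF AA_in[OF r1(1)] r1(2)] by simp
    then show ?thesis using r_pos 3 by (simp add: zero_le_mult_iff)
  next
    case 4
    have "0 \<le> real_of_int (PP i) * p k'" using r1(8,3) 4 by simp
    then show ?thesis using p_pos[OF 4(2)] by (simp add: zero_le_mult_iff)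
  qed
qed

lemma outer_step:
  assumes st: "outer_st u TA TB t" and row: "row_spec u TA TB PP"
    and PM: "\<And>i. i < Mv \<Longrightarrow> PP i \<le> PM" "\<exists>i<Mv. PP i = PM"
    and u': "\<And>i. i < Mv \<Longrightarrow> u' i = u i * (200 * PM + PP i)"
  shows "outer_st u' TA TB (Suc t)"
proof -
  from row obtain k S and w :: "nat \<Rightarrow> real" and \<psi> where rr: "k < K" "S \<in> \<A>" "0 < \<psi>" "\<forall>e\<in>S. 0 \<le> w e"
    "\<forall>i<m. (\<Sum>e\<in>S \<inter> SS i. w e) \<le> d i" "0 < (\<Sum>e\<in>S. w e)"
    "real_of_int TA / (TB * Us u) * (u (m + 1 + k) / p k + \<kappa> (AA k) S * u m / r +
       (\<Sum>i<m. if 0 < cn i then (\<Sum>e\<in>S \<inter> SS i. w e) * u i / c i else 0)) \<le> (\<Sum>e\<in>S. w e)"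
    "\<forall>i<m. 0 < cn i \<longrightarrow> PP i * c i = \<psi> * (\<Sum>e\<in>S \<inter> SS i. w e)"
    "\<forall>i<m. \<not> 0 < cn i \<longrightarrow> PP i = 0 \<and> (\<Sum>e\<in>S \<inter> SS i. w e) = 0"
    "PP m * r = \<psi> * \<kappa> (AA k) S" "\<forall>k'<K. PP (m + 1 + k') * p k' = (if k' = k then \<psi> else 0)"
    unfolding row_spec_def by (elim exE conjE) (rule that; assumption)
  note r1 = rr[rule_format]
  note PP0 = row_nonneg[OF row]
  obtain i0 where "i0 < Mv" "0 < PP i0" using PP0(2) by blast
  then have PM0: "0 < PM" using PM(1)[of i0] by linarith
  have us: "ust u TA TB" using st by (simp add: outer_st_def)
  have UTB: "0 < TB" "0 < Us u" using us Us_pos[OF us] by (auto simp: ust_def)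
  have us': "ust u' TA TB"
  proof -
    have "1 \<le> u' i" if i: "i < Mv" for i
    proof -
      have "1 * 1 \<le> u i * (200 * PM + PP i)"
      proof (rule mult_mono)
        show "1 \<le> u i" using us i unfolding ust_def by blast
        then show "0 \<le> u i" by simp
        show "1 \<le> 200 * PM + PP i" using PP0(1)[OF i] PM0 by linarith
      qed simp
      then show ?thesis using u'[OF i] by simp
    qed
    then show ?thesis using us by (simp add: ust_def)
  qed
  \<comment> \<open>At first stage 0 the dual solution \<open>w\<close> of the row has positive
    value, so the recourse of \<open>S\<close> is positive and \<open>opt_ge_of_non_null\<close>
    applies.\<close>
  have "T0 \<le> opt"
  proof -
    have "(\<Sum>e\<in>S. w e * (1 - cov (\<lambda>_. 0) e)) \<le> g (\<lambda>_. 0) S" by (rule g_ge[OF r1(2,4,5)])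
    then have "0 < g (\<lambda>_. 0) S" using r1(6) by simp
    then show ?thesis unfolding T0_def by (rule opt_ge_of_non_null[OF nonnull r1(2)])
  qed
  moreover have "\<exists>\<gamma> G \<Lambda>. cert \<gamma> G \<Lambda> \<and> mwu_state Mv (TA / TB) (Suc t) (\<lambda>i. u' i) (oload \<gamma> G) \<Lambda> \<and>
      (\<forall>i<m. \<not> 0 < cn i \<longrightarrow> G i = 0)" if TA: "0 < TA"
  proof -
    obtain \<gamma> G \<Lambda> where c1: "cert \<gamma> G \<Lambda>" and mw: "mwu_state Mv (TA / TB) t (\<lambda>i. u i) (oload \<gamma> G) \<Lambda>"
      and G0: "\<And>i. i < m \<Longrightarrow> \<not> 0 < cn i \<Longrightarrow> G i = 0" using st TA unfolding outer_st_def by blast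
    \<comment> \<open>With q = \<open>PP / PM\<close>, adding \<open>\<sigma>\<close> copies of the
      row to the certificate raises the normalised load of variable \<open>i\<close> by exactly
      \<open>q i\<close>.\<close>
    define \<sigma> where "\<sigma> = \<psi> / PM"
    have s0: "0 < \<sigma>" using r1(3) PM0 by (simp add: \<sigma>_def)
    define \<gamma>' where "\<gamma>' = bump \<gamma> k S \<sigma>"
    define G' where "G' i = G i + \<sigma> * (\<Sum>e\<in>S \<inter> SS i. w e)" for i
    define \<Lambda>' where "\<Lambda>' = \<Lambda> + \<sigma> * (\<Sum>e\<in>S. w e)"
    have ct: "cert \<gamma>' G' \<Lambda>'" unfolding \<gamma>'_def G'_def \<Lambda>'_def
      by (rule cert_step[OF c1 r1(1,2)]) (use s0 r1 in auto)
    define q where "q i = real_of_int (PP i) / PM" for i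
    have qi1: "q i * c i = \<sigma> * (\<Sum>e\<in>S \<inter> SS i. w e)" if "i < m" "0 < cn i" for i
      using r1(8)[OF that] by (simp add: q_def \<sigma>_def)
    have qm: "q m * r = \<sigma> * \<kappa> (AA k) S" using r1(10) by (simp add: q_def \<sigma>_def)
    have qk: "q (m + 1 + k') * p k' = (if k' = k then \<sigma> else 0)" if "k' < K" for k'
      using r1(11)[OF that] by (simp add: q_def \<sigma>_def split: if_splits)
    have ci: "0 < c i" if "0 < cn i" for i using that cd_pos[of i] by (simp add: c_eq)
    have ol: "oload \<gamma> G i + q i = oload \<gamma>' G' i" if i: "i < Mv" for i
    proof -
      consider "i < m" "0 < cn i" | "i < m" "\<not> 0 < cn i" | "i = m" | k' where "i = m + 1 + k'" "k' < K"
      proof -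
        assume h: "i < m \<Longrightarrow> 0 < cn i \<Longrightarrow> thesis" "i < m \<Longrightarrow> \<not> 0 < cn i \<Longrightarrow> thesis" "i = m \<Longrightarrow> thesis"
          "\<And>k'. i = m + 1 + k' \<Longrightarrow> k' < K \<Longrightarrow> thesis"
        show thesis using h(1,2,3) h(4)[of "i - m - 1"] i by (cases "i < m"; cases "i = m") (auto simp: Mv_def)
      qed
      then show ?thesis
      proof cases
        case 1
        have "q i = \<sigma> * (\<Sum>e\<in>S \<inter> SS i. w e) / c i" using qi1[OF 1] ci[OF 1(2)] by (simp add: eq_divide_eq)
        then show ?thesis using 1 by (simp add: oload_def G'_def add_divide_distrib)
      next
        case 2
        then show ?thesis using r1(9)[OF 2] by (simp add: oload_def q_def)
      next
        case 3
        have "(\<Sum>k'<K. \<Sum>B\<in>\<A>. \<kappa> (AA k') B * \<gamma>' k' B) =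
          (\<Sum>k'<K. (\<Sum>B\<in>\<A>. \<kappa> (AA k') B * \<gamma> k' B) + (if k' = k then \<kappa> (AA k') S * \<sigma> else 0))"
          unfolding \<gamma>'_def by (intro sum.cong refl bump_sum r1)
        also have "\<dots> = (\<Sum>k'<K. \<Sum>B\<in>\<A>. \<kappa> (AA k') B * \<gamma> k' B) + \<kappa> (AA k) S * \<sigma>"
          using r1(1) by (simp add: sum.distrib sum.delta)
        finally have e: "(\<Sum>k'<K. \<Sum>B\<in>\<A>. \<kappa> (AA k') B * \<gamma>' k' B) = (\<Sum>k'<K. \<Sum>B\<in>\<A>. \<kappa> (AA k') B * \<gamma> k' B) + \<kappa> (AA k) S * \<sigma>" .
        have "q m = \<kappa> (AA k) S * \<sigma> / r" using qm r_pos by (simp add: eq_divide_eq mult.commute)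
        then show ?thesis using 3 by (simp add: oload_def e add_divide_distrib)
      next
        case 4
        have e: "(\<Sum>B\<in>\<A>. \<gamma>' k' B) = (\<Sum>B\<in>\<A>. \<gamma> k' B) + (if k' = k then \<sigma> else 0)"
          using bump_sum[OF r1(2), of "\<lambda>_. 1" \<gamma> k \<sigma> k'] by (simp add: \<gamma>'_def)
        have "q i = (if k' = k then \<sigma> else 0) / p k'" using qk[OF 4(2)] p_pos[OF 4(2)] 4 by (simp add: eq_divide_eq)
        then show ?thesis using 4 by (simp add: oload_def e add_divide_distrib)
      qed
    qed
    have "mwu_state Mv (TA / TB) (Suc t) (\<lambda>i. u' i) (\<lambda>i. oload \<gamma> G i + q i) \<Lambda>'"
      unfolding \<Lambda>'_def
    proof (rule mwu_state_step[OF mw, where C = "200 * real_of_int PM"])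
      show "0 < real_of_int TA / TB" "0 < 200 * real_of_int PM" using TA UTB PM0 by auto
      show "0 \<le> q i \<and> q i \<le> 1" if "i < Mv" for i using PP0(1)[OF that] PM(1)[OF that] PM0 by (simp add: q_def)
      show "\<exists>i<Mv. q i = 1" using PM(2) PM0 by (auto simp: q_def)
      show "real_of_int (u' i) = 200 * real_of_int PM * (u i * (1 + q i / 200))" if "i < Mv" for i
        using PM0 by (simp add: u'[OF that] q_def field_simps)
      define X where "X = u (m + 1 + k) / p k + \<kappa> (AA k) S * u m / r +
        (\<Sum>i<m. if 0 < cn i then (\<Sum>e\<in>S \<inter> SS i. w e) * u i / c i else 0)"
      have "(\<Sum>i<m. q i * u i) = \<sigma> * (\<Sum>i<m. if 0 < cn i then (\<Sum>e\<in>S \<inter> SS i. w e) * u i / c i else 0)"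
        unfolding sum_distrib_left
      proof (intro sum.cong refl)
        fix i assume "i \<in> {..<m}"
        then have i: "i < m" by simp
        show "q i * u i = \<sigma> * (if 0 < cn i then (\<Sum>e\<in>S \<inter> SS i. w e) * u i / c i else 0)"
        proof (cases "0 < cn i")
          case True
          have "q i = \<sigma> * (\<Sum>e\<in>S \<inter> SS i. w e) / c i" using qi1[OF i True] ci[OF True] by (simp add: eq_divide_eq)
          then show ?thesis using True by simp
        next
          case False
          then show ?thesis using r1(9)[OF i False] by (simp add: q_def)
        qed
      qed
      moreover have "q m * u m = \<sigma> * (\<kappa> (AA k) S * u m / r)"
      proof -
        have "q m = \<sigma> * \<kappa> (AA k) S / r" using qm r_pos by (simp add: eq_divide_eq)
        then show ?thesis by simp
      qed
      moreover have "(\<Sum>k'<K. q (m + 1 + k') * u (m + 1 + k')) = \<sigma> * (u (m + 1 + k) / p k)"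
      proof -
        have "(\<Sum>k'<K. q (m + 1 + k') * u (m + 1 + k')) = (\<Sum>k'<K. if k' = k then \<sigma> * (u (m + 1 + k) / p k) else 0)"
        proof (intro sum.cong refl)
          fix k' assume "k' \<in> {..<K}"
          then have k': "k' < K" by simp
          have "q (m + 1 + k') = (if k' = k then \<sigma> else 0) / p k'" using qk[OF k'] p_pos[OF k'] by (simp add: eq_divide_eq)
          then show "q (m + 1 + k') * u (m + 1 + k') = (if k' = k then \<sigma> * (u (m + 1 + k) / p k) else 0)" by simp
        qed
        then show ?thesis using r1(1) by (simp add: sum.delta)
      qed
      ultimately have qs: "(\<Sum>i<Mv. q i * u i) = \<sigma> * X"
        unfolding sum_Mv X_def by (simp add: distrib_left)
      have "real_of_int TA / (TB * Us u) * X \<le> (\<Sum>e\<in>S. w e)" using r1(7) unfolding X_def .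
      then have "\<sigma> * Us u * (real_of_int TA / (TB * Us u) * X) \<le> \<sigma> * Us u * (\<Sum>e\<in>S. w e)"
        using s0 UTB by (intro mult_left_mono) auto
      moreover have "\<sigma> * Us u * (real_of_int TA / (TB * Us u) * X) = real_of_int TA / TB * (\<sigma> * X)"
        using UTB by simp
      moreover have "real_of_int (Us u) = (\<Sum>i<Mv. real_of_int (u i))" by (simp add: Us_def)
      ultimately show "real_of_int TA / TB * (\<Sum>i<Mv. q i * u i) \<le> \<sigma> * (\<Sum>e\<in>S. w e) * (\<Sum>i<Mv. real_of_int (u i))"
        unfolding qs by (simp add: mult_ac)
    qed
    then have "mwu_state Mv (TA / TB) (Suc t) (\<lambda>i. u' i) (oload \<gamma>' G') \<Lambda>'"
      by (rule mwu_state_cong) (use ol in auto)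
    moreover have "\<forall>i<m. \<not> 0 < cn i \<longrightarrow> G' i = 0" using G0 r1(9) by (simp add: G'_def)
    ultimately show ?thesis using ct by blast
  qed
  ultimately show ?thesis unfolding outer_st_def using us' by blast
qed

text \<open>All normalised loads are at most \<zeta> = 1.01 \<Lambda>/T, so the certificate divided
  by \<zeta> is feasible and proves the lower bound \<Lambda>/\<zeta> = T/1.01.\<close>

lemma outer_fail:
  assumes st: "outer_st u TA TB t" and t: "160000 * Mv\<^sup>2 \<le> t" and TA: "0 < TA"
  shows "real_of_int TA / TB \<le> 101 / 100 * opt"
proof -
  obtain \<gamma> G \<Lambda> where c1: "cert \<gamma> G \<Lambda>" and mw: "mwu_state Mv (TA / TB) t (\<lambda>i. u i) (oload \<gamma> G) \<Lambda>"
    and G0: "\<And>i. i < m \<Longrightarrow> \<not> 0 < cn i \<Longrightarrow> G i = 0" using st TA unfolding outer_st_def by blast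
  define T where "T = real_of_int TA / TB"
  have T: "0 < T" using st TA by (simp add: T_def outer_st_def ust_def)
  have Mv0: "0 < Mv" by (simp add: Mv_def)
  have fin: "T * oload \<gamma> G i \<le> 101 / 100 * \<Lambda>" if "i < Mv" for i
    by (rule mwu_state_final[OF mw[folded T_def] T Mv0 t that])
  \<comment> \<open>Otherwise every load would be at most 0, although the loads sum to at least the
    positive number of rows.\<close>
  have "0 < \<Lambda>"
  proof (rule ccontr)
    assume "\<not> 0 < \<Lambda>"
    have "oload \<gamma> G i \<le> 0" if "i < Mv" for i
    proof (rule ccontr)
      assume "\<not> oload \<gamma> G i \<le> 0"
      then have "0 < T * oload \<gamma> G i" using T by simp
      then show False using fin[OF that] \<open>\<not> 0 < \<Lambda>\<close> by linarith
    qed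
    then have "(\<Sum>i<Mv. oload \<gamma> G i) \<le> 0" by (intro sum_nonpos) auto
    moreover have "real t \<le> (\<Sum>i<Mv. oload \<gamma> G i)" using mw by (simp add: mwu_state_def)
    moreover have "0 < t" using t Mv0 by (metis less_le_trans mult_pos_pos zero_less_numeral zero_less_power)
    ultimately show False by simp
  qed
  define \<zeta> where "\<zeta> = 101 / 100 * \<Lambda> / T"
  have z: "0 < \<zeta>" using \<open>0 < \<Lambda>\<close> T by (simp add: \<zeta>_def)
  have le: "oload \<gamma> G i \<le> \<zeta>" if "i < Mv" for i
    using fin[OF that] T unfolding \<zeta>_def by (simp add: pos_le_divide_eq mult_ac)
  have "\<Lambda> / \<zeta> \<le> opt"
  proof (rule cert_final[OF c1 z])
    fix k assume k: "k < K"
    have "(\<Sum>B\<in>\<A>. \<gamma> k B) / p k \<le> \<zeta>" using le[of "m + 1 + k"] k by (simp add: oload_def Mv_def)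
    then show "(\<Sum>B\<in>\<A>. \<gamma> k B) \<le> \<zeta> * p k" using p_pos[OF k] by (simp add: pos_divide_le_eq)
  next
    have "(\<Sum>k<K. \<Sum>B\<in>\<A>. \<kappa> (AA k) B * \<gamma> k B) / r \<le> \<zeta>" using le[of m] by (simp add: oload_def Mv_def)
    then show "(\<Sum>k<K. \<Sum>B\<in>\<A>. \<kappa> (AA k) B * \<gamma> k B) \<le> \<zeta> * r" using r_pos by (simp add: pos_divide_le_eq)
  next
    fix i assume i: "i < m"
    show "G i \<le> \<zeta> * c i"
    proof (cases "0 < cn i")
      case True
      then have "0 < c i" using cd_pos[of i] by (simp add: c_eq)
      moreover have "G i / c i \<le> \<zeta>" using le[of i] i True by (simp add: oload_def Mv_def)
      ultimately show ?thesis by (simp add: pos_divide_le_eq)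
    next
      case False
      then show ?thesis using G0[OF i] z c_nonneg[OF i] by simp
    qed
  qed
  moreover have "\<Lambda> / \<zeta> = T / (101 / 100)" using \<open>0 < \<Lambda>\<close> T by (simp add: \<zeta>_def)
  ultimately show ?thesis unfolding T_def[symmetric] by simp
qed

section \<open>The rounded output and its guarantee\<close>

definition xs :: "(nat \<Rightarrow> int) \<Rightarrow> int \<Rightarrow> int \<Rightarrow> nat \<Rightarrow> rat" where
  "xs u TA TB i = (if 11 * XDs u TB \<le> 21 * XNs u TA TB i then 1 else if 0 < XNs u TA TB i
     then of_int (21 * XNs u TA TB i * (11 * XDs u TB) + 1) / of_int (11 * XDs u TB * (11 * XDs u TB)) else 0)"

definition xbar :: "(nat \<Rightarrow> int) \<Rightarrow> int \<Rightarrow> int \<Rightarrow> nat set \<Rightarrow> rat" where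
  "xbar u TA TB S = xs u TA TB (THE i. i < m \<and> SS i = S)"

definition fval :: "int \<Rightarrow> int \<Rightarrow> rat" where
  "fval TA TB = (if 0 < TA then of_int (1225 * TA * TB + 1) / of_int (625 * TB * TB) else 0)"

lemma xbar_SS: "i < m \<Longrightarrow> xbar u TA TB (SS i) = xs u TA TB i"
proof -
  assume i: "i < m"
  have dist: "distinct (sets_of I)" using valid unfolding valid_instance_def covering_collection_def by auto
  have "(THE j. j < m \<and> SS j = SS i) = i"
    by (rule the_equality) (use i dist in \<open>auto simp: nth_eq_iff_index_eq\<close>)
  then show ?thesis by (simp add: xbar_def)
qed

lemma XN_nonneg: "ust u TA TB \<Longrightarrow> i < m \<Longrightarrow> 0 \<le> XNs u TA TB i"
proof -
  assume h: "ust u TA TB" "i < m"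
  then have "1 \<le> u i" by (auto simp: ust_def Mv_def)
  then show ?thesis using h XF_nonneg[OF h(2)] XD_pos[OF h(1)] by (simp add: XNs_def ust_def)
qed

text \<open>Replacing P/Q by (P Q + 1)/Q^2 adds 1/Q^2. For P < Q it stays below 1, because P Q + 1
  <= (Q - 1) Q + 1 <= Q^2 for integers.\<close>

lemma xs_bounds:
  assumes us: "ust u TA TB" and i: "i < m"
  defines "x \<equiv> real_of_rat (xs u TA TB i)" and "\<rho> \<equiv> real_of_int (XNs u TA TB i) / XDs u TB"
  shows "0 \<le> x" "x \<le> 1" "min 1 (21 / 11 * \<rho>) \<le> x" "XNs u TA TB i = 0 \<Longrightarrow> x = 0"
    "x \<le> 21 / 11 * \<rho> + 1 / (11 * real_of_int (XDs u TB))\<^sup>2"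
proof -
  define P Q where "P = 21 * XNs u TA TB i" and "Q = 11 * XDs u TB"
  have Q: "0 < Q" using XD_pos[OF us] by (simp add: Q_def)
  have P: "0 \<le> P" using XN_nonneg[OF us i] by (simp add: P_def)
  have \<rho>: "21 / 11 * \<rho> = real_of_int P / Q" by (simp add: \<rho>_def P_def Q_def)
  have x: "x = (if Q \<le> P then 1 else if 0 < P then real_of_int (P * Q + 1) / real_of_int (Q * Q) else 0)"
    unfolding x_def xs_def P_def Q_def by (auto simp: of_rat_divide of_rat_of_int_eq simp del: of_int_mult of_int_add)
  have eq: "real_of_int (P * Q + 1) / real_of_int (Q * Q) = real_of_int P / Q + 1 / (real_of_int Q)\<^sup>2"
    using Q by (simp add: add_divide_distrib power2_eq_square)
  have pq: "0 \<le> real_of_int P / Q" "0 \<le> 1 / (real_of_int Q)\<^sup>2" using P Q by simp_all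
  have ge: "1 \<le> real_of_int P / Q" if "Q \<le> P" using that Q by simp
  have lt: "real_of_int P / Q + 1 / (real_of_int Q)\<^sup>2 \<le> 1" if "P < Q" "0 < P"
  proof -
    have "P * Q + 1 \<le> (Q - 1) * Q + 1" using that Q by (intro add_right_mono mult_right_mono) auto
    also have "\<dots> \<le> Q * Q" using Q by (simp add: algebra_simps)
    finally have "real_of_int (P * Q + 1) \<le> real_of_int (Q * Q)" by (simp only: of_int_le_iff)
    moreover have "0 < real_of_int (Q * Q)" using Q by simp
    ultimately have "real_of_int (P * Q + 1) / real_of_int (Q * Q) \<le> 1" by (simp only: divide_le_eq_1_pos)
    then show ?thesis unfolding eq .
  qed
  show "0 \<le> x" unfolding x eq using pq by simp
  show "x \<le> 1" unfolding x eq using lt by simp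
  show "min 1 (21 / 11 * \<rho>) \<le> x" unfolding x eq \<rho> using pq P by auto
  show "x = 0" if "XNs u TA TB i = 0" using that Q P unfolding x by (simp add: P_def)
  show "x \<le> 21 / 11 * \<rho> + 1 / (11 * real_of_int (XDs u TB))\<^sup>2"
  proof -
    have "1 / (11 * real_of_int (XDs u TB))\<^sup>2 = 1 / (real_of_int Q)\<^sup>2" by (simp add: Q_def)
    moreover have "1 \<le> real_of_int P / Q + 1 / (real_of_int Q)\<^sup>2" if "Q \<le> P" using ge[OF that] pq by linarith
    ultimately show ?thesis unfolding x eq \<rho> using pq by auto
  qed
qed

lemma xbar_P: "ust u TA TB \<Longrightarrow> (\<lambda>S. real_of_rat (xbar u TA TB S)) \<in> P"
  unfolding fractional_decisions_def
proof (rule Pi_I)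
  fix S assume us: "ust u TA TB" and "S \<in> set (sets_of I)"
  then obtain i where i: "i < m" "S = SS i" by (metis in_set_conv_nth)
  show "real_of_rat (xbar u TA TB S) \<in> {0..1}"
    using xs_bounds(1,2)[OF us i(1)] unfolding i(2) xbar_SS[OF i(1)] atLeastAtMost_iff by blast
qed

text \<open>Capping at 1 loses nothing: a set at level 1 covers its elements alone, and without such
  a set every summand is at least 21/11 times its value in the candidate.\<close>

lemma cov_xbar:
  assumes us: "ust u TA TB"
  shows "min 1 (21 / 11 * (real_of_int (Ys u TA TB e) / XDs u TB)) \<le> cov (\<lambda>S. real_of_rat (xbar u TA TB S)) e"
proof -
  let ?x = "\<lambda>i. real_of_rat (xs u TA TB i)" and ?r = "\<lambda>i. real_of_int (XNs u TA TB i) / XDs u TB"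
  have ce: "cov (\<lambda>S. real_of_rat (xbar u TA TB S)) e = (\<Sum>i<m. if e \<in> SS i then ?x i else 0)"
    by (intro sum.cong) (auto simp: xbar_SS)
  show ?thesis
  proof (cases "\<exists>i<m. e \<in> SS i \<and> 1 \<le> ?x i")
    case True
    then obtain i where i: "i < m" "e \<in> SS i" "1 \<le> ?x i" by blast
    have "(if e \<in> SS i then ?x i else 0) \<le> (\<Sum>i<m. if e \<in> SS i then ?x i else 0)"
      using i xs_bounds(1)[OF us] by (intro member_le_sum[where f = "\<lambda>i. if e \<in> SS i then ?x i else 0"]) auto
    then have "1 \<le> (\<Sum>i<m. if e \<in> SS i then ?x i else 0)" unfolding if_P[OF i(2)] using i(3) by linarith
    then show ?thesis unfolding ce by linarith
  next
    case False
    have "21 / 11 * (real_of_int (Ys u TA TB e) / XDs u TB) = (\<Sum>i<m. if e \<in> SS i then 21 / 11 * ?r i else 0)"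
      unfolding Ys_def of_int_sum sum_divide_distrib sum_distrib_left by (intro sum.cong) auto
    also have "\<dots> \<le> (\<Sum>i<m. if e \<in> SS i then ?x i else 0)"
    proof (intro sum_mono)
      fix i assume "i \<in> {..<m}"
      then have i: "i < m" by simp
      show "(if e \<in> SS i then 21 / 11 * ?r i else 0) \<le> (if e \<in> SS i then ?x i else 0)"
      proof (cases "e \<in> SS i")
        case True
        then have "\<not> 1 \<le> ?x i" using False i by blast
        then have "21 / 11 * ?r i \<le> ?x i" using xs_bounds(3)[OF us i] by linarith
        then show ?thesis using True by simp
      qed simp
    qed
    finally show ?thesis unfolding ce by simp
  qed
qed

text \<open>The rounding of set \<open>i\<close> costs at most c_i/(11 XD)^2. As c_i <=
  \<open>Ga\<close> and XD = \<open>TB * Us * Ga\<close>, this is at most T/(121 Us) when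
  \<open>TA\<close> is a positive integer; summing over \<open>m <= Us\<close> sets gives
  T/121.\<close>

lemma cost_xbar:
  assumes us: "ust u TA TB"
  shows "(\<Sum>i<m. c i * real_of_rat (xbar u TA TB (SS i))) \<le>
    21 / 11 * (real_of_int TA / (TB * Us u) * (\<Sum>i<m. u i)) + 1 / 121 * (real_of_int TA / TB)"
proof -
  have UTB: "0 < TB" "0 < Us u" "0 \<le> TA" using us Us_pos[OF us] by (auto simp: ust_def)
  have "c i * real_of_rat (xbar u TA TB (SS i)) \<le> 21 / 11 * (real_of_int TA / (TB * Us u) * u i) + 1 / 121 * (real_of_int TA / (TB * Us u))"
    if i: "i < m" for i
  proof -
    let ?x = "real_of_rat (xs u TA TB i)"
    have ui: "1 \<le> u i" using us i by (auto simp: ust_def Mv_def)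
    have R0: "0 \<le> 21 / 11 * (real_of_int TA / (TB * Us u) * u i) + 1 / 121 * (real_of_int TA / (TB * Us u))"
      using UTB ui by simp
    show ?thesis
    proof (cases "0 < cn i \<and> 0 < TA")
      case False
      have "c i * ?x = 0"
      proof (cases "0 < cn i")
        case True
        then have "XNs u TA TB i = 0" using False UTB by (simp add: XNs_def)
        then show ?thesis using xs_bounds(4)[OF us i] by simp
      next
        case False
        then show ?thesis using cn_nonneg[OF i] by (simp add: c_eq)
      qed
      then show ?thesis using R0 unfolding xbar_SS[OF i] by linarith
    next
      case True
      then have c0: "0 < c i" using cd_pos[of i] by (simp add: c_eq)
      have "c i * ?x \<le> c i * (21 / 11 * (XNs u TA TB i / XDs u TB) + 1 / (11 * real_of_int (XDs u TB))\<^sup>2)"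
        using xs_bounds(5)[OF us i] c0 by (intro mult_left_mono) auto
      also have "\<dots> = 21 / 11 * (real_of_int TA / (TB * Us u) * u i) + 1 / 121 * (c i / (real_of_int (XDs u TB))\<^sup>2)"
        unfolding XN_ratio[OF us i conjunct1[OF True]] using c0 by (simp add: distrib_left power_mult_distrib)
      also have "c i / (real_of_int (XDs u TB))\<^sup>2 \<le> real_of_int TA / (TB * Us u)"
      proof -
        have "c i \<le> Ga"
        proof -
          have dv: "(if 0 < cn i then cn i else 1) dvd Ga" unfolding Ga_def using i by (intro dvd_prodI) auto
          then have "cn i \<le> Ga" using True Ga_pos by (simp add: zdvd_imp_le)
          moreover have "c i \<le> cn i" using cd_pos[of i] True by (simp add: c_eq divide_le_eq mult_le_cancel_left1)
          ultimately show ?thesis by linarith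
        qed
        define D where "D = real_of_int (TB * Us u)"
        have D1: "1 \<le> D" using UTB unfolding D_def by (metis int_one_le_iff_zero_less mult_pos_pos of_int_1_le_iff)
        have G1: "1 \<le> real_of_int Ga" using Ga_pos by simp
        have xd: "real_of_int (XDs u TB) = D * Ga" by (simp add: XDs_def D_def)
        have "c i / (D * Ga)\<^sup>2 \<le> Ga / (D * Ga)\<^sup>2" using \<open>c i \<le> Ga\<close> by (intro divide_right_mono) auto
        also have "\<dots> = 1 / D * (1 / (D * Ga))" using D1 G1 by (simp add: power2_eq_square)
        also have "\<dots> \<le> 1 / D * real_of_int TA"
        proof (intro mult_left_mono)
          have "1 \<le> D * Ga" using mult_mono[of 1 D 1 "real_of_int Ga"] D1 G1 by simp
          then have "1 / (D * Ga) \<le> 1" by simp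
          then show "1 / (D * Ga) \<le> real_of_int TA" using True by linarith
        qed (use D1 in simp)
        finally show ?thesis unfolding xd by (simp add: D_def)
      qed
      finally show ?thesis using i by (simp add: xbar_SS)
    qed
  qed
  then have "(\<Sum>i<m. c i * real_of_rat (xbar u TA TB (SS i))) \<le>
    (\<Sum>i<m. 21 / 11 * (real_of_int TA / (TB * Us u) * u i) + 1 / 121 * (real_of_int TA / (TB * Us u)))"
    by (intro sum_mono) auto
  also have "\<dots> = 21 / 11 * (real_of_int TA / (TB * Us u) * (\<Sum>i<m. u i)) + 1 / 121 * (m * (real_of_int TA / (TB * Us u)))"
    by (simp add: sum.distrib sum_distrib_left)
  also have "m * (real_of_int TA / (TB * Us u)) \<le> real_of_int TA / TB"
  proof -
    have "int m \<le> Us u" using Us_ge[OF us] by (simp add: Mv_def)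
    then have mU: "real m / Us u \<le> 1" using UTB by simp
    have "m * (real_of_int TA / (TB * Us u)) = (real m / Us u) * (real_of_int TA / TB)" by simp
    also have "\<dots> \<le> 1 * (real_of_int TA / TB)" using mU UTB by (intro mult_right_mono) auto
    finally show ?thesis by simp
  qed
  finally show ?thesis by simp
qed

text \<open>Scaled by \<open>\<beta>1\<close> and \<open>\<beta>1 * \<beta>2\<close> respectively,
  39/20 \<theta> and 39/20 y form a dual solution for the second stage of \<open>xbar\<close>. For
  each scenario \<open>B\<close>, \<open>recourse_cand_ge\<close> passes to the queried collection,
  and the approximation guarantee compares \<open>B\<close> with the returned scenario, which fits
  its budget.\<close>

lemma success:
  assumes us: "ust u TA TB" and gd: "\<And>k. k < K \<Longrightarrow> good u TA TB k"
  shows "h (\<lambda>S. real_of_rat (xbar u TA TB S)) \<le> \<beta>1 * \<beta>2 * (49 / 25 * (real_of_int TA / TB))"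
proof -
  let ?x = "\<lambda>S. real_of_rat (xbar u TA TB S)"
  define cl where "cl = CLs u TA TB"
  have cl1: "1 \<le> cl e" for e using CLs_ge by (simp add: cl_def)
  have UTB: "0 < TB" "0 < Us u" "0 \<le> TA" using us Us_pos[OF us] by (auto simp: ust_def)
  define Z where "Z = real_of_int TA / (TB * Us u)"
  have Z0: "0 \<le> Z" using UTB by (simp add: Z_def)
  define y where "y = Z * (u m / r)"
  define \<theta> where "\<theta> k = Z * (u (m + 1 + k) / p k)" for k
  have um: "1 \<le> u m" using us by (auto simp: ust_def Mv_def)
  have y0: "0 \<le> y" using Z0 um r_pos by (simp add: y_def)
  have th0: "0 \<le> \<theta> k" if "k < K" for k
  proof -
    have "1 \<le> u (m + 1 + k)" using us that unfolding ust_def Mv_def by auto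
    then show ?thesis using Z0 p_pos[OF that] by (simp add: \<theta>_def)
  qed
  define H where "H = 3 * real_of_int Dd * YDs u TB"
  have YD: "0 < YDs u TB" using UTB rn_pos by (simp add: YDs_def)
  have H0: "0 < H" using YD Dd_pos by (simp add: H_def)
  let ?J = "set (klist cl)" and ?dq = "\<lambda>S. real_of_rat (dqs cl u TB S)"
  have dqc: "?dq (cand cl k) = real_of_int (CC k) * YDs u TB" if "k \<in> ?J" for k
    using dqs_cand[OF that] by (simp add: of_rat_mult)
  have lower: "H * g ?x A \<le> recourse (cand cl ` ?J) ?dq (\<lambda>_. 0) A" if A: "A \<in> \<A>" for A
  proof (rule recourse_cand_ge[OF A])
    show "?J \<subseteq> {..<3 * m}" using klist_lt by auto
    show "inj_on (cand cl) ?J" by (rule klist_inj)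
    show "A \<subseteq> \<Union>(cand cl ` ?J)" by (rule klist_cov[OF _ A]) (rule cl1)
    show "0 \<le> H" using H0 by simp
    show "?dq (cand cl k) = H * d (k div 3) * (if k mod 3 = 0 then 1 else if k mod 3 = 1 then 2 / 3 else 0)"
      if k: "k \<in> ?J" for k
      unfolding dqc[OF k] CC_eq[OF klist_lt[OF k]] H_def by simp
    show "0 \<le> ?x (SS i)" if "i < m" for i using xs_bounds(1)[OF us that] that by (simp add: xbar_SS)
    fix e
    have XD: "0 < real_of_int (XDs u TB)" using XD_pos[OF us] by simp
    note cx = cov_xbar[OF us, of e]
    consider "cl e = 1" | "cl e = 2" | "cl e = 3" using CLs_cases[of u TA TB e] by (auto simp: cl_def)
    then show "cl e = 1 \<or> cl e = 2 \<and> 1 / 3 \<le> cov ?x e \<or> cl e = 3 \<and> 1 \<le> cov ?x e"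
    proof cases
      case 2
      then have "XDs u TB \<le> 3 * Ys u TA TB e" unfolding cl_def CLs_def by (auto split: if_splits)
      then have "real_of_int (XDs u TB) \<le> 3 * real_of_int (Ys u TA TB e)" by linarith
      then have "1 / 3 \<le> real_of_int (Ys u TA TB e) / XDs u TB" using XD by (simp add: le_divide_eq)
      then have "1 / 3 \<le> min 1 (21 / 11 * (real_of_int (Ys u TA TB e) / XDs u TB))"
        by (intro min.boundedI) linarith+
      then show ?thesis using 2 cx by linarith
    next
      case 3
      then have "11 * XDs u TB \<le> 21 * Ys u TA TB e" unfolding cl_def CLs_def by (auto split: if_splits)
      then have "11 * real_of_int (XDs u TB) \<le> 21 * real_of_int (Ys u TA TB e)" by linarith
      then have "11 / 21 \<le> real_of_int (Ys u TA TB e) / XDs u TB" using XD by (simp add: le_divide_eq)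
      then have "1 \<le> min 1 (21 / 11 * (real_of_int (Ys u TA TB e) / XDs u TB))"
        by (intro min.boundedI) linarith+
      then show ?thesis using 3 cx by linarith
    qed simp
  qed
  have main: "g ?x B \<le> \<beta>1 * (39 / 20 * \<theta> k) + \<beta>1 * \<beta>2 * (39 / 20 * y) * \<kappa> (AA k) B" if k: "k < K" and B: "B \<in> \<A>" for k B
  proof -
    from gd[OF k] obtain S where S: "S \<in> \<A>"
      "approx_scenario (cand cl ` ?J) ?dq \<A> \<kappa> \<beta>1 \<beta>2 (yqs u TA) (AA k) S"
      "covers cl S (real_of_int (TNs u TA k (fst (quotient_of (scen_dist I (AA k) S))) (snd (quotient_of (scen_dist I (AA k) S))))
      / TDs u TB k (snd (quotient_of (scen_dist I (AA k) S))))" unfolding good_def cl_def by blast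
    define qn qd where "qn = fst (quotient_of (scen_dist I (AA k) S))" and "qd = snd (quotient_of (scen_dist I (AA k) S))"
    have kq: "\<kappa> (AA k) S = qn / qd" "0 < qd" using quot(1,2) by (simp_all add: qn_def qd_def)
    define Tt where "Tt = real_of_int (TNs u TA k qn qd) / TDs u TB k qd"
    have pos: "0 < pn k" "0 < pd k" "0 < rn" "0 < rd" using pn_pos[OF k] pd_pos rn_pos rd_pos by auto
    have Tt_eq: "Tt = 117 / 20 * Dd * (\<theta> k + \<kappa> (AA k) S * y)"
      using pos kq UTB unfolding Tt_def \<theta>_def y_def Z_def TNs_def TDs_def kq p_eq r_eq by (simp add: field_simps)
    have yq: "yqs u TA = H * (39 / 20 * y)"
      using pos UTB unfolding yqs_def H_def YDs_def y_def Z_def r_eq by (simp add: field_simps)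
    obtain v where v: "\<And>k. k < 3 * m \<Longrightarrow> 0 \<le> v k" "\<And>e. e \<in> S \<Longrightarrow> 1 \<le> (\<Sum>k<3 * m. if e \<in> cand cl k then v k else 0)"
      "(\<Sum>k<3 * m. real_of_int (CC k) * v k) \<le> Tt"
      using S(3) unfolding covers_def Tt_def qn_def qd_def by blast
    have "recourse (cand cl ` ?J) ?dq (\<lambda>_. 0) S \<le> (\<Sum>k<3 * m. (real_of_int (CC k) * YDs u TB) * v k)"
    proof (rule recourse_le_indexed)
      show "0 \<le> ?dq X" if "X \<in> cand cl ` ?J" for X
      proof -
        obtain k where k: "k \<in> ?J" "X = cand cl k" using \<open>X \<in> cand cl ` ?J\<close> by blast
        show ?thesis unfolding k(2) dqc[OF k(1)] using CC_nonneg[OF klist_lt[OF k(1)]] YD by simp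
      qed
      show "cand cl k \<in> cand cl ` ?J \<and> ?dq (cand cl k) \<le> real_of_int (CC k) * YDs u TB" if "k < 3 * m" for k
      proof -
        obtain k' where k': "k' \<in> ?J" "cand cl k' = cand cl k" "CC k' \<le> CC k" using klist_rep[OF \<open>k < 3 * m\<close>] by blast
        have "cand cl k \<in> cand cl ` ?J" using k'(1,2) by (metis imageI)
        moreover have "?dq (cand cl k) \<le> real_of_int (CC k) * YDs u TB"
          using dqc[OF k'(1)] k'(2,3) YD by (simp add: mult_right_mono)
        ultimately show ?thesis ..
      qed
    qed (use v in auto)
    also have "\<dots> = YDs u TB * (\<Sum>k<3 * m. real_of_int (CC k) * v k)" by (simp add: sum_distrib_left mult_ac)
    also have "\<dots> \<le> YDs u TB * Tt" using v(3) YD by (intro mult_left_mono) auto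
    also have "\<dots> = H * (39 / 20 * (\<theta> k + \<kappa> (AA k) S * y))" unfolding Tt_eq H_def by simp
    finally have up: "recourse (cand cl ` ?J) ?dq (\<lambda>_. 0) S \<le> H * (39 / 20 * (\<theta> k + \<kappa> (AA k) S * y))" .
    have "recourse (cand cl ` ?J) ?dq (\<lambda>_. 0) B / \<beta>1 - \<beta>2 * yqs u TA * \<kappa> (AA k) B \<le>
      recourse (cand cl ` ?J) ?dq (\<lambda>_. 0) S - yqs u TA * \<kappa> (AA k) S"
      using S(2) B unfolding approx_scenario_def by blast
    \<comment> \<open>The distance term subtracted for \<open>S\<close> cancels exactly the part of
      its budget paid by \<open>y\<close>; this is why the query uses the multiplier 39/20
      y.\<close>
    then have "recourse (cand cl ` ?J) ?dq (\<lambda>_. 0) B / \<beta>1 \<le> \<beta>2 * (H * (39 / 20 * y)) * \<kappa> (AA k) B + H * (39 / 20 * \<theta> k)"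
      using up unfolding yq by (simp add: algebra_simps)
    then have "recourse (cand cl ` ?J) ?dq (\<lambda>_. 0) B \<le> (\<beta>2 * (H * (39 / 20 * y)) * \<kappa> (AA k) B + H * (39 / 20 * \<theta> k)) * \<beta>1"
      using b1 by (subst (asm) pos_divide_le_eq) auto
    also have "\<dots> = H * (\<beta>1 * (39 / 20 * \<theta> k) + \<beta>1 * \<beta>2 * (39 / 20 * y) * \<kappa> (AA k) B)" by (simp add: algebra_simps)
    finally have "H * g ?x B \<le> H * (\<beta>1 * (39 / 20 * \<theta> k) + \<beta>1 * \<beta>2 * (39 / 20 * y) * \<kappa> (AA k) B)"
      using lower[OF B] by linarith
    then show ?thesis using H0 by (simp only: mult_le_cancel_left_pos)
  qed
  have "h ?x \<le> (\<Sum>i<m. c i * ?x (SS i)) + (\<Sum>k<K. p k * (\<beta>1 * (39 / 20 * \<theta> k))) + r * (\<beta>1 * \<beta>2 * (39 / 20 * y))"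
    by (rule h_le) (use main y0 th0 b1 b2 in auto)
  also have "(\<Sum>k<K. p k * (\<beta>1 * (39 / 20 * \<theta> k))) = \<beta>1 * (39 / 20 * (Z * (\<Sum>k<K. u (m + 1 + k))))"
  proof -
    have "p k * (\<beta>1 * (39 / 20 * \<theta> k)) = \<beta>1 * (39 / 20 * (Z * u (m + 1 + k)))" if "k < K" for k
      using p_pos[OF that] by (simp add: \<theta>_def)
    then have "(\<Sum>k<K. p k * (\<beta>1 * (39 / 20 * \<theta> k))) = (\<Sum>k<K. \<beta>1 * (39 / 20 * (Z * u (m + 1 + k))))"
      by (intro sum.cong refl) blast
    then show ?thesis by (simp only: sum_distrib_left of_int_sum)
  qed
  also have "r * (\<beta>1 * \<beta>2 * (39 / 20 * y)) = \<beta>1 * \<beta>2 * (39 / 20 * (Z * u m))" using r_pos by (simp add: y_def)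
  finally have h1: "h ?x \<le> (\<Sum>i<m. c i * ?x (SS i)) + \<beta>1 * (39 / 20 * (Z * (\<Sum>k<K. u (m + 1 + k)))) +
    \<beta>1 * \<beta>2 * (39 / 20 * (Z * u m))" .
  define X1 where "X1 = Z * (\<Sum>i<m. u i)"
  define X2 where "X2 = Z * u m"
  define X3 where "X3 = Z * (\<Sum>k<K. u (m + 1 + k))"
  have X: "X1 + X2 + X3 = real_of_int TA / TB"
  proof -
    have "X1 + X2 + X3 = Z * real_of_int (Us u)" unfolding X1_def X2_def X3_def Us_def sum_Mv by (simp add: distrib_left)
    then show ?thesis using UTB by (simp add: Z_def)
  qed
  have Xn: "0 \<le> X1" "0 \<le> X2" "0 \<le> X3"
  proof -
    have un: "0 \<le> u i" if "i < Mv" for i using us that by (auto simp: ust_def intro: order_trans[OF zero_le_one])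
    show "0 \<le> X1" "0 \<le> X2" "0 \<le> X3" unfolding X1_def X2_def X3_def using Z0 un
      by (auto intro!: mult_nonneg_nonneg sum_nonneg simp: Mv_def)
  qed
  have cx: "(\<Sum>i<m. c i * ?x (SS i)) \<le> 21 / 11 * X1 + 1 / 121 * (real_of_int TA / TB)"
    using cost_xbar[OF us] unfolding X1_def Z_def .
  have bb: "1 \<le> \<beta>1 * \<beta>2" "\<beta>1 \<le> \<beta>1 * \<beta>2" using b1 b2 mult_mono[of 1 \<beta>1 1 \<beta>2] by simp_all
  have T0': "0 \<le> real_of_int TA / TB" using UTB by simp
  have "h ?x \<le> 1 * (21 / 11 * X1 + 1 / 121 * (real_of_int TA / TB)) + \<beta>1 * (39 / 20 * X3) + \<beta>1 * \<beta>2 * (39 / 20 * X2)"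
    unfolding mult_1 by (rule order_trans[OF h1[folded X2_def X3_def]]) (intro add_mono cx order_refl)
  also have "\<dots> \<le> \<beta>1 * \<beta>2 * (21 / 11 * X1 + 1 / 121 * (real_of_int TA / TB)) + \<beta>1 * \<beta>2 * (39 / 20 * X3) + \<beta>1 * \<beta>2 * (39 / 20 * X2)"
    using bb Xn T0' by (intro add_mono mult_right_mono order_refl) auto
  also have "\<dots> = \<beta>1 * \<beta>2 * (21 / 11 * X1 + 1 / 121 * (real_of_int TA / TB) + 39 / 20 * X3 + 39 / 20 * X2)"
    by (simp add: distrib_left)
  also have "\<dots> \<le> \<beta>1 * \<beta>2 * (49 / 25 * (real_of_int TA / TB))"
  proof (intro mult_left_mono)
    \<comment> \<open>The three shares add up to T, 21/11 < 39/20, and 39/20 + 1/121 <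
      49/25.\<close>
    show "21 / 11 * X1 + 1 / 121 * (real_of_int TA / TB) + 39 / 20 * X3 + 39 / 20 * X2 \<le> 49 / 25 * (real_of_int TA / TB)"
      using X Xn T0' by linarith
    show "0 \<le> \<beta>1 * \<beta>2" using bb by linarith
  qed
  finally show ?thesis .
qed

text \<open>The rounding adds 1/(25 TB)^2, at most T/625 when \<open>TA\<close> is a positive
  integer, and 49/25 + 1/625 = 1226/625.\<close>

lemma fval_bounds:
  assumes "0 < TB" "0 \<le> TA"
  shows "49 / 25 * (real_of_int TA / TB) \<le> real_of_rat (fval TA TB)"
    "real_of_rat (fval TA TB) \<le> 1226 / 625 * (real_of_int TA / TB)"
proof -
  have "49 / 25 * (real_of_int TA / TB) \<le> real_of_rat (fval TA TB) \<and> real_of_rat (fval TA TB) \<le> 1226 / 625 * (real_of_int TA / TB)"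
  proof (cases "0 < TA")
    case True
    have f: "real_of_rat (fval TA TB) = real_of_int (1225 * TA * TB + 1) / real_of_int (625 * TB * TB)"
      using True unfolding fval_def by (simp add: of_rat_divide of_rat_of_int_eq del: of_int_mult of_int_add)
    have e: "real_of_int (1225 * TA * TB + 1) / real_of_int (625 * TB * TB) = 49 / 25 * (real_of_int TA / TB) + 1 / 625 * (1 / TB * (1 / TB))"
      using assms(1) by (simp add: field_simps)
    have "1 / real_of_int TB * (1 / TB) \<le> real_of_int TA * (1 / TB)"
    proof (intro mult_right_mono)
      have "1 / real_of_int TB \<le> 1" using assms(1) by simp
      then show "1 / real_of_int TB \<le> real_of_int TA" using True by linarith
    qed (use assms in simp)
    then have "1 / real_of_int TB * (1 / TB) \<le> real_of_int TA / TB" by simp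
    moreover have "0 \<le> 1 / real_of_int TB * (1 / TB)" using assms(1) by simp
    ultimately show ?thesis unfolding f e by linarith
  next
    case False
    then show ?thesis using assms(2) by (simp add: fval_def)
  qed
  then show "49 / 25 * (real_of_int TA / TB) \<le> real_of_rat (fval TA TB)"
    "real_of_rat (fval TA TB) \<le> 1226 / 625 * (real_of_int TA / TB)" by auto
qed

end

section \<open>The main loop\<close>

lemma quotient_of_coprime: "0 < b \<Longrightarrow> coprime a b \<Longrightarrow> quotient_of (of_int a / of_int b) = (a, b)"
  by (simp flip: Fract_of_int_quotient add: quotient_of_Fract normalize_stable)

lemma coprime_succ: "coprime (p * q + 1) (q * q :: int)"
proof -
  have "coprime (p * q + 1) q"
  proof (rule coprimeI)
    fix c assume "c dvd p * q + 1" "c dvd q"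
    then show "is_unit c" by (metis dvd_add_right_iff dvd_mult)
  qed
  then show ?thesis by simp
qed

lemma wp_sv: "wp sub L (HSet j (HN 0) e ;; c) Q a b = wp sub L c Q (upd a j 0 (hval e a)) b"
  by simp

text \<open>\<open>smax\<close> bounds the values of \<open>T\<close> tried before twice the total
  first-stage cost is exceeded. \<open>L_main\<close> lets one loop run through all of them, with
  \<open>160000 * Mv\<^sup>2\<close> rows for each.\<close>

locale dr_main = dr_run +
  fixes smax :: nat
  assumes smax: "\<And>j. T0 * (201 / 200) ^ j \<le> 2 * (\<Sum>i<m. c i) \<Longrightarrow> j < smax"
    and L_main: "(smax + 1) * (160000 * Mv\<^sup>2) + 1 \<le> L"
begin

abbreviation "Nt \<equiv> 160000 * Mv\<^sup>2"

lemma wp_PM: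
  assumes B: "inp a" and pos: "\<exists>i<Mv. 0 < a aPP i"
  shows "wpL p_PM (\<lambda>a' b'. (\<forall>i<Mv. a aPP i \<le> a' aPM 0) \<and> (\<exists>i<Mv. a aPP i = a' aPM 0)) a b"
proof -
  note [simp] = inpD[OF B]
  show ?thesis unfolding p_PM_def wp.simps
  proof (rule wp_For[where N = Mv and I = "\<lambda>i a' b. 0 \<le> a' aPM 0 \<and> (\<forall>j<i. a aPP j \<le> a' aPM 0) \<and>
      (a' aPM 0 = 0 \<or> (\<exists>j<i. a aPP j = a' aPM 0))"], goal_cases)
    case (6 i a1 b1)
    have "a1 aPP = a aPP" using same_offD[OF 6(4)] by simp
    then show ?case using 6(2,3) by (auto simp: less_Suc_eq)
  next
    case (7 a1 b1)
    then have "a1 aPM 0 \<noteq> 0" using pos by force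
    then show ?case using 7 by auto
  qed (use L_facts in \<open>auto simp: Mv_def\<close>)
qed

lemma wp_ones:
  assumes B: "inp a"
  shows "wpL p_ones (\<lambda>a' b'. \<forall>i<Mv. a' aW i = 1) a b"
  unfolding p_ones_def
  by (rule wp_For[where N = Mv and I = "\<lambda>i a b. \<forall>j<i. a aW j = 1"])
    (use L_facts inpD[OF B] in \<open>auto simp: Mv_def less_Suc_eq\<close>)

definition next_T :: "int \<Rightarrow> int \<Rightarrow> int \<Rightarrow> int \<Rightarrow> bool" where
  "next_T TA TB TA' TB' \<longleftrightarrow> (if 0 < TA then TA' = TA * 201 \<and> TB' = TB * 200
     else TA' = rn * kd \<and> TB' = rn * kd + kn * rd)"

lemma wp_step:
  assumes o: "ost u TA TB a" and it: "a aIt 0 = int t" and st: "outer_st u TA TB t"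
    and row: "row_spec u TA TB (a aPP)"
  shows "wpL p_step (\<lambda>a' b'. \<exists>u'. outer_st u' TA TB (Suc t) \<and>
     (Suc t < Nt \<and> ost u' TA TB a' \<and> a' aIt 0 = int (Suc t) \<or>
      Nt \<le> Suc t \<and> a' aIt 0 = 0 \<and> (\<exists>TA' TB'. next_T TA TB TA' TB' \<and> ost (\<lambda>_. 1) TA' TB' a'))) a b"
proof -
  have B: "base a" using o by (simp add: ost_def)
  note PP0 = row_nonneg[OF row]
  show ?thesis unfolding p_step_def
  proof (rule wp_seqI[OF wp_PM[OF baseD(1)[OF B] PP0(2)]], goal_cases)
    case (1 a1 b1)
    define PM where "PM = a1 aPM 0"
    have so1: "same_off {aPM, i1} False a b a1 b1" using 1(2) by (auto simp: same_off_def p_PM_def)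
    have o1: "ost u TA TB a1" by (rule ost_off[OF o so1]) simp
    have B1: "base a1" using o1 by (simp add: ost_def)
    note [simp] = inpD[OF baseD(1)[OF B1]]
    have pp1: "a1 aPP = a aPP" "a1 aIt 0 = int t" using same_offD[OF so1] it by simp_all
    define u' where "u' i = u i * (200 * PM + a aPP i)" for i
    have st': "outer_st u' TA TB (Suc t)"
      by (rule outer_step[OF st row]) (use 1(1) in \<open>auto simp: PM_def u'_def\<close>)
    have W1: "i < Mv \<Longrightarrow> a1 aW i = u i" for i using o1 by (simp add: ost_def)
    have "wpL (HFor i1 eMv (HSet aW (V i1) (HV aW (V i1) \<otimes> (HN 200 \<otimes> V aPM \<oplus> HV aPP (V i1)))))
      (\<lambda>a' b'. \<forall>i<Mv. a' aW i = u' i) a1 b1"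
    proof (rule wp_For[where N = Mv and I = "\<lambda>i a' b. \<forall>j<Mv. a' aW j = (if j < i then u' j else u j)"], goal_cases)
      case (6 i a2 b2)
      have "a2 aPP = a aPP" "a2 aPM 0 = PM" using same_offD[OF 6(4)] pp1 by (simp_all add: PM_def)
      then show ?case using 6(1-3) by (auto simp: less_Suc_eq u'_def)
    qed (use L_facts W1 in \<open>auto simp: Mv_def\<close>)
    then show ?case
    proof (rule wp_seqI, goal_cases)
      case (1 a2 b2)
      have so2: "same_off {aW, i1} False a1 b1 a2 b2" using 1(2) by (auto simp: same_off_def)
      have B2: "base a2" by (rule base_off[OF B1 so2]) simp
      let ?a3 = "upd a2 aIt 0 (int t + 1)"
      have it2: "a2 aIt 0 = int t" using same_offD[OF so2] pp1 by simp
      have B3: "base ?a3" by (rule base_cong[OF B2]) auto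
      have tt: "a2 aTA 0 = TA" "a2 aTB 0 = TB" using same_offD[OF so2] o1 by (simp_all add: ost_def)
      have o3: "ost u' TA TB ?a3" unfolding ost_def using B3 1(1) tt by simp
      note [simp] = inpD[OF baseD(1)[OF B3]]
      let ?e = "V aIt \<ominus> HN 160000 \<otimes> eMv \<otimes> eMv \<oplus> HN 1"
      have ev: "0 < hval ?e ?a3 \<longleftrightarrow> Nt \<le> Suc t"
      proof -
        have "hval ?e ?a3 = int (Suc t) - int Nt + 1" using inpD(2,3)[OF baseD(1)[OF B2]]
          by (simp add: Mv_def power2_eq_square algebra_simps)
        then show ?thesis by linarith
      qed
      let ?Q = "\<lambda>a' b'. \<exists>u'. outer_st u' TA TB (Suc t) \<and>
         (Suc t < Nt \<and> ost u' TA TB a' \<and> a' aIt 0 = int (Suc t) \<or>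
          Nt \<le> Suc t \<and> a' aIt 0 = 0 \<and> (\<exists>TA' TB'. next_T TA TB TA' TB' \<and> ost (\<lambda>_. 1) TA' TB' a'))"
      have "wpL (When ?e (SV aIt (HN 0) ;; p_ones ;;
         HIf (V aTA) (SV aTA (V aTA \<otimes> HN 201) ;; SV aTB (V aTB \<otimes> HN 200))
           (SV aTA (V aRn \<otimes> HV aINP (V oR \<oplus> HN 3)) ;;
            SV aTB (V aRn \<otimes> HV aINP (V oR \<oplus> HN 3) \<oplus> HV aINP (V oR \<oplus> HN 2) \<otimes> V aRd)))) ?Q ?a3 b2"
      proof (cases "Nt \<le> Suc t")
        case False
        then show ?thesis using st' o3 by (intro wp_if_neg) (auto simp: ev simp del: hval.simps)
      next
        case True
        let ?a4 = "upd ?a3 aIt 0 0"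
        have B4: "base ?a4" by (rule base_cong[OF B3]) auto
        have "wpL (p_ones ;;
         HIf (V aTA) (SV aTA (V aTA \<otimes> HN 201) ;; SV aTB (V aTB \<otimes> HN 200))
           (SV aTA (V aRn \<otimes> HV aINP (V oR \<oplus> HN 3)) ;;
            SV aTB (V aRn \<otimes> HV aINP (V oR \<oplus> HN 3) \<oplus> HV aINP (V oR \<oplus> HN 2) \<otimes> V aRd))) ?Q ?a4 b2"
        proof (rule wp_seqI[OF wp_ones[OF baseD(1)[OF B4]]], goal_cases)
          case (1 a5 b5)
          have so5: "same_off {aW, i1} False ?a4 b2 a5 b5" using 1(2) by (auto simp: same_off_def p_ones_def)
          have B5: "base a5" by (rule base_off[OF B4 so5]) simp
          note [simp] = inpD[OF baseD(1)[OF B5]]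
          have [simp]: "a5 aTA 0 = TA" "a5 aTB 0 = TB" "a5 aIt 0 = 0" using same_offD[OF so5] tt by simp_all
          have e3: "a5 aINP (nat \<bar>int offR + 3\<bar>) = kd" "a5 aINP (nat \<bar>int offR + 2\<bar>) = kn"
            using inpD(16,17)[OF baseD(1)[OF B5]] by (simp_all add: nat_add_distrib)
          have bs: "base (upd (upd a5 aTA 0 x) aTB 0 y)" for x y by (rule base_cong[OF B5]) auto
          show ?case
          proof (cases "0 < TA")
            case pos: True
            have "ost (\<lambda>_. 1) (TA * 201) (TB * 200) (upd (upd a5 aTA 0 (TA * 201)) aTB 0 (TB * 200))"
              unfolding ost_def using bs 1(1) by simp
            then have "?Q (upd (upd a5 aTA 0 (TA * 201)) aTB 0 (TB * 200)) b5"
              using st' True pos by (intro exI[of _ u']) (auto simp: next_T_def)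
            then show ?thesis using pos by (intro wp_if_pos) simp_all
          next
            case neg: False
            have "ost (\<lambda>_. 1) (rn * kd) (rn * kd + kn * rd) (upd (upd a5 aTA 0 (rn * kd)) aTB 0 (rn * kd + kn * rd))"
              unfolding ost_def using bs 1(1) by simp
            then have "?Q (upd (upd a5 aTA 0 (rn * kd)) aTB 0 (rn * kd + kn * rd)) b5"
              using st' True neg by (intro exI[of _ u']) (auto simp: next_T_def)
            then show ?thesis using neg e3 by (intro wp_if_neg) simp_all
          qed
        qed
        then have "wpL (SV aIt (HN 0) ;; p_ones ;;
         HIf (V aTA) (SV aTA (V aTA \<otimes> HN 201) ;; SV aTB (V aTB \<otimes> HN 200))
           (SV aTA (V aRn \<otimes> HV aINP (V oR \<oplus> HN 3)) ;;
            SV aTB (V aRn \<otimes> HV aINP (V oR \<oplus> HN 3) \<oplus> HV aINP (V oR \<oplus> HN 2) \<otimes> V aRd))) ?Q ?a3 b2"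
          unfolding wp_sv hval.simps(1) .
        then show ?thesis by (rule wp_if_pos[rotated]) (use True ev in blast)
      qed
      moreover have "hval (V aIt \<oplus> HN 1) a2 = int t + 1" using it2 by simp
      ultimately show ?case unfolding wp_sv by (simp only:)
    qed
  qed
qed

section \<open>The scan over candidate values of T\<close>

definition stage :: "nat \<Rightarrow> int \<Rightarrow> int \<Rightarrow> bool" where
  "stage st TA TB \<longleftrightarrow> (case st of 0 \<Rightarrow> TA = 0 \<and> TB = 1
     | Suc j \<Rightarrow> TA = rn * kd * 201 ^ j \<and> TB = (rn * kd + kn * rd) * 200 ^ j)"

lemma den_pos: "0 < rn * kd" "0 < rn * kd + kn * rd"
  using rn_pos kd_pos kn_nonneg rd_pos by (simp_all add: add_pos_nonneg)

lemma T0_eq: "T0 = real_of_int (rn * kd) / (rn * kd + kn * rd)"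
proof -
  have "T0 = (rn / rd) / (rn / rd + kn / kd)" by (simp add: T0_def r_eq k_eq)
  also have "\<dots> = real_of_int (rn * kd) / (rn * kd + kn * rd)"
    using rn_pos kd_pos kn_nonneg rd_pos den_pos by (simp add: field_simps add_pos_nonneg)
  finally show ?thesis .
qed

lemma stage_T: "stage (Suc j) TA TB \<Longrightarrow> real_of_int TA / TB = T0 * (201 / 200) ^ j"
  by (simp add: stage_def T0_eq power_divide)

lemma stage_pos: "stage st TA TB \<Longrightarrow> 0 \<le> TA \<and> 0 < TB \<and> (0 < TA \<longleftrightarrow> 0 < st)"
  using den_pos by (cases st) (auto simp: stage_def)

lemma stage_next:
  assumes "stage st TA TB" "next_T TA TB TA' TB'"
  shows "stage (Suc st) TA' TB'"
  using assms stage_pos[OF assms(1)] by (cases st) (auto simp: stage_def next_T_def)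

text \<open>The optimum is at most the total first-stage cost, so a value within 127/125 of it
  cannot pass the cap in \<open>smax\<close>.\<close>

lemma stage_bound:
  assumes "stage st TA TB" "real_of_int TA / TB \<le> 127 / 125 * opt"
  shows "st \<le> smax"
proof (cases st)
  case (Suc j)
  have "T0 * (201 / 200) ^ j \<le> 127 / 125 * opt" using assms stage_T[of j TA TB] Suc by simp
  also have "\<dots> \<le> 2 * (\<Sum>i<m. c i)" using opt_le_cost opt_nonneg by linarith
  finally show ?thesis using smax[of j] Suc by simp
qed simp

definition done_st :: "arrays \<Rightarrow> bool" where
  "done_st a \<longleftrightarrow> (\<exists>u TA TB. ost u TA TB a \<and> ust u TA TB \<and> real_of_int TA / TB \<le> 127 / 125 * opt \<and>
     (\<forall>k<K. good u TA TB k) \<and> a aXD 0 = XDs u TB \<and> (\<forall>i<m. a aXN i = XNs u TA TB i))"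

text \<open>\<open>k\<close> is the variant of the main loop: \<open>st * Nt + t\<close> iterations
  have been made, \<open>Nt\<close> for each abandoned value and \<open>t\<close> for the current
  one.\<close>

definition run_st :: "nat \<Rightarrow> arrays \<Rightarrow> bool" where
  "run_st k a \<longleftrightarrow> (\<exists>u TA TB t st. ost u TA TB a \<and> a aIt 0 = int t \<and> outer_st u TA TB t \<and> t < Nt \<and> stage st TA TB \<and>
     real_of_int TA / TB \<le> 127 / 125 * opt \<and> k + (st * Nt + t) = (smax + 1) * Nt + 1)"

lemma wp_main:
  assumes v: "a aViol 0 = 1" and rs: "run_st ((smax + 1) * Nt + 1) a"
  shows "wpL p_main (\<lambda>a' b'. done_st a') a b"
  unfolding p_main_def
proof (rule wp_While[where I = "\<lambda>k a b. a aViol 0 = 1 \<and> run_st k a \<or> a aViol 0 = 0 \<and> done_st a" and k = "(smax + 1) * Nt + 1"], goal_cases)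
  case 1
  then show ?case using v rs by blast
next
  case 2
  then show ?case by (rule L_main)
next
  case (4 k a b)
  then show ?case by auto
next
  case (3 k a b)
  then have "a aViol 0 = 1" "run_st k a" by auto
  then obtain u TA TB t st where o: "ost u TA TB a" and it: "a aIt 0 = int t" and os: "outer_st u TA TB t" and t: "t < Nt"
    and sg: "stage st TA TB" and T: "real_of_int TA / TB \<le> 127 / 125 * opt" and k: "k + (st * Nt + t) = (smax + 1) * Nt + 1"
    unfolding run_st_def by blast
  have us: "ust u TA TB" using os by (simp add: outer_st_def)
  have k0: "0 < k"
  proof -
    have "st \<le> smax" by (rule stage_bound[OF sg T])
    then have "st * Nt \<le> smax * Nt" by (rule mult_le_mono1)
    moreover have "(smax + 1) * Nt = smax * Nt + Nt" by simp
    ultimately show ?thesis using k t by linarith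
  qed
  let ?I = "\<lambda>a b. a aViol 0 = 1 \<and> run_st (k - 1) a \<or> a aViol 0 = 0 \<and> done_st a"
  have "wpL (p_U ;; p_XN ;; p_CL ;; p_CB ;; p_keep ;; p_check ;; When (V aViol) p_step) ?I a b"
  proof (rule wp_seqI[OF wp_U[OF o]], goal_cases)
    case (1 a1 b1)
    have so1: "same_off {aU, i1} False a b a1 b1" using 1(2) by (auto simp: same_off_def p_U_def)
    have o1: "ost u TA TB a1" by (rule ost_off[OF o so1]) simp
    show ?case
    proof (rule wp_seqI[OF wp_XN[OF o1 1(1)]], goal_cases)
      case (1 a2 b2)
      have so12: "same_off {aXD, aXN, i1} False a1 b1 a2 b2" using 1(2) by (auto simp: same_off_def p_XN_def)
      have so2: "same_off {aU, aXD, aXN, i1} False a b a2 b2" using so1 so12 by (auto simp: same_off_def)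
      have o2: "ost u TA TB a2" by (rule ost_off[OF o so2]) simp
      have B2: "base a2" using o2 by (simp add: ost_def)
      have U2: "a2 aU 0 = Us u" using same_offD[OF so12, of aU] \<open>a1 aU 0 = Us u\<close> by simp
      have X2: "a2 aXD 0 = XDs u TB" "\<And>i. i < m \<Longrightarrow> a2 aXN i = XNs u TA TB i" using 1(1) by auto
      have w2: "wpL p_CL (\<lambda>a' b'. \<forall>e<n. a' aCL e = CLs u TA TB e) a2 b2"
        by (rule wp_CL[OF baseD(1)[OF B2] X2(2,1)])
      show ?case
      proof (rule wp_seqI[OF w2], goal_cases)
        case (1 a3 b3)
        have so23: "same_off {aCL, aY, i1, i2} False a2 b2 a3 b3" using 1(2) by (auto simp: same_off_def p_CL_def p_Y_def)
        have B3: "base a3" by (rule base_off[OF B2 so23]) simp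
        have CL3: "a3 aCL e = CLs u TA TB e" if "e < n" for e using 1(1) that by simp
        have w3: "wpL p_CB (\<lambda>a' b'. bits_ok (CLs u TA TB) a') a3 b3" by (rule wp_CB[OF baseD(1)[OF B3] CL3])
        show ?case
        proof (rule wp_seqI[OF w3], goal_cases)
          case (1 a4 b4)
          have so34: "same_off {aCB, i1, i2} False a3 b3 a4 b4" using 1(2) by (auto simp: same_off_def p_CB_def)
          have B4: "base a4" by (rule base_off[OF B3 so34]) simp
          show ?case
          proof (rule wp_seqI[OF wp_keep[OF B4 1(1)]], goal_cases)
            case (1 a5 b5)
            have so45: "same_off {aCnt, aKL, aKp, aDf, i1, i2, i3} False a4 b4 a5 b5"
              using 1(2) by (auto simp: same_off_def p_keep_def p_keep1_def p_diff_def)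
            have so25: "same_off {aCL, aY, aCB, aCnt, aKL, aKp, aDf, i1, i2, i3} False a2 b2 a5 b5"
              using so23 so34 so45 by (auto simp: same_off_def)
            have o5: "ost u TA TB a5" by (rule ost_off[OF o2 so25]) simp
            have U5: "a5 aU 0 = Us u" using same_offD[OF so25, of aU] U2 by simp
            have C5: "bits_ok (CLs u TA TB) a5" by (rule bits_off[OF \<open>bits_ok (CLs u TA TB) a4\<close> so45]) simp
            have CL5: "a5 aCL e = CLs u TA TB e" if "e < n" for e
              using same_offD[OF so45, of aCL] same_offD[OF so34, of aCL] CL3[OF that] by simp
            have w5: "wpL p_check (\<lambda>a' b'. a' aViol 0 = 1 \<and> row_spec u TA TB (a' aPP) \<or>
               a' aViol 0 = 0 \<and> (\<forall>k<K. good u TA TB k)) a5 b5"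
              by (rule wp_check[OF o5 us U5 CL5 C5 1(1)])
            show ?case
            proof (rule wp_seqI[OF w5], goal_cases)
              case (1 a6 b6)
              let ?M = "{aBB, i2, i3, aQn, aQd, aTN, aTD, aIu, aLa, aSuc, aIU, aLhs, aIM, aFr, aFnd, aRow, aRM, i4, aML, aLd, aWD, aPP, aOm, aViol, i1}"
              have so56: "same_off ?M True a5 b5 a6 b6"
                using 1(2) by (auto simp: same_off_def p_check_def mods_frag)
              have o6: "ost u TA TB a6" by (rule ost_off[OF o5 so56]) simp
              from 1(1) show ?case
              proof (elim disjE conjE)
                assume vv: "a6 aViol 0 = 0" "\<forall>k<K. good u TA TB k"
                have "a6 aXD = a2 aXD" "a6 aXN = a2 aXN" using same_offD[OF so56] same_offD[OF so25] by simp_all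
                then have "done_st a6" unfolding done_st_def using o6 us T vv X2 by (intro exI[of _ u] exI[of _ TA] exI[of _ TB]) auto
                then show ?thesis using vv(1) by (intro wp_if_neg) simp_all
              next
                assume vv: "a6 aViol 0 = 1" "row_spec u TA TB (a6 aPP)"
                have it6: "a6 aIt 0 = int t"
                  using same_offD[OF so56, of aIt] same_offD[OF so25, of aIt] same_offD[OF so2, of aIt] it by simp
                have "wpL p_step ?I a6 b6"
                  using wp_frame[OF wp_step[OF o6 it6 os vv(2)]]
                proof (rule wp_mono, goal_cases)
                  case (1 a7 b7)
                  then obtain u' where st': "outer_st u' TA TB (Suc t)" and
                    cs: "Suc t < Nt \<and> ost u' TA TB a7 \<and> a7 aIt 0 = int (Suc t) \<or>
                      Nt \<le> Suc t \<and> a7 aIt 0 = 0 \<and> (\<exists>TA' TB'. next_T TA TB TA' TB' \<and> ost (\<lambda>_. 1) TA' TB' a7)" by blast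
                  have v7: "a7 aViol 0 = 1" using 1 vv(1) by (simp add: same_off_def p_step_def mods_frag)
                  have "run_st (k - 1) a7"
                    using cs
                  proof (elim disjE conjE exE)
                    assume "Suc t < Nt" "ost u' TA TB a7" "a7 aIt 0 = int (Suc t)"
                    then show ?thesis unfolding run_st_def using st' sg T k k0
                      by (intro exI[of _ u'] exI[of _ TA] exI[of _ TB] exI[of _ "Suc t"] exI[of _ st]) auto
                  next
                    fix TA' TB' assume h: "Nt \<le> Suc t" "a7 aIt 0 = 0" "next_T TA TB TA' TB'" "ost (\<lambda>_. 1) TA' TB' a7"
                    have sg': "stage (Suc st) TA' TB'" by (rule stage_next[OF sg h(3)])
                    have p': "0 \<le> TA'" "0 < TB'" using stage_pos[OF sg'] by auto
                    have os': "outer_st (\<lambda>_. 1) TA' TB' 0" by (rule outer_init[OF p'])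
                    \<comment> \<open>A positive value that failed is at most 1.01 times the
                      optimum, and 101/100 * 201/200 < 127/125. After the value 0 the new value is
                      \<open>T0\<close>, which is below the optimum because a row was found.\<close>
                    have T': "real_of_int TA' / TB' \<le> 127 / 125 * opt"
                    proof (cases "0 < TA")
                      case True
                      have "real_of_int TA / TB \<le> 101 / 100 * opt" by (rule outer_fail[OF st' h(1) True])
                      moreover have "real_of_int TA' / TB' = 201 / 200 * (real_of_int TA / TB)" using h(3) True by (simp add: next_T_def)
                      ultimately show ?thesis using opt_nonneg by linarith
                    next
                      case False
                      then have "real_of_int TA' / TB' = T0" using h(3) by (simp add: next_T_def T0_eq)
                      moreover have "T0 \<le> opt" using st' by (simp add: outer_st_def)
                      ultimately show ?thesis using opt_nonneg by linarith
                    qed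
                    have "Suc t = Nt" using h(1) t by simp
                    then have "Suc st * Nt = st * Nt + Suc t" unfolding mult_Suc by linarith
                    then have "k - 1 + (Suc st * Nt + 0) = (smax + 1) * Nt + 1" using k k0 by linarith
                    moreover have "0 < Nt" by (simp add: Mv_def)
                    ultimately show ?thesis unfolding run_st_def using os' sg' T' h
                      by (intro exI[of _ "\<lambda>_. 1"] exI[of _ TA'] exI[of _ TB'] exI[of _ 0] exI[of _ "Suc st"]) auto
                  qed
                  then show ?case using v7 by blast
                qed
                then show ?thesis using vv(1) by (intro wp_if_pos) simp_all
              qed
            qed
          qed
        qed
      qed
    qed
  qed
  then show ?case using k0 by blast
qed

end

context dr_main
begin

section \<open>Writing the answer in lowest terms\<close>

lemma enc_xs:
  assumes us: "ust u TA TB"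
  shows "enc_rat (xs u TA TB i) = (if 11 * XDs u TB \<le> 21 * XNs u TA TB i then [1, 1] else if 0 < XNs u TA TB i
     then [21 * XNs u TA TB i * (11 * XDs u TB) + 1, 11 * XDs u TB * (11 * XDs u TB)] else [0, 1])"
proof -
  have "quotient_of (of_int (21 * XNs u TA TB i * (11 * XDs u TB) + 1) / of_int (11 * XDs u TB * (11 * XDs u TB))) =
    (21 * XNs u TA TB i * (11 * XDs u TB) + 1, 11 * XDs u TB * (11 * XDs u TB))"
    using XD_pos[OF us] by (intro quotient_of_coprime coprime_succ) simp
  then show ?thesis unfolding xs_def enc_rat_def by (simp del: of_int_mult of_int_add)
qed

lemma enc_fval:
  assumes "0 < TB"
  shows "enc_rat (fval TA TB) = (if 0 < TA then [1225 * TA * TB + 1, 625 * TB * TB] else [0, 1])"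
proof -
  have "coprime (49 * TA * (25 * TB) + 1) (25 * TB * (25 * TB))" by (rule coprime_succ)
  then have "coprime (1225 * TA * TB + 1) (625 * TB * TB)" by (simp add: mult_ac)
  then have "quotient_of (of_int (1225 * TA * TB + 1) / of_int (625 * TB * TB)) = (1225 * TA * TB + 1, 625 * TB * TB)"
    using assms by (intro quotient_of_coprime) simp_all
  then show ?thesis unfolding fval_def enc_rat_def by (simp del: of_int_mult of_int_add)
qed

definition result :: "block \<Rightarrow> bool" where
  "result b \<longleftrightarrow> (\<exists>x f. query b = enc_vec (sets_of I) x @ enc_rat f \<and> (\<lambda>S. of_rat (x S)) \<in> P \<and>
     h (\<lambda>S. of_rat (x S)) \<le> \<beta>1 * \<beta>2 * of_rat f \<and> of_rat f \<le> 2 * (1 + \<epsilon>) * opt)"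

lemma wp_out:
  assumes d: "done_st a"
  shows "wpL p_out (\<lambda>a' b'. result b') a b"
proof -
  obtain u TA TB where o: "ost u TA TB a" and us: "ust u TA TB" and T: "real_of_int TA / TB \<le> 127 / 125 * opt"
    and gd: "\<And>k. k < K \<Longrightarrow> good u TA TB k" and X: "a aXD 0 = XDs u TB" "\<And>i. i < m \<Longrightarrow> a aXN i = XNs u TA TB i"
    using d unfolding done_st_def by blast
  have UTB: "0 < TB" "0 \<le> TA" using us by (auto simp: ust_def)
  have B: "base a" using o by (simp add: ost_def)
  note [simp] = inpD[OF baseD(1)[OF B]]
  let ?f = "fval TA TB" and ?x = "xbar u TA TB"
  have res: "result b'" if "b' 0 = 2 * int m + 2" "\<And>i. i < m \<Longrightarrow> has b' (1 + i * 2) (enc_rat (xs u TA TB i))"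
    "has b' (1 + m * 2) (enc_rat ?f)" for b'
  proof -
    have "has b' 1 (concat (map (\<lambda>A. enc_rat (?x A)) (sets_of I)))"
      by (subst concat_map_nth, subst has_concat[where l = 2]) (use that(2) in \<open>auto simp: xbar_SS\<close>)
    then have "has b' 1 (enc_vec (sets_of I) ?x @ enc_rat ?f)"
      using that(3) by (simp add: enc_vec_def length_concat_const)
    then have q: "query b' = enc_vec (sets_of I) ?x @ enc_rat ?f"
      using that(1) by (intro query_eq) (simp_all add: enc_vec_def length_concat_const)
    have "h (\<lambda>S. of_rat (?x S)) \<le> \<beta>1 * \<beta>2 * (49 / 25 * (real_of_int TA / TB))" by (rule success[OF us gd])
    also have "\<dots> \<le> \<beta>1 * \<beta>2 * of_rat ?f"
      using fval_bounds(1)[OF UTB] b1 b2 by (intro mult_left_mono mult_nonneg_nonneg) auto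
    finally have h1: "h (\<lambda>S. of_rat (?x S)) \<le> \<beta>1 * \<beta>2 * of_rat ?f" .
    have "real_of_rat ?f \<le> 1226 / 625 * (real_of_int TA / TB)" by (rule fval_bounds(2)[OF UTB])
    also have "\<dots> \<le> 1226 / 625 * (127 / 125 * opt)" using T by simp
    \<comment> \<open>1226/625 * 127/125 = 155702/78125 < 2.\<close>
    also have "\<dots> \<le> 2 * opt" using opt_nonneg by simp
    also have "\<dots> \<le> 2 * (1 + \<epsilon>) * opt" using opt_nonneg eps by (intro mult_right_mono) auto
    finally show ?thesis unfolding result_def using q h1 xbar_P[OF us] by blast
  qed
  have loop: "wpL (HFor i1 (V aM) (
     HPut (HN 1 \<oplus> HN 2 \<otimes> V i1) (HN 1) ;; HPut (HN 2 \<oplus> HN 2 \<otimes> V i1) (HN 1) ;;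
     When (eQ \<ominus> eP) (HIf eP
       (HPut (HN 1 \<oplus> HN 2 \<otimes> V i1) (eP \<otimes> eQ \<oplus> HN 1) ;; HPut (HN 2 \<oplus> HN 2 \<otimes> V i1) (eQ \<otimes> eQ))
       (HPut (HN 1 \<oplus> HN 2 \<otimes> V i1) (HN 0)))))
    (\<lambda>a' b'. b' 0 = 2 * int m + 2 \<and> (\<forall>i<m. has b' (1 + i * 2) (enc_rat (xs u TA TB i)))) a (b(0 := 2 * int m + 2))"
  proof (rule wp_For[where N = m and I = "\<lambda>j a' b'. b' 0 = 2 * int m + 2 \<and> (\<forall>i<j. has b' (1 + i * 2) (enc_rat (xs u TA TB i)))"], goal_cases)
    case (6 i a1 b1)
    have so: "same_off {i1} True a b a1 b1" using 6(4) by (auto simp: same_off_def)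
    have [simp]: "a1 aXD 0 = XDs u TB" "a1 aXN i = XNs u TA TB i" using same_offD[OF so] X 6(1) by simp_all
    have ix: "nat (1 + 2 * int i) = Suc (2 * i)" "nat (2 + 2 * int i) = Suc (Suc (2 * i))" by linarith+
    have XN0: "0 \<le> XNs u TA TB i" by (rule XN_nonneg[OF us 6(1)])
    have old: "has (b1(Suc (2 * i) := x, Suc (Suc (2 * i)) := y)) (1 + j * 2) (enc_rat (xs u TA TB j))" if "j < i" for j x y
    proof -
      have "has b1 (1 + j * 2) (enc_rat (xs u TA TB j))" using 6(2) that by blast
      then show ?thesis using that unfolding enc_rat_def by auto
    qed
    have new: "has (b1(Suc (2 * i) := x, Suc (Suc (2 * i)) := y)) (1 + i * 2) (enc_rat (xs u TA TB i))"
      if "enc_rat (xs u TA TB i) = [x, y]" for x y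
      unfolding that by (simp add: mult.commute)
    have all: "\<forall>j<Suc i. has (b1(Suc (2 * i) := x, Suc (Suc (2 * i)) := y)) (1 + j * 2) (enc_rat (xs u TA TB j))"
      if "enc_rat (xs u TA TB i) = [x, y]" for x y
      using old new[OF that] by (auto simp: less_Suc_eq)
    consider "11 * XDs u TB \<le> 21 * XNs u TA TB i" | "21 * XNs u TA TB i < 11 * XDs u TB" "0 < XNs u TA TB i"
      | "21 * XNs u TA TB i < 11 * XDs u TB" "XNs u TA TB i = 0" using XN0 by linarith
    then show ?case
    proof cases
      case 1
      then show ?thesis using 6(2,3) all[of 1 1] enc_xs[OF us, of i] by (simp add: ix)
    next
      case 2
      have "b1(Suc (2 * i) := x', Suc (Suc (2 * i)) := y', Suc (2 * i) := x, Suc (Suc (2 * i)) := y) =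
        b1(Suc (2 * i) := x, Suc (Suc (2 * i)) := y)" for x y x' y' by auto
      then show ?thesis
        using 6(2,3) 2 all[of "21 * XNs u TA TB i * (11 * XDs u TB) + 1" "11 * XDs u TB * (11 * XDs u TB)"] enc_xs[OF us, of i]
        by (simp add: ix)
    next
      case 3
      have "b1(Suc (2 * i) := x', Suc (Suc (2 * i)) := y', Suc (2 * i) := x) =
        b1(Suc (2 * i) := x, Suc (Suc (2 * i)) := y')" for x x' y' by auto
      then show ?thesis using 6(2,3) 3 all[of 0 1] enc_xs[OF us, of i] by (simp add: ix)
    qed
  qed (use L_facts in auto)
  have "wpL (HFor i1 (V aM) (
     HPut (HN 1 \<oplus> HN 2 \<otimes> V i1) (HN 1) ;; HPut (HN 2 \<oplus> HN 2 \<otimes> V i1) (HN 1) ;;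
     When (eQ \<ominus> eP) (HIf eP
       (HPut (HN 1 \<oplus> HN 2 \<otimes> V i1) (eP \<otimes> eQ \<oplus> HN 1) ;; HPut (HN 2 \<oplus> HN 2 \<otimes> V i1) (eQ \<otimes> eQ))
       (HPut (HN 1 \<oplus> HN 2 \<otimes> V i1) (HN 0)))) ;;
   HIf (V aTA) (HPut (HN 1 \<oplus> HN 2 \<otimes> V aM) (HN 1225 \<otimes> V aTA \<otimes> V aTB \<oplus> HN 1) ;;
       HPut (HN 2 \<oplus> HN 2 \<otimes> V aM) (HN 625 \<otimes> V aTB \<otimes> V aTB))
     (HPut (HN 1 \<oplus> HN 2 \<otimes> V aM) (HN 0) ;; HPut (HN 2 \<oplus> HN 2 \<otimes> V aM) (HN 1))) (\<lambda>a' b'. result b') a (b(0 := 2 * int m + 2))"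
  proof (rule wp_seqI[OF loop], goal_cases)
    case (1 a2 b2)
    have so: "same_off {i1} True a b a2 b2" using 1(2) by (auto simp: same_off_def)
    have [simp]: "a2 aTA 0 = TA" "a2 aTB 0 = TB" "a2 aM 0 = int m" using same_offD[OF so] o by (simp_all add: ost_def)
    have ix: "nat (1 + 2 * int m) = Suc (2 * m)" "nat (2 + 2 * int m) = Suc (Suc (2 * m))" by linarith+
    have fin: "result (b2(Suc (2 * m) := x, Suc (Suc (2 * m)) := y))" if "enc_rat ?f = [x, y]" for x y
    proof (rule res)
      show "(b2(Suc (2 * m) := x, Suc (Suc (2 * m)) := y)) 0 = 2 * int m + 2" using 1(1) by simp
      show "has (b2(Suc (2 * m) := x, Suc (Suc (2 * m)) := y)) (1 + m * 2) (enc_rat ?f)"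
        unfolding that by (simp add: mult.commute)
      show "has (b2(Suc (2 * m) := x, Suc (Suc (2 * m)) := y)) (1 + i * 2) (enc_rat (xs u TA TB i))" if "i < m" for i
      proof -
        have "has b2 (1 + i * 2) (enc_rat (xs u TA TB i))" using 1(1) that by blast
        then show ?thesis using that unfolding enc_rat_def by auto
      qed
    qed
    show ?case
    proof (cases "0 < TA")
      case True
      then show ?thesis using fin[of "1225 * TA * TB + 1" "625 * TB * TB"] enc_fval[OF UTB(1), of TA] by (simp add: ix)
    next
      case False
      then show ?thesis using fin[of 0 1] enc_fval[OF UTB(1), of TA] by (simp add: ix)
    qed
  qed
  then show ?thesis unfolding p_out_def by simp
qed

section \<open>Reading the input and tabulating the constants\<close>

lemma wp_read:
  assumes b: "b 0 = int (length (run_input I \<epsilon>))" "has b 1 (run_input I \<epsilon>)"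
  shows "wpL p_read (\<lambda>a' b'. inp a') a b"
proof -
  let ?w = "run_input I \<epsilon>"
  let ?a1 = "upd a aLen 0 (int (length ?w))"
  have loop: "wpL (HFor i1 (V aLen) (HGet aINP (V i1) (HN 1 \<oplus> V i1))) (\<lambda>a' b'. has (a' aINP) 0 ?w) ?a1 b"
  proof (rule wp_For[where N = "length ?w" and I = "\<lambda>i a' b'. \<forall>j<i. a' aINP j = ?w ! j"], goal_cases)
    case (6 i a1 b1)
    have b1: "b1 = b" using 6(4) by (simp add: same_off_def)
    have "b (Suc i) = ?w ! i" using b(2) 6(1) by (simp add: has_def)
    moreover have "\<bar>?w ! i\<bar> \<le> 2 ^ L" using L_in 6(1) by simp
    ultimately show ?case using 6(2,3) b1 by (auto simp: nat_add_distrib less_Suc_eq)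
  qed (use L_len in \<open>auto simp: has_def\<close>)
  have "wpL (HFor i1 (V aLen) (HGet aINP (V i1) (HN 1 \<oplus> V i1)) ;;
   SV aN (HV aINP (HN 1)) ;; SV aM (HV aINP (HN 2)) ;;
   SV oC1 (HN 3 \<oplus> V aM \<otimes> V aN) ;; SV oC2 (V oC1 \<oplus> HN 2 \<otimes> V aM) ;; SV oR (V oC2 \<oplus> HN 2 \<otimes> V aM) ;;
   SV aK (HV aINP (V oR \<oplus> HN 4)) ;; SV oA (V oR \<oplus> HN 5) ;; SV oP (V oA \<oplus> V aK \<otimes> V aN) ;;
   SV aRn (HV aINP (V oR)) ;; SV aRd (HV aINP (V oR \<oplus> HN 1))) (\<lambda>a' b'. inp a') ?a1 b"
  proof (rule wp_seqI[OF loop], goal_cases)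
    case (1 a2 b2)
    let ?f = "a2 aINP"
    have f1: "?f 1 = int n" and f2: "has ?f 2 (enc_sets n (sets_of I))"
      and f3: "has ?f off1 (enc_vec (sets_of I) (cost1 I))" and f4: "has ?f off2 (enc_vec (sets_of I) (cost2 I))"
      and f5: "has ?f offR (enc_rat (radius I))" and f6: "has ?f (offR + 2) (enc_rat (max_scen_dist I))"
      and f7: "has ?f (offR + 4) (enc_sets n (support_of I))" and f8: "has ?f offP (enc_vec (support_of I) (prob_of I))"
      using 1(1) unfolding run_input_def enc_instance_def
      by (simp_all add: enc_sets_def enc_vec_def length_concat_const off1_def off2_def offR_def offA_def offP_def
        eval_nat_numeral algebra_simps)
    have g2: "?f 2 = int m" and g3: "\<And>i e. i < m \<Longrightarrow> e < n \<Longrightarrow> ?f (3 + i * n + e) = (if e \<in> SS i then 1 else 0)"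
    proof -
      show "?f 2 = int m" using f2 by (simp add: enc_sets_def)
      have "has ?f 3 (concat (map (\<lambda>q. enc_set n (SS q)) [0..<m]))" using f2 concat_map_nth[of "enc_set n" "sets_of I"]
        by (simp add: enc_sets_def eval_nat_numeral)
      then show "?f (3 + i * n + e) = (if e \<in> SS i then 1 else 0)" if "i < m" "e < n" for i e
        using that by (subst (asm) has_concat[where l = n]) (simp_all add: has_enc_set)
    qed
    have g7: "?f (offR + 4) = int K" and g8: "\<And>k e. k < K \<Longrightarrow> e < n \<Longrightarrow> ?f (offA + k * n + e) = (if e \<in> AA k then 1 else 0)"
    proof -
      show "?f (offR + 4) = int K" using f7 by (simp add: enc_sets_def)
      have "has ?f offA (concat (map (\<lambda>q. enc_set n (AA q)) [0..<K]))" using f7 concat_map_nth[of "enc_set n" "support_of I"]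
        by (simp add: enc_sets_def offA_def eval_nat_numeral)
      then show "?f (offA + k * n + e) = (if e \<in> AA k then 1 else 0)" if "k < K" "e < n" for k e
        using that by (subst (asm) has_concat[where l = n]) (simp_all add: has_enc_set)
    qed
    have vec: "?f (p + 2 * i) = fst (quotient_of (v (As ! i))) \<and> ?f (Suc (p + 2 * i)) = snd (quotient_of (v (As ! i)))"
      if "has ?f p (enc_vec As v)" "i < length As" for p As v i
    proof -
      have "has ?f p (concat (map (\<lambda>q. enc_rat (v (As ! q))) [0..<length As]))"
        using that(1) concat_map_nth[of "\<lambda>A. enc_rat (v A)" As] by (simp add: enc_vec_def)
      then have "has ?f (p + i * 2) (enc_rat (v (As ! i)))"
        using that(2) by (subst (asm) has_concat[where l = 2]) simp_all
      then show ?thesis by (simp add: enc_rat_def mult.commute)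
    qed
    have rr: "?f offR = rn" "?f (Suc offR) = rd" "?f (offR + 2) = kn" "?f (offR + 3) = kd"
      using f5 f6 by (simp_all add: enc_rat_def rn_def rd_def kn_def kd_def eval_nat_numeral)
    have e1: "3 + int m * int n = int off1" "int off1 + 2 * int m = int off2" "int off2 + 2 * int m = int offR"
      "int offR + 5 = int offA" "int offA + int K * int n = int offP"
      by (simp_all add: off1_def off2_def offR_def offA_def offP_def)
    have e2: "nat \<bar>int offR + 4\<bar> = offR + 4" "nat \<bar>int offR + 1\<bar> = Suc offR" by linarith+
    have e3: "nat (7 + (4 * int m + int m * int n)) = offR + 4" "nat (4 * int m + int off1) = offR"
      "nat (4 + (4 * int m + int m * int n)) = Suc offR" "4 * int m + int off1 = int offR"
      "8 + (4 * int m + int m * int n) = int offA" "8 + (4 * int m + int m * int n) + int K * int n = int offP"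
    proof -
      have o: "int offR = 3 + (4 * int m + int m * int n)" by (simp add: offR_def off2_def off1_def)
      have mn: "0 \<le> int m * int n" by simp
      show "nat (7 + (4 * int m + int m * int n)) = offR + 4" "nat (4 + (4 * int m + int m * int n)) = Suc offR"
        using o by linarith+
      show "nat (4 * int m + int off1) = offR" "4 * int m + int off1 = int offR" by (simp_all add: offR_def off2_def)
      show "8 + (4 * int m + int m * int n) = int offA" using o by (simp add: offA_def)
      then show "8 + (4 * int m + int m * int n) + int K * int n = int offP" by (simp add: offP_def)
    qed
    show ?case
      using f1 g2 g3 g7 g8 rr vec[OF f3] vec[OF f4] vec[OF f8]
      unfolding inp_def cn_def cd_def dn_def dd_def pn_def pd_def
      by (simp add: e1 e2 e3)
  qed
  then show ?thesis unfolding p_read_def using b(1) L_len2 by simp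
qed

lemma wp_Dd: "inp a \<Longrightarrow> wpL p_Dd (\<lambda>a' b'. a' aDd 0 = Dd) a b"
proof -
  assume B: "inp a"
  note [simp] = inpD[OF B]
  show ?thesis unfolding p_Dd_def wp.simps
    by (rule wp_For[where N = m and I = "\<lambda>i a b. a aDd 0 = (\<Prod>j<i. dd j)"])
      (use L_facts in \<open>auto simp: same_off_def idxs Dd_def\<close>)
qed

lemma wp_CC: "inp a \<Longrightarrow> a aDd 0 = Dd \<Longrightarrow> wpL p_CC (\<lambda>a' b'. \<forall>k<3 * m. a' aCC k = CC k) a b"
proof -
  assume B: "inp a" and D: "a aDd 0 = Dd"
  note [simp] = inpD[OF B] D
  show ?thesis unfolding p_CC_def
  proof (rule wp_For[where N = m and I = "\<lambda>i a b. \<forall>k<3 * i. a aCC k = CC k"], goal_cases)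
    case (6 i a1 b1)
    have so: "same_off {aCC, i1} False a b a1 b1" using 6(4) by (auto simp: same_off_def)
    have [simp]: "a1 aINP = a aINP" "a1 oC2 = a oC2" "a1 aDd = a aDd" using same_offD[OF so] by simp_all
    have md: "(3 * i) div 3 = i" "(3 * i) mod 3 = 0" "Suc (3 * i) div 3 = i" "Suc (3 * i) mod 3 = 1"
      "Suc (Suc (3 * i)) div 3 = i" "Suc (Suc (3 * i)) mod 3 = 2" by presburger+
    have c: "CC (3 * i) = 3 * (dn i * Dd div dd i)" "CC (Suc (3 * i)) = 2 * (dn i * Dd div dd i)" "CC (Suc (Suc (3 * i))) = 0"
      unfolding CC_def md by simp_all
    have lt: "k < 3 * Suc i \<longleftrightarrow> k < 3 * i \<or> k = 3 * i \<or> k = Suc (3 * i) \<or> k = Suc (Suc (3 * i))" for k by auto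
    have ix: "nat \<bar>3 * int i\<bar> = 3 * i" "nat \<bar>3 * int i + 1\<bar> = Suc (3 * i)" "nat \<bar>3 * int i + 2\<bar> = Suc (Suc (3 * i))"
      "nat \<bar>int off2 + 2 * int i\<bar> = off2 + 2 * i" "nat \<bar>int off2 + 2 * int i + 1\<bar> = Suc (off2 + 2 * i)" by linarith+
    show ?case using 6(1-3) by (auto simp: lt c ix simp del: mult_Suc_right abs_of_nonneg)
  qed (use L_facts in auto)
qed

lemma wp_Pi: "inp a \<Longrightarrow> \<forall>k<3 * m. a aCC k = CC k \<Longrightarrow> wpL p_Pi (\<lambda>a' b'. a' aPi 0 = PC) a b"
proof -
  assume B: "inp a" and D: "\<forall>k<3 * m. a aCC k = CC k"
  note [simp] = inpD[OF B]
  show ?thesis unfolding p_Pi_def wp.simps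
    by (rule wp_For[where N = "3 * m" and I = "\<lambda>i a b. a aPi 0 = (\<Prod>k<i. if 0 < CC k then CC k else 1)"])
      (use L_facts D in \<open>auto simp: same_off_def PC_def\<close>)
qed

lemma wp_IC: "inp a \<Longrightarrow> \<forall>k<3 * m. a aCC k = CC k \<Longrightarrow> a aPi 0 = PC \<Longrightarrow> wpL p_IC (\<lambda>a' b'. \<forall>k<3 * m. a' aIC k = IC k) a b"
proof -
  assume B: "inp a" and D: "\<forall>k<3 * m. a aCC k = CC k" "a aPi 0 = PC"
  note [simp] = inpD[OF B]
  show ?thesis unfolding p_IC_def
    by (rule wp_For[where N = "3 * m" and I = "\<lambda>i a b. \<forall>k<i. a aIC k = IC k"])
      (use L_facts D in \<open>auto simp: same_off_def IC_def less_Suc_eq\<close>)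
qed

lemma wp_Ga: "inp a \<Longrightarrow> wpL p_Ga (\<lambda>a' b'. a' aGa 0 = Ga) a b"
proof -
  assume B: "inp a"
  note [simp] = inpD[OF B]
  show ?thesis unfolding p_Ga_def wp.simps
    by (rule wp_For[where N = m and I = "\<lambda>i a b. a aGa 0 = (\<Prod>j<i. if 0 < cn j then cn j else 1)"])
      (use L_facts in \<open>auto simp: same_off_def idxs Ga_def\<close>)
qed

lemma wp_XF: "inp a \<Longrightarrow> a aGa 0 = Ga \<Longrightarrow> wpL p_XF (\<lambda>a' b'. \<forall>i<m. a' aXF i = XF i) a b"
proof -
  assume B: "inp a" and D: "a aGa 0 = Ga"
  note [simp] = inpD[OF B]
  show ?thesis unfolding p_XF_def
    by (rule wp_For[where N = m and I = "\<lambda>i a b. \<forall>j<i. a aXF j = XF j"])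
      (use L_facts D in \<open>auto simp: same_off_def idxs XF_def less_Suc_eq\<close>)
qed

lemma wp_init:
  assumes b: "b 0 = int (length (run_input I \<epsilon>))" "has b 1 (run_input I \<epsilon>)"
  shows "wpL p_init (\<lambda>a' b'. a' aViol 0 = 1 \<and> run_st ((smax + 1) * Nt + 1) a') a b"
  unfolding p_init_def
proof (rule wp_seqI[OF wp_read[OF b]], goal_cases)
  case (1 a1 b1)
  note i1 = 1(1)
  show ?case
  proof (rule wp_seqI[OF wp_Dd[OF i1]], goal_cases)
    case (1 a2 b2)
    have so: "same_off {aDd, i1} False a1 b1 a2 b2" using 1(2) by (auto simp: same_off_def p_Dd_def)
    have i2: "inp a2" by (rule inp_off[OF i1 so]) simp
    note d2 = 1(1)
    show ?case
    proof (rule wp_seqI[OF wp_CC[OF i2 d2]], goal_cases)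
      case (1 a3 b3)
      have so: "same_off {aCC, i1} False a2 b2 a3 b3" using 1(2) by (auto simp: same_off_def p_CC_def)
      have i3: "inp a3" by (rule inp_off[OF i2 so]) simp
      have d3: "a3 aDd 0 = Dd" using same_offD[OF so] d2 by simp
      note c3 = 1(1)
      show ?case
      proof (rule wp_seqI[OF wp_Pi[OF i3 c3]], goal_cases)
        case (1 a4 b4)
        have so: "same_off {aPi, i1} False a3 b3 a4 b4" using 1(2) by (auto simp: same_off_def p_Pi_def)
        have i4: "inp a4" by (rule inp_off[OF i3 so]) simp
        have d4: "a4 aDd 0 = Dd" "\<forall>k<3 * m. a4 aCC k = CC k" using same_offD[OF so] d3 c3 by simp_all
        note p4 = 1(1)
        show ?case
        proof (rule wp_seqI[OF wp_IC[OF i4 d4(2) p4]], goal_cases)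
          case (1 a5 b5)
          have so: "same_off {aIC, i1} False a4 b4 a5 b5" using 1(2) by (auto simp: same_off_def p_IC_def)
          have i5: "inp a5" by (rule inp_off[OF i4 so]) simp
          have d5: "a5 aDd 0 = Dd" "\<forall>k<3 * m. a5 aCC k = CC k" "a5 aPi 0 = PC" "\<forall>k<3 * m. a5 aIC k = IC k"
            using same_offD[OF so] d4 p4 1(1) by simp_all
          show ?case
          proof (rule wp_seqI[OF wp_Ga[OF i5]], goal_cases)
            case (1 a6 b6)
            have so: "same_off {aGa, i1} False a5 b5 a6 b6" using 1(2) by (auto simp: same_off_def p_Ga_def)
            have i6: "inp a6" by (rule inp_off[OF i5 so]) simp
            have d6: "a6 aDd 0 = Dd" "\<forall>k<3 * m. a6 aCC k = CC k" "a6 aPi 0 = PC" "\<forall>k<3 * m. a6 aIC k = IC k"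
              using same_offD[OF so] d5 by simp_all
            note g6 = 1(1)
            show ?case
            proof (rule wp_seqI[OF wp_XF[OF i6 g6]], goal_cases)
              case (1 a7 b7)
              have so: "same_off {aXF, i1} False a6 b6 a7 b7" using 1(2) by (auto simp: same_off_def p_XF_def)
              have i7: "inp a7" by (rule inp_off[OF i6 so]) simp
              have B7: "base a7" unfolding base_def using i7 same_offD[OF so] d6 g6 1(1) by simp
              show ?case
              proof (rule wp_seqI[OF wp_ones[OF i7]], goal_cases)
                case (1 a8 b8)
                have so: "same_off {aW, i1} False a7 b7 a8 b8" using 1(2) by (auto simp: same_off_def p_ones_def)
                have B8: "base a8" by (rule base_off[OF B7 so]) simp
                let ?a = "upd (upd (upd (upd a8 aTA 0 0) aTB 0 1) aIt 0 0) aViol 0 1"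
                have "base ?a" by (rule base_cong[OF B8]) auto
                then have "ost (\<lambda>_. 1) 0 1 ?a" unfolding ost_def using 1(1) by simp
                then have "run_st ((smax + 1) * Nt + 1) ?a" unfolding run_st_def
                  using outer_init[of 0 1] opt_nonneg
                  by (intro exI[of _ "\<lambda>_. 1"] exI[of _ 0] exI[of _ 1]) (simp add: stage_def Mv_def)
                then show ?case by simp
              qed
            qed
          qed
        qed
      qed
    qed
  qed
qed

lemma wp_program:
  assumes b: "b 0 = int (length (run_input I \<epsilon>))" "has b 1 (run_input I \<epsilon>)"
  shows "wpL program (\<lambda>a' b'. result b') a b"
  unfolding program_def
proof (rule wp_seqI[OF wp_init[OF b]], goal_cases)
  case (1 a1 b1)
  then have v: "a1 aViol 0 = 1" and rs: "run_st ((smax + 1) * Nt + 1) a1" by blast+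
  show ?case by (rule wp_seqI[OF wp_main[OF v rs]]) (rule wp_out)
qed

end

section \<open>Sizes and running time\<close>

lemma word_size_Cons: "word_size (v # ws) = 1 + floorlog 2 (nat \<bar>v\<bar>) + word_size ws"
  by (simp add: word_size_def)

lemma length_le_word_size: "length ws \<le> word_size ws"
  by (induction ws) (simp_all add: word_size_Cons)

lemma abs_le_word_size: "v \<in> set ws \<Longrightarrow> \<bar>v\<bar> \<le> 2 ^ word_size ws"
proof (induction ws)
  case (Cons w ws)
  have tl: "(2::int) ^ word_size ws \<le> 2 ^ word_size (w # ws)"
    by (intro power_increasing) (simp_all add: word_size_Cons)
  have hd: "\<bar>w\<bar> \<le> 2 ^ word_size (w # ws)"
  proof -
    have "floorlog 2 (nat \<bar>w\<bar>) \<le> word_size (w # ws)" by (simp add: word_size_Cons)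
    then have "nat \<bar>w\<bar> < 2 ^ word_size (w # ws)" by (subst (asm) floorlog_le_iff) auto
    then have "int (nat \<bar>w\<bar>) < int (2 ^ word_size (w # ws))" by (simp only: of_nat_less_iff)
    then show ?thesis by simp
  qed
  show ?case
  proof (cases "v = w")
    case False
    then have "\<bar>v\<bar> \<le> 2 ^ word_size ws" using Cons by simp
    then show ?thesis using tl by (rule order_trans)
  qed (use hd in simp)
qed simp

lemma two_le_ratio_power: "(2::real) \<le> (201 / 200) ^ 200"
proof -
  have "1 + real 200 * (1 / 200) \<le> (1 + 1 / 200 :: real) ^ 200" by (rule Bernoulli_inequality) simp
  then show ?thesis by simp
qed

lemma read_block_rel: "rel s a b \<Longrightarrow> read_block s 0 = query b"
  by (auto simp: read_block_def query_def rel_def intro!: map_cong)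
    (metis of_nat_0, metis of_nat_Suc add.commute)

lemma rel_initial: "rel (initial_memory ws) (\<lambda>_ _. 0) (answer (\<lambda>_. 0) ws)"
proof -
  have "rel (\<lambda>_. 0) (\<lambda>_ _. 0) (\<lambda>_. 0)" by (simp add: rel_def)
  then show ?thesis unfolding initial_memory_def
  proof (rule rel_write)
    fix i show "write_block (\<lambda>_. 0) 0 ws (int i) = answer (\<lambda>_. 0) ws i"
      by (cases i) (auto simp: write_block_def answer_def nat_diff_distrib)
  qed (auto simp: write_block_def)
qed

context dr_inst
begin

lemma length_enc_instance: "length (enc_instance I) = 7 + m * n + 4 * m + K * n + 2 * K"
  by (simp add: enc_instance_def enc_sets_def enc_vec_def length_concat_const)

lemma K_pos: "0 < K"
  using p_sum by (intro gr0I) simp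

lemma size_bounds:
  shows "n \<le> input_size I" "m \<le> input_size I" "m * n \<le> input_size I" "K \<le> input_size I" "1 \<le> input_size I"
    "length (enc_instance I) \<le> input_size I"
    "\<And>v. v \<in> set (enc_instance I) \<Longrightarrow> \<bar>v\<bar> \<le> 2 ^ input_size I"
    "\<And>A B v. A \<in> \<A> \<Longrightarrow> B \<in> \<A> \<Longrightarrow> v \<in> set (enc_rat (scen_dist I A B)) \<Longrightarrow> \<bar>v\<bar> \<le> 2 ^ input_size I"
proof -
  have le: "length (enc_instance I) \<le> input_size I"
    using length_le_word_size[of "enc_instance I"] by (simp add: input_size_def)
  then show "length (enc_instance I) \<le> input_size I" .
  \<comment> \<open>The support is nonempty because its probabilities sum to 1, so its bit vectors
    alone account for \<open>n\<close> words of the input.\<close>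
  have "n \<le> K * n" using mult_le_mono1[OF Suc_leI[OF K_pos], of n] by (simp only: mult_Suc mult_0 add_0_right)
  then show "n \<le> input_size I" "m \<le> input_size I" "m * n \<le> input_size I" "K \<le> input_size I" "1 \<le> input_size I"
    using le unfolding length_enc_instance by linarith+
  show "\<bar>v\<bar> \<le> 2 ^ input_size I" if "v \<in> set (enc_instance I)" for v
  proof -
    have "(2::int) ^ word_size (enc_instance I) \<le> 2 ^ input_size I"
      by (intro power_increasing) (simp_all add: input_size_def)
    then show ?thesis using abs_le_word_size[OF that] by linarith
  qed
  show "\<bar>v\<bar> \<le> 2 ^ input_size I" if h: "A \<in> \<A>" "B \<in> \<A>" "v \<in> set (enc_rat (scen_dist I A B))" for A B v
  proof -
    let ?X = "{word_size (enc_rat (scen_dist I A A')) | A A'. A \<in> \<A> \<and> A' \<in> \<A>}"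
    have "?X = (\<lambda>(A, A'). word_size (enc_rat (scen_dist I A A'))) ` (\<A> \<times> \<A>)" by auto
    then have "finite ?X" using fin_scen by simp
    then have "word_size (enc_rat (scen_dist I A B)) \<le> Max ?X" using h by (intro Max_ge) auto
    then have "word_size (enc_rat (scen_dist I A B)) \<le> input_size I" by (simp add: input_size_def)
    then have "(2::int) ^ word_size (enc_rat (scen_dist I A B)) \<le> 2 ^ input_size I" by (intro power_increasing) auto
    then show ?thesis using abs_le_word_size[OF h(3)] by linarith
  qed
qed

end

context dr_run
begin

text \<open>With s the input size and Z = 2^s, \<open>T0\<close> is at least 1/(2 Z^2) and the total
  first-stage cost is at most Z^2. The factor 201/200 doubles the value within 200 steps, so after
  200 (4 s + 3) steps it has reached 8 Z^4 / (2 Z^2) = 4 Z^2, beyond twice that cost.\<close>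

lemma scan_bound:
  assumes "T0 * (201 / 200) ^ j \<le> 2 * (\<Sum>i<m. c i)"
  shows "j < 200 * (4 * input_size I + 3)"
proof (rule ccontr)
  assume "\<not> ?thesis"
  then have j: "200 * (4 * input_size I + 3) \<le> j" by simp
  let ?s = "input_size I"
  define Z where "Z = (2::real) ^ ?s"
  have Z1: "1 \<le> Z" by (simp add: Z_def)
  have "(2::real) ^ (4 * ?s + 3) \<le> ((201 / 200) ^ 200) ^ (4 * ?s + 3)"
    by (intro power_mono two_le_ratio_power) simp
  also have "\<dots> = (201 / 200) ^ (200 * (4 * ?s + 3))" by (simp only: power_mult)
  also have "\<dots> \<le> (201 / 200) ^ j" using j by (intro power_increasing) auto
  finally have "(2::real) ^ (4 * ?s + 3) \<le> (201 / 200) ^ j" .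
  moreover have "(2::real) ^ (4 * ?s + 3) = 8 * (Z * Z * Z * Z)"
  proof -
    have "(2::real) ^ (4 * ?s) = Z ^ 4" unfolding Z_def by (simp only: mult.commute[of 4] power_mult)
    then show ?thesis by (simp add: power_add power4_eq_xxxx)
  qed
  ultimately have pw: "8 * (Z * Z * Z * Z) \<le> (201 / 200) ^ j" by simp
  have word: "\<bar>real_of_int v\<bar> \<le> Z" if "v \<in> set (enc_instance I)" for v
  proof -
    have "real_of_int \<bar>v\<bar> \<le> real_of_int (2 ^ ?s)" using size_bounds(7)[OF that] by (simp only: of_int_le_iff)
    then show ?thesis by (simp add: Z_def)
  qed
  have "rn \<in> set (enc_instance I)" "rd \<in> set (enc_instance I)" "kn \<in> set (enc_instance I)" "kd \<in> set (enc_instance I)"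
    by (simp_all add: enc_instance_def enc_rat_def rn_def rd_def kn_def kd_def)
  note w4 = this[THEN word]
  have den: "0 < real_of_int rn" "0 < real_of_int rd" "0 \<le> real_of_int kn" "0 < real_of_int kd"
    using rn_pos rd_pos kn_nonneg kd_pos by auto
  have "1 \<le> real_of_int (rn * kd)" using rn_pos kd_pos
    by (metis int_one_le_iff_zero_less mult_pos_pos of_int_1_le_iff)
  have d2: "real_of_int rn * kd + real_of_int kn * rd \<le> 2 * (Z * Z)"
  proof -
    have "real_of_int rn * kd \<le> Z * Z" "real_of_int kn * rd \<le> Z * Z" using w4 den by (intro mult_mono; simp)+
    then show ?thesis by simp
  qed
  have "T0 = (real_of_int rn / rd) / (real_of_int rn / rd + real_of_int kn / kd)" by (simp add: T0_def r_eq k_eq)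
  also have "\<dots> = real_of_int (rn * kd) / (real_of_int rn * kd + real_of_int kn * rd)"
    using den by (simp add: field_simps add_pos_nonneg)
  finally have T0: "T0 = real_of_int (rn * kd) / (real_of_int rn * kd + real_of_int kn * rd)" .
  have dpos: "0 < real_of_int rn * kd + real_of_int kn * rd" using den by (simp add: add_pos_nonneg)
  have "1 / (2 * (Z * Z)) \<le> real_of_int (rn * kd) / (real_of_int rn * kd + real_of_int kn * rd)"
    using \<open>1 \<le> real_of_int (rn * kd)\<close> d2 dpos by (intro frac_le) auto
  moreover have "0 \<le> T0"
    unfolding T0 using \<open>1 \<le> real_of_int (rn * kd)\<close> dpos by (intro divide_nonneg_nonneg) linarith+
  ultimately have "1 / (2 * (Z * Z)) * (8 * (Z * Z * Z * Z)) \<le> T0 * (201 / 200) ^ j"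
    unfolding T0[symmetric] using pw Z1 by (intro mult_mono) auto
  moreover have "1 / (2 * (Z * Z)) * (8 * (Z * Z * Z * Z)) = 4 * (Z * Z)" using Z1 by simp
  moreover have "(\<Sum>i<m. c i) \<le> Z * Z"
  proof -
    have "c i \<le> Z" if i: "i < m" for i
    proof -
      have "cn i \<in> set (enc_instance I)"
        using i by (auto simp: enc_instance_def enc_vec_def enc_rat_def cn_def)
      then have "\<bar>real_of_int (cn i)\<bar> \<le> Z" by (rule word)
      moreover have "c i \<le> cn i"
      proof -
        have "real_of_int (cn i) * 1 \<le> real_of_int (cn i) * real_of_int (cd i)"
          using cn_nonneg[OF i] cd_pos[of i] by (intro mult_left_mono) auto
        then show ?thesis using cd_pos[of i] by (simp add: c_eq divide_le_eq)
      qed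
      ultimately show ?thesis by linarith
    qed
    then have "(\<Sum>i<m. c i) \<le> (\<Sum>i<m. Z)" by (intro sum_mono) auto
    also have "\<dots> = real m * Z" by simp
    also have "\<dots> \<le> Z * Z"
    proof (intro mult_right_mono)
      have "m < 2 ^ ?s" using size_bounds(2) less_exp[of ?s] by linarith
      then have "real m < real (2 ^ ?s)" by (simp only: of_nat_less_iff)
      then show "real m \<le> Z" by (simp add: Z_def)
    qed (use Z1 in simp)
    finally show ?thesis .
  qed
  moreover have "0 < Z * Z" using Z1 by simp
  ultimately show False using assms by linarith
qed

end

theorem theorem3p16:
  shows "\<exists>(prog :: com) (C :: real) (k :: nat).
    \<forall>(I :: dr_instance) (\<beta>1 :: real) (\<beta>2 :: real) (sub :: int list \<Rightarrow> int list) (\<epsilon> :: real).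
      valid_instance I \<and> non_null_cost_ge_1 I \<and>
      1 \<le> \<beta>1 \<and> 1 \<le> \<beta>2 \<and> approx_subroutine I \<beta>1 \<beta>2 sub \<and> 0 < \<epsilon> \<longrightarrow>
      (\<exists>(t :: nat) (s :: memory) (x :: nat set \<Rightarrow> rat) (f :: rat).
         exec sub prog (initial_memory (run_input I \<epsilon>)) t s \<and>
         real t \<le> C * (real (input_size I) + max 0 (log 2 (1 / \<epsilon>))) ^ k \<and>
         read_block s 0 = enc_vec (sets_of I) x @ enc_rat f \<and>
         (\<lambda>S. of_rat (x S)) \<in> fractional_decisions I \<and>
         robust_objective I (\<lambda>S. of_rat (x S)) \<le> \<beta>1 * \<beta>2 * of_rat f \<and>
         of_rat f \<le> 2 * (1 + \<epsilon>) * (INF x'\<in>fractional_decisions I. robust_objective I x'))"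
proof -
  obtain C k where Ck: "\<And>sub L Q a b s. 1 \<le> L \<and> wp sub L program Q a b \<and> rel s a b \<and> (\<forall>j i. \<bar>a j i\<bar> \<le> 2 ^ L) \<and>
    (\<forall>i. \<bar>b i\<bar> \<le> 2 ^ L) \<Longrightarrow>
    (\<exists>t s' a' b'. exec sub (comp program) s t s' \<and> rel s' a' b' \<and> Q a' b' \<and> t \<le> C * L ^ k)"
    using wp_exec[OF wf_program] by blast
  show ?thesis
  proof (rule exI[of _ "comp program"], rule exI[of _ "real C * 24000000000 ^ k"], rule exI[of _ "3 * k"],
      intro allI impI, elim conjE)
    fix I \<beta>1 \<beta>2 sub and \<epsilon> :: real
    assume valid: "valid_instance I" and nn: "non_null_cost_ge_1 I" and b1: "1 \<le> \<beta>1" and b2: "1 \<le> \<beta>2"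
      and ap: "approx_subroutine I \<beta>1 \<beta>2 sub" and eps: "0 < \<epsilon>"
    interpret dr_inst I by unfold_locales (rule valid)
    let ?w = "run_input I \<epsilon>"
    define l where "l = nat \<lceil>max 0 (log 2 (1 / \<epsilon>))\<rceil>"
    define z where "z = input_size I + l"
    \<comment> \<open>The largest demand on \<open>L\<close> comes from the main loop: at most 1401
      z values with 1440000 z^2 rows each, that is 2017440000 z^3 iterations and one more.\<close>
    define L where "L = 3000000000 * z ^ 3"
    have z1: "1 \<le> z" using size_bounds(5) by (simp add: z_def)
    have zz: "z \<le> z ^ 3" "z ^ 2 \<le> z ^ 3" using z1 power_increasing[of 1 3 z] power_increasing[of 2 3 z] by simp_all
    have zL: "3000000000 * z \<le> L" "3000000000 * z ^ 2 \<le> L" using zz by (simp_all add: L_def)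
    have sz: "input_size I \<le> z" by (simp add: z_def)
    have sL: "input_size I \<le> L" "l \<le> L" using zL(1) by (simp_all add: z_def)
    have "\<bar>\<lceil>1 / \<epsilon>\<rceil>\<bar> \<le> 2 ^ l"
    proof -
      have "1 / \<epsilon> = 2 powr (log 2 (1 / \<epsilon>))" using eps by simp
      also have "\<dots> \<le> 2 powr real l"
      proof (rule powr_mono)
        have "max 0 (log 2 (1 / \<epsilon>)) \<le> real l" unfolding l_def by linarith
        then show "log 2 (1 / \<epsilon>) \<le> real l" by linarith
      qed simp
      also have "\<dots> = real_of_int (2 ^ l)" by (simp add: powr_realpow)
      finally have "\<lceil>1 / \<epsilon>\<rceil> \<le> 2 ^ l" by (simp only: ceiling_le_iff)
      moreover have "0 \<le> \<lceil>1 / \<epsilon>\<rceil>"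
      proof -
        have "0 < 1 / \<epsilon>" using eps by simp
        then show ?thesis by linarith
      qed
      ultimately show ?thesis by simp
    qed
    then have el: "\<And>v. v = \<lceil>1 / \<epsilon>\<rceil> \<Longrightarrow> \<bar>v\<bar> \<le> 2 ^ l" by simp
    have p2: "(2::int) ^ l \<le> 2 ^ L" "(2::int) ^ input_size I \<le> 2 ^ L" using sL by (simp_all add: power_increasing)
    have words: "\<bar>v\<bar> \<le> 2 ^ L" if "v \<in> set ?w" for v
    proof -
      have "v = \<lceil>1 / \<epsilon>\<rceil> \<or> v \<in> set (enc_instance I)" using that by (auto simp: run_input_def)
      then show ?thesis
        by (elim disjE) (rule order_trans[OF el p2(1)], assumption, rule order_trans[OF size_bounds(7) p2(2)], assumption)
    qed
    have len: "length ?w \<le> L" using size_bounds(6) zL(1) z1 sz by (simp add: run_input_def)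
    have len2: "int (length ?w) \<le> 2 ^ L"
    proof -
      have "length ?w \<le> 2 ^ L" using len less_exp[of L] by linarith
      then have "int (length ?w) \<le> int (2 ^ L)" by (simp only: of_nat_le_iff)
      then show ?thesis by simp
    qed
    interpret dr_run I sub \<beta>1 \<beta>2 \<epsilon> L
    proof unfold_locales
      show "\<bar>v\<bar> \<le> 2 ^ L" if "A \<in> scenarios I" "B \<in> scenarios I" "v \<in> set (enc_rat (scen_dist I A B))" for A B v
        using size_bounds(8)[OF that] p2 by linarith
      show "2 * n + 2 \<le> L" "m + 1 + K \<le> L" using size_bounds sz zL(1) z1 by linarith+
      show "4 + 3 * m * n + 6 * m + n \<le> L"
      proof -
        have "3 * m * n = 3 * (m * n)" by simp
        then show ?thesis using size_bounds(1,2,3) sz zL(1) z1 by linarith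
      qed
      show "1440000 * m * m + 1 \<le> L"
      proof -
        have "m * m \<le> z * z" using size_bounds(2) sz by (intro mult_le_mono) auto
        moreover have "1440000 * m * m = 1440000 * (m * m)" by simp
        moreover have "1 * 1 \<le> z * z" using z1 by (intro mult_le_mono) auto
        ultimately show ?thesis using zL(2) unfolding power2_eq_square by linarith
      qed
    qed (use ap b1 b2 eps nn len len2 words in auto)
    interpret dr_main I sub \<beta>1 \<beta>2 \<epsilon> L "200 * (4 * input_size I + 3)"
    proof unfold_locales
      show "j < 200 * (4 * input_size I + 3)" if "T0 * (201 / 200) ^ j \<le> 2 * (\<Sum>i<m. c i)" for j
        by (rule scan_bound[OF that])
      have "Mv \<le> 3 * z" using size_bounds(2,4) sz z1 by (simp add: Mv_def)
      then have "Mv\<^sup>2 \<le> 9 * z\<^sup>2" using power_mono[of Mv "3 * z" 2] by (simp add: power_mult_distrib)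
      then have "160000 * Mv\<^sup>2 \<le> 1440000 * z\<^sup>2" by simp
      moreover have "200 * (4 * input_size I + 3) + 1 \<le> 1401 * z" using sz z1 by simp
      ultimately have "(200 * (4 * input_size I + 3) + 1) * (160000 * Mv\<^sup>2) \<le> (1401 * z) * (1440000 * z\<^sup>2)"
        by (rule mult_le_mono[rotated])
      also have "\<dots> = 2017440000 * z ^ 3" by (simp add: power2_eq_square power3_eq_cube)
      finally show "(200 * (4 * input_size I + 3) + 1) * (160000 * Mv\<^sup>2) + 1 \<le> L"
        using zz(1) z1 unfolding L_def by linarith
    qed
    let ?b = "answer (\<lambda>_. 0) ?w"
    have "?b 0 = int (length ?w)" "has ?b 1 ?w" by (simp_all add: answer_def has_def)
    then have "wp sub L program (\<lambda>a' b'. result b') (\<lambda>_ _. 0) ?b" by (rule wp_program)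
    moreover have "\<bar>?b i\<bar> \<le> 2 ^ L" for i
      using words len2 by (auto simp: answer_def)
    moreover have "1 \<le> L" using zL(1) z1 by linarith
    ultimately obtain t s' a' b' where ex: "exec sub (comp program) (initial_memory ?w) t s'" "rel s' a' b'" "result b'"
      "t \<le> C * L ^ k"
      using Ck[of L sub "\<lambda>a' b'. result b'" "\<lambda>_ _. 0" ?b "initial_memory ?w"] rel_initial[of ?w] by auto
    from ex(3) obtain x f where xf: "query b' = enc_vec (sets_of I) x @ enc_rat f" "(\<lambda>S. of_rat (x S)) \<in> fractional_decisions I"
      "robust_objective I (\<lambda>S. of_rat (x S)) \<le> \<beta>1 * \<beta>2 * of_rat f" "of_rat f \<le> 2 * (1 + \<epsilon>) * opt"
      unfolding result_def by blast
    let ?Y = "real (input_size I) + max 0 (log 2 (1 / \<epsilon>))"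
    have "real t \<le> real C * 24000000000 ^ k * ?Y ^ (3 * k)"
    proof -
      define y where "y = ?Y"
      \<comment> \<open>Rounding the logarithm up costs at most 1, which the input size absorbs, so
        z <= 2 y; cubing turns 3000000000 into 24000000000.\<close>
      have "real l \<le> max 0 (log 2 (1 / \<epsilon>)) + 1" unfolding l_def by linarith
      then have "real z \<le> 2 * y" using size_bounds(5) unfolding z_def y_def by simp
      then have "real z ^ 3 \<le> (2 * y) ^ 3" by (rule power_mono) simp
      then have "real L \<le> 24000000000 * y ^ 3" by (simp add: L_def power_mult_distrib)
      then have "real L ^ k \<le> (24000000000 * y ^ 3) ^ k" by (rule power_mono) simp
      then have "real C * real L ^ k \<le> real C * (24000000000 ^ k * y ^ (3 * k))"
        by (intro mult_left_mono) (simp_all add: power_mult_distrib power_mult)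
      moreover have "real t \<le> real C * real L ^ k" using ex(4) by (metis of_nat_le_iff of_nat_mult of_nat_power)
      ultimately show ?thesis unfolding y_def[symmetric] by (simp only: mult.assoc)
    qed
    then show "\<exists>t s x f. exec sub (comp program) (initial_memory ?w) t s \<and>
         real t \<le> real C * 24000000000 ^ k * ?Y ^ (3 * k) \<and>
         read_block s 0 = enc_vec (sets_of I) x @ enc_rat f \<and>
         (\<lambda>S. of_rat (x S)) \<in> fractional_decisions I \<and>
         robust_objective I (\<lambda>S. of_rat (x S)) \<le> \<beta>1 * \<beta>2 * of_rat f \<and>
         of_rat f \<le> 2 * (1 + \<epsilon>) * (INF x'\<in>fractional_decisions I. robust_objective I x')"
      using ex(1) read_block_rel[OF ex(2)] xf unfolding opt_def by (intro exI[of _ t] exI[of _ s'] exI[of _ x] exI[of _ f]) simp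
  qed
qed

end
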